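(* Let $(C,L,V)$ be a triplet where $C$ is an irreducible smooth complex projective curve, $L$ is an ample line bundle on $C$ and $V\subseteq H^0(C,L)$ is a subspace spanning $L$, with associated morphism $\phi_V:C\to\mathbb P^N$, $N+1=\dim V$. Then the discriminant locus $\mathcal D(C,V)$ is irreducible if and only if $\phi_V$ is an immersion.
   Context: Everything is over $\mathbb C$. $V$ spans $L$ means that $V$ generates $L$ at every point. An element $D\in|V|$ defined by $s\in V$ is singular at $x$ if $s$ vanishes to order at least $2$ at $x$. The discriminant locus $\mathcal D(C,V)\subset|V|=\mathbb P^{N\vee}$ is the algebraic set, with reduced structure, of elements of $|V|$ that are singular at some point. "Immersion" means that the differential of $\phi_V$ is injective at every point. Convention: the empty set is regarded as irreducible (this is relevant only for $(C,L,V)=(\mathbb P^1,\mathcal O_{\mathbb P^1}(1),H^0(\mathbb P^1,\mathcal O_{\mathbb P^1}(1)))$, whose discriminant locus is empty). *)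

theory Defs
  imports
    "HOL-Analysis.Abstract_Topology"
    "HOL-Library.Function_Algebras"
    "HOL-Library.Poly_Mapping"
begin

section \<open>Complex-valued functions as complex vector spaces\<close>

definition cscale :: "complex \<Rightarrow> ('a \<Rightarrow> complex) \<Rightarrow> 'a \<Rightarrow> complex" where
  "cscale c f = (\<lambda>x. c * f x)"

interpretation cfun: vector_space "cscale :: complex \<Rightarrow> ('a \<Rightarrow> complex) \<Rightarrow> 'a \<Rightarrow> complex"
  by unfold_locales (simp_all add: cscale_def fun_eq_iff algebra_simps)


section \<open>Homogeneous polynomials\<close>

text \<open>A polynomial is a finitely supported map from exponent vectors to coefficients; the
  variables are indexed by the natural numbers.\<close>

type_synonym cpoly = "(nat \<Rightarrow>\<^sub>0 nat) \<Rightarrow>\<^sub>0 complex"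

definition meval :: "(nat \<Rightarrow>\<^sub>0 nat) \<Rightarrow> (nat \<Rightarrow> complex) \<Rightarrow> complex" where
  "meval m v = (\<Prod>i\<in>Poly_Mapping.keys m. v i ^ Poly_Mapping.lookup m i)"

definition peval :: "cpoly \<Rightarrow> (nat \<Rightarrow> complex) \<Rightarrow> complex" where
  "peval p v = (\<Sum>m\<in>Poly_Mapping.keys p. Poly_Mapping.lookup p m * meval m v)"

definition mdeg :: "(nat \<Rightarrow>\<^sub>0 nat) \<Rightarrow> nat" where
  "mdeg m = (\<Sum>i\<in>Poly_Mapping.keys m. Poly_Mapping.lookup m i)"

text \<open>Homogeneous polynomials of degree \<open>d\<close> in the variables \<open>0, \<dots>, n\<close>, including \<open>0\<close>.\<close>

definition hpoly :: "nat \<Rightarrow> nat \<Rightarrow> cpoly set" where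
  "hpoly n d = {p. \<forall>m\<in>Poly_Mapping.keys p. mdeg m = d \<and> Poly_Mapping.keys m \<subseteq> {..n}}"

lemma meval_superset:
  assumes "finite A" "Poly_Mapping.keys m \<subseteq> A"
  shows "meval m v = (\<Prod>i\<in>A. v i ^ Poly_Mapping.lookup m i)"
  unfolding meval_def using assms
  by (intro prod.mono_neutral_left) (auto simp: in_keys_iff)

lemma meval_add: "meval (m + k) v = meval m v * meval k v"
proof -
  let ?A = "Poly_Mapping.keys m \<union> Poly_Mapping.keys k"
  have "meval (m + k) v = (\<Prod>i\<in>?A. v i ^ Poly_Mapping.lookup (m + k) i)"
    by (rule meval_superset) (simp_all add: Poly_Mapping.keys_add)
  also have "\<dots> = (\<Prod>i\<in>?A. v i ^ Poly_Mapping.lookup m i) * (\<Prod>i\<in>?A. v i ^ Poly_Mapping.lookup k i)"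
    by (simp add: lookup_add power_add prod.distrib)
  also have "\<dots> = meval m v * meval k v"
    by (simp add: meval_superset[symmetric])
  finally show ?thesis .
qed

lemma mdeg_superset:
  assumes "finite A" "Poly_Mapping.keys m \<subseteq> A"
  shows "mdeg m = (\<Sum>i\<in>A. Poly_Mapping.lookup m i)"
  unfolding mdeg_def using assms
  by (intro sum.mono_neutral_left) (auto simp: in_keys_iff)

lemma mdeg_add: "mdeg (m + k) = mdeg m + mdeg k"
proof -
  let ?A = "Poly_Mapping.keys m \<union> Poly_Mapping.keys k"
  have "mdeg (m + k) = (\<Sum>i\<in>?A. Poly_Mapping.lookup (m + k) i)"
    by (rule mdeg_superset) (simp_all add: Poly_Mapping.keys_add)
  also have "\<dots> = (\<Sum>i\<in>?A. Poly_Mapping.lookup m i) + (\<Sum>i\<in>?A. Poly_Mapping.lookup k i)"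
    by (simp add: lookup_add sum.distrib)
  also have "\<dots> = mdeg m + mdeg k"
    by (simp add: mdeg_superset[symmetric])
  finally show ?thesis .
qed

lemma peval_superset:
  assumes "finite A" "Poly_Mapping.keys p \<subseteq> A"
  shows "peval p v = (\<Sum>m\<in>A. Poly_Mapping.lookup p m * meval m v)"
  unfolding peval_def using assms
  by (intro sum.mono_neutral_left) (auto simp: in_keys_iff)

lemma peval_add: "peval (p + q) v = peval p v + peval q v"
proof -
  let ?A = "Poly_Mapping.keys p \<union> Poly_Mapping.keys q"
  have "peval (p + q) v = (\<Sum>m\<in>?A. Poly_Mapping.lookup (p + q) m * meval m v)"
    by (rule peval_superset) (simp_all add: Poly_Mapping.keys_add)
  also have "\<dots> = (\<Sum>m\<in>?A. Poly_Mapping.lookup p m * meval m v)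
      + (\<Sum>m\<in>?A. Poly_Mapping.lookup q m * meval m v)"
    by (simp add: lookup_add distrib_right sum.distrib)
  also have "\<dots> = peval p v + peval q v"
    by (simp add: peval_superset[symmetric])
  finally show ?thesis .
qed

lemma peval_zero [simp]: "peval 0 v = 0"
  by (simp add: peval_def)

lemma peval_sum: "peval (\<Sum>a\<in>A. f a) v = (\<Sum>a\<in>A. peval (f a) v)"
  by (induction A rule: infinite_finite_induct) (auto simp: peval_add)

lemma peval_single: "peval (Poly_Mapping.single m c) v = c * meval m v"
  by (simp add: peval_def)

lemma poly_sum_singles:
  "p = (\<Sum>m\<in>Poly_Mapping.keys p. Poly_Mapping.single m (Poly_Mapping.lookup p m))"
proof (rule poly_mapping_eqI)
  fix k
  have "Poly_Mapping.lookup (\<Sum>m\<in>Poly_Mapping.keys p. Poly_Mapping.single m (Poly_Mapping.lookup p m)) k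
     = (\<Sum>m\<in>Poly_Mapping.keys p. if m = k then Poly_Mapping.lookup p m else 0)"
    by (simp add: lookup_sum lookup_single when_def)
  also have "\<dots> = Poly_Mapping.lookup p k"
    by (simp add: sum.delta' in_keys_iff)
  finally show "Poly_Mapping.lookup p k = Poly_Mapping.lookup
      (\<Sum>m\<in>Poly_Mapping.keys p. Poly_Mapping.single m (Poly_Mapping.lookup p m)) k" by simp
qed

lemma peval_mult: "peval (p * q) v = peval p v * peval q v"
proof -
  let ?s = "\<lambda>p m. Poly_Mapping.single m (Poly_Mapping.lookup p m)"
  have "p * q = (\<Sum>m\<in>Poly_Mapping.keys p. ?s p m) * (\<Sum>k\<in>Poly_Mapping.keys q. ?s q k)"
    using poly_sum_singles[of p] poly_sum_singles[of q] by simp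
  also have "\<dots> = (\<Sum>m\<in>Poly_Mapping.keys p. \<Sum>k\<in>Poly_Mapping.keys q.
      Poly_Mapping.single (m + k) (Poly_Mapping.lookup p m * Poly_Mapping.lookup q k))"
    by (simp add: sum_product mult_single)
  finally have "peval (p * q) v = (\<Sum>m\<in>Poly_Mapping.keys p. \<Sum>k\<in>Poly_Mapping.keys q.
      (Poly_Mapping.lookup p m * Poly_Mapping.lookup q k) * (meval m v * meval k v))"
    by (simp add: peval_sum peval_single meval_add)
  also have "\<dots> = peval p v * peval q v"
    by (simp add: peval_def sum_product mult_ac)
  finally show ?thesis .
qed

lemma hpoly_mult:
  assumes "p \<in> hpoly n d" "q \<in> hpoly n e"
  shows "p * q \<in> hpoly n (d + e)"
proof -
  have "mdeg m = d + e \<and> Poly_Mapping.keys m \<subseteq> {..n}" if m: "m \<in> Poly_Mapping.keys (p * q)" for m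
  proof -
    obtain a b where ab: "m = a + b" "a \<in> Poly_Mapping.keys p" "b \<in> Poly_Mapping.keys q"
      using subsetD[OF Poly_Mapping.keys_mult m] by blast
    have "mdeg a = d" "mdeg b = e" "Poly_Mapping.keys a \<subseteq> {..n}" "Poly_Mapping.keys b \<subseteq> {..n}"
      using ab(2,3) assms unfolding hpoly_def by blast+
    then show ?thesis
      unfolding ab(1) mdeg_add using Poly_Mapping.keys_add[of a b] by blast
  qed
  then show ?thesis by (auto simp: hpoly_def)
qed

lemma peval_one [simp]: "peval 1 v = 1"
  by (simp add: peval_def meval_def lookup_one)

lemma one_hpoly: "1 \<in> hpoly n 0"
  by (auto simp: hpoly_def mdeg_def)


section \<open>Projective space and its Zariski topology\<close>

text \<open>A point with homogeneous coordinates \<open>v\<close> is the set of nonzero multiples of \<open>v\<close>. The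
  coordinates of a point of the \<open>n\<close>-dimensional projective space are indexed by \<open>0, \<dots>, n\<close>,
  and \<open>v\<close> is extended by \<open>0\<close> to the other indices.\<close>

type_synonym pt = "(nat \<Rightarrow> complex) set"

definition hpoint :: "(nat \<Rightarrow> complex) \<Rightarrow> pt" where
  "hpoint v = {cscale c v |c. c \<noteq> 0}"

definition PS :: "nat \<Rightarrow> pt set" where
  "PS n = {hpoint v |v. v \<noteq> 0 \<and> (\<forall>i>n. v i = 0)}"

definition zero_locus :: "nat \<Rightarrow> cpoly set \<Rightarrow> pt set" where
  "zero_locus n F = {x \<in> PS n. \<forall>f\<in>F. \<forall>v\<in>x. peval f v = 0}"

definition zclosed :: "nat \<Rightarrow> pt set \<Rightarrow> bool" where
  "zclosed n Z \<longleftrightarrow> (\<exists>F \<subseteq> (\<Union>d. hpoly n d). Z = zero_locus n F)"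

definition zariski :: "nat \<Rightarrow> pt topology" where
  "zariski n = topology (\<lambda>U. U \<subseteq> PS n \<and> zclosed n (PS n - U))"

lemma meval_cscale: "meval m (cscale c v) = c ^ mdeg m * meval m v"
  by (simp add: meval_def mdeg_def cscale_def power_mult_distrib prod.distrib power_sum)

lemma peval_cscale:
  assumes "p \<in> hpoly n d"
  shows "peval p (cscale c v) = c ^ d * peval p v"
proof -
  have "Poly_Mapping.lookup p m * meval m (cscale c v) = c ^ d * (Poly_Mapping.lookup p m * meval m v)"
    if "m \<in> Poly_Mapping.keys p" for m
    using assms that by (auto simp: hpoly_def meval_cscale)
  then show ?thesis unfolding peval_def sum_distrib_left by (rule sum.cong[OF refl])
qed

lemma zclosed_Un:
  assumes "zclosed n Y" "zclosed n Z"
  shows "zclosed n (Y \<union> Z)"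
proof -
  from assms obtain F G where F: "F \<subseteq> (\<Union>d. hpoly n d)" "Y = zero_locus n F"
    and G: "G \<subseteq> (\<Union>d. hpoly n d)" "Z = zero_locus n G"
    unfolding zclosed_def by blast
  let ?H = "{f * g |f g. f \<in> F \<and> g \<in> G}"
  have H: "?H \<subseteq> (\<Union>d. hpoly n d)"
  proof
    fix p assume "p \<in> ?H"
    then obtain f g where p: "p = f * g" "f \<in> F" "g \<in> G" by blast
    obtain d e where "f \<in> hpoly n d" "g \<in> hpoly n e" using p(2,3) F(1) G(1) by blast
    then have "p \<in> hpoly n (d + e)" using p(1) hpoly_mult by simp
    then show "p \<in> (\<Union>d. hpoly n d)" by blast
  qed
  have "Y \<union> Z \<subseteq> zero_locus n ?H"
    unfolding F(2) G(2) zero_locus_def by (auto simp: peval_mult)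
  moreover have "zero_locus n ?H \<subseteq> Y \<union> Z"
  proof
    fix x assume x: "x \<in> zero_locus n ?H"
    then have xP: "x \<in> PS n" by (simp add: zero_locus_def)
    show "x \<in> Y \<union> Z"
    proof (rule ccontr)
      assume neg: "x \<notin> Y \<union> Z"
      then obtain f v where f: "f \<in> F" "v \<in> x" "peval f v \<noteq> 0"
        using xP unfolding F(2) zero_locus_def by blast
      from neg obtain g w where g: "g \<in> G" "w \<in> x" "peval g w \<noteq> 0"
        using xP unfolding G(2) zero_locus_def by blast
      obtain u where u: "x = hpoint u" using xP by (auto simp: PS_def)
      from f(2) u obtain a where a: "v = cscale a u" "a \<noteq> 0" by (auto simp: hpoint_def)
      from g(2) u obtain b where b: "w = cscale b u" "b \<noteq> 0" by (auto simp: hpoint_def)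
      from f(1) F(1) obtain d where d: "f \<in> hpoly n d" by blast
      from g(1) G(1) obtain e where e: "g \<in> hpoly n e" by blast
      have "peval f u \<noteq> 0" using f(3) by (simp add: a(1) peval_cscale[OF d])
      then have "peval f w \<noteq> 0" using b(2) by (simp add: b(1) peval_cscale[OF d])
      moreover have "peval (f * g) w = 0"
        using x f(1) g(1,2) unfolding zero_locus_def by blast
      ultimately show False using g(3) by (simp add: peval_mult)
    qed
  qed
  ultimately have "Y \<union> Z = zero_locus n ?H" by (rule equalityI)
  then show ?thesis unfolding zclosed_def using H by (intro exI[of _ ?H] conjI)
qed

lemma zclosed_Inter:
  assumes "\<And>Z. Z \<in> K \<Longrightarrow> zclosed n Z"
  shows "zclosed n (PS n \<inter> \<Inter>K)"
proof -
  obtain F where F: "\<And>Z. Z \<in> K \<Longrightarrow> F Z \<subseteq> (\<Union>d. hpoly n d) \<and> Z = zero_locus n (F Z)"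
    using assms unfolding zclosed_def by metis
  have F1: "F Z \<subseteq> (\<Union>d. hpoly n d)" and F2: "zero_locus n (F Z) = Z" if "Z \<in> K" for Z
    using F[OF that] by simp_all
  have "PS n \<inter> \<Inter>K = zero_locus n (\<Union>Z\<in>K. F Z)"
  proof (intro equalityI subsetI)
    fix x assume x: "x \<in> PS n \<inter> \<Inter>K"
    have "peval f v = 0" if "Z \<in> K" "f \<in> F Z" "v \<in> x" for Z f v
    proof -
      have "x \<in> zero_locus n (F Z)" unfolding F2[OF that(1)] using x that(1) by blast
      then show ?thesis using that(2,3) by (simp add: zero_locus_def)
    qed
    then show "x \<in> zero_locus n (\<Union>Z\<in>K. F Z)"
      using x by (simp add: zero_locus_def)
  next
    fix x assume x: "x \<in> zero_locus n (\<Union>Z\<in>K. F Z)"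
    have "x \<in> Z" if "Z \<in> K" for Z
    proof -
      have "x \<in> zero_locus n (F Z)" using x that unfolding zero_locus_def by blast
      then show ?thesis unfolding F2[OF that] .
    qed
    then show "x \<in> PS n \<inter> \<Inter>K" using x unfolding zero_locus_def by blast
  qed
  moreover have "(\<Union>Z\<in>K. F Z) \<subseteq> (\<Union>d. hpoly n d)" using F1 by blast
  ultimately show ?thesis unfolding zclosed_def by (intro exI[of _ "\<Union>Z\<in>K. F Z"] conjI)
qed

lemma istopology_zariski: "istopology (\<lambda>U. U \<subseteq> PS n \<and> zclosed n (PS n - U))"
  unfolding istopology_def
proof (intro conjI allI impI)
  fix S T assume "S \<subseteq> PS n \<and> zclosed n (PS n - S)" "T \<subseteq> PS n \<and> zclosed n (PS n - T)"
  then show "S \<inter> T \<subseteq> PS n" "zclosed n (PS n - S \<inter> T)"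
    unfolding Diff_Int by (blast, blast intro: zclosed_Un)
next
  fix K assume K: "\<forall>U\<in>K. U \<subseteq> PS n \<and> zclosed n (PS n - U)"
  then show "\<Union>K \<subseteq> PS n" by blast
  have "zclosed n (PS n \<inter> \<Inter>((\<lambda>U. PS n - U) ` K))"
    by (rule zclosed_Inter) (use K in auto)
  moreover have "PS n \<inter> \<Inter>((\<lambda>U. PS n - U) ` K) = PS n - \<Union>K" by blast
  ultimately show "zclosed n (PS n - \<Union>K)" by simp
qed

lemma openin_zariski: "openin (zariski n) U \<longleftrightarrow> U \<subseteq> PS n \<and> zclosed n (PS n - U)"
  unfolding zariski_def topology_inverse'[OF istopology_zariski] ..

lemma topspace_zariski [simp]: "topspace (zariski n) = PS n"
proof -
  have "x \<notin> zero_locus n {1}" for x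
  proof
    assume x: "x \<in> zero_locus n {1}"
    then obtain v where v: "x = hpoint v" unfolding zero_locus_def PS_def by blast
    have "cscale 1 v \<in> x"
      unfolding v hpoint_def by (intro CollectI exI[of _ 1] conjI refl one_neq_zero)
    then have "peval 1 (cscale 1 v) = 0" using x by (simp add: zero_locus_def)
    then show False by (simp only: peval_one one_neq_zero)
  qed
  then have "PS n - PS n = zero_locus n {1}" by (simp add: set_eq_iff)
  moreover have "{1} \<subseteq> (\<Union>d. hpoly n d)" using one_hpoly[of n] by (intro subsetI UN_I[of 0]) simp_all
  ultimately have "zclosed n (PS n - PS n)"
    unfolding zclosed_def by (intro exI[of _ "{1}"] conjI)
  then have 1: "openin (zariski n) (PS n)" unfolding openin_zariski by (intro conjI subset_refl)
  have 2: "topspace (zariski n) \<subseteq> PS n"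
    using openin_topspace[of "zariski n"] unfolding openin_zariski by (rule conjunct1)
  show ?thesis
    by (rule subset_antisym[OF 2 openin_subset[OF 1]])
qed

lemma closedin_zariski: "closedin (zariski n) Z \<longleftrightarrow> zclosed n Z"
proof -
  have 1: "Z \<subseteq> PS n" if "zclosed n Z"
    using that unfolding zclosed_def zero_locus_def by blast
  have 2: "PS n - (PS n - Z) = Z" if "Z \<subseteq> PS n" using that by blast
  show ?thesis
    unfolding closedin_def openin_zariski topspace_zariski by (metis 1 2 Diff_subset)
qed

text \<open>Irreducibility of a subset in its subspace topology; the empty set counts as irreducible.\<close>

definition irreducible_in :: "'a topology \<Rightarrow> 'a set \<Rightarrow> bool" where
  "irreducible_in T S \<longleftrightarrow> S \<subseteq> topspace T \<and>
     (\<forall>A B. closedin T A \<longrightarrow> closedin T B \<longrightarrow> S \<subseteq> A \<union> B \<longrightarrow> S \<subseteq> A \<or> S \<subseteq> B)"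

definition irreducible_chain :: "'a topology \<Rightarrow> nat \<Rightarrow> bool" where
  "irreducible_chain T d \<longleftrightarrow> (\<exists>Z :: nat \<Rightarrow> 'a set.
     (\<forall>i\<le>d. Z i \<noteq> {} \<and> closedin T (Z i) \<and> irreducible_in T (Z i)) \<and> (\<forall>i<d. Z i \<subset> Z (Suc i)))"

definition has_krull_dim :: "'a topology \<Rightarrow> nat \<Rightarrow> bool" where
  "has_krull_dim T d \<longleftrightarrow> irreducible_chain T d \<and> \<not> irreducible_chain T (Suc d)"


section \<open>Regular functions, tangent spaces, morphisms\<close>

text \<open>Here \<open>X\<close> is a closed subset of the \<open>n\<close>-dimensional projective space. Functions on
  subsets of \<open>X\<close> are represented by total functions, whose values elsewhere are irrelevant.\<close>

definition regular_on :: "nat \<Rightarrow> pt set \<Rightarrow> pt set \<Rightarrow> (pt \<Rightarrow> complex) \<Rightarrow> bool" where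
  "regular_on n X U f \<longleftrightarrow> openin (subtopology (zariski n) X) U \<and>
     (\<forall>x\<in>U. \<exists>W d. \<exists>g\<in>hpoly n d. \<exists>h\<in>hpoly n d.
        openin (subtopology (zariski n) X) W \<and> x \<in> W \<and> W \<subseteq> U \<and>
        (\<forall>y\<in>W. \<forall>v\<in>y. peval h v \<noteq> 0 \<and> f y = peval g v / peval h v))"

definition local_ring :: "nat \<Rightarrow> pt set \<Rightarrow> pt \<Rightarrow> (pt \<Rightarrow> complex) set" where
  "local_ring n X x = {f. \<exists>U. x \<in> U \<and> regular_on n X U f}"

definition same_germ :: "nat \<Rightarrow> pt set \<Rightarrow> pt \<Rightarrow> (pt \<Rightarrow> complex) \<Rightarrow> (pt \<Rightarrow> complex) \<Rightarrow> bool" where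
  "same_germ n X x f g \<longleftrightarrow>
     (\<exists>U. openin (subtopology (zariski n) X) U \<and> x \<in> U \<and> (\<forall>y\<in>U. f y = g y))"

text \<open>The Zariski tangent space, as the space of point derivations of the local ring. The
  first condition only normalizes the values at functions which are not regular at \<open>x\<close>.\<close>

definition tangent_space :: "nat \<Rightarrow> pt set \<Rightarrow> pt \<Rightarrow> ((pt \<Rightarrow> complex) \<Rightarrow> complex) set" where
  "tangent_space n X x = {\<delta>.
     (\<forall>f. f \<notin> local_ring n X x \<longrightarrow> \<delta> f = 0) \<and>
     (\<forall>f\<in>local_ring n X x. \<forall>g\<in>local_ring n X x.
        (same_germ n X x f g \<longrightarrow> \<delta> f = \<delta> g) \<and>
        \<delta> (f + g) = \<delta> f + \<delta> g \<and>
        \<delta> (f * g) = f x * \<delta> g + g x * \<delta> f) \<and>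
     (\<forall>c. \<forall>f\<in>local_ring n X x. \<delta> (cscale c f) = c * \<delta> f)}"

text \<open>Membership of the germ of \<open>f\<close> in the \<open>k\<close>-th power of the maximal ideal at \<open>x\<close>.\<close>

definition vanishes_to_order ::
    "nat \<Rightarrow> pt set \<Rightarrow> pt \<Rightarrow> nat \<Rightarrow> (pt \<Rightarrow> complex) \<Rightarrow> bool" where
  "vanishes_to_order n X x k f \<longleftrightarrow>
     (\<exists>(r::nat) c h.
        (\<forall>j<r. c j \<in> local_ring n X x) \<and>
        (\<forall>j<r. \<forall>l<k. h j l \<in> local_ring n X x \<and> h j l x = 0) \<and>
        same_germ n X x f (\<lambda>y. \<Sum>j<r. c j y * (\<Prod>l<k. h j l y)))"

definition morphism :: "nat \<Rightarrow> pt set \<Rightarrow> nat \<Rightarrow> pt set \<Rightarrow> (pt \<Rightarrow> pt) \<Rightarrow> bool" where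
  "morphism n X m Y \<phi> \<longleftrightarrow>
     continuous_map (subtopology (zariski n) X) (subtopology (zariski m) Y) \<phi> \<and>
     (\<forall>U f. regular_on m Y U f \<longrightarrow> regular_on n X {x \<in> X. \<phi> x \<in> U} (f \<circ> \<phi>))"

definition closed_embedding :: "nat \<Rightarrow> pt set \<Rightarrow> nat \<Rightarrow> (pt \<Rightarrow> pt) \<Rightarrow> bool" where
  "closed_embedding n X m \<phi> \<longleftrightarrow>
     closedin (zariski m) (\<phi> ` X) \<and> inj_on \<phi> X \<and>
     morphism n X m (\<phi> ` X) \<phi> \<and> morphism m (\<phi> ` X) n X (inv_into X \<phi>)"

definition differential ::
    "nat \<Rightarrow> pt set \<Rightarrow> (pt \<Rightarrow> pt) \<Rightarrow> pt \<Rightarrow> ((pt \<Rightarrow> complex) \<Rightarrow> complex) \<Rightarrow> (pt \<Rightarrow> complex) \<Rightarrow> complex" where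
  "differential m Y \<phi> x \<delta> = (\<lambda>f. if f \<in> local_ring m Y (\<phi> x) then \<delta> (f \<circ> \<phi>) else 0)"

definition immersion :: "nat \<Rightarrow> pt set \<Rightarrow> nat \<Rightarrow> pt set \<Rightarrow> (pt \<Rightarrow> pt) \<Rightarrow> bool" where
  "immersion n X m Y \<phi> \<longleftrightarrow> (\<forall>x\<in>X. inj_on (differential m Y \<phi> x) (tangent_space n X x))"

definition smooth_projective_curve :: "nat \<Rightarrow> pt set \<Rightarrow> bool" where
  "smooth_projective_curve n C \<longleftrightarrow>
     closedin (zariski n) C \<and> irreducible_in (zariski n) C \<and>
     has_krull_dim (subtopology (zariski n) C) 1 \<and>
     (\<forall>x\<in>C. cfun.dim (tangent_space n C x) = 1)"


section \<open>Line bundles and linear systems\<close>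

text \<open>A line bundle is given by an open cover and transition functions. A section is a
  family of local functions with \<open>s\<^sub>i = g\<^sub>i\<^sub>j s\<^sub>j\<close>, encoded as one function on pairs
  (index, point), which is \<open>0\<close> at the pairs whose point does not lie in the given chart.\<close>

record 'i line_bundle =
  idx :: "'i set"
  chart :: "'i \<Rightarrow> pt set"
  trans_fun :: "'i \<Rightarrow> 'i \<Rightarrow> pt \<Rightarrow> complex"

type_synonym 'i sec = "'i \<times> pt \<Rightarrow> complex"

definition line_bundle_on :: "nat \<Rightarrow> pt set \<Rightarrow> 'i line_bundle \<Rightarrow> bool" where
  "line_bundle_on n X L \<longleftrightarrow>
     (\<forall>i\<in>idx L. openin (subtopology (zariski n) X) (chart L i)) \<and>
     X = (\<Union>i\<in>idx L. chart L i) \<and>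
     (\<forall>i\<in>idx L. \<forall>j\<in>idx L. regular_on n X (chart L i \<inter> chart L j) (trans_fun L i j)) \<and>
     (\<forall>i\<in>idx L. \<forall>x\<in>chart L i. trans_fun L i i x = 1) \<and>
     (\<forall>i\<in>idx L. \<forall>j\<in>idx L. \<forall>k\<in>idx L. \<forall>x\<in>chart L i \<inter> chart L j \<inter> chart L k.
        trans_fun L i j x * trans_fun L j k x = trans_fun L i k x)"

definition tensor_power :: "'i line_bundle \<Rightarrow> nat \<Rightarrow> 'i line_bundle" where
  "tensor_power L m = L\<lparr>trans_fun := (\<lambda>i j x. trans_fun L i j x ^ m)\<rparr>"

definition H0 :: "nat \<Rightarrow> pt set \<Rightarrow> 'i line_bundle \<Rightarrow> 'i sec set" where
  "H0 n X L = {s.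
     (\<forall>i x. \<not> (i \<in> idx L \<and> x \<in> chart L i) \<longrightarrow> s (i, x) = 0) \<and>
     (\<forall>i\<in>idx L. regular_on n X (chart L i) (\<lambda>x. s (i, x))) \<and>
     (\<forall>i\<in>idx L. \<forall>j\<in>idx L. \<forall>x\<in>chart L i \<inter> chart L j. s (i, x) = trans_fun L i j x * s (j, x))}"

definition generates :: "pt set \<Rightarrow> 'i line_bundle \<Rightarrow> 'i sec set \<Rightarrow> bool" where
  "generates X L V \<longleftrightarrow> (\<forall>x\<in>X. \<exists>s\<in>V. \<exists>i\<in>idx L. x \<in> chart L i \<and> s (i, x) \<noteq> 0)"

text \<open>The map to projective space given by the sections \<open>s 0, \<dots>, s M\<close>. If they generate the
  line bundle, the value at \<open>x\<close> does not depend on the chart used to compute it.\<close>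

definition proj_map :: "'i line_bundle \<Rightarrow> (nat \<Rightarrow> 'i sec) \<Rightarrow> nat \<Rightarrow> pt \<Rightarrow> pt" where
  "proj_map L s M x =
     (let i = (SOME i. i \<in> idx L \<and> x \<in> chart L i)
      in hpoint (\<lambda>k. if k \<le> M then s k (i, x) else 0))"

definition very_ample :: "nat \<Rightarrow> pt set \<Rightarrow> 'i line_bundle \<Rightarrow> bool" where
  "very_ample n X L \<longleftrightarrow> (\<exists>M s. s ` {..M} \<subseteq> H0 n X L \<and> generates X L (s ` {..M}) \<and>
     closed_embedding n X M (proj_map L s M))"

definition ample :: "nat \<Rightarrow> pt set \<Rightarrow> 'i line_bundle \<Rightarrow> bool" where
  "ample n X L \<longleftrightarrow> (\<exists>m>0. very_ample n X (tensor_power L m))"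

definition basis_of :: "(nat \<Rightarrow> 'i sec) \<Rightarrow> nat \<Rightarrow> 'i sec set \<Rightarrow> bool" where
  "basis_of b N V \<longleftrightarrow>
     inj_on b {..N} \<and> cfun.independent (b ` {..N}) \<and> cfun.span (b ` {..N}) = V"

definition singular_at :: "nat \<Rightarrow> pt set \<Rightarrow> 'i line_bundle \<Rightarrow> 'i sec \<Rightarrow> pt \<Rightarrow> bool" where
  "singular_at n X L s x \<longleftrightarrow>
     (\<exists>i\<in>idx L. x \<in> chart L i \<and> vanishes_to_order n X x 2 (\<lambda>y. s (i, y)))"

text \<open>The basis \<open>b\<close> identifies the linear system of \<open>V\<close> with the (dual) projective space: the
  element defined by \<open>\<Sum>k\<le>N. a k * b k\<close> is the point with homogeneous coordinates \<open>a\<close>.\<close>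

definition discriminant ::
    "nat \<Rightarrow> pt set \<Rightarrow> 'i line_bundle \<Rightarrow> (nat \<Rightarrow> 'i sec) \<Rightarrow> nat \<Rightarrow> pt set" where
  "discriminant n X L b N =
     {p \<in> PS N. \<exists>a\<in>p. \<exists>x\<in>X. singular_at n X L (\<Sum>k\<le>N. cscale (a k) (b k)) x}"

end

theory Submission
  imports Defs "HOL-Analysis.Continuum_Not_Denumerable"
    "HOL-Computational_Algebra.Fundamental_Theorem_Algebra"
begin

text \<open>
  If \<open>\<phi>\<^sub>V\<close> is an immersion, the sections singular at a point \<open>x\<close> form a space of dimension \<open>N - 1\<close>
  that varies like a vector bundle over the irreducible curve \<open>C\<close>, and the discriminant is the
  image of its projectivization.

  Conversely suppose that the differential vanishes at \<open>x0\<close>. Every section vanishing at \<open>x0\<close> is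
  singular there, so the discriminant contains the hyperplane of these sections; being contained
  in a hypersurface and irreducible, it equals this hyperplane. Hence all sections singular
  somewhere vanish at \<open>x0\<close>, that is, all tangent lines pass through one point; in characteristic \<open>0\<close>
  this gives \<open>N = 1\<close>. The map to the projective line is then unramified except over the image of
  \<open>x0\<close>. The derivation \<open>d/dt\<close> acts on the functions regular over the affine line and lowers the pole
  orders at infinity, so it is locally nilpotent and these functions are polynomials in the
  coordinate \<open>t\<close>. The map is therefore an isomorphism, a contradiction.
\<close>

section \<open>Forms\<close>

text \<open>Ampleness enters to exclude N = 0: a nowhere vanishing section has empty, hence
  irreducible, discriminant, while the constant map is no immersion. Proper closed subsets of C are
  finite, so local statements become statements about all but finitely many points. Dimension theory
  is replaced by counting: on C the forms of degree d span a space of dimension O(d). This gives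
  algebraic relations between functions, hence finite orders of vanishing, and also an equation of
  the discriminant. A further obstacle is that \<open>dv\<close> picks a generator of each tangent
  line separately, so the derivative of a regular function is not a regular function; only quotients
  of derivatives are, and Nakayama's lemma is needed to see it. For N = 1 the topological reason
  would be that the affine line is simply connected. Nilpotence of d/dt supplies an algebraic
  substitute, and the final count is that the order 1 of a uniformizer would be a multiple of the
  ramification index at infinity.\<close>

definition pvar :: "nat \<Rightarrow> cpoly" where
  "pvar i = Poly_Mapping.single (Poly_Mapping.single i 1) 1"

definition pconst :: "complex \<Rightarrow> cpoly" where
  "pconst c = Poly_Mapping.single 0 c"

lemma peval_pvar [simp]: "peval (pvar i) v = v i"
  by (simp add: pvar_def peval_single meval_def)

lemma peval_pconst [simp]: "peval (pconst c) v = c"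
  by (simp add: pconst_def peval_single meval_def)

lemma peval_uminus [simp]: "peval (- p) v = - peval p v"
proof -
  have "peval (p + - p) v = 0" by simp
  then show ?thesis unfolding peval_add by (simp add: add_eq_0_iff)
qed

lemma peval_diff [simp]: "peval (p - q) v = peval p v - peval q v"
  using peval_add[of p "- q" v] by simp

declare peval_add [simp] peval_mult [simp] peval_sum [simp]

lemma peval_power [simp]: "peval (p ^ k) v = peval p v ^ k"
  by (induction k) simp_all

lemma peval_prod [simp]: "peval (\<Prod>i\<in>A. f i) v = (\<Prod>i\<in>A. peval (f i) v)"
  by (induction A rule: infinite_finite_induct) auto

lemma hpoly_zero [simp]: "0 \<in> hpoly n d"
  by (simp add: hpoly_def)

lemma hpoly_add [intro]: "p \<in> hpoly n d \<Longrightarrow> q \<in> hpoly n d \<Longrightarrow> p + q \<in> hpoly n d"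
  using Poly_Mapping.keys_add[of p q] unfolding hpoly_def by blast

lemma hpoly_sum: "(\<And>i. i \<in> A \<Longrightarrow> f i \<in> hpoly n d) \<Longrightarrow> (\<Sum>i\<in>A. f i) \<in> hpoly n d"
  by (induction A rule: infinite_finite_induct) auto

lemma hpoly_pconst [simp]: "pconst c \<in> hpoly n 0"
  by (auto simp: pconst_def hpoly_def mdeg_def)

lemma hpoly_pvar: "i \<le> n \<Longrightarrow> pvar i \<in> hpoly n 1"
  by (auto simp: pvar_def hpoly_def mdeg_def)

lemma hpoly_cmult: "p \<in> hpoly n d \<Longrightarrow> pconst c * p \<in> hpoly n d"
  using hpoly_mult[of "pconst c" n 0 p d] by simp

lemma hpoly_uminus: "p \<in> hpoly n d \<Longrightarrow> - p \<in> hpoly n d"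
  by (auto simp: hpoly_def in_keys_iff)

lemma hpoly_diff: "p \<in> hpoly n d \<Longrightarrow> q \<in> hpoly n d \<Longrightarrow> p - q \<in> hpoly n d"
  using hpoly_add[of p n d "- q"] hpoly_uminus[of q n d] by simp

lemma hpoly_power: "p \<in> hpoly n d \<Longrightarrow> p ^ k \<in> hpoly n (k * d)"
proof (induction k)
  case 0
  show ?case using one_hpoly by simp
next
  case (Suc k)
  then show ?case using hpoly_mult[of p n d "p ^ k" "k * d"] by simp
qed

lemma hpoly_single:
  "mdeg m = d \<Longrightarrow> Poly_Mapping.keys m \<subseteq> {..n} \<Longrightarrow> Poly_Mapping.single m c \<in> hpoly n d"
  by (auto simp: hpoly_def)

definition mons :: "nat \<Rightarrow> nat \<Rightarrow> (nat \<Rightarrow>\<^sub>0 nat) set" where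
  "mons n d = {m. mdeg m = d \<and> Poly_Mapping.keys m \<subseteq> {..n}}"

lemma hpoly_keys: "p \<in> hpoly n d \<longleftrightarrow> Poly_Mapping.keys p \<subseteq> mons n d"
  by (auto simp: hpoly_def mons_def)

lemma lookup_le_mdeg: "Poly_Mapping.lookup m i \<le> mdeg m"
proof (cases "i \<in> Poly_Mapping.keys m")
  case True
  then show ?thesis unfolding mdeg_def by (intro member_le_sum) auto
qed (simp add: in_keys_iff)

text \<open>A monomial of degree d is a table of n + 1 exponents, each at most d.\<close>

lemma finite_mons: "finite (mons n d)"
proof (rule finite_subset)
  let ?F = "{..n} \<rightarrow>\<^sub>E {..d}"
  show "mons n d \<subseteq> (\<lambda>f. Abs_poly_mapping (\<lambda>i. if i \<le> n then f i else 0)) ` ?F"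
  proof
    fix m assume m: "m \<in> mons n d"
    let ?f = "restrict (Poly_Mapping.lookup m) {..n}"
    have "?f \<in> ?F" using m lookup_le_mdeg[of m] by (auto simp: mons_def)
    moreover have "(\<lambda>i. if i \<le> n then ?f i else 0) = Poly_Mapping.lookup m"
      using m by (auto simp: mons_def fun_eq_iff in_keys_iff)
    then have "m = Abs_poly_mapping (\<lambda>i. if i \<le> n then ?f i else 0)" by simp
    ultimately show "m \<in> (\<lambda>f. Abs_poly_mapping (\<lambda>i. if i \<le> n then f i else 0)) ` ?F" by blast
  qed
  show "finite ((\<lambda>f. Abs_poly_mapping (\<lambda>i. if i \<le> n then f i else 0)) ` ?F)"
    by (intro finite_imageI finite_PiE) auto
qed

lemma cscale_apply [simp]: "cscale c f x = c * f x"
  by (simp add: cscale_def)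

lemma sum_fun_apply: "(\<Sum>i\<in>A. f i) x = (\<Sum>i\<in>A. f i x)" for f :: "'i \<Rightarrow> 'a \<Rightarrow> complex"
  by (induction A rule: infinite_finite_induct) auto

text \<open>Forms are evaluated at a point through a fixed representative. Only vanishing and quotients
  of forms of equal degree are meaningful.\<close>

definition rp :: "pt \<Rightarrow> nat \<Rightarrow> complex" where
  "rp x = (SOME v. v \<in> x)"

definition ev :: "cpoly \<Rightarrow> pt \<Rightarrow> complex" where
  "ev p x = peval p (rp x)"

lemma hpoint_self: "v \<in> hpoint v"
  unfolding hpoint_def by (rule CollectI, rule exI[of _ 1]) (simp add: cscale_def)

lemma hpoint_cscale: "c \<noteq> 0 \<Longrightarrow> hpoint (cscale c v) = hpoint v"
proof -
  assume c: "c \<noteq> 0"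
  have "\<exists>e. cscale d (cscale c v) = cscale e v \<and> e \<noteq> 0" if "d \<noteq> 0" for d
    using c that by (intro exI[of _ "d * c"]) (auto simp: cscale_def fun_eq_iff)
  moreover have "\<exists>e. cscale d v = cscale e (cscale c v) \<and> e \<noteq> 0" if "d \<noteq> 0" for d
    using c that by (intro exI[of _ "d / c"]) (auto simp: cscale_def fun_eq_iff)
  ultimately show ?thesis unfolding hpoint_def by blast
qed

lemma PS_mem:
  assumes "x \<in> PS n" "v \<in> x"
  shows "x = hpoint v" "v \<noteq> 0" "\<And>i. i > n \<Longrightarrow> v i = 0"
proof -
  obtain w where w: "x = hpoint w" "w \<noteq> 0" "\<forall>i>n. w i = 0" using assms(1) by (auto simp: PS_def)
  obtain c where c: "v = cscale c w" "c \<noteq> 0" using assms(2) w(1) by (auto simp: hpoint_def)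
  show "x = hpoint v" using hpoint_cscale[OF c(2)] c w by simp
  show "v \<noteq> 0" using c w by (auto simp: fun_eq_iff cscale_def)
  show "v i = 0" if "i > n" for i using c w that by (simp add: cscale_def)
qed

lemma rp_mem: "x \<in> PS n \<Longrightarrow> rp x \<in> x"
proof -
  assume "x \<in> PS n"
  then obtain v where "x = hpoint v" unfolding PS_def by auto
  then have "v \<in> x" using hpoint_self by simp
  then show ?thesis unfolding rp_def by (rule someI[of "\<lambda>v. v \<in> x" v])
qed

lemma hpoint_rp: "x \<in> PS n \<Longrightarrow> hpoint (rp x) = x"
  using PS_mem(1) rp_mem by metis

lemma rp_nonzero: "x \<in> PS n \<Longrightarrow> rp x \<noteq> 0"
  using PS_mem(2) rp_mem by metis

lemma rp_supp: "x \<in> PS n \<Longrightarrow> i > n \<Longrightarrow> rp x i = 0"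
  using PS_mem(3) rp_mem by metis

lemma rp_coord_nonzero: "x \<in> PS n \<Longrightarrow> \<exists>i\<le>n. rp x i \<noteq> 0"
  using rp_nonzero[of x n] rp_supp[of x n] unfolding fun_eq_iff zero_fun_def by (meson not_le)

lemma mem_rp:
  assumes "x \<in> PS n" "v \<in> x"
  obtains c where "c \<noteq> 0" "v = cscale c (rp x)"
  using assms hpoint_rp[OF assms(1)] by (auto simp: hpoint_def)

lemma peval_mem_zero_iff:
  "x \<in> PS n \<Longrightarrow> v \<in> x \<Longrightarrow> p \<in> hpoly n d \<Longrightarrow> peval p v = 0 \<longleftrightarrow> ev p x = 0"
  by (elim mem_rp) (auto simp: peval_cscale ev_def)

text \<open>The scaling factors c^d cancel. Zeros of \<open>q\<close> are no exception, since both
  quotients are then 0.\<close>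

lemma peval_mem_ratio:
  "x \<in> PS n \<Longrightarrow> v \<in> x \<Longrightarrow> p \<in> hpoly n d \<Longrightarrow> q \<in> hpoly n d \<Longrightarrow> peval p v / peval q v = ev p x / ev q x"
  by (elim mem_rp) (auto simp: peval_cscale ev_def)

lemma hpoint_PS: "v \<noteq> 0 \<Longrightarrow> (\<And>i. i > n \<Longrightarrow> v i = 0) \<Longrightarrow> hpoint v \<in> PS n"
  by (auto simp: PS_def)

lemma ev_hpoint_zero_iff:
  "v \<noteq> 0 \<Longrightarrow> (\<And>i. i > n \<Longrightarrow> v i = 0) \<Longrightarrow> p \<in> hpoly n d \<Longrightarrow> ev p (hpoint v) = 0 \<longleftrightarrow> peval p v = 0"
  using peval_mem_zero_iff[OF hpoint_PS[of v n] hpoint_self] by auto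

lemma ev_simps [simp]:
  "ev (p + q) x = ev p x + ev q x" "ev (p * q) x = ev p x * ev q x" "ev 0 x = 0" "ev 1 x = 1"
  "ev (- p) x = - ev p x" "ev (p - q) x = ev p x - ev q x" "ev (p ^ k) x = ev p x ^ k"
  "ev (pconst c) x = c" "ev (pvar i) x = rp x i"
  by (simp_all add: ev_def)

lemma zero_locus_ev:
  assumes "F \<subseteq> (\<Union>d. hpoly n d)"
  shows "zero_locus n F = {x \<in> PS n. \<forall>f\<in>F. ev f x = 0}"
proof -
  have "(\<forall>v\<in>x. peval f v = 0) \<longleftrightarrow> ev f x = 0" if x: "x \<in> PS n" and f: "f \<in> F" for x f
  proof -
    obtain d where d: "f \<in> hpoly n d" using f assms by blast
    show ?thesis using peval_mem_zero_iff[OF x _ d] rp_mem[OF x] by blast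
  qed
  then show ?thesis unfolding zero_locus_def by auto
qed

lemma zclosed_form: "p \<in> hpoly n d \<Longrightarrow> zclosed n {x \<in> PS n. ev p x = 0}"
  unfolding zclosed_def using zero_locus_ev[of "{p}" n] by (intro exI[of _ "{p}"]) auto

lemma zclosed_separate:
  assumes "zclosed n Z" "x \<in> PS n" "x \<notin> Z"
  obtains p d where "p \<in> hpoly n d" "ev p x \<noteq> 0" "\<And>z. z \<in> Z \<Longrightarrow> ev p z = 0"
proof -
  obtain F where F: "F \<subseteq> (\<Union>d. hpoly n d)" "Z = zero_locus n F" using assms(1) unfolding zclosed_def by blast
  then obtain f where "f \<in> F" "ev f x \<noteq> 0" using assms(2,3) by (auto simp: zero_locus_ev)
  moreover obtain d where "f \<in> hpoly n d" using F \<open>f \<in> F\<close> by blast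
  ultimately show ?thesis using that F by (auto simp: zero_locus_ev)
qed

lemma zclosed_singleton:
  assumes "x \<in> PS n" shows "zclosed n {x}"
proof -
  let ?v = "rp x"
  obtain j where j: "j \<le> n" "?v j \<noteq> 0" using rp_coord_nonzero[OF assms] by blast
  \<comment> \<open>The vanishing of these minors says that the coordinate vector is proportional to
    \<open>?v\<close>.\<close>
  let ?f = "\<lambda>i. pconst (?v j) * pvar i - pconst (?v i) * pvar j"
  have F: "?f ` {..n} \<subseteq> (\<Union>d. hpoly n d)"
    using j by (auto intro!: hpoly_diff hpoly_cmult hpoly_pvar)
  have "zero_locus n (?f ` {..n}) = {x}"
  proof
    show "zero_locus n (?f ` {..n}) \<subseteq> {x}"
    proof
      fix y assume "y \<in> zero_locus n (?f ` {..n})"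
      then have y: "y \<in> PS n" and e: "\<And>i. i \<le> n \<Longrightarrow> ?v j * rp y i = ?v i * rp y j"
        unfolding zero_locus_ev[OF F] by auto
      have nz: "rp y j \<noteq> 0"
      proof
        assume "rp y j = 0"
        then have "rp y i = 0" if "i \<le> n" for i using e[OF that] j by simp
        then show False using rp_coord_nonzero[OF y] by blast
      qed
      have "rp y = cscale (rp y j / ?v j) ?v"
      proof
        fix i show "rp y i = cscale (rp y j / ?v j) ?v i"
          using e[of i] j rp_supp[OF y, of i] rp_supp[OF assms, of i]
          by (cases "i \<le> n") (auto simp: field_simps)
      qed
      then have "hpoint (rp y) = hpoint ?v" using hpoint_cscale[of "rp y j / ?v j" ?v] nz j by simp
      then show "y \<in> {x}" using hpoint_rp[OF y] hpoint_rp[OF assms] by simp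
    qed
    show "{x} \<subseteq> zero_locus n (?f ` {..n})" unfolding zero_locus_ev[OF F] using assms by auto
  qed
  then show ?thesis unfolding zclosed_def using F by (intro exI[of _ "?f ` {..n}"]) simp
qed

section \<open>The Zariski topology is Noetherian\<close>

text \<open>Dickson's lemma. Passing to monotone subsequences for one variable after the other makes
  all exponents weakly increasing, so that each monomial of the subsequence divides the later
  ones.\<close>

lemma dickson:
  fixes m :: "nat \<Rightarrow> (nat \<Rightarrow>\<^sub>0 nat)"
  assumes "\<And>i. Poly_Mapping.keys (m i) \<subseteq> {..n}"
  obtains i j k where "i < j" "m j = m i + k"
proof -
  have "\<exists>r::nat \<Rightarrow> nat. strict_mono r \<and> (\<forall>l<N. incseq (\<lambda>i. Poly_Mapping.lookup (m (r i)) l))" for N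
  proof (induction N)
    case 0
    show ?case by (intro exI[of _ id]) (auto simp: strict_mono_def)
  next
    case (Suc N)
    then obtain r where r: "strict_mono r" "\<And>l. l < N \<Longrightarrow> incseq (\<lambda>i. Poly_Mapping.lookup (m (r i)) l)" by blast
    let ?f = "\<lambda>i. Poly_Mapping.lookup (m (r i)) N"
    obtain s :: "nat \<Rightarrow> nat" where s: "strict_mono s" "monoseq (\<lambda>i. ?f (s i))"
      using seq_monosub[of ?f] by (auto simp: o_def)
    have "\<exists>t. strict_mono t \<and> incseq (\<lambda>i. ?f (t i))"
    proof (cases "incseq (\<lambda>i. ?f (s i))")
      case False
      \<comment> \<open>A decreasing sequence of natural numbers is constant once its minimum is
        reached.\<close>
      then have d: "decseq (\<lambda>i. ?f (s i))" using s(2) unfolding monoseq_iff by blast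
      define M where "M = (LEAST y. y \<in> range (\<lambda>i. ?f (s i)))"
      have "M \<in> range (\<lambda>i. ?f (s i))" unfolding M_def by (rule LeastI) blast
      then obtain i0 where i0: "M = ?f (s i0)" by (elim rangeE)
      have "?f (s (i + i0)) = M" for i
      proof (rule antisym)
        show "?f (s (i + i0)) \<le> M" unfolding i0 using d by (auto simp: decseq_def)
        show "M \<le> ?f (s (i + i0))" unfolding M_def by (rule Least_le) blast
      qed
      then have "incseq (\<lambda>i. ?f (s (i + i0)))" by (simp add: incseq_def)
      moreover have "strict_mono (\<lambda>i. s (i + i0))" using s(1) by (auto simp: strict_mono_def)
      ultimately show ?thesis by blast
    qed (use s in blast)
    then obtain t where t: "strict_mono t" "incseq (\<lambda>i. ?f (t i))" by blast
    have "strict_mono (r \<circ> t)" using r(1) t(1) by (rule strict_mono_o)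
    moreover have "incseq (\<lambda>i. Poly_Mapping.lookup (m ((r \<circ> t) i)) l)" if "l < Suc N" for l
    proof (cases "l = N")
      case True
      then show ?thesis using t by simp
    next
      case False
      then have l: "l < N" using that by simp
      have ti: "t i \<le> t j" if "i \<le> j" for i j using t(1) that by (simp add: strict_mono_less_eq)
      show ?thesis unfolding incseq_def
        by (auto intro!: incseqD[OF r(2)[OF l]] ti)
    qed
    ultimately show ?case by blast
  qed
  from this[of "Suc n"] obtain r where r: "strict_mono r"
    "\<And>l. l < Suc n \<Longrightarrow> incseq (\<lambda>i. Poly_Mapping.lookup (m (r i)) l)" by blast
  have le: "Poly_Mapping.lookup (m (r 0)) l \<le> Poly_Mapping.lookup (m (r 1)) l" for l
  proof (cases "l < Suc n")
    case True
    then show ?thesis using incseqD[OF r(2)[OF True], of 0 1] by simp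
  next
    case False
    then have "l \<notin> Poly_Mapping.keys (m (r 0))" using assms[of "r 0"] by auto
    then show ?thesis by (simp add: in_keys_iff)
  qed
  have "m (r 1) = m (r 0) + (m (r 1) - m (r 0))"
    by (rule poly_mapping_eqI) (use le in \<open>simp add: lookup_add lookup_minus\<close>)
  moreover have "r 0 < r 1" using r(1) by (simp add: strict_mono_def)
  ultimately show ?thesis using that[of "r 0" "r 1"] by simp
qed

text \<open>The descending chain condition without a detour through finitely generated ideals. For
  each i take a form vanishing on \<open>Z (Suc i)\<close> but not on \<open>Z i\<close> with the
  smallest possible leading monomial. By Dickson's lemma an earlier leading monomial divides a later
  one, and subtracting a multiple of the earlier form makes the later one smaller.\<close>

lemma zclosed_descending_stable:
  fixes Z :: "nat \<Rightarrow> pt set"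
  assumes cl: "\<And>i. zclosed n (Z i)" and desc: "\<And>i. Z (Suc i) \<subset> Z i"
  shows False
proof -
  have anti: "Z j \<subseteq> Z i" if "i \<le> j" for i j
    using lift_Suc_antimono_le[of Z] desc that by blast
  have sub: "Z i \<subseteq> PS n" for i using cl[of i] unfolding zclosed_def zero_locus_def by blast
  define Q where "Q i d p \<longleftrightarrow> p \<in> hpoly n d \<and> (\<forall>z\<in>Z (Suc i). ev p z = 0) \<and> (\<exists>z\<in>Z i. ev p z \<noteq> 0)" for i d p
  have ex: "\<exists>d p. Q i d p" for i
  proof -
    obtain x where x: "x \<in> Z i" "x \<notin> Z (Suc i)" using desc[of i] by blast
    then obtain p d where "p \<in> hpoly n d" "ev p x \<noteq> 0" "\<And>z. z \<in> Z (Suc i) \<Longrightarrow> ev p z = 0"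
      using zclosed_separate[OF cl[of "Suc i"], of x] sub by blast
    then show ?thesis unfolding Q_def using x by blast
  qed
  \<comment> \<open>The linear order on exponent vectors is compatible with addition, so this is a
    leading monomial in the usual sense.\<close>
  define lm where "lm p = Max (Poly_Mapping.keys (p :: cpoly))" for p
  have ex2: "\<exists>d g. Q i d g \<and> (\<forall>p. Q i d p \<longrightarrow> lm g \<le> lm p)" for i
  proof -
    \<comment> \<open>Fixing the degree first leaves finitely many candidates, so that the minimum
      exists.\<close>
    obtain d where d: "\<exists>p. Q i d p" using ex[of i] by blast
    let ?S = "lm ` {p. Q i d p}"
    have "?S \<subseteq> mons n d"
    proof
      fix a assume "a \<in> ?S"
      then obtain p where p: "Q i d p" "a = lm p" by blast
      have "Poly_Mapping.keys p \<noteq> {}" using p(1) unfolding Q_def ev_def peval_def by force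
      then have "a \<in> Poly_Mapping.keys p" unfolding p(2) lm_def by (intro Max_in) auto
      then show "a \<in> mons n d" using p(1) unfolding Q_def hpoly_keys by blast
    qed
    then have fin: "finite ?S" using finite_mons finite_subset by blast
    have "?S \<noteq> {}" using d by blast
    then have "Min ?S \<in> ?S" using fin by (rule Min_in[rotated])
    then obtain g where "Q i d g" "lm g = Min ?S" by auto
    then show ?thesis using fin by (metis (no_types, lifting) Min_le imageI mem_Collect_eq)
  qed
  then obtain d g where g: "\<And>i. Q i (d i) (g i)" "\<And>i p. Q i (d i) p \<Longrightarrow> lm (g i) \<le> lm p"
    by metis
  have ne: "Poly_Mapping.keys (g i) \<noteq> {}" for i
    using g(1)[of i] unfolding Q_def ev_def peval_def by force
  have lmk: "lm (g i) \<in> Poly_Mapping.keys (g i)" for i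
    unfolding lm_def using ne by (intro Max_in) auto
  have "Poly_Mapping.keys (lm (g i)) \<subseteq> {..n}" for i
    using g(1)[of i] lmk[of i] unfolding Q_def hpoly_def by blast
  then obtain i j k where ij: "i < j" "lm (g j) = lm (g i) + k" using dickson[of "\<lambda>i. lm (g i)" n] by metis
  define c where "c = Poly_Mapping.lookup (g j) (lm (g j)) / Poly_Mapping.lookup (g i) (lm (g i))"
  define s where "s = Poly_Mapping.single k c * g i"
  \<comment> \<open>The leading terms cancel. As \<open>g i\<close> vanishes on \<open>Z j\<close>,
    the form \<open>h\<close> takes the values of \<open>g j\<close> there and meets the same
    conditions.\<close>
  define h where "h = g j - s"
  have lks: "Poly_Mapping.lookup s (k + a) = c * Poly_Mapping.lookup (g i) a" for a
  proof -
    have "s = (\<Sum>b\<in>Poly_Mapping.keys (g i). Poly_Mapping.single (k + b) (c * Poly_Mapping.lookup (g i) b))"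
      unfolding s_def by (subst poly_sum_singles[of "g i"]) (simp add: sum_distrib_left mult_single)
    then have "Poly_Mapping.lookup s (k + a) = (\<Sum>b\<in>Poly_Mapping.keys (g i). if b = a then c * Poly_Mapping.lookup (g i) b else 0)"
      by (simp add: lookup_sum lookup_single when_def)
    then show ?thesis by (simp add: sum.delta' in_keys_iff)
  qed
  have keyss: "\<exists>a\<in>Poly_Mapping.keys (g i). b = k + a" if "b \<in> Poly_Mapping.keys s" for b
    using subsetD[OF Poly_Mapping.keys_mult that[unfolded s_def]] by (auto split: if_splits)
  have lmne: "Poly_Mapping.lookup (g i) (lm (g i)) \<noteq> 0" using lmk[of i] by (simp add: in_keys_iff)
  have key: "b < lm (g j)" if b: "b \<in> Poly_Mapping.keys h" for b
  proof -
    have "b \<noteq> lm (g j)"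
    proof
      assume "b = lm (g j)"
      then have "Poly_Mapping.lookup h b = 0"
        unfolding h_def lookup_minus using lks[of "lm (g i)"] lmne ij(2) by (simp add: c_def add.commute)
      then show False using b by (simp add: in_keys_iff)
    qed
    moreover have "b \<in> Poly_Mapping.keys (g j) \<or> b \<in> Poly_Mapping.keys s"
      using b unfolding h_def by (auto simp: in_keys_iff lookup_minus)
    then have "b \<le> lm (g j)"
    proof
      assume "b \<in> Poly_Mapping.keys (g j)"
      then show ?thesis unfolding lm_def by (intro Max_ge) auto
    next
      assume "b \<in> Poly_Mapping.keys s"
      then obtain a where a: "a \<in> Poly_Mapping.keys (g i)" "b = k + a" using keyss by blast
      have "a \<le> lm (g i)" unfolding lm_def using a by (intro Max_ge) auto
      then show ?thesis unfolding a(2) ij(2) by (metis add.commute add_left_mono)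
    qed
    ultimately show ?thesis by simp
  qed
  have gj: "g j \<in> hpoly n (d j)" and gi: "g i \<in> hpoly n (d i)" using g(1) unfolding Q_def by auto
  have hh: "h \<in> hpoly n (d j)"
  proof -
    have m: "mdeg (lm (g j)) = d j" "mdeg (lm (g i)) = d i" "Poly_Mapping.keys (lm (g j)) \<subseteq> {..n}"
      using lmk g(1) unfolding Q_def hpoly_def by blast+
    have "mdeg k + d i = d j" using m ij(2) by (simp add: mdeg_add)
    moreover have "Poly_Mapping.keys k \<subseteq> {..n}"
      using m(3) unfolding ij(2) by (auto simp: in_keys_iff lookup_add subset_iff)
    then have "s \<in> hpoly n (mdeg k + d i)" unfolding s_def by (intro hpoly_mult hpoly_single gi refl)
    ultimately show ?thesis unfolding h_def using gj by (auto intro: hpoly_diff)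
  qed
  have gi0: "ev (g i) z = 0" if "z \<in> Z j" for z
    using g(1)[of i] anti[of "Suc i" j] ij(1) that unfolding Q_def by auto
  have "Q j (d j) h"
    unfolding Q_def
  proof (intro conjI hh ballI)
    show "ev h z = 0" if "z \<in> Z (Suc j)" for z
      using g(1)[of j] gi0[of z] that desc[of j] unfolding Q_def h_def s_def by auto
    obtain z where "z \<in> Z j" "ev (g j) z \<noteq> 0" using g(1)[of j] unfolding Q_def by blast
    then show "\<exists>z\<in>Z j. ev h z \<noteq> 0" using gi0 unfolding h_def s_def by (intro bexI[of _ z]) auto
  qed
  then have le: "lm (g j) \<le> lm h" using g(2) by blast
  have "Poly_Mapping.keys h \<noteq> {}" using \<open>Q j (d j) h\<close> unfolding Q_def ev_def peval_def by force
  then have "lm h \<in> Poly_Mapping.keys h" unfolding lm_def by (intro Max_in) auto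
  then show False using key le by fastforce
qed

text \<open>Noetherian induction: without a minimal member, dependent choice would build an infinite
  strictly descending chain.\<close>

lemma zclosed_minimal:
  assumes "zclosed n Z" "P Z"
  obtains Y where "zclosed n Y" "P Y" "Y \<subseteq> Z" "\<And>W. zclosed n W \<Longrightarrow> P W \<Longrightarrow> W \<subseteq> Y \<Longrightarrow> W = Y"
proof (rule ccontr)
  assume neg: "\<not> thesis"
  define S where "S = {Y. zclosed n Y \<and> P Y \<and> Y \<subseteq> Z}"
  note thesisI = that
  have st: "\<exists>W. W \<in> S \<and> W \<subset> Y" if Y: "Y \<in> S" for Y
  proof (rule ccontr)
    assume no: "\<not> ?thesis"
    show False
    proof (rule notE[OF neg], rule thesisI)
      show "zclosed n Y" "P Y" "Y \<subseteq> Z" using Y by (auto simp: S_def)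
      show "W = Y" if "zclosed n W" "P W" "W \<subseteq> Y" for W
        using no that Y unfolding S_def by blast
    qed
  qed
  have "Z \<in> S" using assms by (auto simp: S_def)
  obtain g where g: "\<And>Y. Y \<in> S \<Longrightarrow> g Y \<in> S" "\<And>Y. Y \<in> S \<Longrightarrow> g Y \<subset> Y"
    using st by metis
  define f where "f i = (g ^^ i) Z" for i :: nat
  have f: "f i \<in> S" for i by (induction i) (auto simp: f_def g \<open>Z \<in> S\<close>)
  have "f (Suc i) \<subset> f i" for i using g(2)[OF f[of i]] by (simp add: f_def)
  moreover have "zclosed n (f i)" for i using f[of i] by (auto simp: S_def)
  ultimately show False by (intro zclosed_descending_stable[of n f])
qed

section \<open>Linear dependence of functions\<close>

text \<open>Stated for families instead of sets because the counting arguments may list one function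
  twice; such a repetition is itself a linear relation.\<close>

lemma family_dependent:
  fixes f :: "'i \<Rightarrow> 'a \<Rightarrow> complex"
  assumes I: "finite I" and S: "finite S" "card S < card I" and sp: "\<And>i. i \<in> I \<Longrightarrow> f i \<in> cfun.span S"
  obtains c where "\<exists>i\<in>I. c i \<noteq> 0" "\<And>x. (\<Sum>i\<in>I. c i * f i x) = 0"
proof (cases "inj_on f I")
  case False
  then obtain i j where ij: "i \<in> I" "j \<in> I" "i \<noteq> j" "f i = f j" by (auto simp: inj_on_def)
  let ?c = "\<lambda>k. if k = i then 1 else if k = j then -1 else (0::complex)"
  have "(\<Sum>k\<in>I. ?c k * f k x) = 0" for x
  proof -
    have "(\<Sum>k\<in>I. ?c k * f k x) = (\<Sum>k\<in>{i,j}. ?c k * f k x)"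
      using ij I by (intro sum.mono_neutral_right) auto
    then show ?thesis using ij by simp
  qed
  then show ?thesis using ij by (intro that[of ?c] bexI[of _ i]) auto
next
  case True
  have "cfun.dependent (f ` I)"
  proof (rule ccontr)
    assume "\<not> cfun.dependent (f ` I)"
    then have "card (f ` I) \<le> card S"
      using cfun.independent_span_bound[of S "f ` I"] S(1) sp by (simp add: image_subset_iff)
    then show False using card_image[OF True] S by simp
  qed
  then obtain u where u: "\<exists>v\<in>f ` I. u v \<noteq> 0" "(\<Sum>v\<in>f ` I. cscale (u v) v) = 0"
    using cfun.dependent_finite[of "f ` I"] I by auto
  have "(\<Sum>i\<in>I. u (f i) * f i x) = 0" for x
  proof -
    have "(\<Sum>v\<in>f ` I. cscale (u v) v) x = 0" using u(2) by simp
    then show ?thesis by (simp add: sum_fun_apply sum.reindex[OF True])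
  qed
  then show ?thesis using that[of "u \<circ> f"] u(1) by auto
qed

section \<open>Nullstellensatz\<close>

lemma pconst_hom [simp]:
  "pconst 0 = 0" "pconst 1 = 1" "pconst (a + b) = pconst a + pconst b"
  "pconst (a * b) = pconst a * pconst b" "pconst (- a) = - pconst a" "pconst (a - b) = pconst a - pconst b"
  by (simp_all add: pconst_def single_add mult_single single_uminus single_diff)

lemma single_sum: "Poly_Mapping.single (\<Sum>i\<in>A. m i) (1::complex) = (\<Prod>i\<in>A. Poly_Mapping.single (m i) 1)"
  for m :: "'i \<Rightarrow> (nat \<Rightarrow>\<^sub>0 nat)"
proof (induction A rule: infinite_finite_induct)
  case (insert x F)
  have "Poly_Mapping.single (m x + sum m F) (1::complex) = Poly_Mapping.single (m x) 1 * Poly_Mapping.single (sum m F) 1"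
    by (simp add: mult_single)
  then show ?case using insert by simp
qed auto

lemma pvar_power: "pvar i ^ k = Poly_Mapping.single (Poly_Mapping.single i k) 1"
  by (induction k) (auto simp: pvar_def mult_single simp flip: single_add)

lemma single_monomial:
  "Poly_Mapping.single m c = pconst c * (\<Prod>i\<in>Poly_Mapping.keys m. pvar i ^ Poly_Mapping.lookup m i)"
proof -
  have "m = (\<Sum>i\<in>Poly_Mapping.keys m. Poly_Mapping.single i (Poly_Mapping.lookup m i))"
  proof (rule poly_mapping_eqI)
    fix k
    have "Poly_Mapping.lookup (\<Sum>i\<in>Poly_Mapping.keys m. Poly_Mapping.single i (Poly_Mapping.lookup m i)) k
      = (\<Sum>i\<in>Poly_Mapping.keys m. if i = k then Poly_Mapping.lookup m i else 0)"
      by (simp add: lookup_sum lookup_single when_def)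
    then show "Poly_Mapping.lookup m k =
      Poly_Mapping.lookup (\<Sum>i\<in>Poly_Mapping.keys m. Poly_Mapping.single i (Poly_Mapping.lookup m i)) k"
      by (simp add: sum.delta' in_keys_iff)
  qed
  then have "Poly_Mapping.single m 1 = (\<Prod>i\<in>Poly_Mapping.keys m. pvar i ^ Poly_Mapping.lookup m i)"
    by (metis (no_types, lifting) single_sum pvar_power prod.cong)
  moreover have "Poly_Mapping.single m c = pconst c * Poly_Mapping.single m 1"
    by (simp add: pconst_def mult_single)
  ultimately show ?thesis by simp
qed

lemma cpoly_single_induct [case_names single add]:
  assumes "\<And>m c. P (Poly_Mapping.single m c)" "\<And>p q. P p \<Longrightarrow> P q \<Longrightarrow> P (p + q)"
  shows "P (p :: cpoly)"
proof -
  have "P 0" using assms(1)[of 0 0] by simp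
  then have "P (\<Sum>m\<in>A. Poly_Mapping.single m (f m))" for A f
    by (induction A rule: infinite_finite_induct) (auto intro: assms)
  then show ?thesis by (subst poly_sum_singles[of p])
qed

lemma cpoly_induct [case_names const var add mult]:
  assumes "\<And>c. P (pconst c)" "\<And>i. P (pvar i)" "\<And>p q. P p \<Longrightarrow> P q \<Longrightarrow> P (p + q)"
    "\<And>p q. P p \<Longrightarrow> P q \<Longrightarrow> P (p * q)"
  shows "P p"
proof (induction p rule: cpoly_single_induct)
  case (single m c)
  have one: "P 1" using assms(1)[of 1] by simp
  have "P (pvar i ^ k)" for i k by (induction k) (auto intro: assms one)
  then have "P (\<Prod>i\<in>A. pvar i ^ f i)" for A f
    by (induction A rule: infinite_finite_induct) (auto intro: assms one)
  then show ?case unfolding single_monomial by (intro assms)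
qed (rule assms(3))

lemma lookup_pconst_mult [simp]: "Poly_Mapping.lookup (pconst c * p) m = c * Poly_Mapping.lookup p m"
  unfolding pconst_def mult_map_scale_conv_mult[symmetric] by (simp add: Poly_Mapping.map.rep_eq when_def)

section \<open>Maximal ideals of the polynomial ring in countably many variables\<close>

definition pideal :: "cpoly set \<Rightarrow> bool" where
  "pideal I \<longleftrightarrow> 0 \<in> I \<and> (\<forall>p\<in>I. \<forall>q\<in>I. p + q \<in> I) \<and> (\<forall>p\<in>I. \<forall>r. r * p \<in> I)"

lemma pidealD:
  assumes "pideal I"
  shows "0 \<in> I" "p \<in> I \<Longrightarrow> q \<in> I \<Longrightarrow> p + q \<in> I" "p \<in> I \<Longrightarrow> r * p \<in> I"
  using assms unfolding pideal_def by auto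

lemma pideal_diff: "pideal I \<Longrightarrow> p \<in> I \<Longrightarrow> q \<in> I \<Longrightarrow> p - q \<in> I"
  using pidealD(2)[of I p "- q"] pidealD(3)[of I q "- 1"] by simp

lemma pideal_sum: "pideal I \<Longrightarrow> (\<And>i. i \<in> A \<Longrightarrow> f i \<in> I) \<Longrightarrow> (\<Sum>i\<in>A. f i) \<in> I"
  by (induction A rule: infinite_finite_induct) (auto simp: pidealD)

lemma pideal_adjoin:
  assumes "pideal I" shows "pideal {q + s * g |q s. q \<in> I}"
proof -
  have "\<exists>q s. 0 = q + s * g \<and> q \<in> I" using pidealD(1)[OF assms] by (intro exI[of _ 0]) auto
  moreover have "\<exists>q s. (q1 + s1 * g) + (q2 + s2 * g) = q + s * g \<and> q \<in> I"
    if "q1 \<in> I" "q2 \<in> I" for q1 q2 s1 s2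
    using pidealD(2)[OF assms that] by (intro exI[of _ "q1 + q2"] exI[of _ "s1 + s2"]) (auto simp: algebra_simps)
  moreover have "\<exists>q s. r * (q1 + s1 * g) = q + s * g \<and> q \<in> I"
    if "q1 \<in> I" for q1 s1 r
    using pidealD(3)[OF assms that, of r] by (intro exI[of _ "r * q1"] exI[of _ "r * s1"]) (simp add: distrib_left mult.assoc)
  ultimately show ?thesis unfolding pideal_def by auto
qed

definition maxideal :: "cpoly set \<Rightarrow> bool" where
  "maxideal M \<longleftrightarrow> pideal M \<and> 1 \<notin> M \<and> (\<forall>J. pideal J \<longrightarrow> M \<subseteq> J \<longrightarrow> 1 \<notin> J \<longrightarrow> J = M)"

text \<open>With infinitely many variables the ring is not Noetherian, hence the appeal to Zorn's
  lemma.\<close>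

lemma maxideal_exists:
  assumes "pideal I" "1 \<notin> I" obtains M where "maxideal M" "I \<subseteq> M"
proof -
  let ?A = "{J. pideal J \<and> I \<subseteq> J \<and> 1 \<notin> J}"
  have "\<exists>M\<in>?A. \<forall>X\<in>?A. M \<subseteq> X \<longrightarrow> X = M"
  proof (rule subset_Zorn_nonempty)
    show "?A \<noteq> {}" using assms by blast
    fix K assume K: "K \<noteq> {}" "subset.chain ?A K"
    have sub: "K \<subseteq> ?A" and tot: "\<And>X Y. X \<in> K \<Longrightarrow> Y \<in> K \<Longrightarrow> X \<subseteq> Y \<or> Y \<subseteq> X"
      using K(2) unfolding subset_chain_def by auto
    have id: "pideal X" if "X \<in> K" for X using that sub by blast
    have "pideal (\<Union>K)"
      unfolding pideal_def
    proof (intro conjI ballI allI)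
      show "0 \<in> \<Union>K" using K(1) pidealD(1)[OF id] by blast
      fix p assume p: "p \<in> \<Union>K"
      show "r * p \<in> \<Union>K" for r using p pidealD(3)[OF id] by blast
      fix q assume q: "q \<in> \<Union>K"
      obtain X Y where XY: "X \<in> K" "Y \<in> K" "p \<in> X" "q \<in> Y" using p q by blast
      then show "p + q \<in> \<Union>K" using tot[of X Y] pidealD(2)[OF id] by (metis UnionI subsetD)
    qed
    then show "\<Union>K \<in> ?A" using K(1) sub by blast
  qed
  then obtain M where M: "M \<in> ?A" "\<forall>X\<in>?A. M \<subseteq> X \<longrightarrow> X = M" by (rule bexE)
  have "J = M" if "pideal J" "M \<subseteq> J" "1 \<notin> J" for J
    using bspec[OF M(2), of J] M(1) that by auto
  then have "maxideal M" using M(1) unfolding maxideal_def by auto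
  then show ?thesis using that[of M] M(1) by auto
qed

lemma maxideal_inverse:
  assumes M: "maxideal M" and p: "p \<notin> M" obtains g where "g * p - 1 \<in> M"
proof -
  have id: "pideal M" using M by (simp add: maxideal_def)
  let ?J = "{q + s * p |q s. q \<in> M}"
  have "M \<subseteq> ?J"
  proof
    fix q assume "q \<in> M"
    then show "q \<in> ?J" by (intro CollectI exI[of _ q] exI[of _ 0]) simp
  qed
  moreover have "p \<in> ?J" using pidealD(1)[OF id] by (intro CollectI exI[of _ 0] exI[of _ 1]) simp
  ultimately have "1 \<in> ?J"
    using M p pideal_adjoin[OF id, of p] unfolding maxideal_def by (metis (no_types, lifting))
  then obtain q s where "1 = q + s * p" "q \<in> M" by blast
  then have "s * p - 1 = (- 1) * q" by (simp add: algebra_simps)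
  then have "s * p - 1 \<in> M" using pidealD(3)[OF id \<open>q \<in> M\<close>, of "- 1"] by simp
  then show ?thesis using that by blast
qed

lemma maxideal_prime:
  assumes M: "maxideal M" and pq: "p * q \<in> M" shows "p \<in> M \<or> q \<in> M"
proof (cases "p \<in> M")
  case False
  then obtain g where g: "g * p - 1 \<in> M" using maxideal_inverse[OF M] by blast
  have id: "pideal M" using M by (simp add: maxideal_def)
  have "q = g * (p * q) - q * (g * p - 1)" by (simp add: algebra_simps)
  then show ?thesis using pideal_diff[OF id pidealD(3)[OF id pq, of g] pidealD(3)[OF id g, of q]] by simp
qed simp

definition polyat :: "cpoly \<Rightarrow> complex poly \<Rightarrow> cpoly" where
  "polyat x p = poly (map_poly pconst p) x"

lemma polyat_pCons [simp]: "polyat x (pCons a p) = pconst a + x * polyat x p"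
  by (simp add: polyat_def map_poly_pCons)

lemma polyat_0 [simp]: "polyat x 0 = 0"
  by (simp add: polyat_def)

lemma polyat_1 [simp]: "polyat x 1 = 1"
  unfolding one_pCons by (simp del: one_pCons)

lemma polyat_add [simp]: "polyat x (p + q) = polyat x p + polyat x q"
  by (induction p q rule: poly_induct2) (auto simp: algebra_simps)

lemma polyat_smult [simp]: "polyat x (smult a p) = pconst a * polyat x p"
  by (induction p) (auto simp: algebra_simps)

lemma polyat_mult [simp]: "polyat x (p * q) = polyat x p * polyat x q"
  by (induction p) (auto simp: algebra_simps)

lemma polyat_sum [simp]: "polyat x (\<Sum>i\<in>A. f i) = (\<Sum>i\<in>A. polyat x (f i))"
  by (induction A rule: infinite_finite_induct) auto

lemma polyat_prod [simp]: "polyat x (\<Prod>i\<in>A. f i) = (\<Prod>i\<in>A. polyat x (f i))"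
  by (induction A rule: infinite_finite_induct) auto

text \<open>Over the complex numbers \<open>q\<close> splits into linear factors, and a maximal
  ideal is prime.\<close>

lemma maxideal_root:
  assumes M: "maxideal M" and q: "q \<noteq> 0" "polyat x q \<in> M"
  shows "\<exists>r. x - pconst r \<in> M"
  using q
proof (induction "degree q" arbitrary: q rule: less_induct)
  case less
  have id: "pideal M" using M by (simp add: maxideal_def)
  show ?case
  proof (cases "degree q = 0")
    case True
    then obtain a where a: "q = [:a:]" by (rule degree_eq_zeroE)
    then have "a \<noteq> 0" "pconst a \<in> M" using less.prems by auto
    then have "pconst (1 / a) * pconst a \<in> M" using pidealD(3)[OF id] by blast
    then have "1 \<in> M" using \<open>a \<noteq> 0\<close> by (simp flip: pconst_hom(4))
    then show ?thesis using M by (simp add: maxideal_def)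
  next
    case False
    then have "\<not> constant (poly q)" by (simp add: constant_degree)
    then obtain r where "poly q r = 0" using fundamental_theorem_of_algebra by blast
    then obtain q' where q': "q = [:- r, 1:] * q'" by (auto simp: poly_eq_0_iff_dvd elim: dvdE)
    have "(x - pconst r) * polyat x q' \<in> M" using less.prems(2) unfolding q' polyat_mult by simp
    then have "x - pconst r \<in> M \<or> polyat x q' \<in> M" by (rule maxideal_prime[OF M])
    moreover have "q' \<noteq> 0" using q' less.prems(1) by auto
    moreover have "degree q' < degree q" unfolding q' using \<open>q' \<noteq> 0\<close> by (subst degree_mult_eq) auto
    ultimately show ?thesis using less.hyps by blast
  qed
qed

text \<open>Exponent vectors come from association lists of pairs of natural numbers.\<close>

lemma countable_exponents: "countable (UNIV :: (nat \<Rightarrow>\<^sub>0 nat) set)"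
proof -
  have "(UNIV :: (nat \<Rightarrow>\<^sub>0 nat) set) \<subseteq> range Poly_Mapping.the_value"
    by (metis the_value_items rangeI subsetI)
  moreover have "countable (range (Poly_Mapping.the_value :: (nat \<times> nat) list \<Rightarrow> _))"
    by (intro countable_image) simp
  ultimately show ?thesis by (rule countable_subset)
qed

text \<open>The polynomial ring has countable dimension, so the uncountably many would-be inverses of
  \<open>x - c\<close> in the residue field are linearly dependent; hence \<open>x\<close> is algebraic there.\<close>

lemma maxideal_value:
  assumes M: "maxideal M" shows "\<exists>r. x - pconst r \<in> M"
proof (rule ccontr)
  assume "\<nexists>r. x - pconst r \<in> M"
  then have no: "x - pconst r \<notin> M" for r by blast
  have id: "pideal M" using M by (simp add: maxideal_def)
  have "\<exists>g. g * (x - pconst r) - 1 \<in> M" for r using maxideal_inverse[OF M no[of r]] by blast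
  then obtain g where g: "\<And>r. g r * (x - pconst r) - 1 \<in> M" by metis
  \<comment> \<open>There are uncountably many scalars r but only countably many finite sets of
    monomials, so infinitely many of the inverses \<open>g r\<close> share one support.\<close>
  have "\<exists>S. infinite {r. Poly_Mapping.keys (g r) = S}"
  proof (rule ccontr)
    assume "\<nexists>S. infinite {r. Poly_Mapping.keys (g r) = S}"
    then have fin: "countable {r. Poly_Mapping.keys (g r) = S}" for S by (simp add: countable_finite)
    let ?F = "{S :: (nat \<Rightarrow>\<^sub>0 nat) set. finite S \<and> S \<subseteq> UNIV}"
    have "countable ?F"
      using countable_Collect_finite_subset[OF countable_exponents] by simp
    then have "countable (\<Union>S\<in>?F. {r. Poly_Mapping.keys (g r) = S})" using fin by (intro countable_UN) auto
    moreover have "r \<in> (\<Union>S\<in>?F. {r. Poly_Mapping.keys (g r) = S})" for r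
      by (rule UN_I[of "Poly_Mapping.keys (g r)"]) simp_all
    then have "(\<Union>S\<in>?F. {r. Poly_Mapping.keys (g r) = S}) = UNIV" by (rule UNIV_eq_I[symmetric])
    ultimately show False using uncountable_UNIV_complex by simp
  qed
  then obtain S where "infinite {r. Poly_Mapping.keys (g r) = S}" by blast
  then obtain T where T: "T \<subseteq> {r. Poly_Mapping.keys (g r) = S}" "card T = Suc (card S)" "finite T"
    using infinite_arbitrarily_large[of "{r. Poly_Mapping.keys (g r) = S}" "Suc (card S)"] by auto
  have S: "finite S"
  proof -
    have "T \<noteq> {}" using T(2) by auto
    then show ?thesis using T(1) by auto
  qed
  let ?e = "\<lambda>m k. if k = m then 1 else (0::complex)"
  have "Poly_Mapping.lookup (g r) \<in> cfun.span (?e ` S)" if "r \<in> T" for r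
  proof -
    have "Poly_Mapping.lookup (g r) k = (\<Sum>m\<in>S. cscale (Poly_Mapping.lookup (g r) m) (?e m)) k" for k
    proof -
      have "(\<Sum>m\<in>S. cscale (Poly_Mapping.lookup (g r) m) (?e m)) k
          = (\<Sum>m\<in>S. if m = k then Poly_Mapping.lookup (g r) m else 0)"
        unfolding sum_fun_apply by (intro sum.cong) auto
      also have "\<dots> = Poly_Mapping.lookup (g r) k"
        using that T(1) S by (auto simp: sum.delta' in_keys_iff)
      finally show ?thesis by simp
    qed
    then have "Poly_Mapping.lookup (g r) = (\<Sum>m\<in>S. cscale (Poly_Mapping.lookup (g r) m) (?e m))" by (rule ext)
    moreover have "(\<Sum>m\<in>S. cscale (Poly_Mapping.lookup (g r) m) (?e m)) \<in> cfun.span (?e ` S)"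
      by (intro cfun.span_sum cfun.span_scale cfun.span_base imageI)
    ultimately show ?thesis by simp
  qed
  note span = this
  obtain l where l: "\<exists>r\<in>T. l r \<noteq> 0" "\<And>k. (\<Sum>r\<in>T. l r * Poly_Mapping.lookup (g r) k) = 0"
  proof (rule family_dependent[of T "?e ` S" "\<lambda>r. Poly_Mapping.lookup (g r)"])
    show "card (?e ` S) < card T" using card_image_le[OF S, of ?e] T(2) by simp
  qed (use T(3) S span in auto)
  have l0: "(\<Sum>r\<in>T. pconst (l r) * g r) = 0"
    by (rule poly_mapping_eqI) (simp add: lookup_sum l(2))
  \<comment> \<open>Clearing denominators in the relation between the inverses of x - r produces
    \<open>q\<close>. At \<open>r0\<close> a single summand survives, a product of nonzero
    factors.\<close>
  define q where "q = (\<Sum>r\<in>T. smult (l r) (\<Prod>s\<in>T - {r}. [:- s, 1:]))"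
  obtain r0 where r0: "r0 \<in> T" "l r0 \<noteq> 0" using l(1) by blast
  have "poly q r0 = (\<Sum>r\<in>T. if r = r0 then l r * (\<Prod>s\<in>T - {r}. r0 - s) else 0)"
    unfolding q_def poly_sum
  proof (intro sum.cong refl)
    fix r assume "r \<in> T"
    have "(\<Prod>s\<in>T - {r}. r0 - s) = 0" if "r \<noteq> r0" using T(3) r0(1) that by (intro prod_zero bexI[of _ r0]) auto
    then show "poly (smult (l r) (\<Prod>s\<in>T - {r}. [:- s, 1:])) r0 = (if r = r0 then l r * (\<Prod>s\<in>T - {r}. r0 - s) else 0)"
      by (simp add: poly_prod)
  qed
  also have "\<dots> = l r0 * (\<Prod>s\<in>T - {r0}. r0 - s)" using T(3) r0(1) by (simp add: sum.delta')
  also have "\<dots> \<noteq> 0" using r0(2) T(3) by (auto simp: prod_zero_iff)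
  finally have "q \<noteq> 0" by auto
  moreover have "polyat x q \<in> M"
  proof -
    let ?P = "\<Prod>s\<in>T. x - pconst s" and ?R = "\<lambda>r. \<Prod>s\<in>T - {r}. x - pconst s"
    have a: "polyat x q = (\<Sum>r\<in>T. pconst (l r) * ?R r)"
      unfolding q_def by simp
    have b: "g r * ?P - ?R r = ?R r * (g r * (x - pconst r) - 1)" if "r \<in> T" for r
      by (subst prod.remove[OF T(3) that]) (simp add: algebra_simps)
    have "(\<Sum>r\<in>T. pconst (l r) * (g r * ?P - ?R r)) \<in> M"
    proof (intro pideal_sum[OF id] pidealD(3)[OF id])
      fix r assume "r \<in> T"
      show "g r * ?P - ?R r \<in> M" unfolding b[OF \<open>r \<in> T\<close>] by (rule pidealD(3)[OF id g])
    qed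
    moreover have "(\<Sum>r\<in>T. pconst (l r) * (g r * ?P - ?R r)) = (\<Sum>r\<in>T. pconst (l r) * g r) * ?P - polyat x q"
      unfolding a sum_distrib_right sum_subtractf[symmetric] by (intro sum.cong) (auto simp: algebra_simps)
    ultimately have "- polyat x q \<in> M" using l0 by simp
    then show ?thesis using pidealD(3)[OF id, of "- polyat x q" "- 1"] by simp
  qed
  ultimately show False using maxideal_root[OF M] no by blast
qed

text \<open>Modulo a maximal ideal every variable is congruent to a scalar, so every
  \<open>p\<close> is congruent to its value at the point formed by these scalars. A nonzero value
  would turn a member of the ideal into a unit.\<close>

lemma weak_nullstellensatz:
  assumes "pideal I" "1 \<notin> I"
  obtains v where "\<And>p. p \<in> I \<Longrightarrow> peval p v = 0"
proof -
  obtain M where M: "maxideal M" "I \<subseteq> M" using maxideal_exists[OF assms] by blast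
  have id: "pideal M" using M by (simp add: maxideal_def)
  have "\<forall>i. \<exists>r. pvar i - pconst r \<in> M" using maxideal_value[OF M(1)] by blast
  then obtain v where v: "\<And>i. pvar i - pconst (v i) \<in> M" by (auto simp: choice_iff)
  have key: "p - pconst (peval p v) \<in> M" for p
  proof (induction p rule: cpoly_induct)
    case (add p q)
    then show ?case using pidealD(2)[OF id add] by (simp add: algebra_simps)
  next
    case (mult p q)
    have "p * q - pconst (peval (p * q) v) = q * (p - pconst (peval p v)) + pconst (peval p v) * (q - pconst (peval q v))"
      by (simp add: algebra_simps)
    then show ?case using pidealD(2)[OF id pidealD(3)[OF id mult(1)] pidealD(3)[OF id mult(2)]] by simp
  qed (use v pidealD(1)[OF id] in auto)
  have "peval p v = 0" if "p \<in> I" for p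
  proof (rule ccontr)
    assume nz: "peval p v \<noteq> 0"
    have "p - (p - pconst (peval p v)) \<in> M" by (rule pideal_diff[OF id]) (use that M(2) key in auto)
    then have "pconst (1 / peval p v) * pconst (peval p v) \<in> M" using pidealD(3)[OF id] by simp
    then have "1 \<in> M" using nz by (simp flip: pconst_hom(4))
    then show False using M(1) by (simp add: maxideal_def)
  qed
  then show ?thesis by (rule that)
qed

section \<open>Homogeneous components and the projective Nullstellensatz\<close>

definition hcomp :: "nat \<Rightarrow> nat \<Rightarrow> cpoly \<Rightarrow> cpoly" where
  "hcomp n d p = (\<Sum>m\<in>Poly_Mapping.keys p \<inter> mons n d. Poly_Mapping.single m (Poly_Mapping.lookup p m))"

lemma lookup_hcomp: "Poly_Mapping.lookup (hcomp n d p) m = (if m \<in> mons n d then Poly_Mapping.lookup p m else 0)"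
proof -
  have "Poly_Mapping.lookup (hcomp n d p) m
      = (\<Sum>k\<in>Poly_Mapping.keys p \<inter> mons n d. if k = m then Poly_Mapping.lookup p k else 0)"
    unfolding hcomp_def by (simp add: lookup_sum lookup_single when_def)
  then show ?thesis by (auto simp: sum.delta' in_keys_iff)
qed

lemma hcomp_hpoly: "hcomp n d p \<in> hpoly n d"
  unfolding hpoly_keys by (auto simp: in_keys_iff lookup_hcomp split: if_splits)

lemma hcomp_add: "hcomp n d (p + q) = hcomp n d p + hcomp n d q"
  by (rule poly_mapping_eqI) (simp add: lookup_hcomp lookup_add)

lemma hcomp_diff: "hcomp n d (p - q) = hcomp n d p - hcomp n d q"
  by (rule poly_mapping_eqI) (simp add: lookup_hcomp lookup_minus)

lemma hcomp_of_hpoly: "p \<in> hpoly n e \<Longrightarrow> hcomp n d p = (if d = e then p else 0)"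
proof (rule poly_mapping_eqI)
  fix k assume p: "p \<in> hpoly n e"
  show "Poly_Mapping.lookup (hcomp n d p) k = Poly_Mapping.lookup (if d = e then p else 0) k"
  proof (cases "k \<in> Poly_Mapping.keys p")
    case True
    then have "k \<in> mons n e" using p by (auto simp: hpoly_keys)
    then show ?thesis by (auto simp: lookup_hcomp mons_def)
  qed (auto simp: lookup_hcomp in_keys_iff)
qed

lemma hcomp_single: "hcomp n d (Poly_Mapping.single m c) = (if m \<in> mons n d then Poly_Mapping.single m c else 0)"
  by (rule poly_mapping_eqI) (auto simp: lookup_hcomp lookup_single when_def)

lemma mons_add_iff: "a + b \<in> mons n d \<longleftrightarrow> mdeg a \<le> d \<and> a \<in> mons n (mdeg a) \<and> b \<in> mons n (d - mdeg a)"
proof -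
  have "Poly_Mapping.keys (a + b) = Poly_Mapping.keys a \<union> Poly_Mapping.keys b"
    by (auto simp: in_keys_iff lookup_add)
  then show ?thesis by (auto simp: mons_def mdeg_add)
qed

lemma hcomp_mult: "hcomp n d (p * q) = (\<Sum>i\<le>d. hcomp n i p * hcomp n (d - i) q)"
proof (induction p rule: cpoly_single_induct)
  case (single a x)
  show ?case
  proof (induction q rule: cpoly_single_induct)
    case (single b y)
    let ?a = "Poly_Mapping.single a x" and ?b = "Poly_Mapping.single b y"
    have "(\<Sum>i\<le>d. hcomp n i ?a * hcomp n (d - i) ?b)
        = (\<Sum>i\<le>d. if i = mdeg a then hcomp n i ?a * hcomp n (d - i) ?b else 0)"
      by (intro sum.cong) (auto simp: hcomp_single mons_def)
    also have "\<dots> = hcomp n d (?a * ?b)"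
      by (auto simp: sum.delta' mult_single hcomp_single mons_add_iff)
    finally show ?case by simp
  next
    case (add q1 q2)
    then show ?case by (simp add: distrib_left hcomp_add sum.distrib)
  qed
next
  case (add p1 p2)
  then show ?case by (simp add: distrib_right hcomp_add sum.distrib)
qed

lemma hcomp_mult_form:
  assumes "g \<in> hpoly n e"
  shows "hcomp n d (p * g) = (if e \<le> d then hcomp n (d - e) p * g else 0)"
proof -
  have "hcomp n d (p * g) = (\<Sum>i\<le>d. if i + e = d then hcomp n i p * g else 0)"
    unfolding hcomp_mult by (intro sum.cong) (auto simp: hcomp_of_hpoly[OF assms])
  also have "\<dots> = (\<Sum>i\<in>{i. i \<le> d \<and> i + e = d}. hcomp n i p * g)"
    by (auto simp: sum.If_cases intro!: sum.cong)
  also have "{i. i \<le> d \<and> i + e = d} = (if e \<le> d then {d - e} else {})" by auto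
  finally show ?thesis by simp
qed

definition gideal :: "nat \<Rightarrow> (nat \<Rightarrow> cpoly set) \<Rightarrow> bool" where
  "gideal n I \<longleftrightarrow> (\<forall>d. I d \<subseteq> hpoly n d \<and> 0 \<in> I d \<and> (\<forall>p\<in>I d. \<forall>q\<in>I d. p + q \<in> I d) \<and>
     (\<forall>e. \<forall>q\<in>hpoly n e. \<forall>p\<in>I d. q * p \<in> I (e + d)))"

lemma gidealD:
  assumes "gideal n I"
  shows "p \<in> I d \<Longrightarrow> p \<in> hpoly n d" "0 \<in> I d" "p \<in> I d \<Longrightarrow> q \<in> I d \<Longrightarrow> p + q \<in> I d"
    "q \<in> hpoly n e \<Longrightarrow> p \<in> I d \<Longrightarrow> q * p \<in> I (e + d)"
  using assms unfolding gideal_def by auto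

lemma gideal_sum: "gideal n I \<Longrightarrow> (\<And>i. i \<in> A \<Longrightarrow> f i \<in> I d) \<Longrightarrow> (\<Sum>i\<in>A. f i) \<in> I d"
  by (induction A rule: infinite_finite_induct) (auto simp: gidealD)

text \<open>Apply the weak Nullstellensatz to \<open>I + (g - 1)\<close>, whose zeros would be points of the
  projective zero locus of \<open>I\<close> at which \<open>g\<close> does not vanish. The homogeneous components of a
  relation \<open>1 = q + s (g - 1)\<close> are, modulo \<open>I\<close>, the powers of \<open>g\<close>.\<close>

lemma graded_nullstellensatz:
  assumes I: "gideal n I" and g: "g \<in> hpoly n e" "e \<ge> 1"
    and van: "\<And>v. v \<noteq> 0 \<Longrightarrow> (\<And>i. i > n \<Longrightarrow> v i = 0) \<Longrightarrow> (\<And>d p. p \<in> I d \<Longrightarrow> peval p v = 0) \<Longrightarrow> peval g v = 0"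
  shows "\<exists>k. g ^ k \<in> I (k * e)"
proof -
  \<comment> \<open>The ungraded ideal belonging to I: its members may be inhomogeneous, but all
    their components lie in I.\<close>
  define J where "J = {q. \<forall>d. hcomp n d q \<in> I d}"
  have J: "pideal J"
    unfolding pideal_def J_def
  proof (intro conjI ballI allI CollectI)
    show "hcomp n d 0 \<in> I d" for d using gidealD(2)[OF I] by (simp add: hcomp_def)
    fix p d assume p: "p \<in> {q. \<forall>d. hcomp n d q \<in> I d}"
    show "hcomp n d (p + q) \<in> I d" if "q \<in> {q. \<forall>d. hcomp n d q \<in> I d}" for q
      using gidealD(3)[OF I] p that by (simp add: hcomp_add)
    show "hcomp n d (r * p) \<in> I d" for r
      unfolding hcomp_mult
    proof (intro gideal_sum[OF I])
      fix i assume "i \<in> {..d}"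
      then show "hcomp n i r * hcomp n (d - i) p \<in> I d"
        using gidealD(4)[OF I hcomp_hpoly, of "hcomp n (d - i) p" "d - i" i r] p by simp
    qed
  qed
  have "1 \<in> {q + s * (g - 1) |q s. q \<in> J}"
  proof (rule ccontr)
    assume "1 \<notin> {q + s * (g - 1) |q s. q \<in> J}"
    then obtain v where v: "\<And>p. p \<in> {q + s * (g - 1) |q s. q \<in> J} \<Longrightarrow> peval p v = 0"
      using weak_nullstellensatz[OF pideal_adjoin[OF J]] by blast
    have vJ: "peval p v = 0" if "p \<in> J" for p
      using that by (intro v CollectI exI[of _ p] exI[of _ 0]) auto
    have "peval (g - 1) v = 0"
      using pidealD(1)[OF J] by (intro v CollectI exI[of _ 0] exI[of _ 1]) auto
    then have gv: "peval g v = 1" by simp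
    \<comment> \<open>\<open>hcomp\<close> also discards monomials with a variable of index above n,
      so these variables belong to J and vanish at v.\<close>
    have "v i = 0" if "i > n" for i
    proof -
      have "Poly_Mapping.single i 1 \<notin> mons n d" for d using that by (auto simp: mons_def)
      then have "pvar i \<in> J" using gidealD(2)[OF I] by (simp add: J_def pvar_def hcomp_single)
      then show ?thesis using vJ[of "pvar i"] by simp
    qed
    moreover have "v \<noteq> 0"
    proof
      assume "v = 0"
      then have "v = cscale 0 v" by (auto simp: fun_eq_iff)
      then have "peval g v = 0 ^ e * peval g v" using peval_cscale[OF g(1), of 0 v] by metis
      moreover have "(0::complex) ^ e = 0" using g(2) by simp
      ultimately show False using gv by simp
    qed
    moreover have "peval p v = 0" if "p \<in> I d" for d p
      using hcomp_of_hpoly[OF gidealD(1)[OF I that]] that gidealD(2)[OF I]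
      by (intro vJ) (auto simp: J_def)
    ultimately have "peval g v = 0" by (intro van)
    then show False using gv by simp
  qed
  then obtain q s where qs: "1 = q + s * (g - 1)" "q \<in> J" by blast
  have s_eq: "s = q + s * g - 1" using qs(1) by (simp add: algebra_simps)
  have c: "hcomp n d s = hcomp n d q + (if e \<le> d then hcomp n (d - e) s * g else 0) - (if d = 0 then 1 else 0)" for d
    using arg_cong[OF s_eq, of "hcomp n d"]
    by (simp add: hcomp_diff hcomp_add hcomp_mult_form[OF g(1)] hcomp_of_hpoly[OF one_hpoly])
  \<comment> \<open>By the recursion \<open>c\<close>, multiplying by g leads from one multiple of e
    to the next: modulo I the component of s in degree k e is -g^k.\<close>
  have key: "hcomp n (k * e) s + g ^ k \<in> I (k * e)" for k
  proof (induction k)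
    case 0
    have "hcomp n 0 s + 1 = hcomp n 0 q" using c[of 0] g(2) by simp
    then show ?case using qs(2) by (simp add: J_def)
  next
    case (Suc k)
    have "hcomp n (Suc k * e) s + g ^ Suc k = hcomp n (Suc k * e) q + g * (hcomp n (k * e) s + g ^ k)"
      using c[of "Suc k * e"] g(2) by (simp add: algebra_simps)
    moreover have "g * (hcomp n (k * e) s + g ^ k) \<in> I (e + k * e)" by (rule gidealD(4)[OF I g(1) Suc])
    moreover have "hcomp n (Suc k * e) q \<in> I (Suc k * e)" using qs(2) by (simp add: J_def)
    ultimately show ?case using gidealD(3)[OF I] by simp
  qed
  \<comment> \<open>Then k e exceeds the degree of every monomial of s, the component is zero and
    the power of g alone lies in I.\<close>
  define k where "k = Suc (\<Sum>m\<in>Poly_Mapping.keys s. mdeg m)"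
  have "hcomp n (k * e) s = 0"
  proof (rule poly_mapping_eqI)
    fix m
    have "m \<notin> Poly_Mapping.keys s" if "m \<in> mons n (k * e)"
    proof
      assume "m \<in> Poly_Mapping.keys s"
      then have "mdeg m < k" unfolding k_def by (intro le_imp_less_Suc member_le_sum) auto
      moreover have "k \<le> k * e" using g(2) by simp
      ultimately show False using that by (auto simp: mons_def)
    qed
    then show "Poly_Mapping.lookup (hcomp n (k * e) s) m = Poly_Mapping.lookup 0 m"
      by (auto simp: lookup_hcomp in_keys_iff)
  qed
  then show ?thesis using key[of k] by auto
qed

text \<open>By the Nullstellensatz I contains the K-th power of each variable for a common K. In
  degree (n + 1) K or more, every monomial is divisible by one of these powers, because n + 1
  exponents below K have too small a sum.\<close>

lemma gideal_no_zeros: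
  assumes I: "gideal n I"
    and van: "\<And>v. v \<noteq> 0 \<Longrightarrow> (\<And>i. i > n \<Longrightarrow> v i = 0) \<Longrightarrow> \<exists>d. \<exists>p\<in>I d. peval p v \<noteq> 0"
  obtains d0 where "\<And>d. d \<ge> d0 \<Longrightarrow> hpoly n d \<subseteq> I d"
proof -
  have "\<exists>k. pvar i ^ k \<in> I k" if "i \<le> n" for i
    using graded_nullstellensatz[OF I hpoly_pvar[OF that]] van by (metis le_refl mult_1_right)
  then obtain k where k: "\<And>i. i \<le> n \<Longrightarrow> pvar i ^ k i \<in> I (k i)" by metis
  define K where "K = Suc (\<Sum>i\<le>n. k i)"
  have K: "pvar i ^ K \<in> I K" if i: "i \<le> n" for i
  proof -
    have "k i \<le> K" unfolding K_def using i by (intro le_SucI member_le_sum) auto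
    then have "pvar i ^ K = pvar i ^ (K - k i) * pvar i ^ k i" by (simp flip: power_add)
    moreover have "pvar i ^ (K - k i) * pvar i ^ k i \<in> I ((K - k i) * 1 + k i)"
      by (intro gidealD(4)[OF I hpoly_power[OF hpoly_pvar[OF i]] k[OF i]])
    ultimately show ?thesis using \<open>k i \<le> K\<close> by simp
  qed
  have "hpoly n d \<subseteq> I d" if d: "d \<ge> Suc n * K" for d
  proof
    fix p assume p: "p \<in> hpoly n d"
    have "Poly_Mapping.single m c \<in> I d" if m: "m \<in> mons n d" for m c
    proof -
      have md: "mdeg m = d" "Poly_Mapping.keys m \<subseteq> {..n}" using m by (auto simp: mons_def)
      have "\<exists>i\<le>n. K \<le> Poly_Mapping.lookup m i"
      proof (rule ccontr)
        assume "\<not> ?thesis"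
        then have "(\<Sum>i\<le>n. Poly_Mapping.lookup m i) < (\<Sum>i\<le>n. K)" by (intro sum_strict_mono) auto
        then show False using d md mdeg_superset[of "{..n}" m] by simp
      qed
      then obtain i where i: "i \<le> n" "K \<le> Poly_Mapping.lookup m i" by blast
      define m' where "m' = m - Poly_Mapping.single i K"
      have mm: "m = m' + Poly_Mapping.single i K"
        by (rule poly_mapping_eqI) (use i in \<open>auto simp: m'_def lookup_add lookup_minus lookup_single when_def\<close>)
      have "mdeg (Poly_Mapping.single i K) = K" by (simp add: mdeg_def)
      then have md': "mdeg m' + K = d" using md(1) mm mdeg_add by metis
      have km: "Poly_Mapping.keys m' \<subseteq> {..n}"
        using md(2) unfolding m'_def by (auto simp: in_keys_iff lookup_minus subset_iff)
      have "Poly_Mapping.single m' c * pvar i ^ K \<in> I (mdeg m' + K)"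
        using km by (intro gidealD(4)[OF I hpoly_single K[OF i(1)]]) auto
      moreover have "Poly_Mapping.single m' c * pvar i ^ K = Poly_Mapping.single m c"
        unfolding pvar_power mm by (simp add: mult_single)
      ultimately show ?thesis using md' by simp
    qed
    then have "(\<Sum>m\<in>Poly_Mapping.keys p. Poly_Mapping.single m (Poly_Mapping.lookup p m)) \<in> I d"
      using p unfolding hpoly_keys by (intro gideal_sum[OF I]) auto
    then show "p \<in> I d" using poly_sum_singles[of p] by simp
  qed
  then show ?thesis by (rule that)
qed

section \<open>The cofinite topology and the local rings of a smooth curve\<close>

lemma zclosed_empty: "zclosed n {}"
  using closedin_empty[of "zariski n"] by (simp only: closedin_zariski)

lemma zclosed_finite: "finite S \<Longrightarrow> S \<subseteq> PS n \<Longrightarrow> zclosed n S"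
proof (induction S rule: finite_induct)
  case (insert x S)
  then show ?case using zclosed_Un[OF zclosed_singleton[of x n], of S] by simp
qed (simp add: zclosed_empty)

lemma zclosed_Int: "zclosed n Y \<Longrightarrow> zclosed n Z \<Longrightarrow> zclosed n (Y \<inter> Z)"
  using closedin_Int[of "zariski n" Y Z] by (simp add: closedin_zariski)

lemma zclosed_PS: "zclosed n Z \<Longrightarrow> Z \<subseteq> PS n"
  unfolding zclosed_def zero_locus_def by blast

locale curve =
  fixes n :: nat and C :: "pt set"
  assumes sc: "smooth_projective_curve n C"
begin

lemma closedC: "zclosed n C"
  using sc by (simp add: smooth_projective_curve_def closedin_zariski)

lemma C_PS: "x \<in> C \<Longrightarrow> x \<in> PS n"
  using zclosed_PS[OF closedC] by blast

abbreviation T where "T \<equiv> subtopology (zariski n) C"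

lemma PS_Int_C [simp]: "PS n \<inter> C = C"
  using C_PS by auto

lemma closedinT: "closedin T Z \<longleftrightarrow> zclosed n Z \<and> Z \<subseteq> C"
  using closedin_closed_subtopology[of "zariski n" C Z] closedC by (auto simp: closedin_zariski)

lemma irreducibleT:
  assumes "S \<subseteq> C" shows "irreducible_in T S \<longleftrightarrow> irreducible_in (zariski n) S"
proof
  assume irr: "irreducible_in T S"
  show "irreducible_in (zariski n) S"
    unfolding irreducible_in_def
  proof (intro conjI allI impI)
    show "S \<subseteq> topspace (zariski n)" using assms C_PS by auto
    fix A B assume "closedin (zariski n) A" "closedin (zariski n) B" and SAB: "S \<subseteq> A \<union> B"
    then have "closedin T (A \<inter> C)" "closedin T (B \<inter> C)"
      using zclosed_Int closedC by (auto simp: closedinT closedin_zariski)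
    moreover have "S \<subseteq> (A \<inter> C) \<union> (B \<inter> C)" using SAB assms by blast
    ultimately have "S \<subseteq> A \<inter> C \<or> S \<subseteq> B \<inter> C" using irr unfolding irreducible_in_def by blast
    then show "S \<subseteq> A \<or> S \<subseteq> B" by blast
  qed
next
  assume irr: "irreducible_in (zariski n) S"
  show "irreducible_in T S"
    using irr assms unfolding irreducible_in_def by (auto simp: closedinT closedin_zariski)
qed

lemma irreducibleC: "irreducible_in (zariski n) C"
  using sc by (simp add: smooth_projective_curve_def)

text \<open>A chain of length 1 contains an irreducible closed set with at least two points. In a
  finite set one of these points and the rest would both be closed and would split it.\<close>

lemma infiniteC: "infinite C"
proof
  assume fin: "finite C"
  obtain Z :: "nat \<Rightarrow> pt set" where Z: "\<forall>i\<le>1. Z i \<noteq> {} \<and> closedin T (Z i) \<and> irreducible_in T (Z i)"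
    "\<forall>i<1. Z i \<subset> Z (Suc i)"
    using sc unfolding smooth_projective_curve_def has_krull_dim_def irreducible_chain_def by blast
  have Z01: "Z 0 \<noteq> {}" "Z 0 \<subset> Z 1" "closedin T (Z 1)" "irreducible_in T (Z 1)" using Z by auto
  then obtain p where p: "p \<in> Z 0" by blast
  have sub: "Z 1 \<subseteq> C" using Z01(3) by (simp add: closedinT)
  have "closedin T {p}" "closedin T (Z 1 - {p})"
    using p Z01(2) sub fin C_PS by (auto simp: closedinT intro!: zclosed_finite intro: finite_subset)
  moreover have "Z 1 \<subseteq> {p} \<union> (Z 1 - {p})" by blast
  ultimately have "Z 1 \<subseteq> {p} \<or> Z 1 \<subseteq> Z 1 - {p}" using Z01(4) unfolding irreducible_in_def by blast
  then show False using p Z01(2) by blast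
qed

text \<open>This is where dimension at most 1 is used. A minimal infinite closed subset Y is
  irreducible, since one of two closed pieces covering it must be infinite; with a point p in Y, the
  sets {p}, Y and C would form a chain of length 2.\<close>

lemma finite_closed:
  assumes "zclosed n Z" "Z \<subset> C" shows "finite Z"
proof (rule ccontr)
  assume inf: "infinite Z"
  obtain Y where Y: "zclosed n Y" "infinite Y" "Y \<subseteq> Z"
    "\<And>W. zclosed n W \<Longrightarrow> infinite W \<Longrightarrow> W \<subseteq> Y \<Longrightarrow> W = Y"
    using zclosed_minimal[of n Z infinite] assms(1) inf by blast
  have YC: "Y \<subset> C" using Y(3) assms(2) by blast
  have "irreducible_in (zariski n) Y"
    unfolding irreducible_in_def
  proof (intro conjI allI impI)
    show "Y \<subseteq> topspace (zariski n)" using YC C_PS by auto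
    fix A B assume AB: "closedin (zariski n) A" "closedin (zariski n) B" "Y \<subseteq> A \<union> B"
    have "Y = (Y \<inter> A) \<union> (Y \<inter> B)" using AB(3) by blast
    then have "infinite (Y \<inter> A) \<or> infinite (Y \<inter> B)" using Y(2) by (metis finite_Un)
    then have "Y \<inter> A = Y \<or> Y \<inter> B = Y"
      using Y(4)[of "Y \<inter> A"] Y(4)[of "Y \<inter> B"] Y(1) AB zclosed_Int by (auto simp: closedin_zariski)
    then show "Y \<subseteq> A \<or> Y \<subseteq> B" by blast
  qed
  then have irrY: "irreducible_in T Y" using irreducibleT YC by blast
  obtain p where p: "p \<in> Y" using Y(2) by fastforce
  have "p \<in> C" using p YC by blast
  have irrp: "irreducible_in T {p}" using p YC unfolding irreducible_in_def by auto
  have irrC: "irreducible_in T C" using irreducibleT irreducibleC by blast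
  have pY: "{p} \<subset> Y" using p Y(2) by (metis finite.emptyI finite_insert insert_subset empty_subsetI psubsetI)
  have cl: "closedin T {p}" "closedin T Y" "closedin T C"
    using \<open>p \<in> C\<close> YC Y(1) closedC by (auto simp: closedinT intro!: zclosed_singleton C_PS)
  let ?Z = "\<lambda>i::nat. if i = 0 then {p} else if i = 1 then Y else C"
  have "irreducible_chain T (Suc 1)"
    unfolding irreducible_chain_def
    by (rule exI[of _ ?Z]) (use irrY irrp irrC pY cl YC p in \<open>auto simp: less_Suc_eq\<close>)
  then show False using sc unfolding smooth_projective_curve_def has_krull_dim_def by blast
qed

section \<open>The filters of general points and of Zariski neighbourhoods\<close>

definition gen :: "pt filter" where
  "gen = inf cofinite (principal C)"

text \<open>As proper closed subsets are finite, \<open>nb x\<close> is the filter of Zariski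
  neighbourhoods of a point \<open>x\<close> of C, and \<open>gen\<close> plays the role of the
  neighbourhoods of the generic point. Equality of germs and identities of rational functions thus
  become \<open>eventually\<close> statements, which combine without naming open sets.\<close>

definition nb :: "pt \<Rightarrow> pt filter" where
  "nb x = sup gen (principal {x})"

lemma eventually_gen: "eventually P gen \<longleftrightarrow> finite {y \<in> C. \<not> P y}"
proof -
  have "{y. \<not> (y \<in> C \<longrightarrow> P y)} = {y \<in> C. \<not> P y}" by blast
  then show ?thesis by (simp add: gen_def eventually_inf_principal eventually_cofinite)
qed

lemma eventually_nb: "eventually P (nb x) \<longleftrightarrow> eventually P gen \<and> P x"
  by (simp add: nb_def eventually_sup eventually_principal)

lemma nbD: "eventually P (nb x) \<Longrightarrow> P x" "eventually P (nb x) \<Longrightarrow> eventually P gen"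
  by (simp_all add: eventually_nb)

lemma gen_False: "\<not> eventually (\<lambda>_. False) gen"
  using infiniteC by (simp add: eventually_gen)

lemma gen_witness: "eventually P gen \<Longrightarrow> \<exists>y\<in>C. P y"
  using infiniteC unfolding eventually_gen by (metis (mono_tags, lifting) Collect_cong mem_Collect_eq Collect_mem_eq)

lemma gen_C: "eventually (\<lambda>y. y \<in> C) gen"
  by (simp add: eventually_gen)

lemma nb_C: "x \<in> C \<Longrightarrow> eventually (\<lambda>y. y \<in> C) (nb x)"
  by (simp add: eventually_nb gen_C)

lemma gen_nb: "eventually P gen \<Longrightarrow> eventually (\<lambda>y. eventually P (nb y)) gen"
  by (simp add: eventually_nb)

lemma nb_nb: "eventually P (nb x) \<Longrightarrow> eventually (\<lambda>y. eventually P (nb y)) (nb x)"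
  by (simp add: eventually_nb)

lemma openin_nb:
  assumes "openin T U" "x \<in> U" shows "eventually (\<lambda>y. y \<in> U) (nb x)"
proof -
  have U: "U \<subseteq> C" using openin_subset[OF assms(1)] by simp
  have "closedin T (C - U)" using closedin_diff[OF closedin_topspace[of T] assms(1)] by simp
  then have "finite (C - U)" using assms(2) U by (intro finite_closed) (auto simp: closedinT)
  moreover have "{y \<in> C. y \<notin> U} = C - U" by blast
  ultimately show ?thesis using assms(2) by (simp add: eventually_nb eventually_gen)
qed

lemma nb_openin:
  assumes "eventually P gen" shows "openin T {y \<in> C. P y}"
proof -
  have "closedin T {y \<in> C. \<not> P y}"
    using assms C_PS by (auto simp: closedinT eventually_gen intro: zclosed_finite)
  then have "openin T (C - {y \<in> C. \<not> P y})" using openin_diff[OF openin_topspace[of T]] by simp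
  moreover have "C - {y \<in> C. \<not> P y} = {y \<in> C. P y}" by blast
  ultimately show ?thesis by simp
qed

lemma form_dichotomy:
  assumes "p \<in> hpoly n d" shows "(\<forall>y\<in>C. ev p y = 0) \<or> eventually (\<lambda>y. ev p y \<noteq> 0) gen"
proof (rule disjCI)
  assume "\<not> eventually (\<lambda>y. ev p y \<noteq> 0) gen"
  then have inf: "infinite {y \<in> C. ev p y = 0}" by (simp add: eventually_gen)
  have "zclosed n ({x \<in> PS n. ev p x = 0} \<inter> C)"
    by (rule zclosed_Int[OF zclosed_form[OF assms] closedC])
  moreover have "{x \<in> PS n. ev p x = 0} \<inter> C = {y \<in> C. ev p y = 0}" using C_PS by auto
  ultimately have "\<not> {y \<in> C. ev p y = 0} \<subset> C" using finite_closed inf by force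
  then show "\<forall>y\<in>C. ev p y = 0" by blast
qed

lemma form_nonzero: "p \<in> hpoly n d \<Longrightarrow> x \<in> C \<Longrightarrow> ev p x \<noteq> 0 \<Longrightarrow> eventually (\<lambda>y. ev p y \<noteq> 0) (nb x)"
  using form_dichotomy by (auto simp: eventually_nb)

section \<open>Local rings as germs of quotients of forms\<close>

abbreviation lr where "lr x \<equiv> local_ring n C x"

text \<open>One quotient near \<open>x\<close> suffices. Conversely the set where the quotient is
  defined and equals \<open>f\<close> is cofinite, hence open, and can serve as the domain of
  regularity.\<close>

lemma lr_iff:
  assumes x: "x \<in> C"
  shows "f \<in> lr x \<longleftrightarrow> (\<exists>d. \<exists>G\<in>hpoly n d. \<exists>H\<in>hpoly n d. ev H x \<noteq> 0 \<and>
    eventually (\<lambda>y. f y = ev G y / ev H y) (nb x))"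
proof
  assume "f \<in> lr x"
  then obtain U where U: "x \<in> U" "regular_on n C U f" unfolding local_ring_def by blast
  then obtain W d g h where gh: "g \<in> hpoly n d" "h \<in> hpoly n d" "openin T W" "x \<in> W"
    "\<And>y v. y \<in> W \<Longrightarrow> v \<in> y \<Longrightarrow> peval h v \<noteq> 0 \<and> f y = peval g v / peval h v"
    unfolding regular_on_def by meson
  have W: "W \<subseteq> C" using openin_subset[OF gh(3)] by simp
  have e: "ev h y \<noteq> 0" "f y = ev g y / ev h y" if "y \<in> W" for y
  proof -
    have "rp y \<in> y" using rp_mem[of y n] C_PS W that by blast
    from gh(5)[OF that this] show "ev h y \<noteq> 0" "f y = ev g y / ev h y" by (simp_all add: ev_def)
  qed
  have "eventually (\<lambda>y. f y = ev g y / ev h y) (nb x)"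
    using openin_nb[OF gh(3,4)] by eventually_elim (rule e)
  then show "\<exists>d. \<exists>G\<in>hpoly n d. \<exists>H\<in>hpoly n d. ev H x \<noteq> 0 \<and>
    eventually (\<lambda>y. f y = ev G y / ev H y) (nb x)" using gh(1,2) e(1)[OF gh(4)] by blast
next
  assume "\<exists>d. \<exists>G\<in>hpoly n d. \<exists>H\<in>hpoly n d. ev H x \<noteq> 0 \<and> eventually (\<lambda>y. f y = ev G y / ev H y) (nb x)"
  then obtain d G H where GH: "G \<in> hpoly n d" "H \<in> hpoly n d" "ev H x \<noteq> 0"
    "eventually (\<lambda>y. f y = ev G y / ev H y) (nb x)" by blast
  define U where "U = {y \<in> C. ev H y \<noteq> 0 \<and> f y = ev G y / ev H y}"
  have ev: "eventually (\<lambda>y. ev H y \<noteq> 0 \<and> f y = ev G y / ev H y) (nb x)"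
    using form_nonzero[OF GH(2) x GH(3)] GH(4) by eventually_elim simp
  have oU: "openin T U" unfolding U_def by (rule nb_openin[OF nbD(2)[OF ev]])
  have xU: "x \<in> U" using nbD(1)[OF ev] x by (simp add: U_def)
  have "peval H v \<noteq> 0 \<and> f y = peval G v / peval H v" if "y \<in> U" "v \<in> y" for y v
    using that peval_mem_zero_iff[OF C_PS that(2) GH(2)] peval_mem_ratio[OF C_PS that(2) GH(1,2)] by (simp add: U_def)
  then have "regular_on n C U f"
    unfolding regular_on_def using oU GH(1,2) by blast
  then show "f \<in> lr x" unfolding local_ring_def using xU by blast
qed

lemma same_germ_iff:
  assumes x: "x \<in> C"
  shows "same_germ n C x f g \<longleftrightarrow> eventually (\<lambda>y. f y = g y) (nb x)"
proof
  assume "same_germ n C x f g"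
  then obtain U where U: "openin T U" "x \<in> U" "\<forall>y\<in>U. f y = g y" unfolding same_germ_def by blast
  show "eventually (\<lambda>y. f y = g y) (nb x)" using openin_nb[OF U(1,2)] by eventually_elim (use U(3) in blast)
next
  assume ev: "eventually (\<lambda>y. f y = g y) (nb x)"
  then show "same_germ n C x f g"
    unfolding same_germ_def using nb_openin[OF nbD(2)[OF ev]] nbD(1)[OF ev] x
    by (intro exI[of _ "{y \<in> C. f y = g y}"]) auto
qed

lemma lr_cong: "x \<in> C \<Longrightarrow> f \<in> lr x \<Longrightarrow> eventually (\<lambda>y. f y = g y) (nb x) \<Longrightarrow> g \<in> lr x"
proof -
  assume x: "x \<in> C" and f: "f \<in> lr x" and e: "eventually (\<lambda>y. f y = g y) (nb x)"
  obtain d G H where GH: "G \<in> hpoly n d" "H \<in> hpoly n d" "ev H x \<noteq> 0"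
    "eventually (\<lambda>y. f y = ev G y / ev H y) (nb x)" using f lr_iff[OF x] by blast
  have "eventually (\<lambda>y. g y = ev G y / ev H y) (nb x)" using e GH(4) by eventually_elim simp
  then show "g \<in> lr x" using GH lr_iff[OF x] by blast
qed

lemma lr_ratio:
  "x \<in> C \<Longrightarrow> G \<in> hpoly n d \<Longrightarrow> H \<in> hpoly n d \<Longrightarrow> ev H x \<noteq> 0 \<Longrightarrow> (\<lambda>y. ev G y / ev H y) \<in> lr x"
  unfolding lr_iff by (intro exI[of _ d] bexI[of _ G] bexI[of _ H] conjI) (auto simp: eventually_nb)

lemma lr_const: "x \<in> C \<Longrightarrow> (\<lambda>_. c) \<in> lr x"
  using lr_ratio[of x "pconst c" 0 1] one_hpoly by simp

lemma lr_obtain: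
  assumes "x \<in> C" "f \<in> lr x"
  obtains d G H where "G \<in> hpoly n d" "H \<in> hpoly n d" "ev H x \<noteq> 0"
    "eventually (\<lambda>y. ev H y \<noteq> 0 \<and> f y = ev G y / ev H y) (nb x)"
proof -
  obtain d G H where GH: "G \<in> hpoly n d" "H \<in> hpoly n d" "ev H x \<noteq> 0"
    "eventually (\<lambda>y. f y = ev G y / ev H y) (nb x)" using assms lr_iff by blast
  have "eventually (\<lambda>y. ev H y \<noteq> 0 \<and> f y = ev G y / ev H y) (nb x)"
    using form_nonzero[OF GH(2) assms(1) GH(3)] GH(4) by eventually_elim simp
  then show ?thesis using that GH by blast
qed

lemma lr_add: assumes x: "x \<in> C" and "f \<in> lr x" "g \<in> lr x" shows "(\<lambda>y. f y + g y) \<in> lr x"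
proof -
  obtain d G H where 1: "G \<in> hpoly n d" "H \<in> hpoly n d" "ev H x \<noteq> 0"
    "eventually (\<lambda>y. ev H y \<noteq> 0 \<and> f y = ev G y / ev H y) (nb x)" by (rule lr_obtain[OF x assms(2)])
  obtain e G' H' where 2: "G' \<in> hpoly n e" "H' \<in> hpoly n e" "ev H' x \<noteq> 0"
    "eventually (\<lambda>y. ev H' y \<noteq> 0 \<and> g y = ev G' y / ev H' y) (nb x)" by (rule lr_obtain[OF x assms(3)])
  have "G * H' + H * G' \<in> hpoly n (d + e)" using 1 2 by (intro hpoly_add hpoly_mult)
  then have "(\<lambda>y. ev (G * H' + H * G') y / ev (H * H') y) \<in> lr x"
    using 1 2 by (intro lr_ratio[OF x _ hpoly_mult]) auto
  moreover have "eventually (\<lambda>y. ev (G * H' + H * G') y / ev (H * H') y = f y + g y) (nb x)"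
    using 1(4) 2(4) by eventually_elim (auto simp: field_simps)
  ultimately show ?thesis by (rule lr_cong[OF x])
qed

lemma lr_mult: assumes x: "x \<in> C" and "f \<in> lr x" "g \<in> lr x" shows "(\<lambda>y. f y * g y) \<in> lr x"
proof -
  obtain d G H where 1: "G \<in> hpoly n d" "H \<in> hpoly n d" "ev H x \<noteq> 0"
    "eventually (\<lambda>y. ev H y \<noteq> 0 \<and> f y = ev G y / ev H y) (nb x)" by (rule lr_obtain[OF x assms(2)])
  obtain e G' H' where 2: "G' \<in> hpoly n e" "H' \<in> hpoly n e" "ev H' x \<noteq> 0"
    "eventually (\<lambda>y. ev H' y \<noteq> 0 \<and> g y = ev G' y / ev H' y) (nb x)" by (rule lr_obtain[OF x assms(3)])
  have "(\<lambda>y. ev (G * G') y / ev (H * H') y) \<in> lr x"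
    using 1 2 by (intro lr_ratio[OF x hpoly_mult hpoly_mult]) auto
  moreover have "eventually (\<lambda>y. ev (G * G') y / ev (H * H') y = f y * g y) (nb x)"
    using 1(4) 2(4) by eventually_elim (auto simp: field_simps)
  ultimately show ?thesis by (rule lr_cong[OF x])
qed

lemma lr_inverse: assumes x: "x \<in> C" and "f \<in> lr x" "f x \<noteq> 0" shows "(\<lambda>y. inverse (f y)) \<in> lr x"
proof -
  obtain d G H where 1: "G \<in> hpoly n d" "H \<in> hpoly n d" "ev H x \<noteq> 0"
    "eventually (\<lambda>y. ev H y \<noteq> 0 \<and> f y = ev G y / ev H y) (nb x)" by (rule lr_obtain[OF x assms(2)])
  have "ev G x \<noteq> 0" using nbD(1)[OF 1(4)] assms(3) by auto
  then have "(\<lambda>y. ev H y / ev G y) \<in> lr x" using 1 by (intro lr_ratio[OF x]) auto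
  moreover have "eventually (\<lambda>y. ev H y / ev G y = inverse (f y)) (nb x)"
    using 1(4) by eventually_elim auto
  ultimately show ?thesis by (rule lr_cong[OF x])
qed

lemma lr_cmult: "x \<in> C \<Longrightarrow> f \<in> lr x \<Longrightarrow> (\<lambda>y. c * f y) \<in> lr x"
  using lr_mult[OF _ lr_const] by blast

lemma lr_uminus: "x \<in> C \<Longrightarrow> f \<in> lr x \<Longrightarrow> (\<lambda>y. - f y) \<in> lr x"
  using lr_cmult[of x f "- 1"] by simp

lemma lr_diff: "x \<in> C \<Longrightarrow> f \<in> lr x \<Longrightarrow> g \<in> lr x \<Longrightarrow> (\<lambda>y. f y - g y) \<in> lr x"
  using lr_add[OF _ _ lr_uminus, of x f g] by simp

lemma lr_divide: "x \<in> C \<Longrightarrow> f \<in> lr x \<Longrightarrow> g \<in> lr x \<Longrightarrow> g x \<noteq> 0 \<Longrightarrow> (\<lambda>y. f y / g y) \<in> lr x"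
  using lr_mult[OF _ _ lr_inverse, of x f g] by (simp add: divide_inverse)

lemma lr_sum: "x \<in> C \<Longrightarrow> (\<And>i. i \<in> A \<Longrightarrow> f i \<in> lr x) \<Longrightarrow> (\<lambda>y. \<Sum>i\<in>A. f i y) \<in> lr x"
  by (induction A rule: infinite_finite_induct) (auto intro: lr_const lr_add)

lemma lr_prod: "x \<in> C \<Longrightarrow> (\<And>i. i \<in> A \<Longrightarrow> f i \<in> lr x) \<Longrightarrow> (\<lambda>y. \<Prod>i\<in>A. f i y) \<in> lr x"
  by (induction A rule: infinite_finite_induct) (auto intro: lr_const lr_mult)

lemma lr_power: "x \<in> C \<Longrightarrow> f \<in> lr x \<Longrightarrow> (\<lambda>y. f y ^ k) \<in> lr x"
  by (induction k) (auto intro: lr_const lr_mult)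

lemmas lr_intros = lr_const lr_add lr_mult lr_diff lr_uminus lr_sum lr_prod lr_power

lemma lr_near:
  assumes x: "x \<in> C" and f: "f \<in> lr x" shows "eventually (\<lambda>y. y \<in> C \<and> f \<in> lr y) (nb x)"
proof -
  obtain d G H where GH: "G \<in> hpoly n d" "H \<in> hpoly n d" "ev H x \<noteq> 0"
    "eventually (\<lambda>y. ev H y \<noteq> 0 \<and> f y = ev G y / ev H y) (nb x)" by (rule lr_obtain[OF x assms(2)])
  show ?thesis using nb_C[OF x] nb_nb[OF GH(4)]
  proof eventually_elim
    case (elim y)
    then have "eventually (\<lambda>z. f z = ev G z / ev H z) (nb y)" "ev H y \<noteq> 0"
      by (auto simp: eventually_nb elim: eventually_mono)
    then show ?case using elim(1) GH(1,2) lr_iff[of y] by blast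
  qed
qed

text \<open>By irreducibility the numerator vanishes on all of C or at finitely many points only. In
  the second case \<open>x\<close> itself may be a zero, hence \<open>gen\<close> instead of
  \<open>nb x\<close>.\<close>

lemma lr_dichotomy:
  assumes x: "x \<in> C" and f: "f \<in> lr x"
  shows "eventually (\<lambda>y. f y = 0) (nb x) \<or> eventually (\<lambda>y. f y \<noteq> 0) gen"
proof -
  obtain d G H where GH: "G \<in> hpoly n d" "H \<in> hpoly n d" "ev H x \<noteq> 0"
    "eventually (\<lambda>y. ev H y \<noteq> 0 \<and> f y = ev G y / ev H y) (nb x)" by (rule lr_obtain[OF x assms(2)])
  show ?thesis using form_dichotomy[OF GH(1)]
  proof
    assume "\<forall>y\<in>C. ev G y = 0"
    with GH(4) nb_C[OF x] have "eventually (\<lambda>y. f y = 0) (nb x)" by (auto elim: eventually_elim2)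
    then show ?thesis ..
  next
    assume "eventually (\<lambda>y. ev G y \<noteq> 0) gen"
    with nbD(2)[OF GH(4)] have "eventually (\<lambda>y. f y \<noteq> 0) gen" by eventually_elim auto
    then show ?thesis ..
  qed
qed

text \<open>The identity theorem. It transfers relations derived at general points, where one may
  divide, to the special point \<open>x\<close>.\<close>

lemma lr_eq:
  assumes x: "x \<in> C" and "f \<in> lr x" "g \<in> lr x" and e: "eventually (\<lambda>y. f y = g y) gen"
  shows "f x = g x"
proof -
  have "\<not> eventually (\<lambda>y. f y - g y \<noteq> 0) gen"
  proof
    assume "eventually (\<lambda>y. f y - g y \<noteq> 0) gen"
    with e have "eventually (\<lambda>_. False) gen" by eventually_elim simp
    then show False using gen_False by simp
  qed
  then have "eventually (\<lambda>y. f y - g y = 0) (nb x)"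
    using lr_dichotomy[OF x lr_diff[OF x assms(2,3)]] by blast
  then show ?thesis using nbD(1) by fastforce
qed

lemma lr_nonzero: "x \<in> C \<Longrightarrow> f \<in> lr x \<Longrightarrow> f x \<noteq> 0 \<Longrightarrow> eventually (\<lambda>y. f y \<noteq> 0) (nb x)"
  using lr_dichotomy[of x f] by (auto simp: eventually_nb)

text \<open>Since the local ring consists of quotients of polynomials in the affine coordinates
  \<open>rp y i / rp y j\<close>, properties of its elements can be proved by induction.\<close>

lemma lr_induct [consumes 3, case_names const coord add mult inverse cong]:
  assumes x: "x \<in> C" and j: "rp x j \<noteq> 0" and f: "f \<in> lr x"
    and const: "\<And>c. P (\<lambda>_. c)"
    and coord: "\<And>i. i \<le> n \<Longrightarrow> P (\<lambda>y. rp y i / rp y j)"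
    and add: "\<And>f g. f \<in> lr x \<Longrightarrow> g \<in> lr x \<Longrightarrow> P f \<Longrightarrow> P g \<Longrightarrow> P (\<lambda>y. f y + g y)"
    and mult: "\<And>f g. f \<in> lr x \<Longrightarrow> g \<in> lr x \<Longrightarrow> P f \<Longrightarrow> P g \<Longrightarrow> P (\<lambda>y. f y * g y)"
    and inverse: "\<And>f. f \<in> lr x \<Longrightarrow> f x \<noteq> 0 \<Longrightarrow> P f \<Longrightarrow> P (\<lambda>y. inverse (f y))"
    and cong: "\<And>f g. f \<in> lr x \<Longrightarrow> P f \<Longrightarrow> eventually (\<lambda>y. f y = g y) (nb x) \<Longrightarrow> P g"
  shows "P f"
proof -
  define Q where "Q f \<longleftrightarrow> f \<in> lr x \<and> P f" for f
  have jn: "j \<le> n" using rp_supp[OF C_PS[OF x], of j] j by (meson not_le)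
  have Qz: "Q (\<lambda>y. rp y i / rp y j)" if "i \<le> n" for i
    using lr_ratio[OF x hpoly_pvar[OF that] hpoly_pvar[OF jn]] j coord[OF that] by (simp add: Q_def)
  have Qc: "Q (\<lambda>_. c)" for c unfolding Q_def by (intro conjI const lr_const[OF x])
  have Qm: "Q (\<lambda>y. f y * g y)" if "Q f" "Q g" for f g
    using that unfolding Q_def by (intro conjI mult lr_mult[OF x]) auto
  have Qa: "Q (\<lambda>y. f y + g y)" if "Q f" "Q g" for f g
    using that unfolding Q_def by (intro conjI add lr_add[OF x]) auto
  have Qpow: "Q (\<lambda>y. f y ^ k)" if "Q f" for f k by (induction k) (use Qc Qm that in auto)
  have Qprod: "Q (\<lambda>y. \<Prod>i\<in>A. f i y)" if "\<And>i. i \<in> A \<Longrightarrow> Q (f i)" for A :: "nat set" and f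
    using that by (induction A rule: infinite_finite_induct) (auto intro: Qc Qm)
  have Qsum: "Q (\<lambda>y. \<Sum>i\<in>A. f i y)" if "\<And>i. i \<in> A \<Longrightarrow> Q (f i)" for A :: "(nat \<Rightarrow>\<^sub>0 nat) set" and f
    using that by (induction A rule: infinite_finite_induct) (auto intro: Qc Qa)
  \<comment> \<open>Dehomogenization: a form of degree d divided by the d-th power of the coordinate
    j is a polynomial in the affine coordinates.\<close>
  have Qp: "Q (\<lambda>y. ev p y / rp y j ^ d)" if p: "p \<in> hpoly n d" for p d
  proof -
    have eq: "ev p y / rp y j ^ d = (\<Sum>m\<in>Poly_Mapping.keys p. Poly_Mapping.lookup p m *
        (\<Prod>i\<in>Poly_Mapping.keys m. (rp y i / rp y j) ^ Poly_Mapping.lookup m i))" for y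
      unfolding ev_def peval_def sum_divide_distrib
    proof (intro sum.cong refl)
      fix m assume "m \<in> Poly_Mapping.keys p"
      then have "mdeg m = d" using p by (auto simp: hpoly_def)
      then show "Poly_Mapping.lookup p m * meval m (rp y) / rp y j ^ d = Poly_Mapping.lookup p m *
        (\<Prod>i\<in>Poly_Mapping.keys m. (rp y i / rp y j) ^ Poly_Mapping.lookup m i)"
        by (auto simp: meval_def power_divide prod_dividef power_sum[symmetric] mdeg_def)
    qed
    show ?thesis unfolding eq
    proof (intro Qsum Qm[OF Qc] Qprod Qpow)
      fix m i assume "m \<in> Poly_Mapping.keys p" "i \<in> Poly_Mapping.keys m"
      then have "i \<le> n" using p unfolding hpoly_def by blast
      then show "Q (\<lambda>y. rp y i / rp y j)" by (rule Qz)
    qed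
  qed
  obtain d G H where GH: "G \<in> hpoly n d" "H \<in> hpoly n d" "ev H x \<noteq> 0"
    "eventually (\<lambda>y. ev H y \<noteq> 0 \<and> f y = ev G y / ev H y) (nb x)" by (rule lr_obtain[OF x f])
  have "Q (\<lambda>y. inverse (ev H y / rp y j ^ d))"
    using Qp[OF GH(2)] inverse[of "\<lambda>y. ev H y / rp y j ^ d"] lr_inverse[OF x, of "\<lambda>y. ev H y / rp y j ^ d"] GH(3) j
    unfolding Q_def by auto
  then have Q: "Q (\<lambda>y. (ev G y / rp y j ^ d) * inverse (ev H y / rp y j ^ d))"
    by (intro Qm Qp[OF GH(1)])
  have "eventually (\<lambda>y. rp y j \<noteq> 0) (nb x)"
    using form_nonzero[OF hpoly_pvar[OF jn] x] j by simp
  with GH(4) have "eventually (\<lambda>y. (ev G y / rp y j ^ d) * inverse (ev H y / rp y j ^ d) = f y) (nb x)"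
    by eventually_elim (auto simp: field_simps)
  then show "P f" using Q unfolding Q_def by (intro cong[of "\<lambda>y. (ev G y / rp y j ^ d) * inverse (ev H y / rp y j ^ d)" f]) auto
qed

subsection \<open>Derivations\<close>

definition m2 :: "pt \<Rightarrow> (pt \<Rightarrow> complex) set" where
  "m2 x = {f. \<exists>(r::nat) h k. (\<forall>j<r. h j \<in> lr x \<and> k j \<in> lr x \<and> h j x = 0 \<and> k j x = 0) \<and>
      eventually (\<lambda>y. f y = (\<Sum>j<r. h j y * k j y)) (nb x)}"

lemma sum_lessThan_add: "(\<Sum>j<r + s. F j) = (\<Sum>j<r. F j) + (\<Sum>j<s. F (r + j))" for F :: "nat \<Rightarrow> complex"
  by (induction s) (auto simp: add.assoc)

lemma m2I: "(\<And>j. j < (r::nat) \<Longrightarrow> h j \<in> lr x \<and> k j \<in> lr x \<and> h j x = 0 \<and> k j x = 0) \<Longrightarrow>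
      eventually (\<lambda>y. f y = (\<Sum>j<r. h j y * k j y)) (nb x) \<Longrightarrow> f \<in> m2 x"
  unfolding m2_def by blast

lemma m2_germ_zero: "eventually (\<lambda>y. f y = 0) (nb x) \<Longrightarrow> f \<in> m2 x"
  by (rule m2I[of 0]) auto

lemma m2_add:
  assumes "f \<in> m2 x" "g \<in> m2 x" shows "(\<lambda>y. f y + g y) \<in> m2 x"
proof -
  obtain r h k where 1: "\<forall>j<(r::nat). h j \<in> lr x \<and> k j \<in> lr x \<and> h j x = 0 \<and> k j x = 0"
      "eventually (\<lambda>y. f y = (\<Sum>j<r. h j y * k j y)) (nb x)" using assms(1) unfolding m2_def by blast
  obtain s h' k' where 2: "\<forall>j<(s::nat). h' j \<in> lr x \<and> k' j \<in> lr x \<and> h' j x = 0 \<and> k' j x = 0"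
      "eventually (\<lambda>y. g y = (\<Sum>j<s. h' j y * k' j y)) (nb x)" using assms(2) unfolding m2_def by blast
  show ?thesis
  proof (rule m2I[of "r + s" "\<lambda>j. if j < r then h j else h' (j - r)" x "\<lambda>j. if j < r then k j else k' (j - r)"])
    show "eventually (\<lambda>y. f y + g y = (\<Sum>j<r + s. (if j < r then h j else h' (j - r)) y *
        (if j < r then k j else k' (j - r)) y)) (nb x)"
      using 1(2) 2(2) by eventually_elim (simp add: sum_lessThan_add)
  qed (use 1(1) 2(1) in auto)
qed

lemma m2_cmult:
  assumes x: "x \<in> C" and "f \<in> m2 x" shows "(\<lambda>y. c * f y) \<in> m2 x"
proof -
  obtain r h k where 1: "\<forall>j<(r::nat). h j \<in> lr x \<and> k j \<in> lr x \<and> h j x = 0 \<and> k j x = 0"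
      "eventually (\<lambda>y. f y = (\<Sum>j<r. h j y * k j y)) (nb x)" using assms(2) unfolding m2_def by blast
  show ?thesis
  proof (rule m2I[of r "\<lambda>j y. c * h j y" x k])
    show "eventually (\<lambda>y. c * f y = (\<Sum>j<r. c * h j y * k j y)) (nb x)"
      using 1(2) by eventually_elim (simp add: sum_distrib_left mult.assoc)
  qed (use 1(1) lr_cmult[OF x] in auto)
qed

lemma m2_mult:
  assumes "f \<in> lr x" "g \<in> lr x" "f x = 0" "g x = 0" shows "(\<lambda>y. f y * g y) \<in> m2 x"
  by (rule m2I[of 1 "\<lambda>_. f" x "\<lambda>_. g"]) (use assms in auto)

text \<open>The coefficients \<open>c j\<close> are absorbed into one of the two vanishing
  factors.\<close>

lemma vanishes_iff_m2:
  assumes x: "x \<in> C" shows "vanishes_to_order n C x 2 f \<longleftrightarrow> f \<in> m2 x"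
proof
  assume "vanishes_to_order n C x 2 f"
  then obtain r c h where 1: "\<forall>j<(r::nat). c j \<in> lr x"
    "\<forall>j<r. \<forall>l<2. h j l \<in> lr x \<and> h j l x = 0"
    "same_germ n C x f (\<lambda>y. \<Sum>j<r. c j y * (\<Prod>l<(2::nat). h j l y))"
    unfolding vanishes_to_order_def by (elim exE conjE)
  have 2: "(\<Prod>l<(2::nat). h j l y) = h j 0 y * h j 1 y" for j y by (simp add: numeral_2_eq_2 lessThan_Suc mult.commute)
  show "f \<in> m2 x"
  proof (rule m2I[of r "\<lambda>j y. c j y * h j 0 y" x "\<lambda>j. h j 1"])
    show "eventually (\<lambda>y. f y = (\<Sum>j<r. c j y * h j 0 y * h j 1 y)) (nb x)"
      using 1(3) unfolding same_germ_iff[OF x] 2 by (simp add: mult.assoc)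
  qed (use 1 lr_mult[OF x] in auto)
next
  assume "f \<in> m2 x"
  then obtain r h k where 1: "\<forall>j<(r::nat). h j \<in> lr x \<and> k j \<in> lr x \<and> h j x = 0 \<and> k j x = 0"
      "eventually (\<lambda>y. f y = (\<Sum>j<r. h j y * k j y)) (nb x)" unfolding m2_def by blast
  have "(\<Sum>j<r. (\<lambda>_. 1) y * (\<Prod>l<(2::nat). (if l = 0 then h j else k j) y)) = (\<Sum>j<r. h j y * k j y)" for y
    by (simp add: numeral_2_eq_2 lessThan_Suc mult.commute)
  then show "vanishes_to_order n C x 2 f"
    unfolding vanishes_to_order_def same_germ_iff[OF x] using 1 lr_const[OF x]
    by (intro exI[of _ r] exI[of _ "\<lambda>j y. 1"] exI[of _ "\<lambda>j l. if l = 0 then h j else k j"]) (auto simp: numeral_2_eq_2)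
qed

lemma tangent_spaceD:
  assumes "\<delta> \<in> tangent_space n C x"
  shows "f \<notin> lr x \<Longrightarrow> \<delta> f = 0"
    "f \<in> lr x \<Longrightarrow> g \<in> lr x \<Longrightarrow> same_germ n C x f g \<Longrightarrow> \<delta> f = \<delta> g"
    "f \<in> lr x \<Longrightarrow> g \<in> lr x \<Longrightarrow> \<delta> (\<lambda>y. f y + g y) = \<delta> f + \<delta> g"
    "f \<in> lr x \<Longrightarrow> g \<in> lr x \<Longrightarrow> \<delta> (\<lambda>y. f y * g y) = f x * \<delta> g + g x * \<delta> f"
    "f \<in> lr x \<Longrightarrow> \<delta> (\<lambda>y. c * f y) = c * \<delta> f"
  using assms unfolding tangent_space_def plus_fun_def times_fun_def cscale_def by blast+

lemma tangent_spaceI: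
  assumes "\<And>f. f \<notin> lr x \<Longrightarrow> \<delta> f = 0"
    "\<And>f g. f \<in> lr x \<Longrightarrow> g \<in> lr x \<Longrightarrow> same_germ n C x f g \<Longrightarrow> \<delta> f = \<delta> g"
    "\<And>f g. f \<in> lr x \<Longrightarrow> g \<in> lr x \<Longrightarrow> \<delta> (\<lambda>y. f y + g y) = \<delta> f + \<delta> g"
    "\<And>f g. f \<in> lr x \<Longrightarrow> g \<in> lr x \<Longrightarrow> \<delta> (\<lambda>y. f y * g y) = f x * \<delta> g + g x * \<delta> f"
    "\<And>f c. f \<in> lr x \<Longrightarrow> \<delta> (\<lambda>y. c * f y) = c * \<delta> f"
  shows "\<delta> \<in> tangent_space n C x"
  using assms unfolding tangent_space_def plus_fun_def times_fun_def cscale_def by blast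

lemma tangent_generator:
  assumes x: "x \<in> C"
  shows "\<exists>\<delta>. \<delta> \<in> tangent_space n C x \<and> \<delta> \<noteq> 0 \<and> (\<forall>\<epsilon>\<in>tangent_space n C x. \<exists>c. \<epsilon> = cscale c \<delta>)"
proof -
  have dim: "cfun.dim (tangent_space n C x) = 1" using sc x by (simp add: smooth_projective_curve_def)
  obtain B where B: "B \<subseteq> tangent_space n C x" "cfun.independent B" "tangent_space n C x \<subseteq> cfun.span B" "card B = 1"
    using cfun.basis_exists[of "tangent_space n C x"] dim by metis
  then obtain \<delta> where \<delta>: "B = {\<delta>}" by (auto simp: card_1_singleton_iff)
  have "\<delta> \<noteq> 0" using B(2) \<delta> cfun.dependent_zero[of B] by auto
  moreover have "\<exists>c. \<epsilon> = cscale c \<delta>" if "\<epsilon> \<in> tangent_space n C x" for \<epsilon>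
    using B(3) that \<delta> unfolding \<delta> cfun.span_singleton by blast
  ultimately show ?thesis using B(1) \<delta> by blast
qed

text \<open>A generator of the tangent line at \<open>x\<close>, chosen for each \<open>x\<close>
  independently. Hence \<open>dv y f\<close> is not a regular function of y, but quotients of two
  such derivatives do not depend on the choice.\<close>

definition dv :: "pt \<Rightarrow> (pt \<Rightarrow> complex) \<Rightarrow> complex" where
  "dv x = (SOME \<delta>. \<delta> \<in> tangent_space n C x \<and> \<delta> \<noteq> 0 \<and> (\<forall>\<epsilon>\<in>tangent_space n C x. \<exists>c. \<epsilon> = cscale c \<delta>))"

lemma dv:
  assumes "x \<in> C"
  shows "dv x \<in> tangent_space n C x" "dv x \<noteq> 0" "\<epsilon> \<in> tangent_space n C x \<Longrightarrow> \<exists>c. \<epsilon> = cscale c (dv x)"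
  using someI_ex[OF tangent_generator[OF assms]] unfolding dv_def[symmetric] by blast+

lemma dv_germ: "x \<in> C \<Longrightarrow> f \<in> lr x \<Longrightarrow> eventually (\<lambda>y. f y = g y) (nb x) \<Longrightarrow> dv x f = dv x g"
  using tangent_spaceD(2)[OF dv(1), of x f g] lr_cong same_germ_iff by blast

lemma dv_add: "x \<in> C \<Longrightarrow> f \<in> lr x \<Longrightarrow> g \<in> lr x \<Longrightarrow> dv x (\<lambda>y. f y + g y) = dv x f + dv x g"
  by (rule tangent_spaceD(3)[OF dv(1)])

lemma dv_mult: "x \<in> C \<Longrightarrow> f \<in> lr x \<Longrightarrow> g \<in> lr x \<Longrightarrow> dv x (\<lambda>y. f y * g y) = f x * dv x g + g x * dv x f"
  by (rule tangent_spaceD(4)[OF dv(1)])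

lemma dv_cmult: "x \<in> C \<Longrightarrow> f \<in> lr x \<Longrightarrow> dv x (\<lambda>y. c * f y) = c * dv x f"
  by (rule tangent_spaceD(5)[OF dv(1)])

lemma dv_const: "x \<in> C \<Longrightarrow> dv x (\<lambda>_. c) = 0"
proof -
  assume x: "x \<in> C"
  have "dv x (\<lambda>y. 1 * 1) = 0" using dv_mult[OF x lr_const[OF x] lr_const[OF x], of 1 1] by simp
  then show ?thesis using dv_cmult[OF x lr_const[OF x], of c 1] by simp
qed

lemma dv_uminus: "x \<in> C \<Longrightarrow> f \<in> lr x \<Longrightarrow> dv x (\<lambda>y. - f y) = - dv x f"
  using dv_cmult[of x f "- 1"] by simp

lemma dv_diff: "x \<in> C \<Longrightarrow> f \<in> lr x \<Longrightarrow> g \<in> lr x \<Longrightarrow> dv x (\<lambda>y. f y - g y) = dv x f - dv x g"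
  using dv_add[OF _ _ lr_uminus, of x f g] dv_uminus[of x g] by simp

lemma dv_sum: "x \<in> C \<Longrightarrow> (\<And>i. i \<in> A \<Longrightarrow> f i \<in> lr x) \<Longrightarrow> dv x (\<lambda>y. \<Sum>i\<in>A. f i y) = (\<Sum>i\<in>A. dv x (f i))"
  by (induction A rule: infinite_finite_induct) (auto simp: dv_const dv_add lr_sum)

lemma dv_power:
  assumes x: "x \<in> C" and f: "f \<in> lr x"
  shows "dv x (\<lambda>y. f y ^ k) = of_nat k * f x ^ (k - 1) * dv x f"
proof (induction k)
  case (Suc k)
  have "dv x (\<lambda>y. f y ^ Suc k) = f x * dv x (\<lambda>y. f y ^ k) + f x ^ k * dv x f"
    using dv_mult[OF x f lr_power[OF x f, of k]] by simp
  then show ?case unfolding Suc by (cases k) (auto simp: algebra_simps)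
qed (simp add: dv_const[OF x])

lemma dv_inverse:
  assumes x: "x \<in> C" and f: "f \<in> lr x" "f x \<noteq> 0"
  shows "dv x (\<lambda>y. inverse (f y)) = - dv x f / f x ^ 2"
proof -
  note i = lr_inverse[OF x f]
  have "eventually (\<lambda>y. f y * inverse (f y) = 1) (nb x)" using lr_nonzero[OF x f] by eventually_elim simp
  then have "dv x (\<lambda>y. f y * inverse (f y)) = 0"
    using dv_germ[OF x lr_mult[OF x f(1) i], of "\<lambda>_. 1"] dv_const[OF x] by simp
  then show ?thesis using dv_mult[OF x f(1) i] f(2) by (simp add: field_simps power2_eq_square add_eq_0_iff2)
qed

lemma dv_nonzero: assumes x: "x \<in> C" obtains f where "f \<in> lr x" "dv x f \<noteq> 0"
  using dv(2)[OF x] tangent_spaceD(1)[OF dv(1)[OF x]] by (metis ext zero_fun_apply)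

text \<open>The tangent space is dual to the maximal ideal modulo its square. If f vanishes at x but
  lies outside the square, a linear functional that kills the square and not f induces a derivation;
  as a multiple of \<open>dv x\<close>, it shows that \<open>dv x f\<close> is nonzero.\<close>

lemma m2_iff:
  assumes x: "x \<in> C" shows "f \<in> m2 x \<longleftrightarrow> f \<in> lr x \<and> f x = 0 \<and> dv x f = 0"
proof
  assume "f \<in> m2 x"
  then obtain r h k where 1: "\<forall>j<(r::nat). h j \<in> lr x \<and> k j \<in> lr x \<and> h j x = 0 \<and> k j x = 0"
      "eventually (\<lambda>y. f y = (\<Sum>j<r. h j y * k j y)) (nb x)" unfolding m2_def by blast
  let ?g = "\<lambda>y. \<Sum>j<r. h j y * k j y"
  have e: "eventually (\<lambda>y. ?g y = f y) (nb x)" using 1(2) by eventually_elim simp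
  have g: "?g \<in> lr x" using 1(1) by (intro lr_sum lr_mult x) auto
  have "dv x ?g = (\<Sum>j<r. dv x (\<lambda>y. h j y * k j y))" using 1(1) by (intro dv_sum lr_mult x) auto
  also have "\<dots> = 0" using 1(1) dv_mult[OF x] by (intro sum.neutral) auto
  finally show "f \<in> lr x \<and> f x = 0 \<and> dv x f = 0"
    using lr_cong[OF x g e] dv_germ[OF x g e] nbD(1)[OF e] 1(1) by auto
next
  assume f: "f \<in> lr x \<and> f x = 0 \<and> dv x f = 0"
  show "f \<in> m2 x"
  proof (rule ccontr)
    assume nf: "f \<notin> m2 x"
    interpret vp: vector_space_pair "cscale :: complex \<Rightarrow> (pt \<Rightarrow> complex) \<Rightarrow> pt \<Rightarrow> complex" "(*) :: complex \<Rightarrow> complex \<Rightarrow> complex"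
      by unfold_locales (auto simp: algebra_simps)
    have sub: "cfun.subspace (m2 x)"
      unfolding cfun.subspace_def cscale_def plus_fun_def
      using m2_germ_zero[of 0 x] m2_add m2_cmult[OF x] by auto
    obtain B where B: "B \<subseteq> m2 x" "cfun.independent B" "m2 x \<subseteq> cfun.span B"
      using cfun.basis_exists by metis
    have "cfun.span B \<subseteq> m2 x" using B(1) sub by (simp add: cfun.span_minimal)
    then have "cfun.independent (insert f B)" using B(2) nf by (intro cfun.independent_insertI) auto
    then obtain g where g: "Vector_Spaces.linear cscale (*) g" "\<forall>b\<in>insert f B. g b = (if b = f then 1 else 0)"
      using vp.linear_independent_extend[of "insert f B" "\<lambda>b. if b = f then 1 else 0"] by blast
    have g0: "g h = 0" if "h \<in> m2 x" for h
    proof (rule vp.linear_eq_0_on_span[OF g(1), of B])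
      show "g b = 0" if "b \<in> B" for b using g(2) that B(1) nf by auto
    qed (use that B(3) in auto)
    have ga: "g (\<lambda>y. a y + b y) = g a + g b" for a b
      using vp.linear_add[OF g(1), of a b] by (simp add: plus_fun_def)
    have gs: "g (\<lambda>y. c * a y) = c * g a" for a c
      using vp.linear_scale[OF g(1), of c a] by (simp add: cscale_def)
    \<comment> \<open>Subtracting the value at x brings h into the maximal ideal. The Leibniz rule
      then expresses that g kills products of two functions vanishing at x.\<close>
    let ?\<delta> = "\<lambda>h. if h \<in> lr x then g (\<lambda>y. h y - h x) else 0"
    have "?\<delta> \<in> tangent_space n C x"
    proof (rule tangent_spaceI)
      fix a b assume ab: "a \<in> lr x" "b \<in> lr x"
      have la: "(\<lambda>y. a y - a x) \<in> lr x" and lb: "(\<lambda>y. b y - b x) \<in> lr x"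
        using ab lr_diff[OF x _ lr_const[OF x]] by auto
      show "?\<delta> (\<lambda>y. a y + b y) = ?\<delta> a + ?\<delta> b"
        using ab lr_add[OF x ab] ga[of "\<lambda>y. a y - a x" "\<lambda>y. b y - b x"] by (simp add: algebra_simps)
      have "g (\<lambda>y. (a y - a x) * (b y - b x)) = 0" by (intro g0 m2_mult la lb) auto
      moreover have "(\<lambda>y. a y * b y - a x * b x) = (\<lambda>y. (a y - a x) * (b y - b x) + (a x * (b y - b x) + b x * (a y - a x)))"
      proof
        show "a y * b y - a x * b x = (a y - a x) * (b y - b x) + (a x * (b y - b x) + b x * (a y - a x))" for y
          by algebra
      qed
      ultimately have "g (\<lambda>y. a y * b y - a x * b x) = a x * g (\<lambda>y. b y - b x) + b x * g (\<lambda>y. a y - a x)"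
        using ga[of "\<lambda>y. (a y - a x) * (b y - b x)" "\<lambda>y. a x * (b y - b x) + b x * (a y - a x)"]
          ga[of "\<lambda>y. a x * (b y - b x)" "\<lambda>y. b x * (a y - a x)"] gs[of "a x" "\<lambda>y. b y - b x"] gs[of "b x" "\<lambda>y. a y - a x"]
        by simp
      then show "?\<delta> (\<lambda>y. a y * b y) = a x * ?\<delta> b + b x * ?\<delta> a" using ab lr_mult[OF x ab] by simp
      assume "same_germ n C x a b"
      then have e: "eventually (\<lambda>y. a y = b y) (nb x)" using same_germ_iff[OF x] by simp
      have "eventually (\<lambda>y. (a y - a x) + (-1) * (b y - b x) = 0) (nb x)"
        using e by eventually_elim (use nbD(1)[OF e] in simp)
      then have "g (\<lambda>y. (a y - a x) + (-1) * (b y - b x)) = 0" by (intro g0 m2_germ_zero)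
      then have "g (\<lambda>y. a y - a x) + (-1) * g (\<lambda>y. b y - b x) = 0" by (simp only: ga gs)
      then show "?\<delta> a = ?\<delta> b" using ab by simp
    next
      fix a c assume a: "a \<in> lr x"
      show "?\<delta> (\<lambda>y. c * a y) = c * ?\<delta> a"
        using a lr_cmult[OF x a, of c] gs[of c "\<lambda>y. a y - a x"] by (simp add: algebra_simps)
    qed auto
    then obtain c where "?\<delta> = cscale c (dv x)" using dv(3)[OF x] by blast
    from fun_cong[OF this, of f] have "g f = 0" using f by simp
    then show False using g(2) by simp
  qed
qed

lemma vanishes2_iff:
  "x \<in> C \<Longrightarrow> vanishes_to_order n C x 2 f \<longleftrightarrow> f \<in> lr x \<and> f x = 0 \<and> dv x f = 0"
  using vanishes_iff_m2 m2_iff by simp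

end

context curve
begin

section \<open>Uniformizers\<close>

text \<open>Nakayama's lemma by elimination: the k-th relation can be solved for \<omega> k because
  1 - \<open>mk k\<close> is a unit, and substituting the solution preserves the shape of the other
  relations. Neither \<omega> nor \<tau> is assumed regular, so that the lemma also applies to
  derivatives with respect to \<open>dv\<close>.\<close>

lemma nakayama:
  fixes \<omega> :: "'i \<Rightarrow> pt \<Rightarrow> complex"
  assumes x: "x \<in> C" and I: "finite I"
    and rel: "\<And>i. i \<in> I \<Longrightarrow> \<exists>a m. a \<in> lr x \<and> (\<forall>j\<in>I. m j \<in> lr x \<and> m j x = 0) \<and>
        eventually (\<lambda>y. \<omega> i y = a y * \<tau> y + (\<Sum>j\<in>I. m j y * \<omega> j y)) (nb x)"
    and i: "i \<in> I"
  shows "\<exists>a\<in>lr x. eventually (\<lambda>y. \<omega> i y = a y * \<tau> y) (nb x)"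
  using I rel i
proof (induction I arbitrary: i rule: finite_induct)
  case (insert k I)
  obtain ak mk where k: "ak \<in> lr x" "\<And>j. j \<in> insert k I \<Longrightarrow> mk j \<in> lr x \<and> mk j x = 0"
      "eventually (\<lambda>y. \<omega> k y = ak y * \<tau> y + (\<Sum>j\<in>insert k I. mk j y * \<omega> j y)) (nb x)"
    using insert.prems(1)[of k] by auto
  define e where "e y = inverse (1 - mk k y)" for y
  have e: "e \<in> lr x" unfolding e_def
    by (intro lr_inverse x lr_intros) (use k(2)[of k] in auto)
  have "eventually (\<lambda>y. 1 - mk k y \<noteq> 0) (nb x)"
    by (intro lr_nonzero x lr_intros) (use k(2)[of k] in auto)
  with k(3) have k': "eventually (\<lambda>y. \<omega> k y = e y * ak y * \<tau> y + (\<Sum>j\<in>I. e y * mk j y * \<omega> j y)) (nb x)"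
  proof eventually_elim
    case (elim y)
    have "(1 - mk k y) * \<omega> k y = ak y * \<tau> y + (\<Sum>j\<in>I. mk j y * \<omega> j y)"
      using elim(1) insert.hyps by (simp add: algebra_simps)
    then have "\<omega> k y = e y * (ak y * \<tau> y + (\<Sum>j\<in>I. mk j y * \<omega> j y))"
      using elim(2) by (simp add: e_def field_simps)
    then show ?case by (simp add: distrib_left sum_distrib_left mult.assoc)
  qed
  have IH: "\<exists>b\<in>lr x. eventually (\<lambda>y. \<omega> i y = b y * \<tau> y) (nb x)" if "i \<in> I" for i
  proof (rule insert.IH[OF _ that])
    fix i assume iI: "i \<in> I"
    obtain a m where a: "a \<in> lr x" "\<And>j. j \<in> insert k I \<Longrightarrow> m j \<in> lr x \<and> m j x = 0"
      "eventually (\<lambda>y. \<omega> i y = a y * \<tau> y + (\<Sum>j\<in>insert k I. m j y * \<omega> j y)) (nb x)"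
      using insert.prems(1)[of i] iI by auto
    let ?a = "\<lambda>y. a y + m k y * (e y * ak y)" and ?m = "\<lambda>j y. m j y + m k y * (e y * mk j y)"
    have "?a \<in> lr x" by (intro lr_intros x a k e) (use a(2) in auto)
    moreover have "\<forall>j\<in>I. ?m j \<in> lr x \<and> ?m j x = 0"
      using a(2) k(2) by (auto intro!: lr_intros x e)
    moreover have "eventually (\<lambda>y. \<omega> i y = ?a y * \<tau> y + (\<Sum>j\<in>I. ?m j y * \<omega> j y)) (nb x)"
      using a(3) k'
    proof eventually_elim
      case (elim y)
      have "\<omega> i y = a y * \<tau> y + (\<Sum>j\<in>I. m j y * \<omega> j y) + m k y * \<omega> k y"
        using elim(1) insert.hyps by simp
      then show ?case unfolding elim(2)
        by (simp add: algebra_simps sum.distrib sum_distrib_left)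
    qed
    ultimately show "\<exists>a m. a \<in> lr x \<and> (\<forall>j\<in>I. m j \<in> lr x \<and> m j x = 0) \<and>
        eventually (\<lambda>y. \<omega> i y = a y * \<tau> y + (\<Sum>j\<in>I. m j y * \<omega> j y)) (nb x)"
      by (intro exI[of _ ?a] exI[of _ ?m]) blast
  qed
  show ?case
  proof (cases "i = k")
    case True
    have "\<forall>j\<in>I. \<exists>b. b \<in> lr x \<and> eventually (\<lambda>y. \<omega> j y = b y * \<tau> y) (nb x)" using IH by blast
    then obtain b where b: "\<And>j. j \<in> I \<Longrightarrow> b j \<in> lr x" "\<And>j. j \<in> I \<Longrightarrow> eventually (\<lambda>y. \<omega> j y = b j y * \<tau> y) (nb x)"
      unfolding bchoice_iff by blast
    let ?a = "\<lambda>y. e y * ak y + (\<Sum>j\<in>I. e y * mk j y * b j y)"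
    have "?a \<in> lr x" by (intro lr_intros x e k b) (use k(2) in auto)
    moreover have "eventually (\<lambda>y. \<forall>j\<in>I. \<omega> j y = b j y * \<tau> y) (nb x)"
      using b(2) insert.hyps(1) by (intro eventually_ball_finite) auto
    with k' have "eventually (\<lambda>y. \<omega> k y = ?a y * \<tau> y) (nb x)"
    proof eventually_elim
      case (elim y)
      have "(\<Sum>j\<in>I. e y * mk j y * \<omega> j y) = (\<Sum>j\<in>I. e y * mk j y * b j y) * \<tau> y"
        unfolding sum_distrib_right using elim(2) by (intro sum.cong) auto
      then show ?case using elim(1) by (simp add: algebra_simps)
    qed
    ultimately show ?thesis unfolding True by (intro bexI[of _ ?a])
  qed (use IH insert.prems(2) in blast)
qed simp

definition unif :: "pt \<Rightarrow> (pt \<Rightarrow> complex) \<Rightarrow> bool" where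
  "unif x u \<longleftrightarrow> u \<in> lr x \<and> u x = 0 \<and> dv x u \<noteq> 0"

lemma unif_shift:
  assumes x: "x \<in> C" and f: "f \<in> lr x" "dv x f \<noteq> 0"
  shows "unif x (\<lambda>y. f y - f x)"
  using f dv_diff[OF x f(1) lr_const[OF x], of "f x"] dv_const[OF x] lr_diff[OF x f(1) lr_const[OF x]]
  by (simp add: unif_def)

lemma unif_exists: assumes "x \<in> C" obtains u where "unif x u"
  using unif_shift[OF assms] dv_nonzero[OF assms] by metis

context
  fixes x j
  assumes x: "x \<in> C" and j: "rp x j \<noteq> 0"
begin

abbreviation (input) zc where "zc i \<equiv> \<lambda>y. rp y i / rp y j"

lemma j_le: "j \<le> n"
  using rp_supp[OF C_PS[OF x], of j] j by (meson not_le)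

lemma zc_lr: "i \<le> n \<Longrightarrow> zc i \<in> lr x"
  using lr_ratio[OF x hpoly_pvar hpoly_pvar[OF j_le]] j by simp

text \<open>The coefficients come from the difference versions of the sum, product and quotient
  rules.\<close>

lemma maximal_ideal_generators:
  assumes "f \<in> lr x"
  shows "\<exists>g. (\<forall>i\<le>n. g i \<in> lr x) \<and>
    eventually (\<lambda>y. f y - f x = (\<Sum>i\<le>n. g i y * (zc i y - zc i x))) (nb x)"
  using x j assms
proof (induction rule: lr_induct)
  case (const c)
  show ?case by (rule exI[of _ "\<lambda>_ _. 0"]) (auto intro: lr_const x)
next
  case (coord i)
  have "(\<Sum>k\<le>n. (if k = i then 1 else 0) * (zc k y - zc k x)) = zc i y - zc i x" for y
    using coord by (simp add: if_distrib[of "\<lambda>a. a * _"] cong: if_cong)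
  then show ?case by (intro exI[of _ "\<lambda>k _. if k = i then 1 else 0"]) (auto intro: lr_const x)
next
  case (add f1 f2)
  then obtain g1 g2 where
    g1: "\<forall>i\<le>n. g1 i \<in> lr x" "eventually (\<lambda>y. f1 y - f1 x = (\<Sum>i\<le>n. g1 i y * (zc i y - zc i x))) (nb x)" and
    g2: "\<forall>i\<le>n. g2 i \<in> lr x" "eventually (\<lambda>y. f2 y - f2 x = (\<Sum>i\<le>n. g2 i y * (zc i y - zc i x))) (nb x)"
    by blast
  have "eventually (\<lambda>y. (f1 y + f2 y) - (f1 x + f2 x) = (\<Sum>i\<le>n. (g1 i y + g2 i y) * (zc i y - zc i x))) (nb x)"
    using g1(2) g2(2)
  proof eventually_elim
    case (elim y)
    have "(f1 y + f2 y) - (f1 x + f2 x) = (f1 y - f1 x) + (f2 y - f2 x)" by simp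
    then show ?case unfolding elim by (simp add: sum.distrib[symmetric] distrib_right)
  qed
  then show ?case using g1(1) g2(1) by (intro exI[of _ "\<lambda>i y. g1 i y + g2 i y"]) (auto intro: lr_add x)
next
  case (mult f1 f2)
  then obtain g1 g2 where
    g1: "\<forall>i\<le>n. g1 i \<in> lr x" "eventually (\<lambda>y. f1 y - f1 x = (\<Sum>i\<le>n. g1 i y * (zc i y - zc i x))) (nb x)" and
    g2: "\<forall>i\<le>n. g2 i \<in> lr x" "eventually (\<lambda>y. f2 y - f2 x = (\<Sum>i\<le>n. g2 i y * (zc i y - zc i x))) (nb x)"
    by blast
  have "eventually (\<lambda>y. f1 y * f2 y - f1 x * f2 x = (\<Sum>i\<le>n. (f1 y * g2 i y + f2 x * g1 i y) * (zc i y - zc i x))) (nb x)"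
    using g1(2) g2(2)
  proof eventually_elim
    case (elim y)
    have "f1 y * f2 y - f1 x * f2 x = f1 y * (f2 y - f2 x) + f2 x * (f1 y - f1 x)" by (simp add: algebra_simps)
    then show ?case unfolding elim by (simp add: sum.distrib[symmetric] sum_distrib_left algebra_simps)
  qed
  then show ?case using g1(1) g2(1) mult.hyps
    by (intro exI[of _ "\<lambda>i y. f1 y * g2 i y + f2 x * g1 i y"]) (auto intro!: lr_intros x)
next
  case (inverse f1)
  then obtain g1 where
    g1: "\<forall>i\<le>n. g1 i \<in> lr x" "eventually (\<lambda>y. f1 y - f1 x = (\<Sum>i\<le>n. g1 i y * (zc i y - zc i x))) (nb x)"
    by blast
  have "eventually (\<lambda>y. inverse (f1 y) - inverse (f1 x) =
      (\<Sum>i\<le>n. (- inverse (f1 x) * inverse (f1 y) * g1 i y) * (zc i y - zc i x))) (nb x)"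
    using g1(2) lr_nonzero[OF x inverse.hyps]
  proof eventually_elim
    case (elim y)
    have "inverse (f1 y) - inverse (f1 x) = - inverse (f1 x) * inverse (f1 y) * (f1 y - f1 x)"
      using elim(2) inverse.hyps(2) by (simp add: field_simps)
    then show ?case unfolding elim(1) by (simp add: sum_distrib_left mult.assoc)
  qed
  then show ?case using g1(1) inverse.hyps
    by (intro exI[of _ "\<lambda>i y. - inverse (f1 x) * inverse (f1 y) * g1 i y"])
      (auto intro!: lr_mult lr_uminus lr_inverse lr_const x)
next
  case (cong f1 f2)
  then obtain g1 where
    g1: "\<forall>i\<le>n. g1 i \<in> lr x" "eventually (\<lambda>y. f1 y - f1 x = (\<Sum>i\<le>n. g1 i y * (zc i y - zc i x))) (nb x)"
    by blast
  have "eventually (\<lambda>y. f2 y - f2 x = (\<Sum>i\<le>n. g1 i y * (zc i y - zc i x))) (nb x)"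
    using g1(2) cong(2) by eventually_elim (use nbD(1)[OF cong(2)] in simp)
  then show ?case using g1(1) by blast
qed

text \<open>The maximal ideal is generated by u and its own square, and it is finitely generated by
  the shifted coordinates; Nakayama's lemma leaves u as a generator.\<close>

lemma coord_uniformizer:
  assumes u: "unif x u" and i: "i \<le> n"
  shows "\<exists>a\<in>lr x. eventually (\<lambda>y. zc i y - zc i x = a y * u y) (nb x)"
proof (rule nakayama[of x "{..n}" "\<lambda>i y. zc i y - zc i x" u i])
  fix i assume i: "i \<in> {..n}"
  define w where "w i y = zc i y - zc i x" for i y
  have w: "w i \<in> lr x" if "i \<le> n" for i unfolding w_def by (intro lr_diff lr_const x zc_lr that)
  \<comment> \<open>This multiple of u has the same derivative at x as the shifted coordinate, so
    the difference lies in the square of the maximal ideal.\<close>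
  define c where "c = dv x (w i) / dv x u"
  have ul: "u \<in> lr x" "u x = 0" "dv x u \<noteq> 0" using u by (auto simp: unif_def)
  have wi: "w i \<in> lr x" using w i by simp
  have "dv x (\<lambda>y. w i y - c * u y) = 0"
    using dv_diff[OF x wi lr_cmult[OF x ul(1)], of c] dv_cmult[OF x ul(1), of c] ul(3) by (simp add: c_def)
  moreover have "w i x - c * u x = 0" using ul(2) by (simp add: w_def)
  ultimately have "(\<lambda>y. w i y - c * u y) \<in> m2 x"
    unfolding m2_iff[OF x] using lr_diff[OF x wi lr_cmult[OF x ul(1)]] by blast
  then obtain r h k where 1: "\<forall>j<(r::nat). h j \<in> lr x \<and> k j \<in> lr x \<and> h j x = 0 \<and> k j x = 0"
      "eventually (\<lambda>y. w i y - c * u y = (\<Sum>j<r. h j y * k j y)) (nb x)" unfolding m2_def by blast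
  have "\<forall>s\<in>{..<r}. \<exists>g. (\<forall>i\<le>n. g i \<in> lr x) \<and> eventually (\<lambda>y. k s y = (\<Sum>i\<le>n. g i y * w i y)) (nb x)"
    using maximal_ideal_generators[of "k s" for s] 1(1) unfolding w_def by fastforce
  then obtain g where g: "\<And>s i. s < r \<Longrightarrow> i \<le> n \<Longrightarrow> g s i \<in> lr x"
      "\<And>s. s < r \<Longrightarrow> eventually (\<lambda>y. k s y = (\<Sum>i\<le>n. g s i y * w i y)) (nb x)"
    unfolding bchoice_iff by fastforce
  let ?m = "\<lambda>l y. \<Sum>s<r. h s y * g s l y"
  have "eventually (\<lambda>y. \<forall>s\<in>{..<r}. k s y = (\<Sum>i\<le>n. g s i y * w i y)) (nb x)"
    using g(2) by (intro eventually_ball_finite) auto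
  with 1(2) have "eventually (\<lambda>y. w i y = c * u y + (\<Sum>l\<in>{..n}. ?m l y * w l y)) (nb x)"
  proof eventually_elim
    case (elim y)
    have "(\<Sum>s<r. h s y * k s y) = (\<Sum>s<r. \<Sum>l\<le>n. h s y * g s l y * w l y)"
      using elim(2) by (intro sum.cong) (auto simp: sum_distrib_left mult.assoc)
    also have "\<dots> = (\<Sum>l\<le>n. ?m l y * w l y)" by (subst sum.swap) (simp add: sum_distrib_right)
    finally show ?case using elim(1) by (simp add: algebra_simps)
  qed
  moreover have "\<forall>l\<in>{..n}. ?m l \<in> lr x \<and> ?m l x = 0"
    using 1(1) g(1) by (auto intro!: lr_sum lr_mult x)
  ultimately show "\<exists>a m. a \<in> lr x \<and> (\<forall>j\<in>{..n}. m j \<in> lr x \<and> m j x = 0) \<and>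
      eventually (\<lambda>y. zc i y - zc i x = a y * u y + (\<Sum>j\<in>{..n}. m j y * (zc j y - zc j x))) (nb x)"
    unfolding w_def by (intro exI[of _ "\<lambda>_. c"] exI[of _ ?m]) (auto intro: lr_const x)
qed (use x i in auto)

text \<open>The coordinate differentials generate all differentials, with coefficients regular at
  \<open>x\<close> that are valid in a whole neighbourhood. Each case is a rule of
  differentiation.\<close>

lemma differential_generators:
  assumes "f \<in> lr x"
  shows "\<exists>g. (\<forall>i\<le>n. g i \<in> lr x) \<and> eventually (\<lambda>y. dv y f = (\<Sum>i\<le>n. g i y * dv y (zc i))) (nb x)"
  using x j assms
proof (induction rule: lr_induct)
  case (const c)
  show ?case
    by (rule exI[of _ "\<lambda>_ _. 0"]) (use nb_C[OF x] in \<open>auto intro: lr_const x elim!: eventually_mono simp: dv_const\<close>)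
next
  case (coord i)
  have "(\<Sum>k\<le>n. (if k = i then 1 else 0) * dv y (zc k)) = dv y (zc i)" for y
    using coord by (simp add: if_distrib[of "\<lambda>a. a * _"] cong: if_cong)
  then show ?case by (intro exI[of _ "\<lambda>k _. if k = i then 1 else 0"]) (auto intro: lr_const x)
next
  case (add f1 f2)
  then obtain g1 g2 where
    g1: "\<forall>i\<le>n. g1 i \<in> lr x" "eventually (\<lambda>y. dv y f1 = (\<Sum>i\<le>n. g1 i y * dv y (zc i))) (nb x)" and
    g2: "\<forall>i\<le>n. g2 i \<in> lr x" "eventually (\<lambda>y. dv y f2 = (\<Sum>i\<le>n. g2 i y * dv y (zc i))) (nb x)"
    by blast
  have "eventually (\<lambda>y. dv y (\<lambda>y. f1 y + f2 y) = (\<Sum>i\<le>n. (g1 i y + g2 i y) * dv y (zc i))) (nb x)"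
    using g1(2) g2(2) lr_near[OF x add.hyps(1)] lr_near[OF x add.hyps(2)]
    by eventually_elim (simp add: dv_add sum.distrib[symmetric] distrib_right)
  then show ?case using g1(1) g2(1) by (intro exI[of _ "\<lambda>i y. g1 i y + g2 i y"]) (auto intro: lr_add x)
next
  case (mult f1 f2)
  then obtain g1 g2 where
    g1: "\<forall>i\<le>n. g1 i \<in> lr x" "eventually (\<lambda>y. dv y f1 = (\<Sum>i\<le>n. g1 i y * dv y (zc i))) (nb x)" and
    g2: "\<forall>i\<le>n. g2 i \<in> lr x" "eventually (\<lambda>y. dv y f2 = (\<Sum>i\<le>n. g2 i y * dv y (zc i))) (nb x)"
    by blast
  have "eventually (\<lambda>y. dv y (\<lambda>y. f1 y * f2 y) = (\<Sum>i\<le>n. (f1 y * g2 i y + f2 y * g1 i y) * dv y (zc i))) (nb x)"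
    using g1(2) g2(2) lr_near[OF x mult.hyps(1)] lr_near[OF x mult.hyps(2)]
    by eventually_elim (simp add: dv_mult sum.distrib[symmetric] sum_distrib_left algebra_simps)
  then show ?case using g1(1) g2(1) mult.hyps
    by (intro exI[of _ "\<lambda>i y. f1 y * g2 i y + f2 y * g1 i y"]) (auto intro!: lr_intros x)
next
  case (inverse f1)
  then obtain g1 where
    g1: "\<forall>i\<le>n. g1 i \<in> lr x" "eventually (\<lambda>y. dv y f1 = (\<Sum>i\<le>n. g1 i y * dv y (zc i))) (nb x)"
    by blast
  have "eventually (\<lambda>y. dv y (\<lambda>y. inverse (f1 y)) =
      (\<Sum>i\<le>n. (- inverse (f1 y) * inverse (f1 y) * g1 i y) * dv y (zc i))) (nb x)"
    using g1(2) lr_nonzero[OF x inverse.hyps] lr_near[OF x inverse.hyps(1)]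
  proof eventually_elim
    case (elim y)
    have "dv y (\<lambda>y. inverse (f1 y)) = - inverse (f1 y) * inverse (f1 y) * dv y f1"
      using dv_inverse[of y f1] elim(2,3) by (simp add: power2_eq_square divide_inverse)
    then show ?case unfolding elim(1) by (simp add: sum_distrib_left mult.assoc)
  qed
  then show ?case using g1(1) inverse.hyps
    by (intro exI[of _ "\<lambda>i y. - inverse (f1 y) * inverse (f1 y) * g1 i y"]) (auto intro!: lr_mult lr_uminus lr_inverse x)
next
  case (cong f1 f2)
  then obtain g1 where
    g1: "\<forall>i\<le>n. g1 i \<in> lr x" "eventually (\<lambda>y. dv y f1 = (\<Sum>i\<le>n. g1 i y * dv y (zc i))) (nb x)"
    by blast
  have "eventually (\<lambda>y. dv y f2 = (\<Sum>i\<le>n. g1 i y * dv y (zc i))) (nb x)"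
    using g1(2) nb_nb[OF cong(2)] lr_near[OF x cong.hyps(1)]
    by eventually_elim (use dv_germ in metis)
  then show ?case using g1(1) by blast
qed

text \<open>Differentiating z - z(x) = a u gives dz = a du + u da, and da is a combination of
  coordinate differentials. The factor u puts these coefficients into the maximal ideal, so
  Nakayama's lemma applies again.\<close>

lemma coord_differential:
  assumes u: "unif x u" and i: "i \<le> n"
  shows "\<exists>a\<in>lr x. eventually (\<lambda>y. dv y (zc i) = a y * dv y u) (nb x)"
proof (rule nakayama[of x "{..n}" "\<lambda>i y. dv y (zc i)" "\<lambda>y. dv y u" i])
  fix i assume i: "i \<in> {..n}"
  have ul: "u \<in> lr x" "u x = 0" using u by (auto simp: unif_def)
  have z: "zc i \<in> lr x" using zc_lr i by auto
  obtain a where a: "a \<in> lr x" "eventually (\<lambda>y. zc i y - zc i x = a y * u y) (nb x)"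
    using coord_uniformizer[OF u] i by auto
  obtain g where g: "\<forall>i\<le>n. g i \<in> lr x" "eventually (\<lambda>y. dv y a = (\<Sum>i\<le>n. g i y * dv y (zc i))) (nb x)"
    using differential_generators[OF a(1)] by blast
  have "eventually (\<lambda>y. dv y (zc i) = a y * dv y u + (\<Sum>l\<in>{..n}. u y * g l y * dv y (zc l))) (nb x)"
    using nb_nb[OF a(2)] g(2) lr_near[OF x a(1)] lr_near[OF x ul(1)] lr_near[OF x z]
  proof eventually_elim
    case (elim y)
    have "dv y (zc i) = dv y (\<lambda>y. zc i y - zc i x)"
      using elim by (simp add: dv_diff dv_const lr_const)
    also have "\<dots> = dv y (\<lambda>y. a y * u y)"
      using elim by (intro dv_germ lr_diff lr_const) auto
    also have "\<dots> = a y * dv y u + u y * dv y a" using elim by (simp add: dv_mult)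
    finally show ?case unfolding elim(2) by (simp add: sum_distrib_left mult.assoc)
  qed
  then show "\<exists>a m. a \<in> lr x \<and> (\<forall>j\<in>{..n}. m j \<in> lr x \<and> m j x = 0) \<and>
      eventually (\<lambda>y. dv y (zc i) = a y * dv y u + (\<Sum>j\<in>{..n}. m j y * dv y (zc j))) (nb x)"
    using a(1) g(1) ul by (intro exI[of _ a] exI[of _ "\<lambda>l y. u y * g l y"]) (auto intro: lr_mult x)
qed (use x i in auto)

end

lemma unif_divides:
  assumes x: "x \<in> C" and u: "unif x u" and f: "f \<in> lr x" "f x = 0"
  obtains g where "g \<in> lr x" "eventually (\<lambda>y. f y = u y * g y) (nb x)"
proof -
  obtain j where j: "rp x j \<noteq> 0" using rp_coord_nonzero[OF C_PS[OF x]] by blast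
  let ?z = "\<lambda>i y. rp y i / rp y j"
  obtain h where h: "\<forall>i\<le>n. h i \<in> lr x"
    "eventually (\<lambda>y. f y - f x = (\<Sum>i\<le>n. h i y * (?z i y - ?z i x))) (nb x)"
    using maximal_ideal_generators[OF x j f(1)] by blast
  have "\<forall>i\<in>{..n}. \<exists>a. a \<in> lr x \<and> eventually (\<lambda>y. ?z i y - ?z i x = a y * u y) (nb x)"
    using coord_uniformizer[OF x j u] by blast
  then obtain a where a: "\<And>i. i \<le> n \<Longrightarrow> a i \<in> lr x"
    "\<And>i. i \<le> n \<Longrightarrow> eventually (\<lambda>y. ?z i y - ?z i x = a i y * u y) (nb x)"
    unfolding bchoice_iff by fastforce
  have "eventually (\<lambda>y. \<forall>i\<in>{..n}. ?z i y - ?z i x = a i y * u y) (nb x)"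
    using a(2) by (intro eventually_ball_finite) auto
  with h(2) have "eventually (\<lambda>y. f y = u y * (\<Sum>i\<le>n. h i y * a i y)) (nb x)"
  proof eventually_elim
    case (elim y)
    have "(\<Sum>i\<le>n. h i y * (?z i y - ?z i x)) = (\<Sum>i\<le>n. u y * (h i y * a i y))"
      using elim(2) by (intro sum.cong) auto
    then show ?case using elim(1) f(2) by (simp add: sum_distrib_left)
  qed
  moreover have "(\<lambda>y. \<Sum>i\<le>n. h i y * a i y) \<in> lr x" using h(1) a(1) by (intro lr_sum lr_mult x) auto
  ultimately show ?thesis using that by blast
qed

text \<open>The function g is the derivative df/du. Its regularity at \<open>x\<close> is what makes
  derivatives usable as functions.\<close>

lemma unif_derivative:
  assumes x: "x \<in> C" and u: "unif x u" and f: "f \<in> lr x"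
  obtains g where "g \<in> lr x" "eventually (\<lambda>y. dv y f = g y * dv y u) (nb x)"
proof -
  obtain j where j: "rp x j \<noteq> 0" using rp_coord_nonzero[OF C_PS[OF x]] by blast
  let ?z = "\<lambda>i y. rp y i / rp y j"
  obtain h where h: "\<forall>i\<le>n. h i \<in> lr x" "eventually (\<lambda>y. dv y f = (\<Sum>i\<le>n. h i y * dv y (?z i))) (nb x)"
    using differential_generators[OF x j f(1)] by blast
  have "\<forall>i\<in>{..n}. \<exists>a. a \<in> lr x \<and> eventually (\<lambda>y. dv y (?z i) = a y * dv y u) (nb x)"
    using coord_differential[OF x j u] by blast
  then obtain a where a: "\<And>i. i \<le> n \<Longrightarrow> a i \<in> lr x"
    "\<And>i. i \<le> n \<Longrightarrow> eventually (\<lambda>y. dv y (?z i) = a i y * dv y u) (nb x)"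
    unfolding bchoice_iff by fastforce
  have "eventually (\<lambda>y. \<forall>i\<in>{..n}. dv y (?z i) = a i y * dv y u) (nb x)"
    using a(2) by (intro eventually_ball_finite) auto
  with h(2) have "eventually (\<lambda>y. dv y f = (\<Sum>i\<le>n. h i y * a i y) * dv y u) (nb x)"
  proof eventually_elim
    case (elim y)
    have "(\<Sum>i\<le>n. h i y * dv y (?z i)) = (\<Sum>i\<le>n. (h i y * a i y) * dv y u)"
      using elim(2) by (intro sum.cong) auto
    then show ?case using elim(1) by (simp add: sum_distrib_right)
  qed
  moreover have "(\<lambda>y. \<Sum>i\<le>n. h i y * a i y) \<in> lr x" using h(1) a(1) by (intro lr_sum lr_mult x) auto
  ultimately show ?thesis using that by blast
qed

text \<open>Where du vanishes all coordinate differentials vanish, and with them the derivation,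
  although \<open>dv\<close> is nonzero.\<close>

lemma unif_unramified_near:
  assumes x: "x \<in> C" and u: "unif x u" shows "eventually (\<lambda>y. dv y u \<noteq> 0) (nb x)"
proof -
  obtain j where j: "rp x j \<noteq> 0" using rp_coord_nonzero[OF C_PS[OF x]] by blast
  let ?z = "\<lambda>i y. rp y i / rp y j"
  have "eventually (\<lambda>y. \<forall>i\<in>{..n}. dv y u = 0 \<longrightarrow> dv y (?z i) = 0) (nb x)"
  proof (intro eventually_ball_finite ballI)
    fix i assume "i \<in> {..n}"
    then obtain a where "eventually (\<lambda>y. dv y (?z i) = a y * dv y u) (nb x)"
      using coord_differential[OF x j u] by auto
    then show "eventually (\<lambda>y. dv y u = 0 \<longrightarrow> dv y (?z i) = 0) (nb x)" by eventually_elim simp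
  qed simp
  moreover have "eventually (\<lambda>y. rp y j \<noteq> 0) (nb x)"
    using form_nonzero[OF hpoly_pvar[OF j_le[OF x j]] x] j by simp
  ultimately show ?thesis using nb_C[OF x]
  proof eventually_elim
    case (elim y)
    obtain f where f: "f \<in> lr y" "dv y f \<noteq> 0" using dv_nonzero[OF elim(3)] by blast
    obtain g where "eventually (\<lambda>y. dv y f = (\<Sum>i\<le>n. g i y * dv y (?z i))) (nb y)"
      using differential_generators[OF elim(3,2) f(1)] by blast
    then have "dv y f = (\<Sum>i\<le>n. g i y * dv y (?z i))" by (rule nbD(1))
    then show ?case using elim(1) f(2) by (metis (no_types, lifting) atMost_iff mult_zero_right sum.neutral)
  qed
qed

lemma unif_nonzero:
  assumes x: "x \<in> C" and u: "unif x u" shows "eventually (\<lambda>y. u y \<noteq> 0) gen"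
proof -
  have "\<not> eventually (\<lambda>y. u y = 0) (nb x)"
    using dv_germ[OF x, of u "\<lambda>_. 0"] dv_const[OF x] u unfolding unif_def by auto
  then show ?thesis using lr_dichotomy[OF x, of u] u unfolding unif_def by blast
qed

section \<open>The Hilbert function\<close>

text \<open>Extension by zero turns equality on C into equality of functions, so that dimensions can
  be counted in the space of all functions.\<close>

definition rs :: "cpoly \<Rightarrow> pt \<Rightarrow> complex" where
  "rs p y = (if y \<in> C then ev p y else 0)"

lemma rs_span: "p \<in> hpoly n d \<Longrightarrow> rs p \<in> cfun.span (rs ` (\<lambda>m. Poly_Mapping.single m 1) ` mons n d)"
proof -
  assume p: "p \<in> hpoly n d"
  have "rs p = (\<Sum>m\<in>Poly_Mapping.keys p. cscale (Poly_Mapping.lookup p m) (rs (Poly_Mapping.single m 1)))"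
  proof
    fix y
    show "rs p y = (\<Sum>m\<in>Poly_Mapping.keys p. cscale (Poly_Mapping.lookup p m) (rs (Poly_Mapping.single m 1))) y"
      unfolding sum_fun_apply by (simp add: rs_def ev_def peval_single peval_def)
  qed
  moreover have "\<dots> \<in> cfun.span (rs ` (\<lambda>m. Poly_Mapping.single m 1) ` mons n d)"
    using p unfolding hpoly_keys by (intro cfun.span_sum cfun.span_scale cfun.span_base imageI) auto
  ultimately show ?thesis by simp
qed

end

text \<open>Multiplication by h combined with pullback along \<pi>. Later \<pi> is the identity or
  the projection from pairs to points.\<close>

lemma span_mult:
  assumes "\<And>s. s \<in> S \<Longrightarrow> (\<lambda>z. h z * s (\<pi> z)) \<in> cfun.span S'" and "f \<in> cfun.span S"
  shows "(\<lambda>z. h z * f (\<pi> z)) \<in> cfun.span S'"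
  using assms(2)
proof (induction rule: cfun.span_induct)
  case base
  show ?case
    unfolding cfun.subspace_def
  proof (intro conjI ballI allI CollectI)
    show "(\<lambda>z. h z * 0 (\<pi> z)) \<in> cfun.span S'" using cfun.span_zero[of S'] by (simp add: zero_fun_def)
    fix a b c assume a: "a \<in> {f. (\<lambda>z. h z * f (\<pi> z)) \<in> cfun.span S'}"
    have "(\<lambda>z. h z * cscale c a (\<pi> z)) = cscale c (\<lambda>z. h z * a (\<pi> z))" by auto
    then show "(\<lambda>z. h z * cscale c a (\<pi> z)) \<in> cfun.span S'" using a cfun.span_scale by simp
    assume b: "b \<in> {f. (\<lambda>z. h z * f (\<pi> z)) \<in> cfun.span S'}"
    have "(\<lambda>z. h z * (a + b) (\<pi> z)) = (\<lambda>z. h z * a (\<pi> z)) + (\<lambda>z. h z * b (\<pi> z))" by (auto simp: algebra_simps)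
    then show "(\<lambda>z. h z * (a + b) (\<pi> z)) \<in> cfun.span S'" using a b cfun.span_add by simp
  qed
qed (rule assms(1))

text \<open>Adding a small multiple of a coordinate that is nonzero at the new point works for all
  but finitely many scalars.\<close>

lemma linear_form_avoiding:
  assumes "finite Z" "Z \<subseteq> PS n" obtains l where "l \<in> hpoly n 1" "\<And>z. z \<in> Z \<Longrightarrow> ev l z \<noteq> 0"
proof -
  have "\<exists>l\<in>hpoly n 1. \<forall>z\<in>Z. ev l z \<noteq> 0"
    using assms
  proof (induction Z rule: finite_induct)
    case empty
    show ?case by (intro bexI[of _ 0]) auto
  next
    case (insert z Z)
    then obtain l where l: "l \<in> hpoly n 1" "\<forall>z\<in>Z. ev l z \<noteq> 0" by auto
    obtain i where i: "i \<le> n" "rp z i \<noteq> 0" using rp_coord_nonzero[of z n] insert.prems by auto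
    let ?B = "(\<lambda>y. - ev l y / rp y i) ` insert z Z"
    have "finite ?B" using insert.hyps by auto
    then obtain \<epsilon> where \<epsilon>: "\<epsilon> \<notin> insert 0 ?B"
      using ex_new_if_finite[OF infinite_UNIV_char_0, of "insert 0 ?B"] by auto
    have "ev (l + pconst \<epsilon> * pvar i) y \<noteq> 0" if y: "y \<in> insert z Z" for y
    proof
      assume e: "ev (l + pconst \<epsilon> * pvar i) y = 0"
      then have "rp y i \<noteq> 0" using \<epsilon> l(2) y i(2) by auto
      then have "\<epsilon> = - ev l y / rp y i" using e by (simp add: field_simps eq_neg_iff_add_eq_0)
      then show False using \<epsilon> y by blast
    qed
    then show ?case using l(1) i(1) by (intro bexI[of _ "l + pconst \<epsilon> * pvar i"]) (auto intro!: hpoly_add hpoly_cmult hpoly_pvar[unfolded One_nat_def])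
  qed
  then show ?thesis using that by blast
qed

context curve
begin

text \<open>Choose l with finitely many zeros on C and l' avoiding them. Then l, l' and the forms
  vanishing on C have no common projective zero, so they generate all forms of large degree.\<close>

lemma two_forms:
  "\<exists>l\<in>hpoly n 1. \<exists>l'\<in>hpoly n 1. \<exists>d0. \<forall>d\<ge>d0. \<forall>p\<in>hpoly n (Suc d).
     \<exists>a\<in>hpoly n d. \<exists>b\<in>hpoly n d. \<forall>y\<in>C. ev p y = ev l y * ev a y + ev l' y * ev b y"
proof -
  obtain x where x: "x \<in> C" using infiniteC by fastforce
  obtain j where j: "j \<le> n" "rp x j \<noteq> 0" using rp_coord_nonzero[OF C_PS[OF x]] by blast
  define l where "l = pvar j"
  have l: "l \<in> hpoly n 1" unfolding l_def by (rule hpoly_pvar[OF j(1)])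
  have "eventually (\<lambda>y. ev l y \<noteq> 0) gen" using form_nonzero[OF l x] j by (auto simp: l_def eventually_nb)
  then have "finite {y \<in> C. ev l y = 0}" by (simp add: eventually_gen)
  then obtain l' where l': "l' \<in> hpoly n 1" "\<And>z. z \<in> {y \<in> C. ev l y = 0} \<Longrightarrow> ev l' z \<noteq> 0"
    by (rule linear_form_avoiding[of _ n]) (use C_PS in auto)
  \<comment> \<open>The clause for m = 0 forbids nonzero constants a and b, which the truncated m -
    1 would admit.\<close>
  define I where "I m = {p \<in> hpoly n m. \<exists>a b. a \<in> hpoly n (m - 1) \<and> b \<in> hpoly n (m - 1) \<and>
    (m = 0 \<longrightarrow> a = 0 \<and> b = 0) \<and> (\<forall>y\<in>C. ev p y = ev l y * ev a y + ev l' y * ev b y)}" for m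
  have I: "gideal n I"
    unfolding gideal_def
  proof (intro allI conjI ballI)
    fix m
    show "I m \<subseteq> hpoly n m" by (auto simp: I_def)
    show "0 \<in> I m" unfolding I_def by (intro CollectI conjI exI[of _ 0]) auto
    fix p assume "p \<in> I m"
    then obtain a b where p: "p \<in> hpoly n m" "a \<in> hpoly n (m - 1)" "b \<in> hpoly n (m - 1)"
      "m = 0 \<longrightarrow> a = 0 \<and> b = 0" "\<forall>y\<in>C. ev p y = ev l y * ev a y + ev l' y * ev b y" unfolding I_def by blast
    show "p + q \<in> I m" if "q \<in> I m" for q
    proof -
      from that obtain a' b' where q: "q \<in> hpoly n m" "a' \<in> hpoly n (m - 1)" "b' \<in> hpoly n (m - 1)"
        "m = 0 \<longrightarrow> a' = 0 \<and> b' = 0" "\<forall>y\<in>C. ev q y = ev l y * ev a' y + ev l' y * ev b' y" unfolding I_def by blast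
      show ?thesis unfolding I_def using p q
        by (intro CollectI conjI exI[of _ "a + a'"] exI[of _ "b + b'"]) (auto simp: algebra_simps)
    qed
    show "q * p \<in> I (e + m)" if q: "q \<in> hpoly n e" for e q
    proof -
      have "q * r \<in> hpoly n (e + m - 1)" if "r \<in> hpoly n (m - 1)" "m = 0 \<longrightarrow> r = 0" for r
        using hpoly_mult[OF q that(1)] that(2) by (cases m) auto
      then show ?thesis unfolding I_def using p hpoly_mult[OF q p(1)]
        by (intro CollectI conjI exI[of _ "q * a"] exI[of _ "q * b"]) (auto simp: algebra_simps)
    qed
  qed
  have lI: "l \<in> I 1" unfolding I_def using l one_hpoly[of n] by (intro CollectI conjI exI[of _ 1] exI[of _ 0]) auto
  have l'I: "l' \<in> I 1" unfolding I_def using l' one_hpoly[of n] by (intro CollectI conjI exI[of _ 0] exI[of _ 1]) auto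
  obtain d0 where d0: "\<And>d. d \<ge> d0 \<Longrightarrow> hpoly n d \<subseteq> I d"
  proof (rule gideal_no_zeros[OF I])
    fix v :: "nat \<Rightarrow> complex" assume v: "v \<noteq> 0" "\<And>i. i > n \<Longrightarrow> v i = 0"
    have z: "ev p (hpoint v) = 0 \<longleftrightarrow> peval p v = 0" if "p \<in> hpoly n d" for p d
      using ev_hpoint_zero_iff[of v n p d] v that by blast
    show "\<exists>d. \<exists>p\<in>I d. peval p v \<noteq> 0"
    proof (cases "hpoint v \<in> C")
      case False
      obtain p d where p: "p \<in> hpoly n d" "ev p (hpoint v) \<noteq> 0" "\<And>z. z \<in> C \<Longrightarrow> ev p z = 0"
        using zclosed_separate[OF closedC hpoint_PS[OF v] False] by blast
      have "p \<in> I d" unfolding I_def using p by (intro CollectI conjI exI[of _ 0]) auto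
      then show ?thesis using z[OF p(1)] p(2) by blast
    next
      case True
      then have "ev l (hpoint v) \<noteq> 0 \<or> ev l' (hpoint v) \<noteq> 0" using l'(2) by blast
      then show ?thesis using z[OF l] z[OF l'(1)] lI l'I by blast
    qed
  qed blast
  have "\<exists>a\<in>hpoly n d. \<exists>b\<in>hpoly n d. \<forall>y\<in>C. ev p y = ev l y * ev a y + ev l' y * ev b y"
    if "d0 \<le> d" "p \<in> hpoly n (Suc d)" for d p
  proof -
    have "p \<in> I (Suc d)" using d0[of "Suc d"] that by auto
    then show ?thesis unfolding I_def by auto
  qed
  then show ?thesis using l l'(1) by blast
qed

text \<open>Iterating \<open>two_forms\<close> writes the forms of degree d0 + k as combinations of
  l^i l'^(k - i) s with s from a fixed finite set. The linear growth is the numerical shadow of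
  dimension 1.\<close>

lemma hilbert_function_linear:
  "\<exists>c d0. \<forall>d\<ge>d0. \<exists>S. finite S \<and> card S \<le> c * Suc d \<and> rs ` hpoly n d \<subseteq> cfun.span S"
proof -
  obtain l l' d0 where l: "l \<in> hpoly n 1" "l' \<in> hpoly n 1" and
    st: "\<forall>d\<ge>d0. \<forall>p\<in>hpoly n (Suc d).
       \<exists>a\<in>hpoly n d. \<exists>b\<in>hpoly n d. \<forall>y\<in>C. ev p y = ev l y * ev a y + ev l' y * ev b y"
    using two_forms by blast
  define S0 where "S0 = rs ` (\<lambda>m. Poly_Mapping.single m 1) ` mons n d0"
  have S0: "finite S0" unfolding S0_def using finite_mons by blast
  define S where "S k = (\<lambda>(i, s). \<lambda>y. ev l y ^ i * ev l' y ^ (k - i) * s y) ` ({..k} \<times> S0)" for k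
  have fin: "finite (S k)" for k unfolding S_def using S0 by blast
  have card: "card (S k) \<le> Suc k * card S0" for k
  proof -
    have "card (S k) \<le> card ({..k} \<times> S0)" unfolding S_def using S0 by (intro card_image_le) simp
    then show ?thesis by (simp only: card_cartesian_product card_atMost)
  qed
  have span: "rs p \<in> cfun.span (S k)" if "p \<in> hpoly n (d0 + k)" for k p
    using that
  proof (induction k arbitrary: p)
    case 0
    have "S0 \<subseteq> S 0"
    proof
      fix s assume "s \<in> S0"
      then show "s \<in> S 0" unfolding S_def by (intro image_eqI[of _ _ "(0, s)"]) auto
    qed
    then have "cfun.span S0 \<subseteq> cfun.span (S 0)" by (rule cfun.span_mono)
    moreover have "rs p \<in> cfun.span S0" using rs_span[of p d0] 0 unfolding S0_def by simp
    ultimately show ?case by blast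
  next
    case (Suc k)
    obtain a b where ab: "a \<in> hpoly n (d0 + k)" "b \<in> hpoly n (d0 + k)"
      "\<forall>y\<in>C. ev p y = ev l y * ev a y + ev l' y * ev b y" using st[rule_format, of "d0 + k" p] Suc.prems by auto
    have "(\<lambda>y. ev l y * rs a y) \<in> cfun.span (S (Suc k))"
    proof (rule span_mult[OF _ Suc.IH[OF ab(1)]])
      fix s assume "s \<in> S k"
      then obtain i r where r: "i \<le> k" "r \<in> S0" "s = (\<lambda>y. ev l y ^ i * ev l' y ^ (k - i) * r y)" by (auto simp: S_def)
      have "(\<lambda>y. ev l y * s y) \<in> S (Suc k)"
        unfolding S_def r(3) using r(1,2) by (intro image_eqI[of _ _ "(Suc i, r)"]) (auto simp: mult_ac)
      then show "(\<lambda>y. ev l y * s y) \<in> cfun.span (S (Suc k))" by (rule cfun.span_base)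
    qed
    moreover have "(\<lambda>y. ev l' y * rs b y) \<in> cfun.span (S (Suc k))"
    proof (rule span_mult[OF _ Suc.IH[OF ab(2)]])
      fix s assume "s \<in> S k"
      then obtain i r where r: "i \<le> k" "r \<in> S0" "s = (\<lambda>y. ev l y ^ i * ev l' y ^ (k - i) * r y)" by (auto simp: S_def)
      have "(\<lambda>y. ev l' y * s y) \<in> S (Suc k)"
        unfolding S_def r(3) using r(1,2) by (intro image_eqI[of _ _ "(i, r)"]) (auto simp: mult_ac Suc_diff_le)
      then show "(\<lambda>y. ev l' y * s y) \<in> cfun.span (S (Suc k))" by (rule cfun.span_base)
    qed
    moreover have "rs p = (\<lambda>y. ev l y * rs a y) + (\<lambda>y. ev l' y * rs b y)"
      using ab(3) by (auto simp: rs_def fun_eq_iff)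
    ultimately show ?case by (metis cfun.span_add)
  qed
  show ?thesis
  proof (rule exI[of _ "card S0"], rule exI[of _ d0], intro allI impI)
    fix d assume d: "d \<ge> d0"
    have "Suc (d - d0) * card S0 \<le> Suc d * card S0" by (intro mult_le_mono1) simp
    then have "card (S (d - d0)) \<le> Suc d * card S0" using card[of "d - d0"] le_trans by blast
    then have "card (S (d - d0)) \<le> card S0 * Suc d" by (simp only: mult.commute)
    moreover have "rs ` hpoly n d \<subseteq> cfun.span (S (d - d0))" using span[of _ "d - d0"] d by auto
    ultimately
    show "\<exists>S. finite S \<and> card S \<le> card S0 * Suc d \<and> rs ` hpoly n d \<subseteq> cfun.span S"
      using fin by blast
  qed
qed

text \<open>Over a common denominator the (m + 1)^2 monomials in u and g of bidegree at most (m, m)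
  become forms of degree 2 m e. On C these span a space of dimension O(m) only.\<close>

lemma algebraic_relation:
  assumes x: "x \<in> C" and u: "u \<in> lr x" and g: "g \<in> lr x"
  obtains m c where "\<exists>i\<le>m. \<exists>j\<le>m. c i j \<noteq> (0::complex)"
    "eventually (\<lambda>y. (\<Sum>j\<le>(m::nat). \<Sum>i\<le>m. c i j * u y ^ i * g y ^ j) = 0) (nb x)"
proof -
  obtain d1 G H where 1: "G \<in> hpoly n d1" "H \<in> hpoly n d1" "ev H x \<noteq> 0"
    "eventually (\<lambda>y. ev H y \<noteq> 0 \<and> u y = ev G y / ev H y) (nb x)" by (rule lr_obtain[OF x u])
  obtain d2 G' H' where 2: "G' \<in> hpoly n d2" "H' \<in> hpoly n d2" "ev H' x \<noteq> 0"
    "eventually (\<lambda>y. ev H' y \<noteq> 0 \<and> g y = ev G' y / ev H' y) (nb x)" by (rule lr_obtain[OF x g])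
  obtain k where k: "k \<le> n" "rp x k \<noteq> 0" using rp_coord_nonzero[OF C_PS[OF x]] by blast
  \<comment> \<open>The summand 1 stems from the extra factor \<open>pvar k\<close>; it guarantees e
    \<ge> 1, so that D grows with m.\<close>
  define e where "e = d1 + d2 + 1"
  define A where "A = G * H' * pvar k"
  define A' where "A' = H * G' * pvar k"
  define B where "B = H * H' * pvar k"
  have AB: "A \<in> hpoly n e" "A' \<in> hpoly n e" "B \<in> hpoly n e"
    unfolding A_def A'_def B_def e_def using 1 2 k by (intro hpoly_mult hpoly_pvar; simp)+
  have "eventually (\<lambda>y. rp y k \<noteq> 0) (nb x)" using form_nonzero[OF hpoly_pvar[OF k(1)] x] k by simp
  with 1(4) 2(4) have rel: "eventually (\<lambda>y. ev B y \<noteq> 0 \<and> ev A y = u y * ev B y \<and> ev A' y = g y * ev B y) (nb x)"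
    by eventually_elim (auto simp: A_def A'_def B_def)
  obtain c d0 where hf: "\<forall>d\<ge>d0. \<exists>S. finite S \<and> card S \<le> c * Suc d \<and> rs ` hpoly n d \<subseteq> cfun.span S"
    using hilbert_function_linear by blast
  \<comment> \<open>The three summands give D \<ge> d0, absorb the term c 2 m e into m^2, and absorb
    the constant c into m.\<close>
  define m where "m = d0 + 2 * c * e + c"
  define D where "D = 2 * m * e"
  have "D \<ge> d0" unfolding D_def m_def e_def by simp
  then obtain S where S: "finite S" "card S \<le> c * Suc D" "rs ` hpoly n D \<subseteq> cfun.span S" using hf by blast
  have "c * Suc D \<le> m * Suc m"
  proof -
    have "c * Suc D = (2 * c * e) * m + c" by (simp add: D_def algebra_simps)
    also have "\<dots> \<le> m * m + m" by (intro add_mono mult_le_mono1) (auto simp: m_def)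
    finally show ?thesis by simp
  qed
  then have cS: "card S < card ({..m} \<times> {..m})" using S(2) by simp
  let ?f = "\<lambda>(i, j). rs (A ^ i * A' ^ j * B ^ (2 * m - i - j))"
  obtain c' where c': "\<exists>p\<in>{..m} \<times> {..m}. c' p \<noteq> 0" "\<And>y. (\<Sum>p\<in>{..m} \<times> {..m}. c' p * ?f p y) = 0"
  proof (rule family_dependent[of "{..m} \<times> {..m}" S ?f])
    fix p assume "p \<in> {..m} \<times> {..m}"
    then obtain i j where p: "p = (i, j)" "i \<le> m" "j \<le> m" by auto
    have "A ^ i * A' ^ j * B ^ (2 * m - i - j) \<in> hpoly n (i * e + j * e + (2 * m - i - j) * e)"
      by (intro hpoly_mult hpoly_power AB)
    moreover have "i * e + j * e + (2 * m - i - j) * e = D"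
      unfolding D_def using p by (simp flip: distrib_right)
    ultimately show "?f p \<in> cfun.span S" using S(3) p(1) by auto
  qed (use S cS in auto)
  have "eventually (\<lambda>y. (\<Sum>j\<le>m. \<Sum>i\<le>m. c' (i, j) * u y ^ i * g y ^ j) = 0) (nb x)"
    using rel nb_C[OF x]
  proof eventually_elim
    case (elim y)
    have "0 = (\<Sum>p\<in>{..m} \<times> {..m}. c' p * ?f p y)" using c'(2) by simp
    also have "\<dots> = (\<Sum>i\<le>m. \<Sum>j\<le>m. c' (i, j) * (ev A y ^ i * ev A' y ^ j * ev B y ^ (2 * m - i - j)))"
      using elim(2) by (simp add: sum.cartesian_product rs_def case_prod_unfold)
    also have "\<dots> = (\<Sum>i\<le>m. \<Sum>j\<le>m. ev B y ^ (2 * m) * (c' (i, j) * u y ^ i * g y ^ j))"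
    proof (intro sum.cong refl)
      fix i j assume "i \<in> {..m}" "j \<in> {..m}"
      then have "ev B y ^ (2 * m) = ev B y ^ i * ev B y ^ j * ev B y ^ (2 * m - i - j)"
        by (simp flip: power_add)
      then show "c' (i, j) * (ev A y ^ i * ev A' y ^ j * ev B y ^ (2 * m - i - j)) =
          ev B y ^ (2 * m) * (c' (i, j) * u y ^ i * g y ^ j)"
        using elim(1) by (simp add: power_mult_distrib)
    qed
    also have "\<dots> = ev B y ^ (2 * m) * (\<Sum>j\<le>m. \<Sum>i\<le>m. c' (i, j) * u y ^ i * g y ^ j)"
      by (subst sum.swap) (simp add: sum_distrib_left)
    finally show ?case using elim(1) by simp
  qed
  then show ?thesis using that[of m "\<lambda>i j. c' (i, j)"] c'(1) by auto
qed

text \<open>Krull's intersection theorem for a local ring of the curve: an algebraic relation between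
  \<open>u\<close> and \<open>g\<close> bounds the order of vanishing of \<open>g\<close>.\<close>

lemma unif_factor:
  assumes x: "x \<in> C" and u: "unif x u" and g: "g \<in> lr x" "\<not> eventually (\<lambda>y. g y = 0) (nb x)"
  obtains k e where "e \<in> lr x" "e x \<noteq> 0" "eventually (\<lambda>y. g y = u y ^ k * e y) (nb x)"
proof -
  have ul: "u \<in> lr x" "u x = 0" using u by (auto simp: unif_def)
  define P where "P k \<longleftrightarrow> (\<exists>h\<in>lr x. eventually (\<lambda>y. g y = u y ^ k * h y) (nb x))" for k
  have "\<exists>k. \<not> P k"
  proof (rule ccontr)
    assume "\<nexists>k. \<not> P k"
    then have all: "P k" for k by blast
    obtain m c where c: "\<exists>i\<le>m. \<exists>j\<le>m. c i j \<noteq> (0::complex)"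
      "eventually (\<lambda>y. (\<Sum>j\<le>(m::nat). \<Sum>i\<le>m. c i j * u y ^ i * g y ^ j) = 0) (nb x)"
      using algebraic_relation[OF x ul(1) g(1)] by blast
    \<comment> \<open>The lowest power of g that occurs, and below the lowest power
      \<open>i0\<close> of u in its coefficient.\<close>
    define j0 where "j0 = (LEAST j. \<exists>i\<le>m. c i j \<noteq> 0)"
    obtain i1 j1 where i1: "i1 \<le> m" "j1 \<le> m" "c i1 j1 \<noteq> 0" using c(1) by blast
    have "\<exists>i\<le>m. c i j0 \<noteq> 0" unfolding j0_def by (rule LeastI[of _ j1]) (use i1 in blast)
    have j0m: "j0 \<le> m" unfolding j0_def using i1 by (intro order_trans[OF Least_le[of _ j1]]) auto
    have jlt: "c i j = 0" if "j < j0" "i \<le> m" for i j using not_less_Least[OF that(1)[unfolded j0_def]] that(2) by blast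
    define i0 where "i0 = (LEAST i. c i j0 \<noteq> 0)"
    obtain i2 where i2: "i2 \<le> m" "c i2 j0 \<noteq> 0" using \<open>\<exists>i\<le>m. c i j0 \<noteq> 0\<close> by blast
    have i0: "c i0 j0 \<noteq> 0" unfolding i0_def by (rule LeastI[of "\<lambda>i. c i j0 \<noteq> 0", OF i2(2)])
    have i0m: "i0 \<le> m" unfolding i0_def using i2 by (intro order_trans[OF Least_le[of _ i2]]) auto
    have ilt: "c i j0 = 0" if "i < i0" for i using not_less_Least[OF that[unfolded i0_def]] by blast
    obtain h where h: "h \<in> lr x" "eventually (\<lambda>y. g y = u y ^ Suc i0 * h y) (nb x)"
      using all[of "Suc i0"] unfolding P_def by blast
    \<comment> \<open>The relation divided by g^j0 u^i0. Every further power of g contributes u^(i0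
      + 1), so a factor u remains; at x only the coefficient \<open>c i0 j0\<close>
      survives.\<close>
    define W where "W y = (\<Sum>i\<in>{i0..m}. c i j0 * u y ^ (i - i0)) +
      u y * h y * (\<Sum>j\<in>{j0<..m}. (\<Sum>i\<le>m. c i j * u y ^ i) * g y ^ (j - Suc j0))" for y
    have Wl: "W \<in> lr x" unfolding W_def by (intro lr_intros x ul g h)
    have "eventually (\<lambda>y. g y \<noteq> 0) gen" using lr_dichotomy[OF x g(1)] g(2) by blast
    with nbD(2)[OF c(2)] nbD(2)[OF h(2)] unif_nonzero[OF x u] have "eventually (\<lambda>y. W y = 0) gen"
    proof eventually_elim
      case (elim y)
      let ?p = "\<lambda>j. \<Sum>i\<le>m. c i j * u y ^ i"
      have "0 = (\<Sum>j\<le>m. ?p j * g y ^ j)" using elim(1) by (simp add: sum_distrib_right)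
      also have "\<dots> = (\<Sum>j\<in>{j0..m}. ?p j * g y ^ j)"
        by (intro sum.mono_neutral_right) (auto simp: jlt)
      also have "{j0..m} = insert j0 {j0<..m}" using j0m by auto
      also have "(\<Sum>j\<in>insert j0 {j0<..m}. ?p j * g y ^ j) = ?p j0 * g y ^ j0 + (\<Sum>j\<in>{j0<..m}. ?p j * g y ^ j)"
        by simp
      also have "(\<Sum>j\<in>{j0<..m}. ?p j * g y ^ j) = g y ^ j0 * (g y * (\<Sum>j\<in>{j0<..m}. ?p j * g y ^ (j - Suc j0)))"
        unfolding sum_distrib_left
      proof (intro sum.cong refl)
        fix j assume "j \<in> {j0<..m}"
        then have "j = j0 + Suc (j - Suc j0)" by auto
        then have "g y ^ j = g y ^ j0 * (g y * g y ^ (j - Suc j0))" by (metis power_add power_Suc)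
        then show "?p j * g y ^ j = g y ^ j0 * (g y * (?p j * g y ^ (j - Suc j0)))" by (simp add: mult_ac)
      qed
      finally have "g y ^ j0 * (?p j0 + g y * (\<Sum>j\<in>{j0<..m}. ?p j * g y ^ (j - Suc j0))) = 0"
        by (simp add: distrib_left mult.commute)
      then have "?p j0 + g y * (\<Sum>j\<in>{j0<..m}. ?p j * g y ^ (j - Suc j0)) = 0"
        using elim(4) by simp
      moreover have "?p j0 = u y ^ i0 * (\<Sum>i\<in>{i0..m}. c i j0 * u y ^ (i - i0))"
      proof -
        have "?p j0 = (\<Sum>i\<in>{i0..m}. c i j0 * u y ^ i)" by (intro sum.mono_neutral_right) (auto simp: ilt)
        also have "\<dots> = (\<Sum>i\<in>{i0..m}. u y ^ i0 * (c i j0 * u y ^ (i - i0)))"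
          by (intro sum.cong refl) (auto simp flip: power_add simp: mult.left_commute)
        finally show ?thesis by (simp add: sum_distrib_left)
      qed
      ultimately have "u y ^ i0 * W y = 0"
        unfolding W_def by (simp add: distrib_left elim(2) mult_ac)
      then show ?case using elim(3) by simp
    qed
    then have "W x = 0" using lr_eq[OF x Wl lr_const[OF x, of 0]] by simp
    moreover have "W x = c i0 j0"
    proof -
      have "(\<Sum>i\<in>{i0..m}. c i j0 * u x ^ (i - i0)) = (\<Sum>i\<in>{i0..m}. if i = i0 then c i0 j0 else 0)"
        using ul(2) by (intro sum.cong) auto
      then show ?thesis unfolding W_def using ul(2) i0m by simp
    qed
    ultimately show False using i0 by simp
  qed
  then have nk: "\<not> P (LEAST k. \<not> P k)" by (rule LeastI_ex)
  have "P 0" unfolding P_def using g(1) by (intro bexI[of _ g]) auto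
  then obtain k where k: "(LEAST k. \<not> P k) = Suc k" using nk by (cases "LEAST k. \<not> P k") auto
  have "P k" using not_less_Least[of k "\<lambda>k. \<not> P k"] k by simp
  then obtain e where e: "e \<in> lr x" "eventually (\<lambda>y. g y = u y ^ k * e y) (nb x)" unfolding P_def by blast
  have "e x \<noteq> 0"
  proof
    assume "e x = 0"
    then obtain h where h: "h \<in> lr x" "eventually (\<lambda>y. e y = u y * h y) (nb x)" using unif_divides[OF x u e(1)] by blast
    have "eventually (\<lambda>y. g y = u y ^ Suc k * h y) (nb x)" using e(2) h(2) by eventually_elim simp
    then have "P (Suc k)" unfolding P_def using h(1) by blast
    then show False using nk k by simp
  qed
  then show ?thesis using that e by blast
qed

text \<open>Characteristic 0: if f - f(x) = u^k e with e(x) nonzero and k > 0, then its derivative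
  is u^(k - 1) du times a function with value k e(x) at x.\<close>

lemma derivative_zero_const:
  assumes x: "x \<in> C" and f: "f \<in> lr x" and D: "eventually (\<lambda>y. dv y f = 0) gen"
  shows "eventually (\<lambda>y. f y = f x) (nb x)"
proof (rule ccontr)
  assume neg: "\<not> ?thesis"
  obtain u where u: "unif x u" using unif_exists[OF x] by blast
  have ul: "u \<in> lr x" "u x = 0" using u by (auto simp: unif_def)
  let ?g = "\<lambda>y. f y - f x"
  have gl: "?g \<in> lr x" by (intro lr_diff lr_const x f)
  obtain k e where e: "e \<in> lr x" "e x \<noteq> 0" "eventually (\<lambda>y. ?g y = u y ^ k * e y) (nb x)"
    by (rule unif_factor[OF x u gl]) (use neg in \<open>auto elim: eventually_mono\<close>)
  have k: "k > 0" using nbD(1)[OF e(3)] e(2) by (cases k) auto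
  obtain e1 where e1: "e1 \<in> lr x" "eventually (\<lambda>y. dv y e = e1 y * dv y u) (nb x)"
    using unif_derivative[OF x u e(1)] by blast
  let ?W = "\<lambda>y. of_nat k * e y + u y * e1 y"
  have "eventually (\<lambda>y. ?W y = 0) gen"
    using D nbD(2)[OF lr_near[OF x f]] nbD(2)[OF lr_near[OF x ul(1)]] nbD(2)[OF lr_near[OF x e(1)]]
      gen_nb[OF nbD(2)[OF e(3)]] nbD(2)[OF e1(2)] unif_nonzero[OF x u] nbD(2)[OF unif_unramified_near[OF x u]]
  proof eventually_elim
    case (elim y)
    have "0 = dv y ?g" using elim by (simp add: dv_diff dv_const lr_const)
    also have "\<dots> = dv y (\<lambda>y. u y ^ k * e y)"
      using elim by (intro dv_germ lr_diff lr_const) auto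
    also have "\<dots> = u y ^ k * dv y e + e y * (of_nat k * u y ^ (k - 1) * dv y u)"
      using elim by (simp add: dv_mult dv_power lr_power)
    also have "\<dots> = u y ^ (k - 1) * ?W y * dv y u"
      using k by (cases k) (auto simp: elim(6) algebra_simps)
    finally show ?case using elim(7,8) by simp
  qed
  then have "?W x = 0" using lr_eq[OF x _ lr_const[OF x, of 0], of ?W] by (simp add: lr_add lr_mult lr_const x e(1) ul(1) e1(1))
  then show False using ul(2) e(2) k by simp
qed

text \<open>Orders at a point are well defined: cancelling the smaller power of u leaves a unit
  equal to a multiple of u.\<close>

lemma unif_power_unique:
  assumes x: "x \<in> C" and u: "unif x u" and "\<alpha> \<in> lr x" "\<beta> \<in> lr x" "\<alpha> x \<noteq> 0" "\<beta> x \<noteq> 0"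
    and e: "eventually (\<lambda>y. u y ^ a * \<alpha> y = u y ^ b * \<beta> y) gen"
  shows "a = b"
proof -
  have aux: False if "\<alpha> \<in> lr x" "\<beta> \<in> lr x" "\<alpha> x \<noteq> 0" "a < b"
    "eventually (\<lambda>y. u y ^ a * \<alpha> y = u y ^ b * \<beta> y) gen" for \<alpha> \<beta> a b
  proof -
    have "eventually (\<lambda>y. \<alpha> y = u y ^ (b - a) * \<beta> y) gen"
      using that(5) unif_nonzero[OF x u]
    proof eventually_elim
      case (elim y)
      have "u y ^ b = u y ^ a * u y ^ (b - a)" using that(4) by (simp flip: power_add)
      then show ?case using elim by (simp add: mult.assoc)
    qed
    then have "\<alpha> x = u x ^ (b - a) * \<beta> x"
      using u that by (intro lr_eq[OF x]) (auto intro!: lr_mult lr_power x simp: unif_def)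
    then show False using u that(3,4) by (auto simp: unif_def zero_power)
  qed
  have e': "eventually (\<lambda>y. u y ^ b * \<beta> y = u y ^ a * \<alpha> y) gen" using e by eventually_elim simp
  show ?thesis using aux[of \<alpha> \<beta> a b] aux[of \<beta> \<alpha> b a] assms e' by (meson linorder_neqE_nat)
qed

section \<open>Global functions are constant\<close>

lemma eq_everywhere:
  assumes "\<And>x. x \<in> A \<Longrightarrow> x \<in> C \<and> f \<in> lr x" "eventually (\<lambda>y. f y = c) gen" "x \<in> A"
  shows "f x = c"
  using lr_eq[of x f "\<lambda>_. c"] assms lr_const by blast

text \<open>By the Nullstellensatz multiplication by \<open>f\<close> preserves the finite-dimensional space of
  forms of large degree, so \<open>f\<close> satisfies a polynomial equation over the complex numbers.\<close>

lemma global_regular_const: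
  assumes f: "\<And>x. x \<in> C \<Longrightarrow> f \<in> lr x"
  obtains c where "\<And>x. x \<in> C \<Longrightarrow> f x = c"
proof -
  \<comment> \<open>The forms p for which f p is again a form on C. At a point of C a denominator of
    f belongs to this ideal, off C a form vanishing on C, so it has no zeros.\<close>
  define I where "I m = {p \<in> hpoly n m. \<exists>q\<in>hpoly n m. \<forall>y\<in>C. f y * ev p y = ev q y}" for m
  have I: "gideal n I"
    unfolding gideal_def
  proof (intro allI conjI ballI)
    fix m
    show "I m \<subseteq> hpoly n m" by (auto simp: I_def)
    show "0 \<in> I m" unfolding I_def by (intro CollectI conjI bexI[of _ 0]) auto
    fix p assume "p \<in> I m"
    then obtain p' where p: "p \<in> hpoly n m" "p' \<in> hpoly n m" "\<forall>y\<in>C. f y * ev p y = ev p' y" unfolding I_def by blast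
    show "p + q \<in> I m" if "q \<in> I m" for q
    proof -
      from that obtain q' where q: "q \<in> hpoly n m" "q' \<in> hpoly n m" "\<forall>y\<in>C. f y * ev q y = ev q' y" unfolding I_def by blast
      show ?thesis unfolding I_def using p q by (intro CollectI conjI bexI[of _ "p' + q'"]) (auto simp: algebra_simps)
    qed
    show "q * p \<in> I (e + m)" if q: "q \<in> hpoly n e" for e q
      unfolding I_def using p hpoly_mult[OF q p(1)] hpoly_mult[OF q p(2)]
      by (intro CollectI conjI bexI[of _ "q * p'"]) (auto simp: algebra_simps)
  qed
  obtain d0 where d0: "\<And>d. d \<ge> d0 \<Longrightarrow> hpoly n d \<subseteq> I d"
  proof (rule gideal_no_zeros[OF I])
    fix v :: "nat \<Rightarrow> complex" assume v: "v \<noteq> 0" "\<And>i. i > n \<Longrightarrow> v i = 0"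
    have z: "ev p (hpoint v) = 0 \<longleftrightarrow> peval p v = 0" if "p \<in> hpoly n d" for p d
      using ev_hpoint_zero_iff[of v n p d] v that by blast
    show "\<exists>d. \<exists>p\<in>I d. peval p v \<noteq> 0"
    proof (cases "hpoint v \<in> C")
      case False
      obtain p d where p: "p \<in> hpoly n d" "ev p (hpoint v) \<noteq> 0" "\<And>z. z \<in> C \<Longrightarrow> ev p z = 0"
        using zclosed_separate[OF closedC hpoint_PS[OF v] False] by blast
      have "p \<in> I d" unfolding I_def using p by (intro CollectI conjI bexI[of _ 0]) auto
      then show ?thesis using z[OF p(1)] p(2) by blast
    next
      case True
      obtain d G H where GH: "G \<in> hpoly n d" "H \<in> hpoly n d" "ev H (hpoint v) \<noteq> 0"
        "eventually (\<lambda>y. ev H y \<noteq> 0 \<and> f y = ev G y / ev H y) (nb (hpoint v))" by (rule lr_obtain[OF True f[OF True]])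
      have gl: "eventually (\<lambda>y. f y * ev H y = ev G y) gen" using nbD(2)[OF GH(4)] by eventually_elim auto
      have "f y * ev H y = ev G y" if y: "y \<in> C" for y
      proof -
        obtain d' G' H' where 2: "G' \<in> hpoly n d'" "H' \<in> hpoly n d'" "ev H' y \<noteq> 0"
          "eventually (\<lambda>z. ev H' z \<noteq> 0 \<and> f z = ev G' z / ev H' z) (nb y)" by (rule lr_obtain[OF y f[OF y]])
        have "G' * H - H' * G \<in> hpoly n (d' + d)" using 2 GH by (intro hpoly_diff hpoly_mult)
        moreover have "eventually (\<lambda>z. ev (G' * H - H' * G) z = 0) gen"
          using gl nbD(2)[OF 2(4)] by eventually_elim (auto simp: field_simps)
        then have "\<not> eventually (\<lambda>z. ev (G' * H - H' * G) z \<noteq> 0) gen"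
          using gen_False eventually_elim2[of "\<lambda>z. ev (G' * H - H' * G) z = 0" gen "\<lambda>z. ev (G' * H - H' * G) z \<noteq> 0" "\<lambda>_. False"] by blast
        ultimately have "ev (G' * H - H' * G) y = 0" using form_dichotomy y by blast
        then show ?thesis using nbD(1)[OF 2(4)] by (auto simp: field_simps)
      qed
      then have "H \<in> I d" unfolding I_def using GH by blast
      then show ?thesis using z[OF GH(2)] GH(3) by blast
    qed
  qed blast
  obtain x where x: "x \<in> C" using infiniteC by fastforce
  obtain j where j: "j \<le> n" "rp x j \<noteq> 0" using rp_coord_nonzero[OF C_PS[OF x]] by blast
  define r where "r = pvar j ^ d0"
  have r: "r \<in> hpoly n d0" unfolding r_def using hpoly_power[OF hpoly_pvar[OF j(1)], of d0] by simp
  have fr: "\<exists>q\<in>hpoly n d0. \<forall>y\<in>C. f y ^ k * ev r y = ev q y" for k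
  proof (induction k)
    case (Suc k)
    then obtain q where q: "q \<in> hpoly n d0" "\<forall>y\<in>C. f y ^ k * ev r y = ev q y" by blast
    then have "q \<in> I d0" using d0 by blast
    then obtain q' where "q' \<in> hpoly n d0" "\<forall>y\<in>C. f y * ev q y = ev q' y" unfolding I_def by blast
    then show ?case using q(2) by (intro bexI[of _ q']) (auto simp: mult.assoc)
  qed (use r in auto)
  let ?S = "rs ` (\<lambda>m. Poly_Mapping.single m 1) ` mons n d0"
  \<comment> \<open>With exponents up to \<open>card ?S\<close> there is one function more than
    there are spanning monomials.\<close>
  let ?f = "\<lambda>k y. if y \<in> C then f y ^ k * ev r y else 0"
  have S: "finite ?S" using finite_mons by blast
  obtain c where c: "\<exists>k\<in>{..card ?S}. c k \<noteq> 0" "\<And>y. (\<Sum>k\<in>{..card ?S}. c k * ?f k y) = 0"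
  proof (rule family_dependent[of "{..card ?S}" ?S ?f])
    fix k
    obtain q where q: "q \<in> hpoly n d0" "\<forall>y\<in>C. f y ^ k * ev r y = ev q y" using fr by blast
    then have "?f k = rs q" by (auto simp: rs_def)
    then show "?f k \<in> cfun.span ?S" using rs_span[OF q(1)] by simp
  qed (use S in auto)
  define p where "p = (\<Sum>k\<le>card ?S. monom (c k) k)"
  have pp: "poly p z = (\<Sum>k\<le>card ?S. c k * z ^ k)" for z
    unfolding p_def by (simp add: poly_sum poly_monom)
  have "p \<noteq> 0"
  proof
    assume "p = 0"
    then have "(\<Sum>k\<le>card ?S. c k * z ^ k) = 0" for z using pp[of z] by simp
    then have "\<forall>k\<le>card ?S. c k = 0" using polyfun_eq_0 by blast
    then show False using c(1) by auto
  qed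
  have "ev r x \<noteq> 0" using j by (simp add: r_def)
  then have "eventually (\<lambda>y. ev r y \<noteq> 0) gen" by (rule nbD(2)[OF form_nonzero[OF r x]])
  with gen_C have root: "eventually (\<lambda>y. poly p (f y) = 0) gen"
  proof eventually_elim
    case (elim y)
    have "(\<Sum>k\<le>card ?S. c k * f y ^ k) * ev r y = 0"
      using c(2)[of y] elim(1) by (simp add: sum_distrib_right mult.assoc)
    then show ?case using elim(2) pp by simp
  qed
  let ?Y = "{y \<in> C. poly p (f y) = 0}"
  have "infinite ?Y"
  proof
    assume "finite ?Y"
    moreover have "C \<subseteq> ?Y \<union> {y \<in> C. poly p (f y) \<noteq> 0}" by blast
    ultimately show False using root infiniteC finite_subset unfolding eventually_gen by blast
  qed
  moreover have "f ` ?Y \<subseteq> {z. poly p z = 0}" by blast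
  then have "finite (f ` ?Y)" using poly_roots_finite[OF \<open>p \<noteq> 0\<close>] finite_subset by blast
  \<comment> \<open>Infinitely many points share one of the finitely many roots as their
    value.\<close>
  ultimately obtain y0 where "infinite {y \<in> ?Y. f y = f y0}" using pigeonhole_infinite by blast
  then have "infinite {y \<in> C. f y = f y0}"
    using finite_subset[of "{y \<in> ?Y. f y = f y0}" "{y \<in> C. f y = f y0}"] by blast
  then have "\<not> eventually (\<lambda>y. f y - f y0 \<noteq> 0) gen" by (simp add: eventually_gen)
  then have "eventually (\<lambda>y. f y - f y0 = 0) (nb x)"
    using lr_dichotomy[OF x lr_diff[OF x f[OF x] lr_const[OF x]]] by blast
  then have "eventually (\<lambda>y. f y = f y0) gen" by (auto simp: eventually_nb)
  then show ?thesis using that[of "f y0"] eq_everywhere[of C f] f by blast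
qed

end

context curve
begin

section \<open>Coverings of the affine line\<close>

text \<open>Pole orders of rational functions are finite: f = G/H near \<open>x0\<close> is a
  quotient of forms, and the order of H at \<open>x\<close> gives an exponent that clears the
  pole.\<close>

lemma lr_pole:
  assumes x0: "x0 \<in> C" and f: "f \<in> lr x0" and x: "x \<in> C" and u: "unif x u"
  obtains k \<eta> where "\<eta> \<in> lr x" "eventually (\<lambda>y. f y * u y ^ k = \<eta> y) gen"
proof -
  obtain d G H where GH: "G \<in> hpoly n d" "H \<in> hpoly n d" "ev H x0 \<noteq> 0"
    "eventually (\<lambda>y. ev H y \<noteq> 0 \<and> f y = ev G y / ev H y) (nb x0)" by (rule lr_obtain[OF x0 f])
  obtain j where j: "j \<le> n" "rp x j \<noteq> 0" using rp_coord_nonzero[OF C_PS[OF x]] by blast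
  define X where "X = pvar j ^ d"
  have X: "X \<in> hpoly n d" unfolding X_def using hpoly_power[OF hpoly_pvar[OF j(1)], of d] by simp
  have Xx: "ev X x \<noteq> 0" using j(2) by (simp add: X_def)
  have g: "(\<lambda>y. ev G y / ev X y) \<in> lr x" and h: "(\<lambda>y. ev H y / ev X y) \<in> lr x"
    by (intro lr_ratio[OF x _ X] GH Xx)+
  have Xn: "eventually (\<lambda>y. ev X y \<noteq> 0) gen" by (rule nbD(2)[OF form_nonzero[OF X x Xx]])
  have "\<not> eventually (\<lambda>y. ev H y / ev X y = 0) (nb x)"
  proof
    assume "eventually (\<lambda>y. ev H y / ev X y = 0) (nb x)"
    from nbD(2)[OF this] nbD(2)[OF GH(4)] Xn have "eventually (\<lambda>_. False) gen" by eventually_elim auto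
    then show False using gen_False by simp
  qed
  then obtain k e where e: "e \<in> lr x" "e x \<noteq> 0" "eventually (\<lambda>y. ev H y / ev X y = u y ^ k * e y) (nb x)"
    using unif_factor[OF x u h] by blast
  have "eventually (\<lambda>y. f y * u y ^ k = (ev G y / ev X y) / e y) gen"
    using nbD(2)[OF GH(4)] Xn nbD(2)[OF e(3)] nbD(2)[OF lr_nonzero[OF x e(1,2)]]
  proof eventually_elim
    case (elim y)
    then have uk: "u y ^ k = ev H y / ev X y / e y" by (simp add: field_simps)
    show ?case unfolding uk using elim(1,2,4) by simp
  qed
  then show ?thesis by (rule that[OF lr_divide[OF x g e(1,2)]])
qed

lemma lr_poly: "x \<in> C \<Longrightarrow> f \<in> lr x \<Longrightarrow> (\<lambda>y. poly p (f y)) \<in> lr x"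
  by (induction p) (auto intro: lr_const lr_add lr_mult)

lemma dv_poly: "x \<in> C \<Longrightarrow> f \<in> lr x \<Longrightarrow> dv x (\<lambda>y. poly p (f y)) = poly (pderiv p) (f x) * dv x f"
proof (induction p)
  case (pCons a p)
  have "dv x (\<lambda>y. a + f y * poly p (f y)) = f x * dv x (\<lambda>y. poly p (f y)) + poly p (f x) * dv x f"
    using pCons.prems lr_poly[of x f p] by (simp add: dv_add dv_const dv_mult lr_const lr_mult)
  then show ?case using pCons by (simp add: pderiv_pCons algebra_simps)
qed (simp add: dv_const)

lemma antiderivative: "\<exists>P :: complex poly. pderiv P = Q"
proof -
  define P where "P = (\<Sum>i\<le>degree Q. monom (coeff Q i / of_nat (Suc i)) (Suc i))"
  have "coeff P (Suc k) = (\<Sum>i\<le>degree Q. if i = k then coeff Q i / of_nat (Suc i) else 0)" for k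
    unfolding P_def coeff_sum coeff_monom by (intro sum.cong) auto
  then have "coeff (pderiv P) k = coeff Q k" for k
    by (simp add: coeff_pderiv coeff_eq_0 del: of_nat_Suc)
  then show ?thesis by (intro exI[of _ P] poly_eqI)
qed

text \<open>The setting abstracts a map to the projective line: A is the preimage of the affine
  line, t its coordinate, w = 1/t, and \<open>x0\<close> a point over infinity. By assumption the
  map is unramified on A.\<close>

context
  fixes A :: "pt set" and t w :: "pt \<Rightarrow> complex" and x0 :: pt
  assumes A: "A \<subseteq> C"
    and t: "\<And>x. x \<in> A \<Longrightarrow> t \<in> lr x" "\<And>x. x \<in> A \<Longrightarrow> dv x t \<noteq> 0"
    and w: "\<And>x. x \<in> C - A \<Longrightarrow> w \<in> lr x" "\<And>x. x \<in> C - A \<Longrightarrow> w x = 0"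
    and tw: "eventually (\<lambda>y. t y * w y = 1) gen"
    and x0: "x0 \<in> C - A"
begin

lemma A_gen: "eventually (\<lambda>y. y \<in> A) gen"
  using tw gen_C by eventually_elim (use w(2) in force)

lemma A_nb: "x \<in> A \<Longrightarrow> eventually (\<lambda>y. y \<in> A) (nb x)"
  using A_gen by (simp add: eventually_nb)

text \<open>The derivation d/dt. As a quotient of two derivatives it is independent of the choices
  in \<open>dv\<close>.\<close>

definition Dt :: "(pt \<Rightarrow> complex) \<Rightarrow> pt \<Rightarrow> complex" where
  "Dt f y = (if y \<in> A then dv y f / dv y t else 0)"

lemma Dt_lr:
  assumes f: "\<And>x. x \<in> A \<Longrightarrow> f \<in> lr x" and x: "x \<in> A" shows "Dt f \<in> lr x"
proof -
  have xC: "x \<in> C" using x A by blast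
  have u: "unif x (\<lambda>y. t y - t x)" by (rule unif_shift[OF xC t[OF x]])
  obtain g where g: "g \<in> lr x" "eventually (\<lambda>y. dv y f = g y * dv y (\<lambda>z. t z - t x)) (nb x)"
    using unif_derivative[OF xC u f[OF x]] by blast
  have "eventually (\<lambda>y. g y = Dt f y) (nb x)" using g(2) A_nb[OF x]
  proof eventually_elim
    case (elim y)
    then have "y \<in> C" using A by blast
    then have "dv y (\<lambda>z. t z - t x) = dv y t" using t(1)[OF elim(2)] by (simp add: dv_diff dv_const lr_const)
    then show ?case using elim t(2)[OF elim(2)] by (simp add: Dt_def)
  qed
  then show ?thesis by (rule lr_cong[OF xC g(1)])
qed

lemma Dt_iter_lr: "(\<And>x. x \<in> A \<Longrightarrow> f \<in> lr x) \<Longrightarrow> x \<in> A \<Longrightarrow> (Dt ^^ m) f \<in> lr x"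
  by (induction m arbitrary: x) (auto intro: Dt_lr)

text \<open>At a point over infinity with ramification index \<open>e\<close> the derivation \<open>d/dt\<close> raises orders
  by \<open>e\<close>. Here \<open>f\<close> has order at least \<open>j - K\<close>.\<close>

lemma Dt_order:
  assumes f: "\<And>x. x \<in> A \<Longrightarrow> f \<in> lr x" and x: "x \<in> C - A" and u: "unif x u"
    and \<epsilon>: "\<epsilon> \<in> lr x" "\<epsilon> x \<noteq> 0" "eventually (\<lambda>y. w y = u y ^ e * \<epsilon> y) (nb x)"
    and \<eta>: "\<eta> \<in> lr x" "eventually (\<lambda>y. f y * u y ^ K = u y ^ j * \<eta> y) gen"
  shows "\<exists>\<theta>\<in>lr x. eventually (\<lambda>y. Dt f y * u y ^ K = u y ^ (j + e) * \<theta> y) gen"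
proof -
  have xC: "x \<in> C" using x by blast
  have ul: "u \<in> lr x" "u x = 0" using u by (auto simp: unif_def)
  have e: "e > 0" using nbD(1)[OF \<epsilon>(3)] w(2)[OF x] \<epsilon>(2) by (cases e) auto
  obtain \<eta>1 where \<eta>1: "\<eta>1 \<in> lr x" "eventually (\<lambda>y. dv y \<eta> = \<eta>1 y * dv y u) (nb x)"
    using unif_derivative[OF xC u \<eta>(1)] by blast
  obtain \<epsilon>1 where \<epsilon>1: "\<epsilon>1 \<in> lr x" "eventually (\<lambda>y. dv y \<epsilon> = \<epsilon>1 y * dv y u) (nb x)"
    using unif_derivative[OF xC u \<epsilon>(1)] by blast
  \<comment> \<open>Differentiating f u^K = u^j \<eta> and multiplying by u gives u u^K df = u^j a
    du; likewise u dw = u^e b du. With dt = -dw/w^2 this yields the formula for \<theta>.\<close>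
  define a where "a y = of_nat j * \<eta> y + u y * \<eta>1 y - of_nat K * \<eta> y" for y
  define b where "b y = of_nat e * \<epsilon> y + u y * \<epsilon>1 y" for y
  have al: "a \<in> lr x" and bl: "b \<in> lr x"
    unfolding a_def b_def by (intro lr_intros xC ul \<eta> \<epsilon> \<eta>1 \<epsilon>1)+
  have bx: "b x \<noteq> 0" using e \<epsilon>(2) ul(2) by (simp add: b_def)
  define \<theta> where "\<theta> y = - (a y * \<epsilon> y ^ 2 / b y)" for y
  have "\<theta> \<in> lr x" unfolding \<theta>_def by (intro lr_uminus lr_divide lr_mult lr_power xC al bl bx \<epsilon>)
  moreover have "eventually (\<lambda>y. Dt f y * u y ^ K = u y ^ (j + e) * \<theta> y) gen"
    using A_gen gen_nb[OF \<eta>(2)] gen_nb[OF nbD(2)[OF \<epsilon>(3)]] nbD(2)[OF lr_near[OF xC ul(1)]]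
      nbD(2)[OF lr_near[OF xC \<eta>(1)]] nbD(2)[OF lr_near[OF xC \<epsilon>(1)]] nbD(2)[OF \<eta>1(2)] nbD(2)[OF \<epsilon>1(2)]
      unif_nonzero[OF xC u] nbD(2)[OF unif_unramified_near[OF xC u]] nbD(2)[OF lr_nonzero[OF xC bl bx]]
      nbD(2)[OF lr_nonzero[OF xC \<epsilon>(1,2)]] gen_nb[OF tw]
  proof eventually_elim
    case (elim y)
    have yC: "y \<in> C" using elim(1) A by blast
    have fy: "f \<in> lr y" and ty: "t \<in> lr y" using f t(1) elim(1) by auto
    have uy: "u \<in> lr y" "\<eta> \<in> lr y" "\<epsilon> \<in> lr y" using elim by auto
    let ?du = "dv y u"
    \<comment> \<open>Multiplying derivatives of powers by u removes the truncated exponent k - 1,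
      so k = 0 needs no separate treatment.\<close>
    have pw: "u y * (of_nat k * u y ^ (k - 1)) = of_nat k * u y ^ k" for k by (cases k) auto
    have ge: "f y * u y ^ K = u y ^ j * \<eta> y" "w y = u y ^ e * \<epsilon> y" "t y * w y = 1"
      using nbD(1)[OF elim(2)] nbD(1)[OF elim(3)] nbD(1)[OF elim(13)] by auto
    have "dv y (\<lambda>y. f y * u y ^ K) = dv y (\<lambda>y. u y ^ j * \<eta> y)"
      by (intro dv_germ yC lr_mult lr_power fy uy elim(2))
    then have "f y * (of_nat K * u y ^ (K - 1) * ?du) + u y ^ K * dv y f =
        u y ^ j * (\<eta>1 y * ?du) + \<eta> y * (of_nat j * u y ^ (j - 1) * ?du)"
      using yC fy uy elim(7) by (simp add: dv_mult dv_power lr_power)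
    then have "u y * (f y * (of_nat K * u y ^ (K - 1) * ?du) + u y ^ K * dv y f) =
        u y * (u y ^ j * (\<eta>1 y * ?du) + \<eta> y * (of_nat j * u y ^ (j - 1) * ?du))" by simp
    then have "u y * u y ^ K * dv y f = u y ^ j * (u y * \<eta>1 y) * ?du
        + \<eta> y * (u y * (of_nat j * u y ^ (j - 1))) * ?du - f y * (u y * (of_nat K * u y ^ (K - 1))) * ?du"
      by (simp add: algebra_simps)
    then have 1: "u y * u y ^ K * dv y f = u y ^ j * a y * ?du"
      unfolding pw a_def using ge(1) by (simp add: algebra_simps)
    have wl: "(\<lambda>y. u y ^ e * \<epsilon> y) \<in> lr y" by (intro lr_mult lr_power yC uy)
    have "dv y (\<lambda>y. t y * (u y ^ e * \<epsilon> y)) = dv y (\<lambda>_. 1)"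
    proof (intro dv_germ yC lr_mult[OF yC ty wl])
      show "eventually (\<lambda>y. t y * (u y ^ e * \<epsilon> y) = 1) (nb y)"
        using elim(3) elim(13) by eventually_elim simp
    qed
    then have "t y * dv y (\<lambda>y. u y ^ e * \<epsilon> y) + w y * dv y t = 0"
      using dv_mult[OF yC ty wl] dv_const[OF yC] ge(2) by simp
    moreover have "dv y (\<lambda>y. u y ^ e * \<epsilon> y) = u y ^ e * (\<epsilon>1 y * ?du) + \<epsilon> y * (of_nat e * u y ^ (e - 1) * ?du)"
      using yC uy elim(8) by (simp add: dv_mult dv_power lr_power)
    moreover have "u y * (u y ^ e * (\<epsilon>1 y * ?du) + \<epsilon> y * (of_nat e * u y ^ (e - 1) * ?du)) = u y ^ e * b y * ?du"
    proof -
      have "u y * (u y ^ e * (\<epsilon>1 y * ?du) + \<epsilon> y * (of_nat e * u y ^ (e - 1) * ?du)) =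
        u y ^ e * (u y * \<epsilon>1 y) * ?du + \<epsilon> y * (u y * (of_nat e * u y ^ (e - 1))) * ?du" by (simp add: algebra_simps)
      then show ?thesis unfolding pw b_def by (simp add: algebra_simps)
    qed
    ultimately obtain S where S: "t y * S + w y * dv y t = 0" "u y * S = u y ^ e * b y * ?du" by simp
    have "w y * dv y t = - (t y * S)" using S(1) by (simp add: eq_neg_iff_add_eq_0 add.commute)
    then have "u y * (w y * dv y t) = - t y * (u y * S)" by simp
    then have "u y * (w y * dv y t) = - t y * (u y ^ e * b y * ?du)" unfolding S(2) .
    then have "w y * (u y * (w y * dv y t)) = w y * (- t y * (u y ^ e * b y * ?du))" by simp
    also have "\<dots> = - (t y * w y) * (u y ^ e * b y * ?du)" by simp
    finally have 2: "u y * (w y * w y) * dv y t = - (u y ^ e * b y * ?du)" using ge(3) by (simp add: mult_ac)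
    have nz: "u y \<noteq> 0" "?du \<noteq> 0" "b y \<noteq> 0" "\<epsilon> y \<noteq> 0" "dv y t \<noteq> 0" using elim t(2) by auto
    have "u y ^ e * (u y * \<epsilon> y ^ 2 * dv y t) * u y ^ e = u y ^ e * - (b y * ?du)"
      using 2 unfolding ge(2) by (simp add: power2_eq_square algebra_simps)
    then have 2: "u y * \<epsilon> y ^ 2 * dv y t * u y ^ e = - (b y * ?du)"
      using nz(1) by (metis (no_types, lifting) mult.assoc mult_left_cancel power_not_zero)
    have "(dv y f * u y ^ K * b y) * ?du * u y = u y ^ j * a y * (b y * ?du) * ?du"
      using 1 by (simp add: algebra_simps)
    also have "\<dots> = - (u y ^ j * a y * (u y * \<epsilon> y ^ 2 * dv y t * u y ^ e)) * ?du" unfolding 2 by simp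
    finally have "(dv y f * u y ^ K * b y) * (?du * u y) = (- (a y * \<epsilon> y ^ 2) * u y ^ (j + e) * dv y t) * (?du * u y)"
      by (simp add: power_add algebra_simps)
    then have "dv y f * u y ^ K * b y = - (a y * \<epsilon> y ^ 2) * u y ^ (j + e) * dv y t"
      by (rule mult_right_cancel[THEN iffD1, rotated]) (use nz in simp)
    then show ?case using elim(1) nz by (simp add: Dt_def \<theta>_def field_simps)
  qed
  ultimately show ?thesis by blast
qed

lemma w_factor:
  assumes x: "x \<in> C - A" and u: "unif x u"
  obtains e \<epsilon> where "e > 0" "\<epsilon> \<in> lr x" "\<epsilon> x \<noteq> 0" "eventually (\<lambda>y. w y = u y ^ e * \<epsilon> y) (nb x)"
proof -
  have xC: "x \<in> C" using x by blast
  have "\<not> eventually (\<lambda>y. w y = 0) (nb x)"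
  proof
    assume "eventually (\<lambda>y. w y = 0) (nb x)"
    from nbD(2)[OF this] tw have "eventually (\<lambda>_. False) gen" by eventually_elim auto
    then show False using gen_False by simp
  qed
  then obtain e \<epsilon> where e: "\<epsilon> \<in> lr x" "\<epsilon> x \<noteq> 0" "eventually (\<lambda>y. w y = u y ^ e * \<epsilon> y) (nb x)"
    using unif_factor[OF xC u w(1)[OF x]] by blast
  have "e > 0" using nbD(1)[OF e(3)] w(2)[OF x] e(2) by (cases e) auto
  then show ?thesis using that e by blast
qed

text \<open>Only finitely many points lie over infinity. Once m exceeds all pole orders, the m-th
  derivative extends by zero to a regular function on all of C; it is constant, and zero at
  \<open>x0\<close>.\<close>

lemma Dt_nilpotent:
  assumes f: "\<And>x. x \<in> A \<Longrightarrow> f \<in> lr x"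
  obtains m where "\<And>y. y \<in> A \<Longrightarrow> (Dt ^^ m) f y = 0"
proof -
  have fin: "finite (C - A)" using A_gen by (simp add: eventually_gen set_diff_eq)
  obtain x1 where x1: "x1 \<in> A" using gen_witness[OF A_gen] by blast
  then have x1C: "x1 \<in> C" using A by blast
  have "\<exists>K u. unif x u \<and> (\<forall>m. \<exists>\<theta>\<in>lr x. eventually (\<lambda>y. (Dt ^^ m) f y * u y ^ K = u y ^ m * \<theta> y) gen)"
    if x: "x \<in> C - A" for x
  proof -
    have xC: "x \<in> C" using x by blast
    obtain u where u: "unif x u" using unif_exists[OF xC] by blast
    have ul: "u \<in> lr x" using u by (simp add: unif_def)
    obtain e \<epsilon> where e: "e > 0" "\<epsilon> \<in> lr x" "\<epsilon> x \<noteq> 0" "eventually (\<lambda>y. w y = u y ^ e * \<epsilon> y) (nb x)"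
      using w_factor[OF x u] by blast
    obtain K \<eta> where K: "\<eta> \<in> lr x" "eventually (\<lambda>y. f y * u y ^ K = \<eta> y) gen"
      using lr_pole[OF x1C f[OF x1] xC u] by blast
    have "\<exists>\<theta>\<in>lr x. eventually (\<lambda>y. (Dt ^^ m) f y * u y ^ K = u y ^ m * \<theta> y) gen" for m
    proof (induction m)
      case 0
      then show ?case using K by auto
    next
      case (Suc m)
      then obtain \<theta> where \<theta>: "\<theta> \<in> lr x" "eventually (\<lambda>y. (Dt ^^ m) f y * u y ^ K = u y ^ m * \<theta> y) gen" by blast
      obtain \<theta>' where \<theta>': "\<theta>' \<in> lr x" "eventually (\<lambda>y. Dt ((Dt ^^ m) f) y * u y ^ K = u y ^ (m + e) * \<theta>' y) gen"
        using Dt_order[OF Dt_iter_lr[OF f] x u e(2-4) \<theta>] by blast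
      have me: "m + e = Suc m + (e - 1)" using e(1) by simp
      have "eventually (\<lambda>y. (Dt ^^ Suc m) f y * u y ^ K = u y ^ Suc m * (u y ^ (e - 1) * \<theta>' y)) gen"
        using \<theta>'(2) unfolding me power_add by (simp add: mult.assoc)
      moreover have "(\<lambda>y. u y ^ (e - 1) * \<theta>' y) \<in> lr x" by (intro lr_mult lr_power xC ul \<theta>')
      ultimately show ?case by (intro bexI[of _ "\<lambda>y. u y ^ (e - 1) * \<theta>' y"])
    qed
    then show ?thesis using u by (intro exI[of _ K] exI[of _ u]) simp
  qed
  then have "\<forall>x\<in>C - A. \<exists>K u. unif x u \<and>
    (\<forall>m. \<exists>\<theta>\<in>lr x. eventually (\<lambda>y. (Dt ^^ m) f y * u y ^ K = u y ^ m * \<theta> y) gen)" by (intro ballI)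
  from bchoice[OF this] obtain K where "\<forall>x\<in>C - A. \<exists>u. unif x u \<and>
    (\<forall>m. \<exists>\<theta>\<in>lr x. eventually (\<lambda>y. (Dt ^^ m) f y * u y ^ K x = u y ^ m * \<theta> y) gen)" ..
  from bchoice[OF this] obtain u where u: "\<forall>x\<in>C - A. unif x (u x) \<and>
    (\<forall>m. \<exists>\<theta>\<in>lr x. eventually (\<lambda>y. (Dt ^^ m) f y * u x y ^ K x = u x y ^ m * \<theta> y) gen)" ..
  have Ku: "unif x (u x)"
    "\<exists>\<theta>\<in>lr x. eventually (\<lambda>y. (Dt ^^ m) f y * u x y ^ K x = u x y ^ m * \<theta> y) gen" if "x \<in> C - A" for x m
    using bspec[OF u that] by auto
  \<comment> \<open>Strictly larger than each \<open>K x\<close>, so that the extension not only is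
    regular at x but vanishes there.\<close>
  define m where "m = Suc (\<Sum>x\<in>C - A. K x)"
  define F where "F y = (if y \<in> A then (Dt ^^ m) f y else 0)" for y
  have "F \<in> lr x" if xC: "x \<in> C" for x
  proof (cases "x \<in> A")
    case True
    have "eventually (\<lambda>y. (Dt ^^ m) f y = F y) (nb x)" using A_nb[OF True] by eventually_elim (simp add: F_def)
    moreover have "(Dt ^^ m) f \<in> lr x" by (rule Dt_iter_lr[OF _ True]) (rule f)
    ultimately show ?thesis using lr_cong[OF xC] by blast
  next
    case False
    then have x: "x \<in> C - A" using xC by blast
    have ul: "u x \<in> lr x" "u x x = 0" using Ku(1)[OF x] by (auto simp: unif_def)
    obtain \<theta> where \<theta>: "\<theta> \<in> lr x" "eventually (\<lambda>y. (Dt ^^ m) f y * u x y ^ K x = u x y ^ m * \<theta> y) gen"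
      using Ku(2)[OF x] by blast
    have Km: "K x < m" unfolding m_def using x fin by (intro le_imp_less_Suc member_le_sum) auto
    have "eventually (\<lambda>y. u x y ^ (m - K x) * \<theta> y = F y) gen"
      using \<theta>(2) A_gen unif_nonzero[OF xC Ku(1)[OF x]]
    proof eventually_elim
      case (elim y)
      have "u x y ^ m = u x y ^ (m - K x) * u x y ^ K x" using Km by (simp flip: power_add)
      then have "(Dt ^^ m) f y * u x y ^ K x = (u x y ^ (m - K x) * \<theta> y) * u x y ^ K x" using elim(1) by simp
      then show ?case using elim(2,3) by (simp add: F_def)
    qed
    then have "eventually (\<lambda>y. u x y ^ (m - K x) * \<theta> y = F y) (nb x)"
      using False ul(2) Km by (simp add: eventually_nb F_def)
    then show ?thesis by (rule lr_cong[OF xC, rotated]) (intro lr_mult lr_power xC ul \<theta>)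
  qed
  then obtain c where c: "\<And>x. x \<in> C \<Longrightarrow> F x = c" using global_regular_const by blast
  have "c = 0" using c[of x0] x0 by (simp add: F_def)
  then have "(Dt ^^ m) f y = 0" if "y \<in> A" for y using c[of y] that A by (auto simp: F_def)
  then show ?thesis by (rule that)
qed

text \<open>Induction on the order of nilpotence: integrating the polynomial that represents
  \<open>Dt f\<close> gives P with f - P(t) of derivative zero, hence constant on A.\<close>

lemma polynomial_in_t:
  assumes "\<And>x. x \<in> A \<Longrightarrow> f \<in> lr x"
  shows "\<exists>Q. \<forall>y\<in>A. f y = poly Q (t y)"
proof -
  have "\<exists>Q. \<forall>y\<in>A. f y = poly Q (t y)"
    if "\<And>x. x \<in> A \<Longrightarrow> f \<in> lr x" "\<And>y. y \<in> A \<Longrightarrow> (Dt ^^ m) f y = 0" for m f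
    using that
  proof (induction m arbitrary: f)
    case 0
    then show ?case by (intro exI[of _ 0]) auto
  next
    case (Suc m)
    have "\<exists>Q. \<forall>y\<in>A. Dt f y = poly Q (t y)"
      by (rule Suc.IH[OF Dt_lr[OF Suc.prems(1)]]) (use Suc.prems(2) in \<open>auto simp: funpow_Suc_right simp del: funpow.simps\<close>)
    then obtain Q where Q: "\<And>y. y \<in> A \<Longrightarrow> Dt f y = poly Q (t y)" by blast
    obtain P where P: "pderiv P = Q" using antiderivative by blast
    let ?g = "\<lambda>y. f y - poly P (t y)"
    have gl: "?g \<in> lr x" if "x \<in> A" for x
      using that A by (intro lr_diff lr_poly Suc.prems(1) t(1)) auto
    have "eventually (\<lambda>y. dv y ?g = 0) gen" using A_gen
    proof eventually_elim
      case (elim y)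
      have yC: "y \<in> C" using elim A by blast
      have "dv y f = poly Q (t y) * dv y t" using Q[OF elim] t(2)[OF elim] elim by (simp add: Dt_def field_simps)
      then show ?case
        using dv_diff[OF yC Suc.prems(1)[OF elim] lr_poly[OF yC t(1)[OF elim]], of P] dv_poly[OF yC t(1)[OF elim], of P] P by simp
    qed
    note D = this
    obtain x1 where x1: "x1 \<in> A" using gen_witness[OF A_gen] by blast
    have "eventually (\<lambda>y. ?g y = ?g x1) (nb x1)"
      by (rule derivative_zero_const[OF _ gl[OF x1] D]) (use x1 A in blast)
    then have "eventually (\<lambda>y. ?g y = ?g x1) gen" by (rule nbD(2))
    then have "?g y = ?g x1" if "y \<in> A" for y using eq_everywhere[of A ?g "?g x1" y] gl A that by blast
    then have "f y = poly (P + [:?g x1:]) (t y)" if "y \<in> A" for y using that by (simp add: algebra_simps)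
    then show ?case by blast
  qed
  then show ?thesis using Dt_nilpotent[of f] assms by metis
qed

text \<open>A uniformizer at \<open>x0\<close>, multiplied by a polynomial in \<open>t\<close> to cancel its poles in \<open>A\<close>, is a
  polynomial in \<open>t\<close>; so its order at \<open>x0\<close> is a multiple of the order of \<open>w\<close>.\<close>

lemma unramified_at_infinity: "dv x0 w \<noteq> 0"
proof
  assume dw: "dv x0 w = 0"
  have x0C: "x0 \<in> C" using x0 by blast
  obtain u where u: "unif x0 u" using unif_exists[OF x0C] by blast
  have ul: "u \<in> lr x0" "u x0 = 0" "dv x0 u \<noteq> 0" using u by (auto simp: unif_def)
  obtain e \<epsilon> where e: "e > 0" "\<epsilon> \<in> lr x0" "\<epsilon> x0 \<noteq> 0" "eventually (\<lambda>y. w y = u y ^ e * \<epsilon> y) (nb x0)"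
    using w_factor[OF x0 u] by blast
  have e2: "e \<noteq> 1"
  proof
    assume "e = 1"
    then have "dv x0 w = dv x0 (\<lambda>y. u y * \<epsilon> y)" using e(4) by (intro dv_germ x0C w(1) x0) simp
    then show False using dw ul e(2,3) by (simp add: dv_mult x0C)
  qed
  define E where "E = {y \<in> A. u \<notin> lr y}"
  have "finite {y \<in> C. \<not> (y \<in> C \<and> u \<in> lr y)}"
    using nbD(2)[OF lr_near[OF x0C ul(1)]] unfolding eventually_gen .
  then have finE: "finite E" by (rule finite_subset[rotated]) (use A in \<open>auto simp: E_def\<close>)
  have EA: "E \<subseteq> A" by (auto simp: E_def)
  have "\<forall>z\<in>E. \<exists>k \<eta>. \<eta> \<in> lr z \<and> eventually (\<lambda>y. u y * (t y - t z) ^ k = \<eta> y) gen"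
  proof
    fix z assume "z \<in> E"
    then have z: "z \<in> A" "z \<in> C" using EA A by auto
    obtain \<eta> k where "\<eta> \<in> lr z" "eventually (\<lambda>y. u y * (t y - t z) ^ k = \<eta> y) gen"
      by (rule lr_pole[OF x0C ul(1) z(2) unif_shift[OF z(2) t[OF z(1)]]])
    then show "\<exists>k \<eta>. \<eta> \<in> lr z \<and> eventually (\<lambda>y. u y * (t y - t z) ^ k = \<eta> y) gen"
      by (intro exI[of _ k] exI[of _ \<eta>]) simp
  qed
  from bchoice[OF this] obtain k where "\<forall>z\<in>E. \<exists>\<eta>. \<eta> \<in> lr z \<and> eventually (\<lambda>y. u y * (t y - t z) ^ k z = \<eta> y) gen" ..
  from bchoice[OF this] obtain \<eta> where \<eta>:
    "\<forall>z\<in>E. \<eta> z \<in> lr z \<and> eventually (\<lambda>y. u y * (t y - t z) ^ k z = \<eta> z y) gen" ..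
  have k: "\<eta> z \<in> lr z" "eventually (\<lambda>y. u y * (t y - t z) ^ k z = \<eta> z y) gen" if "z \<in> E" for z
    using bspec[OF \<eta> that] by auto
  define P where "P = (\<Prod>z\<in>E. [:- t z, 1:] ^ k z)"
  have Pe: "poly P s = (\<Prod>z\<in>E. (s - t z) ^ k z)" for s by (simp add: P_def poly_prod poly_power)
  have "P \<noteq> 0" using finE by (simp add: P_def prod_zero_iff)
  \<comment> \<open>The regular extension of u P(t) at the pole z: one factor absorbs the pole of u,
    the others remain. F is corrected at these points because the values of u there are
    arbitrary.\<close>
  define R where "R z y = \<eta> z y * (\<Prod>v\<in>E - {z}. (t y - t v) ^ k v)" for z y
  define F where "F y = (if y \<in> E then R y y else u y * poly P (t y))" for y
  have Fgen: "eventually (\<lambda>y. F y = u y * poly P (t y)) gen"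
    unfolding eventually_gen by (rule finite_subset[OF _ finE]) (auto simp: F_def)
  have "F \<in> lr x" if x: "x \<in> A" for x
  proof (cases "x \<in> E")
    case True
    have xC: "x \<in> C" using x A by blast
    have "R x \<in> lr x" unfolding R_def by (intro lr_mult lr_prod lr_power lr_diff lr_const xC k True t(1) x)
    moreover have "eventually (\<lambda>y. R x y = F y) gen" using Fgen k(2)[OF True]
      by eventually_elim (simp add: R_def Pe prod.remove[OF finE True] mult.assoc[symmetric])
    then have "eventually (\<lambda>y. R x y = F y) (nb x)" using True by (simp add: eventually_nb F_def)
    ultimately show ?thesis by (rule lr_cong[OF xC])
  next
    case False
    have xC: "x \<in> C" using x A by blast
    have "u \<in> lr x" using False x by (simp add: E_def)
    then have "(\<lambda>y. u y * poly P (t y)) \<in> lr x" by (intro lr_mult lr_poly xC t(1) x)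
    moreover have "eventually (\<lambda>y. F y = u y * poly P (t y)) (nb x)" using Fgen False by (simp add: eventually_nb F_def)
    then have "eventually (\<lambda>y. u y * poly P (t y) = F y) (nb x)" by eventually_elim simp
    ultimately show ?thesis by (rule lr_cong[OF xC])
  qed
  then obtain Q where Q: "\<forall>y\<in>A. F y = poly Q (t y)" using polynomial_in_t by blast
  have uPQ: "eventually (\<lambda>y. u y * poly P (t y) = poly Q (t y)) gen"
    using Fgen A_gen by eventually_elim (use Q in auto)
  have rf: "poly (reflect_poly p) (w y) = w y ^ degree p * poly p (t y)" if "t y * w y = 1" for p y
  proof -
    have "w y \<noteq> 0" using that by auto
    moreover have "inverse (w y) = t y" using that by (intro inverse_unique) (simp add: mult.commute)
    ultimately
    show ?thesis using poly_reflect_poly_nz[of "w y" p] by simp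
  qed
  have wg: "eventually (\<lambda>y. w y = u y ^ e * \<epsilon> y) gen" by (rule nbD(2)[OF e(4)])
  have "Q \<noteq> 0"
  proof
    assume "Q = 0"
    have Ef: "finite (\<Union>z\<in>E. {y \<in> C. \<not> t y - t z \<noteq> 0})"
    proof (intro finite_UN_I finE)
      fix z assume "z \<in> E"
      then have z: "z \<in> C" "z \<in> A" using EA A by auto
      show "finite {y \<in> C. \<not> t y - t z \<noteq> 0}"
        using unif_nonzero[OF z(1) unif_shift[OF z(1) t[OF z(2)]]] by (simp add: eventually_gen)
    qed
    have "eventually (\<lambda>y. \<forall>z\<in>E. t y - t z \<noteq> 0) gen"
      unfolding eventually_gen by (rule finite_subset[OF _ Ef]) auto
    with uPQ unif_nonzero[OF x0C u] have "eventually (\<lambda>_. False) gen"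
      by eventually_elim (auto simp: \<open>Q = 0\<close> Pe finE prod_zero_iff)
    then show False using gen_False by simp
  qed
  \<comment> \<open>Near infinity this is w^(degree p) p(t). Its value at \<open>x0\<close> is the
    leading coefficient, so p(t) has a pole of order e times the degree of p.\<close>
  define \<alpha> where "\<alpha> p y = poly (reflect_poly p) (w y)" for p y
  have \<alpha>l: "\<alpha> p \<in> lr x0" for p unfolding \<alpha>_def by (intro lr_poly x0C w(1) x0)
  have \<alpha>0: "\<alpha> p x0 \<noteq> 0" if "p \<noteq> 0" for p
    unfolding \<alpha>_def w(2)[OF x0] poly_0_coeff_0 using that by simp
  have "eventually (\<lambda>y. u y ^ (1 + e * degree Q) * (\<alpha> P y * \<epsilon> y ^ degree Q) =
      u y ^ (e * degree P) * (\<alpha> Q y * \<epsilon> y ^ degree P)) gen"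
    using uPQ tw wg
  proof eventually_elim
    case (elim y)
    have "u y * \<alpha> P y * w y ^ degree Q = \<alpha> Q y * w y ^ degree P"
      using elim(1) unfolding \<alpha>_def rf[OF elim(2)] by (simp add: mult_ac)
    then show ?case unfolding elim(3) by (simp add: power_mult_distrib power_mult mult_ac)
  qed
  \<comment> \<open>Comparing orders at \<open>x0\<close> in u P(t) = Q(t); the summand 1 is the
    order of u.\<close>
  then have "1 + e * degree Q = e * degree P"
    by (rule unif_power_unique[OF x0C u, rotated 4])
      (use \<alpha>0 \<open>P \<noteq> 0\<close> \<open>Q \<noteq> 0\<close> e(3) in \<open>auto intro!: lr_mult lr_power x0C \<alpha>l e(2)\<close>)
  then have "e dvd 1" by (metis dvd_add_left_iff dvd_triv_left)
  then show False using e2 by simp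
qed

end

end

section \<open>Sections and their singularities\<close>

definition linform :: "nat \<Rightarrow> (nat \<Rightarrow> complex) \<Rightarrow> cpoly" where
  "linform N a = (\<Sum>k\<le>N. pconst (a k) * pvar k)"

lemma linform_hpoly: "linform N a \<in> hpoly N 1"
  unfolding linform_def by (intro hpoly_sum hpoly_cmult hpoly_pvar) auto

lemma peval_linform [simp]: "peval (linform N a) v = (\<Sum>k\<le>N. a k * v k)"
  by (simp add: linform_def)

lemma peval_line: "\<exists>P. \<forall>s. poly P s = peval p (\<lambda>k. a k + s * c k)"
proof (induction p rule: cpoly_induct)
  case (const x)
  show ?case by (rule exI[of _ "[:x:]"]) simp
next
  case (var i)
  show ?case by (rule exI[of _ "[:a i, c i:]"]) simp
next
  case (add p q)
  then obtain P Q where "\<forall>s. poly P s = peval p (\<lambda>k. a k + s * c k)" "\<forall>s. poly Q s = peval q (\<lambda>k. a k + s * c k)"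
    by blast
  then show ?case by (intro exI[of _ "P + Q"]) simp
next
  case (mult p q)
  then obtain P Q where "\<forall>s. poly P s = peval p (\<lambda>k. a k + s * c k)" "\<forall>s. poly Q s = peval q (\<lambda>k. a k + s * c k)"
    by blast
  then show ?case by (intro exI[of _ "P * Q"]) simp
qed

lemma (in curve) lr_peval:
  "x \<in> C \<Longrightarrow> (\<And>k. v k \<in> lr x) \<Longrightarrow> (\<lambda>y. peval p (\<lambda>k. v k y)) \<in> lr x"
  by (induction p rule: cpoly_induct) (auto intro: lr_const lr_add lr_mult)

lemma (in curve) dv_peval_zero:
  "x \<in> C \<Longrightarrow> (\<And>k. v k \<in> lr x) \<Longrightarrow> (\<And>k. dv x (v k) = 0) \<Longrightarrow> dv x (\<lambda>y. peval p (\<lambda>k. v k y)) = 0"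
proof (induction p rule: cpoly_induct)
  case (add p q)
  then show ?case using dv_add[OF add.prems(1) lr_peval[of x v p] lr_peval[of x v q]] by simp
next
  case (mult p q)
  then show ?case using dv_mult[OF mult.prems(1) lr_peval[of x v p] lr_peval[of x v q]] by simp
qed (auto simp: dv_const)

locale linear_system = curve n C for n C +
  fixes L :: "'i line_bundle" and V :: "'i sec set" and b :: "nat \<Rightarrow> 'i sec" and N :: nat
  assumes lb: "line_bundle_on n C L" and VH: "V \<subseteq> H0 n C L" and gens: "generates C L V"
    and basis: "basis_of b N V"
begin

lemma chart_open: "i \<in> idx L \<Longrightarrow> openin T (chart L i)"
  and chart_cover: "C = (\<Union>i\<in>idx L. chart L i)"
  and trans_regular: "i \<in> idx L \<Longrightarrow> j \<in> idx L \<Longrightarrow> regular_on n C (chart L i \<inter> chart L j) (trans_fun L i j)"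
  and trans_self: "i \<in> idx L \<Longrightarrow> x \<in> chart L i \<Longrightarrow> trans_fun L i i x = 1"
  and trans_cocycle: "i \<in> idx L \<Longrightarrow> j \<in> idx L \<Longrightarrow> k \<in> idx L \<Longrightarrow>
    x \<in> chart L i \<inter> chart L j \<inter> chart L k \<Longrightarrow> trans_fun L i j x * trans_fun L j k x = trans_fun L i k x"
  using lb unfolding line_bundle_on_def by blast+

lemma chart_C: "i \<in> idx L \<Longrightarrow> x \<in> chart L i \<Longrightarrow> x \<in> C"
  using chart_cover by blast

lemma chart_exists: assumes "x \<in> C" obtains i where "i \<in> idx L" "x \<in> chart L i"
  using assms chart_cover by blast

lemma chart_nb: "i \<in> idx L \<Longrightarrow> x \<in> chart L i \<Longrightarrow> eventually (\<lambda>y. y \<in> chart L i) (nb x)"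
  by (rule openin_nb[OF chart_open])

lemma trans_lr: "i \<in> idx L \<Longrightarrow> j \<in> idx L \<Longrightarrow> x \<in> chart L i \<Longrightarrow> x \<in> chart L j \<Longrightarrow> trans_fun L i j \<in> lr x"
  unfolding local_ring_def using trans_regular by blast

lemma trans_nonzero:
  assumes "i \<in> idx L" "j \<in> idx L" "x \<in> chart L i" "x \<in> chart L j" shows "trans_fun L i j x \<noteq> 0"
  using trans_cocycle[of i j i x] trans_self[of i x] assms by auto

lemma b_V: "k \<le> N \<Longrightarrow> b k \<in> V"
  using basis cfun.span_base[of "b k" "b ` {..N}"] unfolding basis_of_def by auto

lemma b_H0: "k \<le> N \<Longrightarrow> b k \<in> H0 n C L"
  using b_V VH by blast

lemma b_lr: "k \<le> N \<Longrightarrow> i \<in> idx L \<Longrightarrow> x \<in> chart L i \<Longrightarrow> (\<lambda>y. b k (i, y)) \<in> lr x"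
  using b_H0[of k] unfolding H0_def local_ring_def by blast

lemma b_trans: "k \<le> N \<Longrightarrow> i \<in> idx L \<Longrightarrow> j \<in> idx L \<Longrightarrow> x \<in> chart L i \<Longrightarrow> x \<in> chart L j \<Longrightarrow>
    b k (i, x) = trans_fun L i j x * b k (j, x)"
  using b_H0[of k] unfolding H0_def by blast

lemma b_outside: "k \<le> N \<Longrightarrow> \<not> (i \<in> idx L \<and> x \<in> chart L i) \<Longrightarrow> b k (i, x) = 0"
  using b_H0[of k] unfolding H0_def by blast

definition sec :: "(nat \<Rightarrow> complex) \<Rightarrow> 'i \<Rightarrow> pt \<Rightarrow> complex" where
  "sec a i y = (\<Sum>k\<le>N. a k * b k (i, y))"

lemma sec_apply: "(\<Sum>k\<le>N. cscale (a k) (b k)) (i, y) = sec a i y"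
  by (simp add: sum_fun_apply sec_def)

lemma sec_lr: "i \<in> idx L \<Longrightarrow> x \<in> chart L i \<Longrightarrow> sec a i \<in> lr x"
  unfolding sec_def[abs_def] using chart_C by (intro lr_sum lr_cmult b_lr) auto

lemma sec_trans: "i \<in> idx L \<Longrightarrow> j \<in> idx L \<Longrightarrow> x \<in> chart L i \<Longrightarrow> x \<in> chart L j \<Longrightarrow>
    sec a i x = trans_fun L i j x * sec a j x"
  unfolding sec_def sum_distrib_left by (intro sum.cong) (auto simp: b_trans[of _ i j x])

lemma sec_linear: "sec (\<lambda>k. a k + s * c k) i y = sec a i y + s * sec c i y"
  unfolding sec_def by (simp add: algebra_simps sum.distrib sum_distrib_left)

lemma base_point_free:
  assumes i: "i \<in> idx L" "x \<in> chart L i" shows "\<exists>k\<le>N. b k (i, x) \<noteq> 0"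
proof (rule ccontr)
  assume "\<not> ?thesis"
  then have 0: "\<And>k. k \<le> N \<Longrightarrow> b k (i, x) = 0" by blast
  obtain s j where s: "s \<in> V" "j \<in> idx L" "x \<in> chart L j" "s (j, x) \<noteq> 0"
    using gens chart_C[OF i] unfolding generates_def by blast
  have sub: "cfun.subspace {s :: 'i sec. s (j, x) = 0}" by (auto simp: cfun.subspace_def)
  have "b k (j, x) = 0" if "k \<le> N" for k using 0[OF that] b_trans[OF that s(2) i(1) s(3) i(2)] by simp
  then have "cfun.span (b ` {..N}) \<subseteq> {s. s (j, x) = 0}" by (intro cfun.span_minimal sub) auto
  then show False using s basis unfolding basis_of_def by blast
qed

definition Sing :: "(nat \<Rightarrow> complex) \<Rightarrow> pt \<Rightarrow> bool" where
  "Sing a x \<longleftrightarrow> (\<exists>i\<in>idx L. x \<in> chart L i \<and> sec a i x = 0 \<and> dv x (sec a i) = 0)"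

text \<open>Under a change of chart the derivative of the transition function is multiplied by the
  section, which vanishes at the point.\<close>

lemma Sing_chart:
  assumes i: "i \<in> idx L" "x \<in> chart L i"
  shows "Sing a x \<longleftrightarrow> sec a i x = 0 \<and> dv x (sec a i) = 0"
proof
  assume "Sing a x"
  then obtain j where j: "j \<in> idx L" "x \<in> chart L j" "sec a j x = 0" "dv x (sec a j) = 0" unfolding Sing_def by blast
  have x: "x \<in> C" by (rule chart_C[OF i])
  have "eventually (\<lambda>y. sec a i y = trans_fun L i j y * sec a j y) (nb x)"
    using chart_nb[OF i] chart_nb[OF j(1,2)] by eventually_elim (rule sec_trans[OF i(1) j(1)])
  from dv_germ[OF x sec_lr[OF i] this] have "dv x (sec a i) = 0"
    using dv_mult[OF x trans_lr[OF i(1) j(1) i(2) j(2)] sec_lr[OF j(1,2), of a]] j by simp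
  then show "sec a i x = 0 \<and> dv x (sec a i) = 0" using sec_trans[OF i(1) j(1) i(2) j(2)] j by simp
qed (use i in \<open>auto simp: Sing_def\<close>)

lemma singular_at_iff:
  assumes "x \<in> C" shows "singular_at n C L (\<Sum>k\<le>N. cscale (a k) (b k)) x \<longleftrightarrow> Sing a x"
  unfolding singular_at_def sec_apply vanishes2_iff[OF assms] Sing_def using sec_lr by blast

lemma Sing_linear: "Sing a x \<Longrightarrow> Sing c x \<Longrightarrow> Sing (\<lambda>k. a k + s * c k) x"
proof -
  assume a: "Sing a x" and c: "Sing c x"
  then obtain i where i: "i \<in> idx L" "x \<in> chart L i" unfolding Sing_def by blast
  have "sec (\<lambda>k. a k + s * c k) i = (\<lambda>y. sec a i y + s * sec c i y)" using sec_linear by blast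
  then show ?thesis
    using a c chart_C[OF i] sec_lr[OF i] unfolding Sing_chart[OF i] by (simp add: dv_add dv_cmult lr_cmult)
qed

lemma Sing_cscale: "Sing a x \<Longrightarrow> Sing (cscale s a) x"
proof -
  assume a: "Sing a x"
  then obtain i where i: "i \<in> idx L" "x \<in> chart L i" unfolding Sing_def by blast
  have "sec (\<lambda>_. 0) i = (\<lambda>_. 0)" by (auto simp: sec_def)
  then have "Sing (\<lambda>_. 0) x" using dv_const[OF chart_C[OF i]] unfolding Sing_chart[OF i] by simp
  from Sing_linear[OF this a, of s] show ?thesis by (simp add: cscale_def)
qed

lemma discriminant_rp:
  assumes "p \<in> discriminant n C L b N" shows "p \<in> PS N" "\<exists>x\<in>C. Sing (rp p) x"
proof -
  obtain a x where a: "p \<in> PS N" "a \<in> p" "x \<in> C" "Sing a x"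
    using assms singular_at_iff unfolding discriminant_def by blast
  show "p \<in> PS N" by (rule a(1))
  have "rp p \<in> hpoint a" using rp_mem[OF a(1)] PS_mem(1)[OF a(1,2)] by simp
  then obtain s where "rp p = cscale s a" unfolding hpoint_def by blast
  then show "\<exists>x\<in>C. Sing (rp p) x" using Sing_cscale[OF a(4), of s] a(3) by auto
qed

lemma discriminant_hpoint:
  "a \<noteq> 0 \<Longrightarrow> (\<And>k. k > N \<Longrightarrow> a k = 0) \<Longrightarrow> x \<in> C \<Longrightarrow> Sing a x \<Longrightarrow> hpoint a \<in> discriminant n C L b N"
  unfolding discriminant_def using hpoint_PS[of a N] hpoint_self[of a] singular_at_iff[of x a] by blast

text \<open>Ramification without reference to \<phi>: sections vanishing at \<open>x\<close> are
  pullbacks of hyperplanes through the image point, and a zero differential makes all of them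
  singular.\<close>

definition ram :: "pt \<Rightarrow> bool" where
  "ram x \<longleftrightarrow> (\<forall>a. (\<exists>i\<in>idx L. x \<in> chart L i \<and> sec a i x = 0) \<longrightarrow> Sing a x)"

text \<open>The affine coordinates of \<phi> on the standard chart of index j, computed in the
  trivialization i.\<close>

definition fr :: "'i \<Rightarrow> nat \<Rightarrow> nat \<Rightarrow> pt \<Rightarrow> complex" where
  "fr i j k y = b k (i, y) / b j (i, y)"

lemma fr_lr:
  assumes "i \<in> idx L" "x \<in> chart L i" "j \<le> N" "b j (i, x) \<noteq> 0" "k \<le> N" shows "fr i j k \<in> lr x"
  unfolding fr_def[abs_def] by (intro lr_divide chart_C[OF assms(1,2)] b_lr assms)

lemma frame_near:
  assumes "i \<in> idx L" "x \<in> chart L i" "j \<le> N" "b j (i, x) \<noteq> 0"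
  shows "eventually (\<lambda>y. y \<in> chart L i \<and> b j (i, y) \<noteq> 0) (nb x)"
  by (intro eventually_conj chart_nb lr_nonzero[of x "\<lambda>y. b j (i, y)"] chart_C[OF assms(1,2)] b_lr assms)

lemma sec_frame: "b j (i, y) \<noteq> 0 \<Longrightarrow> sec a i y = b j (i, y) * (\<Sum>k\<le>N. a k * fr i j k y)"
  unfolding sec_def fr_def by (simp add: sum_distrib_left)

lemma dv_sec_frame:
  assumes i: "i \<in> idx L" "y \<in> chart L i" "j \<le> N" "b j (i, y) \<noteq> 0" and 0: "(\<Sum>k\<le>N. a k * fr i j k y) = 0"
  shows "dv y (sec a i) = b j (i, y) * (\<Sum>k\<le>N. a k * dv y (fr i j k))"
proof -
  have y: "y \<in> C" by (rule chart_C[OF i(1,2)])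
  let ?S = "\<lambda>z. \<Sum>k\<le>N. a k * fr i j k z"
  have S: "?S \<in> lr y" by (intro lr_sum lr_cmult y fr_lr i) auto
  have "eventually (\<lambda>z. sec a i z = b j (i, z) * ?S z) (nb y)"
    using frame_near[OF i] by eventually_elim (simp add: sec_frame)
  then have "dv y (sec a i) = b j (i, y) * dv y ?S"
    using dv_germ[OF y sec_lr[OF i(1,2)]] dv_mult[OF y b_lr[OF i(3,1,2)] S] 0 by simp
  also have "dv y ?S = (\<Sum>k\<le>N. a k * dv y (fr i j k))"
    using fr_lr[OF i] by (subst dv_sum) (auto intro!: sum.cong lr_cmult dv_cmult y)
  finally show ?thesis .
qed

text \<open>The hyperplane a must contain both the image point and its tangent vector. The term with
  the derivative of \<open>b j\<close> drops out because the first sum vanishes.\<close>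

lemma Sing_frame:
  assumes i: "i \<in> idx L" "y \<in> chart L i" "j \<le> N" "b j (i, y) \<noteq> 0"
  shows "Sing a y \<longleftrightarrow> (\<Sum>k\<le>N. a k * fr i j k y) = 0 \<and> (\<Sum>k\<le>N. a k * dv y (fr i j k)) = 0"
  unfolding Sing_chart[OF i(1,2)] using sec_frame[OF i(4)] dv_sec_frame[OF i] i(4) by auto

section \<open>Ramification and the differential\<close>

abbreviation \<phi> where "\<phi> \<equiv> proj_map L b N"

definition bvec :: "'i \<Rightarrow> pt \<Rightarrow> nat \<Rightarrow> complex" where
  "bvec i y = (\<lambda>k. if k \<le> N then b k (i, y) else 0)"

lemma bvec_nonzero: "i \<in> idx L \<Longrightarrow> y \<in> chart L i \<Longrightarrow> bvec i y \<noteq> 0"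
proof
  assume i: "i \<in> idx L" "y \<in> chart L i" and 0: "bvec i y = 0"
  obtain k where "k \<le> N" "b k (i, y) \<noteq> 0" using base_point_free[OF i] by blast
  then show False using fun_cong[OF 0, of k] by (simp add: bvec_def)
qed

lemma proj_map_chart:
  assumes i: "i \<in> idx L" "y \<in> chart L i" shows "\<phi> y = hpoint (bvec i y)"
proof -
  define j where "j = (SOME j. j \<in> idx L \<and> y \<in> chart L j)"
  have j: "j \<in> idx L" "y \<in> chart L j"
    unfolding j_def using someI[of "\<lambda>j. j \<in> idx L \<and> y \<in> chart L j" i] i by auto
  have "\<phi> y = hpoint (bvec j y)" unfolding proj_map_def bvec_def j_def Let_def ..
  also have "bvec j y = cscale (trans_fun L j i y) (bvec i y)"
    using b_trans[OF _ j(1) i(1) j(2) i(2)] by (auto simp: bvec_def)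
  finally show ?thesis unfolding hpoint_cscale[OF trans_nonzero[OF j(1) i(1) j(2) i(2)]] .
qed

lemma proj_map_PS: "i \<in> idx L \<Longrightarrow> y \<in> chart L i \<Longrightarrow> \<phi> y \<in> PS N"
  using proj_map_chart bvec_nonzero hpoint_PS[of "bvec i y" N] by (simp add: bvec_def)

lemma subtopology_PS: "subtopology (zariski N) (PS N) = zariski N"
  using subtopology_topspace[of "zariski N"] by simp

text \<open>A section vanishing to first order only, divided by some \<open>b j\<close>, is the
  pullback of a regular function on projective space with nonzero derivative. Since the tangent
  space is a line, one such function suffices.\<close>

lemma differential_inj_if_not_ram:
  assumes x: "x \<in> C" and r: "\<not> ram x"
  shows "inj_on (differential N (PS N) \<phi> x) (tangent_space n C x)"
proof -
  obtain a i where i: "i \<in> idx L" "x \<in> chart L i" "sec a i x = 0" "\<not> Sing a x" using r unfolding ram_def by blast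
  then have da: "dv x (sec a i) \<noteq> 0" using Sing_chart by blast
  obtain j where j: "j \<le> N" "b j (i, x) \<noteq> 0" using base_point_free[OF i(1,2)] by blast
  define h where "h p = ev (linform N a) p / ev (pvar j) p" for p
  define U where "U = {p \<in> PS N. ev (pvar j) p \<noteq> 0}"
  have jv: "pvar j \<in> hpoly N 1" by (rule hpoly_pvar[OF j(1)])
  have "PS N - U = {p \<in> PS N. ev (pvar j) p = 0}" by (auto simp: U_def)
  then have oU: "openin (zariski N) U" unfolding openin_zariski using zclosed_form[OF jv] by (auto simp: U_def)
  have "peval (pvar j) v \<noteq> 0 \<and> h y = peval (linform N a) v / peval (pvar j) v" if "y \<in> U" "v \<in> y" for y v
    using that(1) peval_mem_zero_iff[OF _ that(2) jv] peval_mem_ratio[OF _ that(2) linform_hpoly jv, of a]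
    unfolding U_def h_def by (simp del: peval_pvar peval_linform)
  then have reg: "regular_on N (PS N) U h"
    unfolding regular_on_def subtopology_PS using oU jv linform_hpoly[of N a] by blast
  have hphi: "h (\<phi> y) = sec a i y / b j (i, y)" if "y \<in> chart L i" for y
  proof -
    have m: "bvec i y \<in> \<phi> y" using proj_map_chart[OF i(1) that] hpoint_self by simp
    have "h (\<phi> y) = peval (linform N a) (bvec i y) / peval (pvar j) (bvec i y)"
      unfolding h_def using peval_mem_ratio[OF proj_map_PS[OF i(1) that] m linform_hpoly jv] by simp
    then show ?thesis using j(1) by (simp add: bvec_def sec_def)
  qed
  have "\<phi> x \<in> U"
    unfolding U_def using proj_map_PS[OF i(1,2)] j proj_map_chart[OF i(1,2)]
      peval_mem_zero_iff[OF proj_map_PS[OF i(1,2)] _ jv, of "bvec i x"] hpoint_self[of "bvec i x"] by (simp add: bvec_def)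
  then have hl: "h \<in> local_ring N (PS N) (\<phi> x)" unfolding local_ring_def using reg by blast
  let ?S = "\<lambda>y. sec a i y / b j (i, y)"
  have S: "?S \<in> lr x" by (intro lr_divide x sec_lr b_lr i j)
  have eS: "eventually (\<lambda>y. ?S y = (h \<circ> \<phi>) y) (nb x)"
    using chart_nb[OF i(1,2)] by eventually_elim (simp add: hphi)
  have "eventually (\<lambda>y. sec a i y = b j (i, y) * ?S y) (nb x)"
    using frame_near[OF i(1,2) j] by eventually_elim simp
  then have "dv x (sec a i) = b j (i, x) * dv x ?S"
    using dv_germ[OF x sec_lr[OF i(1,2)]] dv_mult[OF x b_lr[OF j(1) i(1,2)] S] i(3) by simp
  then have "dv x ?S \<noteq> 0" using da by auto
  then have nz: "dv x (h \<circ> \<phi>) \<noteq> 0" unfolding dv_germ[OF x S eS] .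
  show ?thesis
  proof (rule inj_onI)
    fix \<delta> \<delta>' assume "\<delta> \<in> tangent_space n C x" "\<delta>' \<in> tangent_space n C x"
    then obtain c c' where c: "\<delta> = cscale c (dv x)" "\<delta>' = cscale c' (dv x)" using dv(3)[OF x] by blast
    assume "differential N (PS N) \<phi> x \<delta> = differential N (PS N) \<phi> x \<delta>'"
    from fun_cong[OF this, of h] have "\<delta> (h \<circ> \<phi>) = \<delta>' (h \<circ> \<phi>)" using hl by (simp add: differential_def)
    then show "\<delta> = \<delta>'" using c nz by simp
  qed
qed

text \<open>All affine coordinates of \<phi> have derivative 0 at x. A regular function near the
  image point is a quotient of polynomials in them, so the differential kills the generator
  \<open>dv x\<close>.\<close>

lemma differential_not_inj_if_ram:
  assumes x: "x \<in> C" and r: "ram x"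
  shows "\<not> inj_on (differential N (PS N) \<phi> x) (tangent_space n C x)"
proof
  assume inj: "inj_on (differential N (PS N) \<phi> x) (tangent_space n C x)"
  obtain i where i: "i \<in> idx L" "x \<in> chart L i" using chart_exists[OF x] by blast
  obtain j where j: "j \<le> N" "b j (i, x) \<noteq> 0" using base_point_free[OF i] by blast
  define v where "v k y = (if k \<le> N then fr i j k y else 0)" for k y
  have vl: "v k \<in> lr x" for k
    unfolding v_def[abs_def] using fr_lr[OF i j] lr_const[OF x] by (cases "k \<le> N") auto
  have vd: "dv x (v k) = 0" for k
  proof (cases "k \<le> N")
    case True
    \<comment> \<open>The section \<open>b k\<close> - fr(x) \<open>b j\<close>, which vanishes at x
      and is therefore singular there.\<close>
    define a where "a m = (if m = k then 1 else 0) - (if m = j then fr i j k x else 0)" for m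
    have fj: "fr i j j x = 1" using j(2) by (simp add: fr_def)
    have sum: "(\<Sum>m\<le>N. a m * F m) = F k - fr i j k x * F j" for F :: "nat \<Rightarrow> complex"
    proof -
      have "(\<Sum>m\<le>N. a m * F m) = (\<Sum>m\<le>N. (if m = k then F m else 0) - (if m = j then fr i j k x * F m else 0))"
        by (intro sum.cong) (auto simp: a_def algebra_simps)
      then show ?thesis using True j(1) by (simp add: sum_subtractf)
    qed
    have "(\<Sum>m\<le>N. a m * fr i j m x) = 0" unfolding sum fj by simp
    then have "sec a i x = 0" using sec_frame[OF j(2), of a] by simp
    then have "Sing a x" using r i unfolding ram_def by blast
    then have "(\<Sum>m\<le>N. a m * dv x (fr i j m)) = 0" unfolding Sing_frame[OF i j] by blast
    then have 1: "dv x (fr i j k) = fr i j k x * dv x (fr i j j)" unfolding sum by simp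
    have "eventually (\<lambda>y. fr i j j y = 1) (nb x)"
      using frame_near[OF i j] by eventually_elim (simp add: fr_def)
    then have "dv x (fr i j j) = 0"
      using dv_germ[OF x fr_lr[OF i j j(1)], of "\<lambda>_. 1"] dv_const[OF x, of 1] by simp
    then show ?thesis using 1 True by (simp add: v_def[abs_def])
  qed (simp add: v_def[abs_def] dv_const[OF x])
  have "dv x (f \<circ> \<phi>) = 0" if f: "f \<in> local_ring N (PS N) (\<phi> x)" for f
  proof -
    obtain U where U: "\<phi> x \<in> U" "regular_on N (PS N) U f" using f unfolding local_ring_def by blast
    then have "\<exists>W d. \<exists>g\<in>hpoly N d. \<exists>h\<in>hpoly N d. openin (zariski N) W \<and> \<phi> x \<in> W \<and> W \<subseteq> U \<and>
        (\<forall>y\<in>W. \<forall>v\<in>y. peval h v \<noteq> 0 \<and> f y = peval g v / peval h v)"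
      unfolding regular_on_def subtopology_PS by blast
    then obtain W d g h where W: "g \<in> hpoly N d" "h \<in> hpoly N d" "openin (zariski N) W" "\<phi> x \<in> W"
      "\<forall>y\<in>W. \<forall>v\<in>y. peval h v \<noteq> 0 \<and> f y = peval g v / peval h v" by blast
    have "zclosed N (PS N - W)" using W(3) by (simp add: openin_zariski)
    then obtain q e where q: "q \<in> hpoly N e" "ev q (\<phi> x) \<noteq> 0" "\<And>z. z \<in> PS N - W \<Longrightarrow> ev q z = 0"
      using zclosed_separate[of N "PS N - W" "\<phi> x"] proj_map_PS[OF i] W(4) by blast
    have vm: "(\<lambda>k. v k y) \<in> \<phi> y" if "y \<in> chart L i" "b j (i, y) \<noteq> 0" for y
    proof -
      have "(\<lambda>k. v k y) = cscale (1 / b j (i, y)) (bvec i y)" by (auto simp: v_def bvec_def fr_def)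
      then show ?thesis
        using that(2) unfolding proj_map_chart[OF i(1) that(1)] hpoint_def by (intro CollectI exI[of _ "1 / b j (i, y)"]) simp
    qed
    have "peval q (\<lambda>k. v k x) \<noteq> 0"
      using peval_mem_zero_iff[OF proj_map_PS[OF i] vm[OF i(2) j(2)] q(1)] q(2) by simp
    then have "eventually (\<lambda>y. peval q (\<lambda>k. v k y) \<noteq> 0) (nb x)"
      by (rule lr_nonzero[OF x lr_peval[OF x vl]])
    with frame_near[OF i j] have near: "eventually (\<lambda>y. \<phi> y \<in> W \<and> (\<lambda>k. v k y) \<in> \<phi> y) (nb x)"
    proof eventually_elim
      case (elim y)
      have P: "\<phi> y \<in> PS N" using proj_map_PS[OF i(1)] elim(1) by blast
      have m: "(\<lambda>k. v k y) \<in> \<phi> y" using vm elim(1) by blast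
      then have "ev q (\<phi> y) \<noteq> 0" using peval_mem_zero_iff[OF P m q(1)] elim(2) by simp
      then show ?case using P q(3) m by blast
    qed
    define G where "G y = peval g (\<lambda>k. v k y)" for y
    define H where "H y = peval h (\<lambda>k. v k y)" for y
    have GH: "G \<in> lr x" "H \<in> lr x" "dv x G = 0" "dv x H = 0"
      unfolding G_def[abs_def] H_def[abs_def] by (intro lr_peval dv_peval_zero x vl vd)+
    have "H x \<noteq> 0" using nbD(1)[OF near] W(5) unfolding H_def by blast
    note Hi = lr_inverse[OF x GH(2) this] dv_inverse[OF x GH(2) this]
    have "eventually (\<lambda>y. G y * inverse (H y) = (f \<circ> \<phi>) y) (nb x)"
      using near by eventually_elim (use W(5) in \<open>auto simp: G_def H_def divide_inverse\<close>)
    then have "dv x (\<lambda>y. G y * inverse (H y)) = dv x (f \<circ> \<phi>)" by (rule dv_germ[OF x lr_mult[OF x GH(1) Hi(1)]])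
    moreover have "dv x (\<lambda>y. G y * inverse (H y)) = 0" using dv_mult[OF x GH(1) Hi(1)] Hi(2) GH by simp
    ultimately show ?thesis by (rule trans[OF sym])
  qed
  then have "differential N (PS N) \<phi> x (dv x) = differential N (PS N) \<phi> x 0"
    by (auto simp: differential_def)
  moreover have "0 \<in> tangent_space n C x" by (rule tangent_spaceI) auto
  ultimately show False using inj dv(1,2)[OF x] unfolding inj_on_def by blast
qed

lemma immersion_iff: "immersion n C N (PS N) \<phi> \<longleftrightarrow> (\<forall>x\<in>C. \<not> ram x)"
  unfolding immersion_def using differential_inj_if_not_ram differential_not_inj_if_ram by blast

section \<open>Immersions have irreducible discriminant\<close>

text \<open>The discriminant is the union over x of the linear spaces of sections singular at x.
  This predicate turns containment in A into a condition on x alone.\<close>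

definition inside :: "pt set \<Rightarrow> pt \<Rightarrow> bool" where
  "inside A x \<longleftrightarrow> (\<forall>a. a \<noteq> 0 \<longrightarrow> (\<forall>k>N. a k = 0) \<longrightarrow> Sing a x \<longrightarrow> hpoint a \<in> A)"

text \<open>Near an unramified point the spaces of singular sections form a vector bundle, so every
  singular section at \<open>x\<close> extends to a regular family \<open>c y\<close> of sections singular at \<open>y\<close>.\<close>

lemma inside_closed:
  assumes x: "x \<in> C" and r: "\<not> ram x" and A: "zclosed N A" and inf: "infinite {y \<in> C. inside A y}"
  shows "inside A x"
  unfolding inside_def
proof (intro allI impI, rule ccontr)
  fix a assume a: "a \<noteq> 0" "\<forall>k>N. a k = 0" "Sing a x" "hpoint a \<notin> A"
  obtain F d where F: "F \<in> hpoly N d" "ev F (hpoint a) \<noteq> 0" "\<And>z. z \<in> A \<Longrightarrow> ev F z = 0"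
    using zclosed_separate[OF A hpoint_PS a(4)] a(1,2) by blast
  have Fa: "peval F a \<noteq> 0" using ev_hpoint_zero_iff[OF a(1) _ F(1)] a(2) F(2) by blast
  obtain i where i: "i \<in> idx L" "x \<in> chart L i" using chart_exists[OF x] by blast
  obtain j where j: "j \<le> N" "b j (i, x) \<noteq> 0" using base_point_free[OF i] by blast
  let ?f = "fr i j"
  have f: "?f k \<in> lr x" if "k \<le> N" for k by (rule fr_lr[OF i j that])
  have fj: "eventually (\<lambda>y. ?f j y = 1) (nb x)" using frame_near[OF i j] by eventually_elim (simp add: fr_def)
  have dfj: "eventually (\<lambda>y. dv y (?f j) = 0) (nb x)"
    using nb_nb[OF fj] lr_near[OF x f[OF j(1)]]
    by eventually_elim (use dv_germ[of _ "?f j" "\<lambda>_. 1"] dv_const[of _ 1] in simp)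
  have "\<exists>k0\<le>N. dv x (?f k0) \<noteq> 0"
  proof (rule ccontr)
    assume "\<not> ?thesis"
    then have "\<And>k. k \<le> N \<Longrightarrow> dv x (?f k) = 0" by blast
    then have d0: "(\<Sum>k\<le>N. c k * dv x (?f k)) = 0" for c by (intro sum.neutral) auto
    have "ram x" unfolding ram_def
    proof (intro allI impI)
      fix c assume "\<exists>i'\<in>idx L. x \<in> chart L i' \<and> sec c i' x = 0"
      then have "sec c i x = 0" using sec_trans[OF i(1) _ i(2)] by auto
      then show "Sing c x" unfolding Sing_frame[OF i j] using sec_frame[OF j(2)] j(2) d0 by auto
    qed
    then show False using r by simp
  qed
  then obtain k0 where k0: "k0 \<le> N" "dv x (?f k0) \<noteq> 0" by blast
  have k0j: "k0 \<noteq> j" using k0(2) nbD(1)[OF dfj] by auto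
  \<comment> \<open>With this uniformizer the differential of the coordinate \<open>k0\<close> is du
    itself, so it enters the tangency equation with coefficient 1.\<close>
  define u where "u = (\<lambda>y. ?f k0 y - ?f k0 x)"
  have u: "unif x u" unfolding u_def by (rule unif_shift[OF x f[OF k0(1)] k0(2)])
  have du: "eventually (\<lambda>y. dv y u = dv y (?f k0)) (nb x)"
    using lr_near[OF x f[OF k0(1)]] by eventually_elim (simp add: u_def dv_diff dv_const lr_const)
  have "\<forall>k\<in>{..N}. \<exists>g. g \<in> lr x \<and> eventually (\<lambda>y. dv y (?f k) = g y * dv y u) (nb x)"
  proof
    fix k assume "k \<in> {..N}"
    then have "?f k \<in> lr x" using f by simp
    then obtain g where "g \<in> lr x" "eventually (\<lambda>y. dv y (?f k) = g y * dv y u) (nb x)"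
      by (rule unif_derivative[OF x u])
    then show "\<exists>g. g \<in> lr x \<and> eventually (\<lambda>y. dv y (?f k) = g y * dv y u) (nb x)" by (intro exI[of _ g] conjI)
  qed
  from bchoice[OF this] obtain g where g: "\<forall>k\<in>{..N}. g k \<in> lr x \<and> eventually (\<lambda>y. dv y (?f k) = g k y * dv y u) (nb x)" ..
  have gev: "eventually (\<lambda>y. \<forall>k\<in>{..N}. dv y (?f k) = g k y * dv y u) (nb x)"
    using g by (intro eventually_ball_finite) auto
  define K where "K = {..N} - {j, k0}"
  have K: "finite K" by (simp add: K_def)
  have split: "(\<Sum>k\<le>N. c k * h k) = (\<Sum>k\<in>K. c k * h k) + c k0 * h k0 + c j * h j" for c h :: "nat \<Rightarrow> complex"
  proof -
    have "{..N} = insert j (insert k0 K)" using j(1) k0(1) by (auto simp: K_def)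
    moreover have "j \<notin> insert k0 K" "k0 \<notin> K" using k0j by (auto simp: K_def)
    ultimately show ?thesis using K by (simp add: add_ac)
  qed
  \<comment> \<open>The coordinates in K are kept equal to those of a. The tangency equation then
    determines the coordinate \<open>k0\<close> as p, and the incidence equation the coordinate j as
    q.\<close>
  define p where "p y = - (\<Sum>k\<in>K. a k * g k y)" for y
  define q where "q y = - ((\<Sum>k\<in>K. a k * ?f k y) + p y * ?f k0 y)" for y
  have pl: "p \<in> lr x" unfolding p_def[abs_def] using g by (intro lr_uminus lr_sum lr_cmult x) (auto simp: K_def)
  have ql: "q \<in> lr x" unfolding q_def[abs_def] by (intro lr_uminus lr_add lr_sum lr_cmult lr_mult x pl f) (use k0 in \<open>auto simp: K_def\<close>)
  define c where "c y k = (if k \<in> K then a k else if k = k0 then p y else if k = j then q y else 0)" for y k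
  have cK: "(\<Sum>k\<in>K. c y k * h k) = (\<Sum>k\<in>K. a k * h k)" for y and h :: "nat \<Rightarrow> complex"
    by (intro sum.cong) (auto simp: c_def)
  have ck: "c y k0 = p y" "c y j = q y" for y using k0j by (auto simp: c_def K_def)
  have cs: "c y k = 0" if "k > N" for y k using that j k0 by (auto simp: c_def K_def)
  have sing: "eventually (\<lambda>y. Sing (c y) y) (nb x)"
    using frame_near[OF i j] fj dfj du gev
  proof eventually_elim
    case (elim y)
    have "(\<Sum>k\<in>K. a k * dv y (?f k)) = (\<Sum>k\<in>K. a k * g k y) * dv y u"
      unfolding sum_distrib_right using elim(5) by (intro sum.cong) (auto simp: K_def)
    then have "(\<Sum>k\<le>N. c y k * dv y (?f k)) = 0"
      unfolding split cK ck elim(3) elim(4)[symmetric] by (simp add: p_def)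
    moreover have "(\<Sum>k\<le>N. c y k * ?f k y) = 0" unfolding split cK ck elim(2) by (simp add: q_def)
    ultimately show ?case using Sing_frame[OF i(1) _ j(1)] elim(1) by blast
  qed
  have cx: "c x = a"
  proof -
    have s: "(\<Sum>k\<le>N. a k * ?f k x) = 0" "(\<Sum>k\<le>N. a k * dv x (?f k)) = 0"
      using a(3) unfolding Sing_frame[OF i j] by auto
    have "(\<Sum>k\<in>K. a k * dv x (?f k)) = (\<Sum>k\<in>K. a k * g k x) * dv x u"
      unfolding sum_distrib_right using nbD(1)[OF gev] by (intro sum.cong) (auto simp: K_def)
    then have "((\<Sum>k\<in>K. a k * g k x) + a k0) * dv x u = 0"
      using s(2) nbD(1)[OF dfj] nbD(1)[OF du] unfolding split by (simp add: algebra_simps)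
    then have 1: "a k0 = p x" using u by (simp add: unif_def p_def add_eq_0_iff)
    have "(\<Sum>k\<in>K. a k * ?f k x) + a k0 * ?f k0 x + a j = 0" using s(1) nbD(1)[OF fj] unfolding split by simp
    then have 2: "a j = q x" unfolding q_def 1[symmetric] by (simp add: add_eq_0_iff)
    show ?thesis
    proof
      fix k show "c x k = a k"
        using 1 2 a(2) by (cases "k \<le> N") (auto simp: c_def K_def)
    qed
  qed
  \<comment> \<open>If c y = 0, then a vanishes on K, hence p and q vanish at x as well and a = c x
    = 0.\<close>
  have cnz: "c y \<noteq> 0" for y
  proof
    assume c0: "c y = 0"
    have aK: "a k = 0" if "k \<in> K" for k
    proof -
      have "c y k = 0" using c0 by simp
      then show ?thesis using that by (simp add: c_def)
    qed
    have "p x = 0" unfolding p_def using aK by (simp add: sum.neutral)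
    moreover have "q x = 0" unfolding q_def using aK \<open>p x = 0\<close> by (simp add: sum.neutral)
    ultimately have "c x = 0" using aK by (auto simp: c_def)
    then show False using cx a(1) by simp
  qed
  \<comment> \<open>A regular function vanishing wherever \<open>inside A y\<close> holds near x,
    thus at infinitely many points, but not at x.\<close>
  let ?W = "\<lambda>y. peval F (c y)"
  have "(\<lambda>y. c y k) \<in> lr x" for k
    unfolding c_def using lr_const[OF x] pl ql by (cases "k \<in> K"; cases "k = k0"; cases "k = j") auto
  then have Wl: "?W \<in> lr x" using lr_peval[OF x, of "\<lambda>k y. c y k" F] by simp
  have W0: "eventually (\<lambda>y. inside A y \<longrightarrow> ?W y = 0) (nb x)"
    using sing
  proof eventually_elim
    case (elim y)
    show ?case
    proof
      assume "inside A y"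
      then have "hpoint (c y) \<in> A" using cnz cs elim unfolding inside_def by blast
      then have "ev F (hpoint (c y)) = 0" by (rule F(3))
      then show "?W y = 0" using ev_hpoint_zero_iff[OF cnz cs F(1)] by blast
    qed
  qed
  have "\<not> eventually (\<lambda>y. ?W y \<noteq> 0) gen"
  proof
    assume "eventually (\<lambda>y. ?W y \<noteq> 0) gen"
    with nbD(2)[OF W0] have "eventually (\<lambda>y. \<not> inside A y) gen" by eventually_elim simp
    then show False using inf by (simp add: eventually_gen)
  qed
  then have "eventually (\<lambda>y. ?W y = 0) (nb x)" using lr_dichotomy[OF x Wl] by blast
  from nbD(1)[OF this] show False using cx Fa by simp
qed

text \<open>A linear space is irreducible: on the line through a point outside A and one outside B,
  only finitely many points lie in A or in B.\<close>

lemma linear_space_irreducible: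
  assumes x: "x \<in> C" and A: "zclosed N A" and B: "zclosed N B" and D: "discriminant n C L b N \<subseteq> A \<union> B"
  shows "inside A x \<or> inside B x"
proof (rule ccontr)
  assume neg: "\<not> ?thesis"
  obtain a where a: "a \<noteq> 0" "\<forall>k>N. a k = 0" "Sing a x" "hpoint a \<notin> A" using neg unfolding inside_def by blast
  obtain c where c: "c \<noteq> 0" "\<forall>k>N. c k = 0" "Sing c x" "hpoint c \<notin> B" using neg unfolding inside_def by blast
  obtain F d where F: "F \<in> hpoly N d" "ev F (hpoint a) \<noteq> 0" "\<And>z. z \<in> A \<Longrightarrow> ev F z = 0"
    using zclosed_separate[OF A hpoint_PS a(4)] a(1,2) by blast
  obtain G e where G: "G \<in> hpoly N e" "ev G (hpoint c) \<noteq> 0" "\<And>z. z \<in> B \<Longrightarrow> ev G z = 0"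
    using zclosed_separate[OF B hpoint_PS c(4)] c(1,2) by blast
  obtain P where P: "\<forall>s. poly P s = peval F (\<lambda>k. a k + s * c k)" using peval_line by blast
  obtain Q where Q: "\<forall>s. poly Q s = peval G (\<lambda>k. c k + s * a k)" using peval_line by blast
  have "poly P 0 \<noteq> 0" using P ev_hpoint_zero_iff[OF a(1) _ F(1)] a(2) F(2) by simp
  moreover have "poly Q 0 \<noteq> 0" using Q ev_hpoint_zero_iff[OF c(1) _ G(1)] c(2) G(2) by simp
  ultimately have "P \<noteq> 0" "Q \<noteq> 0" by auto
  obtain k where k: "c k \<noteq> 0" using c(1) by (auto simp: fun_eq_iff)
  \<comment> \<open>Q runs along the same line starting from c, so its parameter is the inverse of
    s. The last value is the one at which coordinate k of a + s c vanishes.\<close>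
  let ?bad = "{s. poly P s = 0} \<union> inverse ` {s. poly Q s = 0} \<union> {0, - a k / c k}"
  have "finite ?bad" using poly_roots_finite[OF \<open>P \<noteq> 0\<close>] poly_roots_finite[OF \<open>Q \<noteq> 0\<close>] by auto
  from ex_new_if_finite[OF infinite_UNIV_char_0 this] obtain s where s: "s \<notin> ?bad" ..
  define v where "v = (\<lambda>k. a k + s * c k)"
  have s0: "s \<noteq> 0" using s by blast
  have vs: "v k = 0" if "k > N" for k using a(2) c(2) that by (simp add: v_def)
  have vnz: "v \<noteq> 0"
  proof
    assume "v = 0"
    from fun_cong[OF this, of k] have "a k + s * c k = 0" by (simp add: v_def)
    then have "s = - a k / c k" using k by (simp add: field_simps eq_neg_iff_add_eq_0)
    then show False using s by blast
  qed
  have "peval F v \<noteq> 0" using s P by (auto simp: v_def)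
  then have nA: "hpoint v \<notin> A" using F(3) ev_hpoint_zero_iff[OF vnz vs F(1)] by blast
  have "poly Q (inverse s) \<noteq> 0"
  proof
    assume "poly Q (inverse s) = 0"
    then have "s \<in> inverse ` {s. poly Q s = 0}" by (intro image_eqI[of _ _ "inverse s"]) auto
    then show False using s by blast
  qed
  moreover have "v = cscale s (\<lambda>k. c k + inverse s * a k)" using s0 by (auto simp: v_def field_simps)
  ultimately have "peval G v \<noteq> 0" using Q s0 by (simp add: peval_cscale[OF G(1)])
  then have nB: "hpoint v \<notin> B" using G(3) ev_hpoint_zero_iff[OF vnz vs G(1)] by blast
  have "hpoint v \<in> discriminant n C L b N"
    using discriminant_hpoint[OF vnz vs x] Sing_linear[OF a(3) c(3)] unfolding v_def by blast
  then show False using D nA nB by blast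
qed

lemma inside_subset:
  assumes A: "zclosed N A" and "\<And>x. x \<in> C \<Longrightarrow> inside A x" shows "discriminant n C L b N \<subseteq> A"
proof
  fix p assume p: "p \<in> discriminant n C L b N"
  note d = discriminant_rp[OF p]
  show "p \<in> A" using d assms(2) rp_nonzero[OF d(1)] rp_supp[OF d(1)] hpoint_rp[OF d(1)] unfolding inside_def by metis
qed

text \<open>Each point of C is inside one of the two closed sets, so one of them serves infinitely
  many points and, by \<open>inside_closed\<close>, all of them.\<close>

lemma irreducible_if_unramified:
  assumes r: "\<And>x. x \<in> C \<Longrightarrow> \<not> ram x"
  shows "irreducible_in (zariski N) (discriminant n C L b N)"
  unfolding irreducible_in_def
proof (intro conjI allI impI)
  show "discriminant n C L b N \<subseteq> topspace (zariski N)" using discriminant_rp(1) by auto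
  fix A B assume cl: "closedin (zariski N) A" "closedin (zariski N) B" and D: "discriminant n C L b N \<subseteq> A \<union> B"
  then have A: "zclosed N A" and B: "zclosed N B" by (auto simp: closedin_zariski)
  have "C \<subseteq> {y \<in> C. inside A y} \<union> {y \<in> C. inside B y}" using linear_space_irreducible[OF _ A B D] by blast
  then have "infinite {y \<in> C. inside A y} \<or> infinite {y \<in> C. inside B y}" using infiniteC finite_subset by blast
  then show "discriminant n C L b N \<subseteq> A \<or> discriminant n C L b N \<subseteq> B"
    using inside_closed[OF _ r A] inside_closed[OF _ r B] inside_subset[OF A] inside_subset[OF B] by blast
qed

end

section \<open>Divisibility by a linear form\<close>

text \<open>The Nullstellensatz for the zero ideal makes a power of p zero. It requires positive
  degree, whence the factor \<open>pvar 0\<close>.\<close>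

lemma form_eq_zero:
  assumes p: "p \<in> hpoly N d" and van: "\<And>v. (\<And>k. k > N \<Longrightarrow> v k = 0) \<Longrightarrow> peval p v = 0"
  shows "p = 0"
proof -
  have I: "gideal N (\<lambda>_. {0})" unfolding gideal_def by auto
  have pos: "q = 0" if q: "q \<in> hpoly N e" "e \<ge> 1" "\<And>v. (\<And>k. k > N \<Longrightarrow> v k = 0) \<Longrightarrow> peval q v = 0" for q e
    using graded_nullstellensatz[OF I q(1,2)] q(3) by auto
  have "pvar 0 * p = 0"
    by (rule pos[OF hpoly_mult[OF hpoly_pvar p]]) (auto simp: van)
  moreover have "pvar 0 \<noteq> 0"
  proof
    assume "pvar 0 = 0"
    then have "peval (pvar 0) (\<lambda>_. 1) = 0" by (simp only: peval_zero)
    then show False by simp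
  qed
  ultimately show ?thesis by simp
qed

context
  fixes N :: nat and l :: "nat \<Rightarrow> complex" and j :: nat
  assumes j: "j \<le> N" and lj: "l j \<noteq> 0"
begin

text \<open>Division with remainder by the linear form, eliminating the variable j. That R is free
  of this variable is expressed through its values; the clause for d = 0 guards the truncated degree
  of G.\<close>

definition reducible :: "nat \<Rightarrow> cpoly \<Rightarrow> bool" where
  "reducible d p \<longleftrightarrow> (\<exists>G R. p = linform N l * G + R \<and> G \<in> hpoly N (d - 1) \<and> (d = 0 \<longrightarrow> G = 0) \<and>
     R \<in> hpoly N d \<and> (\<forall>v s. peval R (v(j := s)) = peval R v))"

lemma reducible_add: "reducible d p \<Longrightarrow> reducible d q \<Longrightarrow> reducible d (p + q)"
proof -
  assume "reducible d p" "reducible d q"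
  then obtain G R G' R' where
    "p = linform N l * G + R" "G \<in> hpoly N (d - 1)" "d = 0 \<longrightarrow> G = 0" "R \<in> hpoly N d" "\<forall>v s. peval R (v(j := s)) = peval R v"
    "q = linform N l * G' + R'" "G' \<in> hpoly N (d - 1)" "d = 0 \<longrightarrow> G' = 0" "R' \<in> hpoly N d" "\<forall>v s. peval R' (v(j := s)) = peval R' v"
    unfolding reducible_def by blast
  then show ?thesis unfolding reducible_def
    by (intro exI[of _ "G + G'"] exI[of _ "R + R'"]) (auto simp: distrib_left)
qed

text \<open>The only real case is k = j, where the variable in front of the remainder is rewritten
  as the linear form minus its other terms, divided by \<open>l j\<close>.\<close>

lemma reducible_pvar:
  assumes "reducible d p" and k: "k \<le> N" shows "reducible (Suc d) (pvar k * p)"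
proof -
  obtain G R where GR: "p = linform N l * G + R" "G \<in> hpoly N (d - 1)" "d = 0 \<longrightarrow> G = 0" "R \<in> hpoly N d"
    "\<forall>v s. peval R (v(j := s)) = peval R v" using assms(1) unfolding reducible_def by blast
  have kG: "pvar k * G \<in> hpoly N d"
    using hpoly_mult[OF hpoly_pvar[OF k] GR(2)] GR(3) by (cases d) auto
  show ?thesis
  proof (cases "k = j")
    case False
    have "pvar k * R \<in> hpoly N (Suc d)" using hpoly_mult[OF hpoly_pvar[OF k] GR(4)] by simp
    then show ?thesis unfolding reducible_def
      using kG GR(1,5) False by (intro exI[of _ "pvar k * G"] exI[of _ "pvar k * R"]) (auto simp: algebra_simps)
  next
    case True
    let ?c = "pconst (1 / l j)" and ?S = "\<Sum>m\<in>{..N} - {j}. pconst (l m) * pvar m"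
    have "linform N l = pconst (l j) * pvar j + ?S"
      unfolding linform_def using j by (intro sum.remove) auto
    moreover have "?c * pconst (l j) = 1" using lj by (simp flip: pconst_hom(4))
    ultimately have "pvar j = ?c * (linform N l - ?S)" by (simp flip: mult.assoc)
    then have "pvar j * R = linform N l * (?c * R) - ?c * ?S * R" by (metis (no_types, lifting) mult.commute mult.left_commute right_diff_distrib')
    then have "pvar k * p = linform N l * (pvar k * G + ?c * R) + - (?c * ?S * R)"
      unfolding GR(1) True by (simp add: algebra_simps)
    moreover have "?c * ?S \<in> hpoly N 1" by (intro hpoly_cmult hpoly_sum hpoly_pvar) auto
    then have "- (?c * ?S * R) \<in> hpoly N (Suc d)" using hpoly_uminus[OF hpoly_mult[OF _ GR(4)], of "?c * ?S" 1] by simp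
    moreover have "pvar k * G + ?c * R \<in> hpoly N d" by (intro hpoly_add kG hpoly_cmult GR(4))
    moreover have "peval (- (?c * ?S * R)) (v(j := s)) = peval (- (?c * ?S * R)) v" for v s
      using GR(5) by simp
    ultimately show ?thesis unfolding reducible_def
      by (intro exI[of _ "pvar k * G + ?c * R"] exI[of _ "- (?c * ?S * R)"]) simp
  qed
qed

lemma reducible_form: assumes "p \<in> hpoly N d" shows "reducible d p"
proof -
  have mon: "reducible d (Poly_Mapping.single m c)" if "m \<in> mons N d" for m c
    using that
  proof (induction d arbitrary: m)
    case 0
    have "m = 0"
    proof (rule poly_mapping_eqI)
      fix k show "Poly_Mapping.lookup m k = Poly_Mapping.lookup 0 k"
        using lookup_le_mdeg[of m k] 0 by (simp add: mons_def)
    qed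
    then show ?case unfolding reducible_def
      by (intro exI[of _ 0] exI[of _ "pconst c"]) (auto simp: pconst_def[symmetric])
  next
    case (Suc d)
    have "Poly_Mapping.keys m \<noteq> {}" using Suc.prems by (auto simp: mons_def mdeg_def)
    then obtain k where k: "k \<in> Poly_Mapping.keys m" by blast
    define m' where "m' = m - Poly_Mapping.single k 1"
    have m: "m = Poly_Mapping.single k 1 + m'"
      by (rule poly_mapping_eqI) (use k in \<open>auto simp: m'_def lookup_add lookup_minus lookup_single when_def in_keys_iff\<close>)
    have "mdeg (Poly_Mapping.single k (1::nat)) = 1" by (simp add: mdeg_def)
    then have "mdeg m' = d" using Suc.prems m mdeg_add[of "Poly_Mapping.single k 1" m'] by (simp add: mons_def)
    moreover have "Poly_Mapping.keys m' \<subseteq> {..N}" using Suc.prems by (auto simp: mons_def m'_def in_keys_iff lookup_minus subset_iff)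
    ultimately have "reducible d (Poly_Mapping.single m' c)" by (intro Suc.IH) (simp add: mons_def)
    then have "reducible (Suc d) (pvar k * Poly_Mapping.single m' c)"
      using k Suc.prems by (intro reducible_pvar) (auto simp: mons_def)
    then show ?case unfolding m by (simp add: pvar_def mult_single)
  qed
  have z: "reducible d 0" unfolding reducible_def by (intro exI[of _ 0]) auto
  have "reducible d (\<Sum>m\<in>A. Poly_Mapping.single m (Poly_Mapping.lookup p m))" if "A \<subseteq> mons N d" for A
    using that by (induction A rule: infinite_finite_induct) (auto intro: z reducible_add mon)
  then show ?thesis using poly_sum_singles[of p] assms unfolding hpoly_keys by metis
qed

text \<open>Any values of the other variables can be completed to a zero of the linear form by
  choosing the variable j. As the remainder does not see this variable, it vanishes
  identically.\<close>

lemma divisible_by_linform: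
  assumes p: "p \<in> hpoly N d" "p \<noteq> 0"
    and van: "\<And>v. (\<And>k. k > N \<Longrightarrow> v k = 0) \<Longrightarrow> peval (linform N l) v = 0 \<Longrightarrow> peval p v = 0"
  obtains G where "d \<ge> 1" "G \<in> hpoly N (d - 1)" "G \<noteq> 0" "p = linform N l * G"
proof -
  obtain G R where GR: "p = linform N l * G + R" "G \<in> hpoly N (d - 1)" "d = 0 \<longrightarrow> G = 0" "R \<in> hpoly N d"
    "\<forall>v s. peval R (v(j := s)) = peval R v" using reducible_form[OF p(1)] unfolding reducible_def by blast
  have "R = 0"
  proof (rule form_eq_zero[OF GR(4)])
    fix v :: "nat \<Rightarrow> complex" assume v: "\<And>k. k > N \<Longrightarrow> v k = 0"
    define s where "s = - (\<Sum>m\<in>{..N} - {j}. l m * v m) / l j"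
    have "(\<Sum>m\<in>{..N} - {j}. l m * (v(j := s)) m) = (\<Sum>m\<in>{..N} - {j}. l m * v m)"
      by (intro sum.cong) auto
    then have l0: "peval (linform N l) (v(j := s)) = 0"
      using j lj by (simp add: sum.remove[of "{..N}" j] s_def)
    then have "peval p (v(j := s)) = 0" using v j by (intro van) auto
    then show "peval R v = 0" using l0 GR(1,5) by (simp del: peval_linform)
  qed
  then have "p = linform N l * G" using GR(1) by simp
  moreover from this have "G \<noteq> 0" using p(2) by auto
  moreover from this have "d \<ge> 1" using GR(3) by (cases d) auto
  ultimately show ?thesis using that GR(2) by blast
qed

end

section \<open>The discriminant is contained in a hypersurface\<close>

context curve
begin

text \<open>Starting the induction with a coordinate as denominator yields e \<ge> 1, which
  \<open>elimination\<close> requires.\<close>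

lemma common_denominator:
  assumes x: "x \<in> C" and I: "finite I" and \<psi>: "\<And>i. i \<in> I \<Longrightarrow> \<psi> i \<in> lr x"
  shows "\<exists>e M G. e \<ge> 1 \<and> M \<in> hpoly n e \<and> ev M x \<noteq> 0 \<and> (\<forall>i\<in>I. G i \<in> hpoly n e) \<and>
    eventually (\<lambda>y. ev M y \<noteq> 0 \<and> (\<forall>i\<in>I. ev (G i) y = ev M y * \<psi> i y)) (nb x)"
  using I \<psi>
proof (induction I rule: finite_induct)
  case empty
  obtain k where k: "k \<le> n" "rp x k \<noteq> 0" using rp_coord_nonzero[OF C_PS[OF x]] by blast
  have "eventually (\<lambda>y. ev (pvar k) y \<noteq> 0) (nb x)" using form_nonzero[OF hpoly_pvar[OF k(1)] x] k by simp
  then show ?case using k hpoly_pvar[OF k(1)]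
    by (intro exI[of _ 1] exI[of _ "pvar k"] exI[of _ "\<lambda>_. 0"]) auto
next
  case (insert i I)
  then obtain e M G where 1: "e \<ge> 1" "M \<in> hpoly n e" "ev M x \<noteq> 0" "\<forall>i\<in>I. G i \<in> hpoly n e"
    "eventually (\<lambda>y. ev M y \<noteq> 0 \<and> (\<forall>i\<in>I. ev (G i) y = ev M y * \<psi> i y)) (nb x)" by auto
  obtain d A B where 2: "A \<in> hpoly n d" "B \<in> hpoly n d" "ev B x \<noteq> 0"
    "eventually (\<lambda>y. ev B y \<noteq> 0 \<and> \<psi> i y = ev A y / ev B y) (nb x)" by (rule lr_obtain[OF x insert.prems[OF insertI1]])
  define G' where "G' k = (if k = i then M * A else G k * B)" for k
  have "\<forall>k\<in>insert i I. G' k \<in> hpoly n (e + d)" using 1 2 by (auto simp: G'_def intro: hpoly_mult)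
  moreover have "eventually (\<lambda>y. ev (M * B) y \<noteq> 0 \<and> (\<forall>k\<in>insert i I. ev (G' k) y = ev (M * B) y * \<psi> k y)) (nb x)"
    using 1(5) 2(4)
  proof eventually_elim
    case (elim y)
    then show ?case using insert.hyps(2) by (auto simp: G'_def)
  qed
  ultimately show ?case using 1(1,3) 2(3) hpoly_mult[OF 1(2) 2(2)]
    by (intro exI[of _ "e + d"] exI[of _ "M * B"] exI[of _ G']) auto
qed

lemma rs_mult: "rs (p * q) y = rs p y * rs q y"
  by (simp add: rs_def)

text \<open>Products of a form of degree \<open>D\<close> on the curve with a monomial of degree \<open>Td\<close> in the
  coordinates \<open>a\<close> of the linear system; the exponents are bounded by \<open>B\<close> except that of \<open>a l\<close>,
  which is determined by homogeneity.\<close>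

definition bimon :: "nat set \<Rightarrow> nat \<Rightarrow> nat \<Rightarrow> nat \<Rightarrow> nat \<Rightarrow> (pt \<times> (nat \<Rightarrow> complex) \<Rightarrow> complex) set" where
  "bimon K l D B Td = {\<lambda>z. rs p (fst z) * ((\<Prod>k\<in>K. snd z k ^ \<beta> k) * snd z l ^ (Td - sum \<beta> K)) |p \<beta>.
     p \<in> hpoly n D \<and> (\<forall>k\<in>K. \<beta> k \<le> B) \<and> sum \<beta> K \<le> Td}"

lemma bimonI:
  "p \<in> hpoly n D \<Longrightarrow> (\<And>k. k \<in> K \<Longrightarrow> \<beta> k \<le> B) \<Longrightarrow> sum \<beta> K \<le> Td \<Longrightarrow>
   (\<And>z. f z = rs p (fst z) * ((\<Prod>k\<in>K. snd z k ^ \<beta> k) * snd z l ^ (Td - sum \<beta> K))) \<Longrightarrow> f \<in> bimon K l D B Td"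
  unfolding bimon_def by blast

lemma bimon_span_mult:
  assumes f: "f \<in> cfun.span (bimon K l D B Td)" and g: "g \<in> cfun.span (bimon K l D' B' Td')"
  shows "(\<lambda>z. f z * g z) \<in> cfun.span (bimon K l (D + D') (B + B') (Td + Td'))"
proof -
  have gen: "(\<lambda>z. s z * s' z) \<in> bimon K l (D + D') (B + B') (Td + Td')"
    if s: "s \<in> bimon K l D B Td" and s': "s' \<in> bimon K l D' B' Td'" for s s'
  proof -
    obtain p \<beta> where 1: "s = (\<lambda>z. rs p (fst z) * ((\<Prod>k\<in>K. snd z k ^ \<beta> k) * snd z l ^ (Td - sum \<beta> K)))"
      "p \<in> hpoly n D" "\<forall>k\<in>K. \<beta> k \<le> B" "sum \<beta> K \<le> Td" using s unfolding bimon_def by blast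
    obtain q \<gamma> where 2: "s' = (\<lambda>z. rs q (fst z) * ((\<Prod>k\<in>K. snd z k ^ \<gamma> k) * snd z l ^ (Td' - sum \<gamma> K)))"
      "q \<in> hpoly n D'" "\<forall>k\<in>K. \<gamma> k \<le> B'" "sum \<gamma> K \<le> Td'" using s' unfolding bimon_def by blast
    have e: "Td + Td' - sum (\<lambda>k. \<beta> k + \<gamma> k) K = (Td - sum \<beta> K) + (Td' - sum \<gamma> K)"
      using 1(4) 2(4) by (simp add: sum.distrib)
    show ?thesis
    proof (rule bimonI[of "p * q" _ K "\<lambda>k. \<beta> k + \<gamma> k"])
      show "s z * s' z = rs (p * q) (fst z) * ((\<Prod>k\<in>K. snd z k ^ (\<beta> k + \<gamma> k)) * snd z l ^ (Td + Td' - sum (\<lambda>k. \<beta> k + \<gamma> k) K))" for z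
        unfolding 1(1) 2(1) e by (simp add: rs_mult power_add prod.distrib mult_ac)
      show "\<beta> k + \<gamma> k \<le> B + B'" if "k \<in> K" for k using 1(3) 2(3) that by (simp add: add_mono)
      show "sum (\<lambda>k. \<beta> k + \<gamma> k) K \<le> Td + Td'" using 1(4) 2(4) by (simp add: sum.distrib)
    qed (rule hpoly_mult[OF 1(2) 2(2)])
  qed
  have "(\<lambda>z. g z * s z) \<in> cfun.span (bimon K l (D + D') (B + B') (Td + Td'))" if s: "s \<in> bimon K l D B Td" for s
  proof -
    have "(\<lambda>z. s z * g z) \<in> cfun.span (bimon K l (D + D') (B + B') (Td + Td'))"
      by (rule span_mult[OF cfun.span_base[OF gen[OF s]] g])
    then show ?thesis by (simp only: mult.commute)
  qed
  then have "(\<lambda>z. g z * f z) \<in> cfun.span (bimon K l (D + D') (B + B') (Td + Td'))"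
    by (rule span_mult[OF _ f])
  then show ?thesis by (simp only: mult.commute)
qed

text \<open>The factor \<open>rs 1\<close> is the indicator function of C; it matters for exponent
  0, because all members of \<open>bimon\<close> vanish off C.\<close>

lemma bimon_span_power:
  assumes f: "f \<in> cfun.span (bimon K l D B Td)"
  shows "(\<lambda>z. rs 1 (fst z) * f z ^ k) \<in> cfun.span (bimon K l (k * D) (k * B) (k * Td))"
proof (induction k)
  case 0
  have "(\<lambda>z. rs 1 (fst z) * f z ^ 0) \<in> bimon K l 0 0 0"
    by (rule bimonI[of 1 0 K "\<lambda>_. 0"]) (auto simp: one_hpoly)
  from cfun.span_base[OF this] show ?case unfolding mult_0 .
next
  case (Suc k)
  have "(\<lambda>z. f z * (rs 1 (fst z) * f z ^ k)) \<in> cfun.span (bimon K l (D + k * D) (B + k * B) (Td + k * Td))"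
    by (rule bimon_span_mult[OF f Suc])
  moreover have "(\<lambda>z. f z * (rs 1 (fst z) * f z ^ k)) = (\<lambda>z. rs 1 (fst z) * f z ^ Suc k)"
    by (auto simp: mult_ac)
  ultimately show ?case unfolding mult_Suc by (simp only:)
qed

text \<open>The exponent of the variable l is determined by the others, so only
  \<open>card K\<close> exponents are free.\<close>

lemma bimon_span_finite:
  assumes K: "finite K" and S: "finite S" "rs ` hpoly n D \<subseteq> cfun.span S"
  obtains S' where "finite S'" "card S' \<le> card S * Suc B ^ card K" "bimon K l D B Td \<subseteq> cfun.span S'"
proof -
  let ?f = "\<lambda>(s, \<beta>) z. ((\<Prod>k\<in>K. snd z k ^ \<beta> k) * snd z l ^ (Td - sum \<beta> K)) * s (fst z)"
  let ?P = "S \<times> (K \<rightarrow>\<^sub>E {..B})"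
  have P: "finite ?P" using S K by (intro finite_cartesian_product finite_PiE) auto
  have "card (?f ` ?P) \<le> card ?P" by (rule card_image_le[OF P])
  also have "card ?P = card S * Suc B ^ card K"
    using K by (simp add: card_cartesian_product card_PiE)
  finally have card: "card (?f ` ?P) \<le> card S * Suc B ^ card K" .
  have "bimon K l D B Td \<subseteq> cfun.span (?f ` ?P)"
  proof
    fix f assume "f \<in> bimon K l D B Td"
    then obtain p \<beta> where f: "f = (\<lambda>z. rs p (fst z) * ((\<Prod>k\<in>K. snd z k ^ \<beta> k) * snd z l ^ (Td - sum \<beta> K)))"
      "p \<in> hpoly n D" "\<forall>k\<in>K. \<beta> k \<le> B" unfolding bimon_def by blast
    let ?\<beta> = "restrict \<beta> K"
    have eq: "(\<Prod>k\<in>K. a k ^ ?\<beta> k) * a l ^ (Td - sum ?\<beta> K) = (\<Prod>k\<in>K. a k ^ \<beta> k) * a l ^ (Td - sum \<beta> K)" for a :: "nat \<Rightarrow> complex"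
      by simp
    have "(\<lambda>z. ((\<Prod>k\<in>K. snd z k ^ ?\<beta> k) * snd z l ^ (Td - sum ?\<beta> K)) * rs p (fst z)) \<in> cfun.span (?f ` ?P)"
    proof (rule span_mult[where f = "rs p" and \<pi> = fst and S = S])
      show "rs p \<in> cfun.span S" using S(2) f(2) by blast
      fix s assume "s \<in> S"
      then have "(s, ?\<beta>) \<in> ?P" using f(3) by auto
      then show "(\<lambda>z. ((\<Prod>k\<in>K. snd z k ^ ?\<beta> k) * snd z l ^ (Td - sum ?\<beta> K)) * s (fst z)) \<in> cfun.span (?f ` ?P)"
        by (intro cfun.span_base image_eqI[of _ _ "(s, ?\<beta>)"]) simp_all
    qed
    then show "f \<in> cfun.span (?f ` ?P)" unfolding f(1) eq by (simp only: mult.commute)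
  qed
  then show ?thesis using that[of "?f ` ?P"] P card by blast
qed

text \<open>Elimination of the point \<open>y\<close> by counting: substituting the expressions for \<open>a j\<close> and
  \<open>a k0\<close> maps the \<open>(m + 1)^N\<close> monomials of degree \<open>N m\<close> with bounded exponents into a space of
  dimension \<open>O(m^(N - 1))\<close>.\<close>

lemma elimination:
  assumes idx: "j \<le> N" "k0 \<le> N" "l \<le> N" "j \<noteq> k0" "l \<noteq> j" "l \<noteq> k0"
    and e: "e \<ge> 1" and H: "H \<in> hpoly n e" and P: "\<And>k. k \<le> N \<Longrightarrow> P k \<in> hpoly n e" and Q: "\<And>k. k \<le> N \<Longrightarrow> Q k \<in> hpoly n e"
  shows "\<exists>d. \<exists>F\<in>hpoly N d. F \<noteq> 0 \<and> (\<forall>y\<in>C. \<forall>a. ev H y \<noteq> 0 \<longrightarrow>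
    ev H y * a j = (\<Sum>k\<in>{..N} - {j, k0}. a k * ev (Q k) y) \<longrightarrow>
    ev H y * a k0 = (\<Sum>k\<in>{..N} - {j, k0}. a k * ev (P k) y) \<longrightarrow> peval F a = 0)"
proof -
  define K where "K = {..N} - {j, k0, l}"
  define J where "J = {..N} - {l}"
  have K: "finite K" "j \<notin> K" "k0 \<notin> K" "l \<notin> K" by (auto simp: K_def)
  have J: "finite J" "J = insert j (insert k0 K)" using idx by (auto simp: J_def K_def)
  have KL: "{..N} - {j, k0} = insert l K" using idx by (auto simp: K_def)
  have NJ: "{..N} = insert l J" "l \<notin> J" using idx by (auto simp: J_def)
  have cJ: "card J = N" using idx by (simp add: J_def)
  have cK: "card K = N - 2" using J K idx(4) cJ by simp
  have N2: "N \<ge> 2" using J K idx(4) cJ by simp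
  obtain c d0 where hf: "\<forall>d\<ge>d0. \<exists>S. finite S \<and> card S \<le> c * Suc d \<and> rs ` hpoly n d \<subseteq> cfun.span S"
    using hilbert_function_linear by blast
  \<comment> \<open>Up to constants \<open>card S\<close> is at most 2 c e (m + 1) and the exponents
    contribute 3^(N - 2) (m + 1)^(N - 2). Their product is at most m (m + 1)^(N - 1), which is less
    than (m + 1)^N.\<close>
  define m where "m = d0 + 2 * c * e * 3 ^ (N - 2)"
  define D where "D = 2 * m * e"
  have "m \<le> m * e" using e by simp
  then have "D \<ge> d0" unfolding D_def using m_def by linarith
  then obtain S where S: "finite S" "card S \<le> c * Suc D" "rs ` hpoly n D \<subseteq> cfun.span S" using hf by blast
  \<comment> \<open>A variable in K has exponent at most m in the monomial itself and gains at most
    m from each of the two substitutions.\<close>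
  obtain S' where S': "finite S'" "card S' \<le> card S * Suc (3 * m) ^ card K" "bimon K l D (3 * m) (N * m) \<subseteq> cfun.span S'"
    by (rule bimon_span_finite[OF K(1) S(1,3)])
  let ?box = "J \<rightarrow>\<^sub>E {..m}"
  have box: "finite ?box" using J(1) by (intro finite_PiE) auto
  have cbox: "card ?box = Suc m ^ N" using J(1) cJ by (simp add: card_PiE)
  have "card S' < card ?box"
  proof -
    have X: "(2 * c * e * X) * (3 * X) ^ k = (2 * c * e * 3 ^ k) * X ^ Suc k" for X k :: nat
      by (simp add: power_mult_distrib)
    have "1 * 1 \<le> 2 * e" using e by linarith
    then have "Suc D \<le> 2 * e * Suc m" by (simp add: D_def)
    then have "c * Suc D \<le> c * (2 * e * Suc m)" by (rule mult_le_mono2)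
    with S(2) have "card S \<le> 2 * c * e * Suc m" by (simp add: mult_ac)
    moreover have "Suc (3 * m) ^ (N - 2) \<le> (3 * Suc m) ^ (N - 2)" by (intro power_mono) auto
    ultimately have "card S * Suc (3 * m) ^ (N - 2) \<le> (2 * c * e * Suc m) * (3 * Suc m) ^ (N - 2)" by (rule mult_le_mono)
    also have "\<dots> = (2 * c * e * 3 ^ (N - 2)) * Suc m ^ (Suc (N - 2))" by (rule X)
    also have "\<dots> \<le> m * Suc m ^ (Suc (N - 2))" by (intro mult_le_mono1) (simp add: m_def)
    also have "\<dots> < Suc m * Suc m ^ (Suc (N - 2))" by (intro mult_strict_right_mono) auto
    also have "\<dots> = Suc m ^ Suc (Suc (N - 2))" by (simp only: power_Suc)
    also have "Suc (Suc (N - 2)) = N" using N2 by simp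
    finally show ?thesis using S'(2) unfolding cK cbox by simp
  qed
  \<comment> \<open>The exponent of the variable l that brings the total degree to N m.\<close>
  define t where "t \<alpha> = N * m - sum \<alpha> J" for \<alpha> :: "nat \<Rightarrow> nat"
  have sumJ: "sum \<alpha> J \<le> N * m" if "\<alpha> \<in> ?box" for \<alpha>
    using sum_bounded_above[of J \<alpha> m] that cJ by (auto simp: PiE_def Pi_def)
  have sumJ': "sum \<alpha> J = \<alpha> j + \<alpha> k0 + sum \<alpha> K" for \<alpha> :: "nat \<Rightarrow> nat"
    using J K idx(4) by simp
  define q where "q z = (\<Sum>k\<in>insert l K. snd z k * rs (Q k) (fst z))" for z :: "pt \<times> (nat \<Rightarrow> complex)"
  define p where "p z = (\<Sum>k\<in>insert l K. snd z k * rs (P k) (fst z))" for z :: "pt \<times> (nat \<Rightarrow> complex)"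
  define h where "h z = rs H (fst z)" for z :: "pt \<times> (nat \<Rightarrow> complex)"
  have lin: "(\<lambda>z. \<Sum>k\<in>insert l K. snd z k * rs (R k) (fst z)) \<in> cfun.span (bimon K l e 1 1)"
    if R: "\<And>k. k \<le> N \<Longrightarrow> R k \<in> hpoly n e" for R
  proof -
    have "(\<lambda>z. snd z k * rs (R k) (fst z)) \<in> cfun.span (bimon K l e 1 1)" if k: "k \<in> insert l K" for k
    proof (rule cfun.span_base, rule bimonI[of "R k" _ K "\<lambda>i. if i = k then 1 else 0"])
      show "R k \<in> hpoly n e" using k idx(3) by (intro R) (auto simp: K_def)
      have s: "(\<Sum>i\<in>K. if i = k then 1 else 0) = (if k \<in> K then 1 else (0::nat))" using K(1) by simp
      show "(\<Sum>i\<in>K. if i = k then 1 else 0) \<le> (1::nat)" unfolding s by simp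
      fix z :: "pt \<times> (nat \<Rightarrow> complex)"
      have "(\<Prod>i\<in>K. snd z i ^ (if i = k then 1 else 0)) = (\<Prod>i\<in>K. if i = k then snd z i else 1)" by (intro prod.cong) auto
      then have pr: "(\<Prod>i\<in>K. snd z i ^ (if i = k then 1 else 0)) = (if k \<in> K then snd z k else 1)" using K(1) by simp
      show "snd z k * rs (R k) (fst z) = rs (R k) (fst z) * ((\<Prod>i\<in>K. snd z i ^ (if i = k then 1 else 0)) *
        snd z l ^ (1 - (\<Sum>i\<in>K. if i = k then 1 else 0)))"
        unfolding s pr using k K(4) by auto
    qed auto
    then have "(\<Sum>k\<in>insert l K. (\<lambda>z. snd z k * rs (R k) (fst z))) \<in> cfun.span (bimon K l e 1 1)" by (rule cfun.span_sum)
    moreover have "(\<Sum>k\<in>insert l K. (\<lambda>z. snd z k * rs (R k) (fst z))) = (\<lambda>z. \<Sum>k\<in>insert l K. snd z k * rs (R k) (fst z))"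
      by (rule ext) (rule sum_fun_apply)
    ultimately show ?thesis by (simp only:)
  qed
  have qs: "q \<in> cfun.span (bimon K l e 1 1)" unfolding q_def[abs_def] by (rule lin) (rule Q)
  have ps: "p \<in> cfun.span (bimon K l e 1 1)" unfolding p_def[abs_def] by (rule lin) (rule P)
  have hs: "h \<in> cfun.span (bimon K l e 0 0)"
    by (rule cfun.span_base, rule bimonI[of H _ K "\<lambda>_. 0"]) (auto simp: H h_def)
  \<comment> \<open>The monomial with exponents \<alpha>, times the 2 m-th power of H, after
    substituting for the variables j and \<open>k0\<close>. The remaining power of H makes the
    degree on C independent of \<alpha>.\<close>
  define \<Phi> where "\<Phi> \<alpha> z = (rs 1 (fst z) * h z ^ (2 * m - \<alpha> j - \<alpha> k0)) * (rs 1 (fst z) * q z ^ \<alpha> j) *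
    (rs 1 (fst z) * p z ^ \<alpha> k0) * (rs 1 (fst z) * ((\<Prod>k\<in>K. snd z k ^ \<alpha> k) * snd z l ^ t \<alpha>))" for \<alpha> z
  have "\<Phi> \<alpha> \<in> cfun.span S'" if \<alpha>: "\<alpha> \<in> ?box" for \<alpha>
  proof -
    have am: "\<alpha> k \<le> m" if "k \<in> J" for k using \<alpha> that by (auto simp: PiE_def Pi_def)
    have "(\<lambda>z. rs 1 (fst z) * ((\<Prod>k\<in>K. snd z k ^ \<alpha> k) * snd z l ^ t \<alpha>)) \<in> bimon K l 0 m (sum \<alpha> K + t \<alpha>)"
      by (rule bimonI[of 1 0 K \<alpha>]) (use am J(2) one_hpoly in auto)
    from bimon_span_mult[OF bimon_span_mult[OF bimon_span_mult[OF bimon_span_power[OF hs, of "2 * m - \<alpha> j - \<alpha> k0"]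
        bimon_span_power[OF qs, of "\<alpha> j"]] bimon_span_power[OF ps, of "\<alpha> k0"]] cfun.span_base[OF this]]
    have 1: "\<Phi> \<alpha> \<in> cfun.span (bimon K l ((2 * m - \<alpha> j - \<alpha> k0) * e + \<alpha> j * e + \<alpha> k0 * e + 0)
      ((2 * m - \<alpha> j - \<alpha> k0) * 0 + \<alpha> j * 1 + \<alpha> k0 * 1 + m)
      ((2 * m - \<alpha> j - \<alpha> k0) * 0 + \<alpha> j * 1 + \<alpha> k0 * 1 + (sum \<alpha> K + t \<alpha>)))"
      unfolding \<Phi>_def[abs_def] .
    have ajk: "\<alpha> j \<le> m" "\<alpha> k0 \<le> m" using am J(2) by auto
    have D': "(2 * m - \<alpha> j - \<alpha> k0) * e + \<alpha> j * e + \<alpha> k0 * e + 0 = D"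
      unfolding D_def using ajk by (simp flip: distrib_right)
    have Td': "(2 * m - \<alpha> j - \<alpha> k0) * 0 + \<alpha> j * 1 + \<alpha> k0 * 1 + (sum \<alpha> K + t \<alpha>) = N * m"
      using sumJ[OF \<alpha>] sumJ'[of \<alpha>] by (simp add: t_def)
    have "bimon K l D ((2 * m - \<alpha> j - \<alpha> k0) * 0 + \<alpha> j * 1 + \<alpha> k0 * 1 + m) (N * m) \<subseteq> bimon K l D (3 * m) (N * m)"
      unfolding bimon_def using ajk by fastforce
    from cfun.span_mono[OF this] 1 have "\<Phi> \<alpha> \<in> cfun.span (bimon K l D (3 * m) (N * m))"
      unfolding D' Td' by blast
    moreover have "cfun.span (bimon K l D (3 * m) (N * m)) \<subseteq> cfun.span S'"
      using S'(3) by (intro cfun.span_minimal) auto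
    ultimately show ?thesis by blast
  qed
  then obtain \<gamma> where \<gamma>: "\<exists>\<alpha>\<in>?box. \<gamma> \<alpha> \<noteq> 0" "\<And>z. (\<Sum>\<alpha>\<in>?box. \<gamma> \<alpha> * \<Phi> \<alpha> z) = 0"
    using family_dependent[OF box S'(1) \<open>card S' < card ?box\<close>, of \<Phi>] by blast
  define xp where "xp \<alpha> k = (if k = l then t \<alpha> else \<alpha> k)" for \<alpha> :: "nat \<Rightarrow> nat" and k
  define E where "E \<alpha> = (\<Sum>k\<le>N. Poly_Mapping.single k (xp \<alpha> k))" for \<alpha>
  have lE: "Poly_Mapping.lookup (E \<alpha>) k = (if k \<le> N then xp \<alpha> k else 0)" for \<alpha> k
  proof -
    have "Poly_Mapping.lookup (E \<alpha>) k = (\<Sum>i\<le>N. if i = k then xp \<alpha> i else 0)"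
      by (simp add: E_def lookup_sum lookup_single when_def)
    then show ?thesis by simp
  qed
  have kE: "Poly_Mapping.keys (E \<alpha>) \<subseteq> {..N}" for \<alpha> by (auto simp: in_keys_iff lE split: if_splits)
  have mE: "meval (E \<alpha>) a = a j ^ \<alpha> j * a k0 ^ \<alpha> k0 * ((\<Prod>k\<in>K. a k ^ \<alpha> k) * a l ^ t \<alpha>)" for \<alpha> a
  proof -
    have "meval (E \<alpha>) a = (\<Prod>k\<le>N. a k ^ xp \<alpha> k)" by (simp add: meval_superset[OF _ kE] lE)
    also have "\<dots> = a l ^ xp \<alpha> l * (a j ^ xp \<alpha> j * (a k0 ^ xp \<alpha> k0 * (\<Prod>k\<in>K. a k ^ xp \<alpha> k)))"
      unfolding NJ(1) using NJ(2) J K idx by simp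
    also have "(\<Prod>k\<in>K. a k ^ xp \<alpha> k) = (\<Prod>k\<in>K. a k ^ \<alpha> k)" using K(4) by (intro prod.cong) (auto simp: xp_def)
    finally show ?thesis using idx by (simp add: xp_def mult_ac)
  qed
  have degE: "mdeg (E \<alpha>) = N * m" if "\<alpha> \<in> ?box" for \<alpha>
  proof -
    have "mdeg (E \<alpha>) = (\<Sum>k\<le>N. xp \<alpha> k)" by (simp add: mdeg_superset[OF _ kE] lE)
    also have "\<dots> = xp \<alpha> l + (\<Sum>k\<in>J. xp \<alpha> k)" unfolding NJ(1) using NJ(2) J(1) by simp
    also have "(\<Sum>k\<in>J. xp \<alpha> k) = sum \<alpha> J" using NJ(2) by (intro sum.cong) (auto simp: xp_def)
    finally show ?thesis using sumJ[OF that] by (simp add: xp_def t_def)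
  qed
  have injE: "\<alpha> = \<beta>" if "\<alpha> \<in> ?box" "\<beta> \<in> ?box" "E \<alpha> = E \<beta>" for \<alpha> \<beta>
  proof (rule PiE_ext[OF that(1,2)])
    fix k assume "k \<in> J"
    then have "k \<le> N" "k \<noteq> l" by (auto simp: J_def)
    then show "\<alpha> k = \<beta> k" using lE[of \<alpha> k] lE[of \<beta> k] that(3) by (simp add: xp_def)
  qed
  define F where "F = (\<Sum>\<alpha>\<in>?box. Poly_Mapping.single (E \<alpha>) (\<gamma> \<alpha>))"
  have Fh: "F \<in> hpoly N (N * m)" unfolding F_def by (intro hpoly_sum hpoly_single degE kE)
  have "F \<noteq> 0"
  proof
    assume "F = 0"
    obtain \<alpha> where \<alpha>: "\<alpha> \<in> ?box" "\<gamma> \<alpha> \<noteq> 0" using \<gamma>(1) by blast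
    have "Poly_Mapping.lookup F (E \<alpha>) = (\<Sum>\<beta>\<in>?box. if \<beta> = \<alpha> then \<gamma> \<beta> else 0)"
      unfolding F_def lookup_sum lookup_single when_def using injE \<alpha>(1) by (intro sum.cong) auto
    also have "\<dots> = \<gamma> \<alpha>" using box \<alpha>(1) by simp
    finally show False using \<open>F = 0\<close> \<alpha>(2) by simp
  qed
  moreover have "peval F a = 0"
    if y: "y \<in> C" and Hy: "ev H y \<noteq> 0" and aj: "ev H y * a j = (\<Sum>k\<in>{..N} - {j, k0}. a k * ev (Q k) y)"
      and ak: "ev H y * a k0 = (\<Sum>k\<in>{..N} - {j, k0}. a k * ev (P k) y)" for y a
  proof -
    have qp: "q (y, a) = ev H y * a j" "p (y, a) = ev H y * a k0" "h (y, a) = ev H y"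
      unfolding q_def p_def h_def aj ak KL using y by (simp_all add: rs_def)
    have "ev H y ^ (2 * m) * peval F a = (\<Sum>\<alpha>\<in>?box. \<gamma> \<alpha> * \<Phi> \<alpha> (y, a))"
      unfolding F_def peval_sum peval_single sum_distrib_left
    proof (intro sum.cong refl)
      fix \<alpha> assume \<alpha>: "\<alpha> \<in> ?box"
      then have "\<alpha> j \<le> m" "\<alpha> k0 \<le> m" using J(2) by (auto simp: PiE_def Pi_def)
      then have "2 * m = (2 * m - \<alpha> j - \<alpha> k0) + \<alpha> j + \<alpha> k0" by simp
      then have "ev H y ^ (2 * m) = ev H y ^ (2 * m - \<alpha> j - \<alpha> k0) * ev H y ^ \<alpha> j * ev H y ^ \<alpha> k0" by (metis power_add)
      then show "ev H y ^ (2 * m) * (\<gamma> \<alpha> * meval (E \<alpha>) a) = \<gamma> \<alpha> * \<Phi> \<alpha> (y, a)"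
        using y unfolding \<Phi>_def qp mE by (simp add: rs_def power_mult_distrib mult_ac)
    qed
    then show ?thesis using \<gamma>(2) Hy by simp
  qed
  ultimately show ?thesis using Fh by blast
qed

end

section \<open>Equations of the discriminant and the converse direction\<close>

context linear_system
begin

text \<open>A section that is zero at general points of one chart is zero in every chart, so it is a
  linear relation between basis elements.\<close>

lemma sections_independent:
  assumes i: "i \<in> idx L" "x \<in> chart L i" and 0: "eventually (\<lambda>y. sec a i y = 0) gen" and k: "k \<le> N"
  shows "a k = 0"
proof (rule ccontr)
  assume ak: "a k \<noteq> 0"
  have "sec a j z = 0" for j z
  proof (cases "j \<in> idx L \<and> z \<in> chart L j")
    case True
    then have j: "j \<in> idx L" "z \<in> chart L j" by auto
    have z: "z \<in> C" by (rule chart_C[OF j])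
    have "eventually (\<lambda>y. sec a j y = 0) gen"
      using 0 nbD(2)[OF chart_nb[OF i]] nbD(2)[OF chart_nb[OF j]]
      by eventually_elim (use sec_trans[OF j(1) i(1)] in simp)
    then show ?thesis using lr_eq[OF z sec_lr[OF j] lr_const[OF z]] by simp
  next
    case False
    then show ?thesis unfolding sec_def by (intro sum.neutral) (auto simp: b_outside)
  qed
  then have z: "(\<Sum>k\<le>N. cscale (a k) (b k)) = 0" using sec_apply by (auto simp: fun_eq_iff)
  have inj: "inj_on b {..N}" and ind: "cfun.independent (b ` {..N})" using basis unfolding basis_of_def by auto
  let ?u = "\<lambda>v. a (inv_into {..N} b v)"
  have "(\<Sum>v\<in>b ` {..N}. cscale (?u v) v) = (\<Sum>k\<le>N. cscale (a k) (b k))"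
    unfolding sum.reindex[OF inj] by (intro sum.cong) (auto simp: inv_into_f_f[OF inj])
  then have "(\<Sum>v\<in>b ` {..N}. cscale (?u v) v) = 0" using z by (rule trans)
  moreover have "?u (b k) \<noteq> 0" using ak k by (simp add: inv_into_f_f[OF inj])
  ultimately have "cfun.dependent (b ` {..N})"
    unfolding cfun.dependent_finite[OF finite_imageI[OF finite_atMost]] using k by (intro exI[of _ ?u]) auto
  then show False using ind by simp
qed

text \<open>A local frame: near \<open>x\<close> the singularity of a section at \<open>y\<close> is expressed by two linear
  equations with regular coefficients.\<close>

definition is_frame :: "pt \<Rightarrow> 'i \<Rightarrow> nat \<Rightarrow> (pt \<Rightarrow> complex) \<Rightarrow> (nat \<Rightarrow> pt \<Rightarrow> complex) \<Rightarrow> bool" where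
  "is_frame x i j u g \<longleftrightarrow> i \<in> idx L \<and> x \<in> chart L i \<and> j \<le> N \<and> b j (i, x) \<noteq> 0 \<and>
    (\<forall>k\<le>N. fr i j k \<in> lr x) \<and> (\<forall>k\<le>N. g k \<in> lr x) \<and>
    eventually (\<lambda>y. y \<in> chart L i \<and> b j (i, y) \<noteq> 0 \<and> y \<in> C \<and> fr i j j y = 1 \<and> g j y = 0 \<and> dv y u \<noteq> 0 \<and>
       (\<forall>k\<in>{..N}. dv y (fr i j k) = g k y * dv y u)) (nb x) \<and>
    eventually (\<lambda>y. \<forall>a. Sing a y \<longleftrightarrow> (\<Sum>k\<le>N. a k * fr i j k y) = 0 \<and> (\<Sum>k\<le>N. a k * g k y) = 0) (nb x)"

lemma is_frameD:
  assumes "is_frame x i j u g"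
  shows "i \<in> idx L" "x \<in> chart L i" "j \<le> N" "b j (i, x) \<noteq> 0"
    "k \<le> N \<Longrightarrow> fr i j k \<in> lr x" "k \<le> N \<Longrightarrow> g k \<in> lr x"
    "eventually (\<lambda>y. y \<in> chart L i \<and> b j (i, y) \<noteq> 0 \<and> y \<in> C \<and> fr i j j y = 1 \<and> g j y = 0 \<and> dv y u \<noteq> 0 \<and>
       (\<forall>k\<in>{..N}. dv y (fr i j k) = g k y * dv y u)) (nb x)"
    "eventually (\<lambda>y. \<forall>a. Sing a y \<longleftrightarrow> (\<Sum>k\<le>N. a k * fr i j k y) = 0 \<and> (\<Sum>k\<le>N. a k * g k y) = 0) (nb x)"
  using assms unfolding is_frame_def by simp_all

lemma frame_exists:
  assumes x: "x \<in> C"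
  obtains i j u g where "is_frame x i j u g"
proof -
  obtain i where i: "i \<in> idx L" "x \<in> chart L i" using chart_exists[OF x] by blast
  obtain j where j: "j \<le> N" "b j (i, x) \<noteq> 0" using base_point_free[OF i] by blast
  have f: "fr i j k \<in> lr x" if "k \<le> N" for k by (rule fr_lr[OF i j that])
  obtain u where u: "unif x u" using unif_exists[OF x] by blast
  have "\<forall>k\<in>{..N}. \<exists>g. g \<in> lr x \<and> eventually (\<lambda>y. dv y (fr i j k) = g y * dv y u) (nb x)"
  proof
    fix k assume "k \<in> {..N}"
    then have "fr i j k \<in> lr x" using f by simp
    then obtain g where "g \<in> lr x" "eventually (\<lambda>y. dv y (fr i j k) = g y * dv y u) (nb x)"
      by (rule unif_derivative[OF x u])
    then show "\<exists>g. g \<in> lr x \<and> eventually (\<lambda>y. dv y (fr i j k) = g y * dv y u) (nb x)" by (intro exI[of _ g] conjI)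
  qed
  from bchoice[OF this] obtain g where
    g: "\<forall>k\<in>{..N}. g k \<in> lr x \<and> eventually (\<lambda>y. dv y (fr i j k) = g k y * dv y u) (nb x)" ..
  have gev: "eventually (\<lambda>y. \<forall>k\<in>{..N}. dv y (fr i j k) = g k y * dv y u) (nb x)"
    using g by (intro eventually_ball_finite) auto
  have fj: "eventually (\<lambda>y. fr i j j y = 1) (nb x)" using frame_near[OF i j] by eventually_elim (simp add: fr_def)
  have near: "eventually (\<lambda>y. y \<in> chart L i \<and> b j (i, y) \<noteq> 0 \<and> y \<in> C \<and> fr i j j y = 1 \<and> g j y = 0 \<and> dv y u \<noteq> 0 \<and>
       (\<forall>k\<in>{..N}. dv y (fr i j k) = g k y * dv y u)) (nb x)"
    using frame_near[OF i j] nb_nb[OF fj] lr_near[OF x f[OF j(1)]] gev unif_unramified_near[OF x u]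
  proof eventually_elim
    case (elim y)
    have "dv y (fr i j j) = 0"
      using dv_germ[of y "fr i j j" "\<lambda>_. 1"] dv_const[of y 1] elim by simp
    moreover have "dv y (fr i j j) = g j y * dv y u" using elim(4) j(1) by blast
    ultimately have "g j y = 0" using elim(5) by simp
    then show ?case using elim nbD(1)[OF elim(2)] by blast
  qed
  then have "eventually (\<lambda>y. \<forall>a. Sing a y \<longleftrightarrow> (\<Sum>k\<le>N. a k * fr i j k y) = 0 \<and> (\<Sum>k\<le>N. a k * g k y) = 0) (nb x)"
  proof eventually_elim
    case (elim y)
    have "(\<Sum>k\<le>N. a k * dv y (fr i j k)) = (\<Sum>k\<le>N. a k * g k y) * dv y u" for a
      unfolding sum_distrib_right using elim by (intro sum.cong) auto
    then show ?case using Sing_frame[OF i(1) _ j(1)] elim by auto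
  qed
  then have "is_frame x i j u g" unfolding is_frame_def using i j f g near by simp
  then show ?thesis by (rule that)
qed

lemma sec_unit: "k \<le> N \<Longrightarrow> sec (\<lambda>m. if m = k then s else 0) i y = s * b k (i, y)"
  unfolding sec_def by (simp add: if_distrib[of "\<lambda>z. z * _"] cong: if_cong)

lemma discriminant_form_generic:
  assumes N: "N \<ge> 1"
  shows "\<exists>d. \<exists>F\<in>hpoly N d. F \<noteq> 0 \<and> eventually (\<lambda>y. \<forall>a. a \<noteq> 0 \<longrightarrow> (\<forall>k>N. a k = 0) \<longrightarrow> Sing a y \<longrightarrow> peval F a = 0) gen"
proof -
  obtain x where x: "x \<in> C" using infiniteC by fastforce
  obtain i j u g where fr: "is_frame x i j u g" by (rule frame_exists[OF x])
  note i = is_frameD(1,2)[OF fr] and j = is_frameD(3,4)[OF fr] and f = is_frameD(5)[OF fr]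
    and g = is_frameD(6)[OF fr] and near = is_frameD(7)[OF fr] and sing = is_frameD(8)[OF fr]
  define k0 where "k0 = (if j = 0 then 1 else 0 :: nat)"
  have k0: "k0 \<le> N" "k0 \<noteq> j" using N by (auto simp: k0_def)
  \<comment> \<open>Otherwise the coordinate \<open>k0\<close> of \<phi> would be constant and
    \<open>b k0\<close> proportional to \<open>b j\<close>.\<close>
  have gk0: "eventually (\<lambda>y. g k0 y \<noteq> 0) gen"
  proof (rule ccontr)
    assume "\<not> ?thesis"
    then have "eventually (\<lambda>y. g k0 y = 0) (nb x)" using lr_dichotomy[OF x g[OF k0(1)]] by blast
    with near have "eventually (\<lambda>y. dv y (fr i j k0) = 0) (nb x)" by eventually_elim (use k0(1) in auto)
    from derivative_zero_const[OF x f[OF k0(1)] nbD(2)[OF this]]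
    have c: "eventually (\<lambda>y. fr i j k0 y = fr i j k0 x) (nb x)" .
    define a where "a = (\<lambda>m. (if m = k0 then 1 else 0) + - fr i j k0 x * (if m = j then 1 else (0::complex)))"
    have "eventually (\<lambda>y. sec a i y = 0) gen" using nbD(2)[OF c] nbD(2)[OF near]
    proof eventually_elim
      case (elim y)
      have "b k0 (i, y) = fr i j k0 x * b j (i, y)" using elim by (simp add: fr_def field_simps)
      then show ?case unfolding a_def sec_linear sec_unit[OF k0(1)] sec_unit[OF j(1)] by simp
    qed
    then have "a k0 = 0" by (rule sections_independent[OF i _ k0(1)])
    then show False using k0(2) by (simp add: a_def)
  qed
  define K where "K = {..N} - {j, k0}"
  have K: "finite K" "j \<notin> K" "k0 \<notin> K" by (auto simp: K_def)
  have NK: "{..N} = insert j (insert k0 K)" using j(1) k0(1) by (auto simp: K_def)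
  have split: "(\<Sum>k\<le>N. c k * h k) = c j * h j + (c k0 * h k0 + (\<Sum>k\<in>K. c k * h k))" for c h :: "nat \<Rightarrow> complex"
    unfolding NK using K k0(2) by simp
  \<comment> \<open>The two singularity equations are solved for the coordinates \<open>k0\<close>
    and j, with common denominator \<open>g k0\<close>.\<close>
  have solve: "eventually (\<lambda>y. \<forall>a. Sing a y \<longrightarrow> g k0 y * a k0 = (\<Sum>k\<in>K. a k * - g k y) \<and>
      g k0 y * a j = (\<Sum>k\<in>K. a k * (g k y * fr i j k0 y - fr i j k y * g k0 y))) gen"
    using nbD(2)[OF near] nbD(2)[OF sing]
  proof eventually_elim
    case (elim y)
    show ?case
    proof (intro allI impI)
      fix a assume "Sing a y"
      then have s: "(\<Sum>k\<le>N. a k * fr i j k y) = 0" "(\<Sum>k\<le>N. a k * g k y) = 0" using elim(2) by auto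
      have 1: "a k0 * g k0 y + (\<Sum>k\<in>K. a k * g k y) = 0" using s(2) elim(1) unfolding split by simp
      then have k: "g k0 y * a k0 = (\<Sum>k\<in>K. a k * - g k y)" by (simp add: sum_negf mult.commute add_eq_0_iff2)
      have "a j + (a k0 * fr i j k0 y + (\<Sum>k\<in>K. a k * fr i j k y)) = 0"
        using s(1) elim(1) unfolding split by simp
      then have aj: "a j = - (a k0 * fr i j k0 y + (\<Sum>k\<in>K. a k * fr i j k y))" by (simp only: eq_neg_iff_add_eq_0)
      have "g k0 y * a j = - (g k0 y * a k0) * fr i j k0 y - g k0 y * (\<Sum>k\<in>K. a k * fr i j k y)"
        unfolding aj by (simp only: ring_distribs mult_minus_right mult_minus_left mult.assoc minus_add_distrib diff_conv_add_uminus)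
      also have "\<dots> = (\<Sum>k\<in>K. a k * (g k y * fr i j k0 y - fr i j k y * g k0 y))"
        unfolding k by (simp add: sum_negf sum_distrib_left sum_distrib_right sum_subtractf algebra_simps)
      finally show "g k0 y * a k0 = (\<Sum>k\<in>K. a k * - g k y) \<and>
        g k0 y * a j = (\<Sum>k\<in>K. a k * (g k y * fr i j k0 y - fr i j k y * g k0 y))" using k by blast
    qed
  qed
  show ?thesis
  proof (cases "K = {}")
    case True
    \<comment> \<open>Here N = 1, and a general point carries no nonzero singular section, so the
      constant form 1 vanishes vacuously.\<close>
    have "eventually (\<lambda>y. \<forall>a. a \<noteq> 0 \<longrightarrow> (\<forall>k>N. a k = 0) \<longrightarrow> Sing a y \<longrightarrow> peval 1 a = 0) gen"
      using solve gk0
    proof eventually_elim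
      case (elim y)
      have "a = 0" if "\<forall>k>N. a k = 0" "Sing a y" for a
      proof
        fix k
        have "g k0 y * a k0 = 0 \<and> g k0 y * a j = 0" using elim(1) that(2) unfolding True sum.empty by blast
        then have "a k0 = 0" "a j = 0" using elim(2) by simp_all
        moreover have "k = j \<or> k = k0" if "k \<le> N"
        proof -
          have "k \<in> insert j (insert k0 K)" unfolding NK[symmetric] using that by simp
          then show ?thesis unfolding True by simp
        qed
        ultimately show "a k = 0 k" using \<open>\<forall>k>N. a k = 0\<close> by (cases "k \<le> N") auto
      qed
      then show ?case by blast
    qed
    then show ?thesis using one_hpoly[of N] by (intro exI[of _ 0] bexI[of _ 1]) auto
  next
    case False
    then obtain l where l: "l \<le> N" "l \<noteq> j" "l \<noteq> k0" by (auto simp: K_def)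
    \<comment> \<open>The first index selects the numerators for the coordinate \<open>k0\<close>
      (0), those for j (1), or the denominator (2), so that one call of
      \<open>common_denominator\<close> treats all three.\<close>
    define \<psi> where "\<psi> s k = (if s = 0 then (\<lambda>y. - g k y)
      else if s = 1 then (\<lambda>y. g k y * fr i j k0 y - fr i j k y * g k0 y) else g k0)" for s k :: nat
    have \<psi>: "\<psi> (fst p) (snd p) \<in> lr x" if "p \<in> {..2} \<times> {..N}" for p
      using that k0 unfolding \<psi>_def by (auto intro!: lr_uminus lr_diff lr_mult x f g)
    obtain e M G where G: "e \<ge> 1" "M \<in> hpoly n e" "ev M x \<noteq> 0" "\<forall>p\<in>{..2} \<times> {..N}. G p \<in> hpoly n e"
      "eventually (\<lambda>y. ev M y \<noteq> 0 \<and> (\<forall>p\<in>{..2} \<times> {..N}. ev (G p) y = ev M y * \<psi> (fst p) (snd p) y)) (nb x)"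
      using common_denominator[OF x, of "{..2} \<times> {..N}" "\<lambda>p. \<psi> (fst p) (snd p)"] \<psi> by auto
    obtain d F where F: "F \<in> hpoly N d" "F \<noteq> 0" and van: "\<forall>y\<in>C. \<forall>a. ev (G (2, 0)) y \<noteq> 0 \<longrightarrow>
      ev (G (2, 0)) y * a j = (\<Sum>k\<in>{..N} - {j, k0}. a k * ev (G (1, k)) y) \<longrightarrow>
      ev (G (2, 0)) y * a k0 = (\<Sum>k\<in>{..N} - {j, k0}. a k * ev (G (0, k)) y) \<longrightarrow> peval F a = 0"
      using elimination[OF j(1) k0(1) l(1) k0(2)[symmetric] l(2,3) G(1), of "G (2, 0)" "\<lambda>k. G (0, k)" "\<lambda>k. G (1, k)"] G(4) by auto
    have "eventually (\<lambda>y. \<forall>a. a \<noteq> 0 \<longrightarrow> (\<forall>k>N. a k = 0) \<longrightarrow> Sing a y \<longrightarrow> peval F a = 0) gen"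
      using solve gk0 nbD(2)[OF G(5)] gen_C
    proof eventually_elim
      case (elim y)
      have ev2: "ev (G (2, 0)) y = ev M y * g k0 y" using elim(3) by (auto simp: \<psi>_def)
      have ev01: "ev (G (0, k)) y = ev M y * - g k y" "ev (G (1, k)) y = ev M y * (g k y * fr i j k0 y - fr i j k y * g k0 y)"
        if "k \<in> K" for k
      proof -
        have "(0, k) \<in> {..2::nat} \<times> {..N}" "(1, k) \<in> {..2::nat} \<times> {..N}" using that by (auto simp: K_def)
        then have "ev (G (0, k)) y = ev M y * \<psi> 0 k y" "ev (G (1, k)) y = ev M y * \<psi> 1 k y" using elim(3) by force+
        then show "ev (G (0, k)) y = ev M y * - g k y" "ev (G (1, k)) y = ev M y * (g k y * fr i j k0 y - fr i j k y * g k0 y)"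
          by (simp_all add: \<psi>_def)
      qed
      have "peval F a = 0" if "Sing a y" for a
      proof -
        have s: "g k0 y * a k0 = (\<Sum>k\<in>K. a k * - g k y)"
          "g k0 y * a j = (\<Sum>k\<in>K. a k * (g k y * fr i j k0 y - fr i j k y * g k0 y))" using elim(1) that by blast+
        have "ev (G (2, 0)) y * a j = (\<Sum>k\<in>K. a k * ev (G (1, k)) y)"
          unfolding ev2 mult.assoc s(2) sum_distrib_left by (intro sum.cong refl) (simp only: ev01 mult.left_commute)
        moreover have "ev (G (2, 0)) y * a k0 = (\<Sum>k\<in>K. a k * ev (G (0, k)) y)"
          unfolding ev2 mult.assoc s(1) sum_distrib_left by (intro sum.cong refl) (simp only: ev01 mult.left_commute)
        moreover have "ev (G (2, 0)) y \<noteq> 0" unfolding ev2 using elim(2,3) by simp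
        ultimately show ?thesis using van elim(4) unfolding K_def by blast
      qed
      then show ?case by blast
    qed
    then show ?thesis using F by blast
  qed
qed

text \<open>At each of the finitely many exceptional points singular sections satisfy one linear
  equation, namely that they vanish there. The generic form is multiplied by these linear
  forms.\<close>

lemma discriminant_form:
  assumes N: "N \<ge> 1"
  shows "\<exists>d. \<exists>F\<in>hpoly N d. F \<noteq> 0 \<and>
    (\<forall>x\<in>C. \<forall>a. a \<noteq> 0 \<longrightarrow> (\<forall>k>N. a k = 0) \<longrightarrow> Sing a x \<longrightarrow> peval F a = 0)"
proof -
  let ?good = "\<lambda>F y. \<forall>a. a \<noteq> 0 \<longrightarrow> (\<forall>k>N. a k = 0) \<longrightarrow> Sing a y \<longrightarrow> peval F a = 0"
  obtain d F where F: "F \<in> hpoly N d" "F \<noteq> 0" "eventually (?good F) gen"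
    using discriminant_form_generic[OF N] by blast
  define E where "E = {y \<in> C. \<not> ?good F y}"
  have E: "finite E" using F(3) unfolding eventually_gen E_def .
  have "\<forall>x\<in>E. \<exists>l. linform N l \<noteq> 0 \<and> (\<forall>a. Sing a x \<longrightarrow> peval (linform N l) a = 0)"
  proof
    fix x assume "x \<in> E"
    then have "x \<in> C" by (simp add: E_def)
    then obtain i where i: "i \<in> idx L" "x \<in> chart L i" using chart_exists by blast
    obtain k where k: "k \<le> N" "b k (i, x) \<noteq> 0" using base_point_free[OF i] by blast
    have s: "peval (linform N (\<lambda>k. b k (i, x))) a = sec a i x" for a by (simp add: sec_def mult.commute)
    have "peval (linform N (\<lambda>k. b k (i, x))) (\<lambda>m. if m = k then 1 else 0) \<noteq> 0"
      unfolding s sec_unit[OF k(1)] using k(2) by simp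
    then have "linform N (\<lambda>k. b k (i, x)) \<noteq> 0" by (metis peval_zero)
    then show "\<exists>l. linform N l \<noteq> 0 \<and> (\<forall>a. Sing a x \<longrightarrow> peval (linform N l) a = 0)"
      using s Sing_chart[OF i] by (intro exI[of _ "\<lambda>k. b k (i, x)"]) auto
  qed
  from bchoice[OF this] obtain l where l: "\<forall>x\<in>E. linform N (l x) \<noteq> 0 \<and> (\<forall>a. Sing a x \<longrightarrow> peval (linform N (l x)) a = 0)" ..
  let ?P = "\<Prod>x\<in>E. linform N (l x)"
  have "(\<Prod>x\<in>E'. linform N (l x)) \<in> hpoly N (card E')" if "finite E'" for E'
    using that
  proof (induction E')
    case (insert z Z)
    then show ?case using hpoly_mult[OF linform_hpoly[of N "l z"] insert.IH] by simp
  qed (simp add: one_hpoly)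
  then have "F * ?P \<in> hpoly N (d + card E)" using hpoly_mult[OF F(1)] E by blast
  moreover have "F * ?P \<noteq> 0" using F(2) l E by (auto simp: prod_zero_iff)
  moreover have "peval (F * ?P) a = 0" if "x \<in> C" "a \<noteq> 0" "\<forall>k>N. a k = 0" "Sing a x" for x a
  proof (cases "x \<in> E")
    case True
    then have "peval (linform N (l x)) a = 0" using l that(4) by blast
    then have "peval ?P a = 0" unfolding peval_prod using E True by (intro prod_zero bexI[of _ x])
    then show ?thesis by (simp only: peval_mult mult_zero_right)
  next
    case False
    then have "peval F a = 0" using that by (auto simp: E_def)
    then show ?thesis by (simp only: peval_mult mult_zero_left)
  qed
  ultimately show ?thesis by blast
qed

text \<open>Divide an equation of the discriminant by the linear form \<open>l\<close> of the hyperplane of sections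
  through \<open>x0\<close> as often as possible: the quotient still vanishes on the rest of the discriminant.\<close>

lemma discriminant_in_hyperplane:
  assumes N: "N \<ge> 1" and irr: "irreducible_in (zariski N) (discriminant n C L b N)"
    and i0: "i0 \<in> idx L" "x0 \<in> chart L i0" and r: "ram x0"
    and x: "x \<in> C" and a: "\<forall>k>N. a k = 0" "Sing a x"
  shows "sec a i0 x0 = 0"
proof -
  define l where "l k = b k (i0, x0)" for k
  have pl: "peval (linform N l) v = sec v i0 x0" for v by (simp add: sec_def l_def mult.commute)
  have x0: "x0 \<in> C" by (rule chart_C[OF i0])
  have dsc: "hpoint v \<in> discriminant n C L b N" if "v \<noteq> 0" "\<forall>k>N. v k = 0" "x \<in> C" "Sing v x" for v x
    by (rule discriminant_hpoint[OF that(1) _ that(3,4)]) (use that(2) in blast)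
  have evz: "ev p (hpoint v) = 0 \<longleftrightarrow> peval p v = 0" if "v \<noteq> 0" "\<forall>k>N. v k = 0" "p \<in> hpoly N e" for p v e
    by (rule ev_hpoint_zero_iff[OF that(1) _ that(3)]) (use that(2) in blast)
  obtain j where j: "j \<le> N" "l j \<noteq> 0" using base_point_free[OF i0] unfolding l_def by blast
  \<comment> \<open>Vanishing is required only off the hyperplane l = 0. A form of least degree with
    this property is not divisible by l.\<close>
  let ?Q = "\<lambda>d. \<exists>F\<in>hpoly N d. F \<noteq> 0 \<and> (\<forall>x\<in>C. \<forall>a. a \<noteq> 0 \<longrightarrow> (\<forall>k>N. a k = 0) \<longrightarrow> Sing a x \<longrightarrow>
    peval F a = 0 \<or> peval (linform N l) a = 0)"
  obtain d1 F1 where F1: "F1 \<in> hpoly N d1" "F1 \<noteq> 0"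
    "\<forall>x\<in>C. \<forall>a. a \<noteq> 0 \<longrightarrow> (\<forall>k>N. a k = 0) \<longrightarrow> Sing a x \<longrightarrow> peval F1 a = 0"
    using discriminant_form[OF N] by blast
  then have "?Q d1" by blast
  define d where "d = (LEAST d. ?Q d)"
  have "?Q d" unfolding d_def by (rule LeastI[of ?Q, OF \<open>?Q d1\<close>])
  then obtain F where F: "F \<in> hpoly N d" "F \<noteq> 0"
    "\<forall>x\<in>C. \<forall>a. a \<noteq> 0 \<longrightarrow> (\<forall>k>N. a k = 0) \<longrightarrow> Sing a x \<longrightarrow> peval F a = 0 \<or> peval (linform N l) a = 0" by blast
  have "\<exists>v. (\<forall>k>N. v k = 0) \<and> peval (linform N l) v = 0 \<and> peval F v \<noteq> 0"
  proof (rule ccontr)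
    assume "\<not> ?thesis"
    then have "\<And>v. (\<And>k. k > N \<Longrightarrow> v k = 0) \<Longrightarrow> peval (linform N l) v = 0 \<Longrightarrow> peval F v = 0" by blast
    then obtain G where G: "d \<ge> 1" "G \<in> hpoly N (d - 1)" "G \<noteq> 0" "F = linform N l * G"
      by (rule divisible_by_linform[where l = l and j = j, OF j F(1,2)])
    have "?Q (d - 1)"
    proof (intro bexI[OF _ G(2)] conjI ballI allI impI)
      fix x a assume "x \<in> C" "a \<noteq> 0" "\<forall>k>N. a k = 0" "Sing a x"
      then have "peval F a = 0 \<or> peval (linform N l) a = 0" using F(3) by blast
      then show "peval G a = 0 \<or> peval (linform N l) a = 0" unfolding G(4) by (auto simp del: peval_linform)
    qed (rule G(3))
    then have "d \<le> d - 1" unfolding d_def by (rule Least_le)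
    then show False using G(1) by simp
  qed
  then obtain v1 where v1: "\<forall>k>N. v1 k = 0" "peval (linform N l) v1 = 0" "peval F v1 \<noteq> 0" by blast
  obtain v where v: "v \<noteq> 0" "\<forall>k>N. v k = 0" "peval (linform N l) v = 0" "peval F v \<noteq> 0"
  proof (cases "v1 = 0")
    case False
    then show ?thesis using that[of v1] v1 by blast
  next
    case True
    define k where "k = (if j = 0 then 1 else 0 :: nat)"
    have k: "k \<le> N" "k \<noteq> j" using N by (auto simp: k_def)
    \<comment> \<open>The zero vector is no projective point. It occurs only when F is constant, and
      then any nonzero vector of the hyperplane serves; N \<ge> 1 provides one.\<close>
    define v where "v = (\<lambda>m. (if m = k then l j else 0) + - l k * (if m = j then 1 else 0))"
    have "sec v i0 x0 = 0"
      unfolding v_def sec_linear sec_unit[OF k(1)] sec_unit[OF j(1)] by (simp add: l_def)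
    moreover have "v k \<noteq> 0" using k(2) j(2) by (simp add: v_def)
    then have "v \<noteq> 0" by auto
    moreover have "\<forall>k>N. v k = 0" using k(1) j(1) by (simp add: v_def)
    moreover have "peval F v \<noteq> 0"
    proof
      assume 0: "peval F v = 0"
      have "v1 = cscale 0 v" using True by (auto simp: fun_eq_iff)
      then have "peval F v1 = 0 ^ d * peval F v" using peval_cscale[OF F(1)] by metis
      then show False using v1(3) 0 by simp
    qed
    ultimately show ?thesis using that[of v] pl by simp
  qed
  let ?A = "{p \<in> PS N. ev (linform N l) p = 0}" and ?B = "{p \<in> PS N. ev F p = 0}"
  have "discriminant n C L b N \<subseteq> ?A \<union> ?B"
  proof
    fix p assume p: "p \<in> discriminant n C L b N"
    note D = discriminant_rp[OF p]
    have "peval F (rp p) = 0 \<or> peval (linform N l) (rp p) = 0"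
      using F(3) D rp_nonzero[OF D(1)] rp_supp[OF D(1)] by blast
    then show "p \<in> ?A \<union> ?B" using D(1) by (auto simp: ev_def simp del: peval_linform)
  qed
  moreover have "closedin (zariski N) ?A" "closedin (zariski N) ?B"
    unfolding closedin_zariski by (rule zclosed_form[OF linform_hpoly], rule zclosed_form[OF F(1)])
  ultimately have "discriminant n C L b N \<subseteq> ?A \<or> discriminant n C L b N \<subseteq> ?B"
    using irr unfolding irreducible_in_def by blast
  moreover have "\<not> discriminant n C L b N \<subseteq> ?B"
  proof
    assume B: "discriminant n C L b N \<subseteq> ?B"
    \<comment> \<open>The section v vanishes at x0, where all such sections are singular, so the
      discriminant has a point outside the zeros of F.\<close>
    have "Sing v x0" using r i0 v(3) unfolding pl ram_def by blast
    then have "hpoint v \<in> discriminant n C L b N" by (rule dsc[OF v(1,2) x0])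
    then have "ev F (hpoint v) = 0" using B by blast
    then show False using evz[OF v(1,2) F(1)] v(4) by blast
  qed
  ultimately have A: "discriminant n C L b N \<subseteq> ?A" by blast
  show ?thesis
  proof (cases "a = 0")
    case True
    then show ?thesis by (simp add: sec_def)
  next
    case False
    then have "hpoint a \<in> ?A" using dsc[OF False a(1) x a(2)] A by blast
    then show ?thesis using evz[OF False a(1) linform_hpoly, of l] pl by (simp del: peval_linform)
  qed
qed

text \<open>All tangent lines of the image pass through one point. In characteristic \<open>0\<close> this forces the
  image to be a line: the Wronskians of the sections through \<open>x0\<close> vanish.\<close>

lemma strange_curve:
  assumes i0: "i0 \<in> idx L" "x0 \<in> chart L i0"
    and hyp: "\<And>x a. x \<in> C \<Longrightarrow> \<forall>k>N. a k = 0 \<Longrightarrow> Sing a x \<Longrightarrow> sec a i0 x0 = 0"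
    and j: "j \<le> N" "b j (i0, x0) \<noteq> 0" and k: "k \<le> N" "k \<noteq> j" and m: "m \<le> N" "m \<noteq> j"
  shows "k = m"
proof (rule ccontr)
  assume km: "k \<noteq> m"
  define l where "l k = b k (i0, x0)" for k
  obtain x where x: "x \<in> C" using infiniteC by fastforce
  obtain i j' u g where fr: "is_frame x i j' u g" by (rule frame_exists[OF x])
  note i = is_frameD(1,2)[OF fr] and f = is_frameD(5)[OF fr]
    and near = is_frameD(7)[OF fr] and sing = is_frameD(8)[OF fr]
  let ?f = "fr i j'"
  \<comment> \<open>The combination of the sections s and j that vanishes at x0, read in the frame:
    projection from the image of x0.\<close>
  define h where "h s = (\<lambda>y. l j * ?f s y - l s * ?f j y)" for s
  have hl: "h s \<in> lr x" if "s \<le> N" for s unfolding h_def by (intro lr_diff lr_cmult x f that j(1))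
  have hsec: "eventually (\<lambda>y. \<forall>s\<le>N. b j' (i, y) * h s y = l j * b s (i, y) - l s * b j (i, y)) gen"
    using nbD(2)[OF near] by eventually_elim (auto simp: h_def fr_def field_simps)
  have w: "eventually (\<lambda>y. h k y * (l j * g m y - l m * g j y) = h m y * (l j * g k y - l k * g j y)) gen"
    using nbD(2)[OF sing] gen_C
  proof eventually_elim
    case (elim y)
    \<comment> \<open>The cross product of the coordinates j, k, m of the image point and of its
      tangent vector. It annihilates both, so it is a section singular at y; that it vanishes at x0
      makes the Wronskian of \<open>h k\<close> and \<open>h m\<close> zero.\<close>
    define a where "a s = (if s = j then ?f k y * g m y - ?f m y * g k y
      else if s = k then ?f m y * g j y - ?f j y * g m y
      else if s = m then ?f j y * g k y - ?f k y * g j y else 0)" for s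
    have sum: "(\<Sum>s\<le>N. a s * c s) = a j * c j + (a k * c k + a m * c m)" for c :: "nat \<Rightarrow> complex"
    proof -
      have "(\<Sum>s\<le>N. a s * c s) = (\<Sum>s\<in>{j, k, m}. a s * c s)"
        using j(1) k(1) m(1) by (intro sum.mono_neutral_right) (auto simp: a_def)
      then show ?thesis using k(2) m(2) km by simp
    qed
    have av: "a j = ?f k y * g m y - ?f m y * g k y" "a k = ?f m y * g j y - ?f j y * g m y"
      "a m = ?f j y * g k y - ?f k y * g j y" using k(2) m(2) km by (auto simp: a_def)
    have "(\<Sum>s\<le>N. a s * ?f s y) = 0" "(\<Sum>s\<le>N. a s * g s y) = 0"
      unfolding sum av by (simp_all add: algebra_simps)
    then have "Sing a y" using elim(1) by blast
    moreover have "\<forall>s>N. a s = 0" using j(1) k(1) m(1) by (auto simp: a_def)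
    ultimately have "sec a i0 x0 = 0" using hyp[OF elim(2)] by blast
    then have "a j * l j + (a k * l k + a m * l m) = 0" unfolding sec_def l_def[symmetric] sum .
    then have "l j * ((?f k y * g m y - ?f m y * g k y) * l j + ((?f m y * g j y - ?f j y * g m y) * l k
       + (?f j y * g k y - ?f k y * g j y) * l m)) = 0"
      unfolding av by (simp add: mult.commute)
    then show ?case unfolding h_def by algebra
  qed
  have lj: "l j \<noteq> 0" using j(2) by (simp add: l_def)
  have hm: "eventually (\<lambda>y. h m y \<noteq> 0) gen"
  proof (rule ccontr)
    assume "\<not> ?thesis"
    then have "eventually (\<lambda>y. h m y = 0) (nb x)" using lr_dichotomy[OF x hl[OF m(1)]] by blast
    from nbD(2)[OF this] hsec have "eventually (\<lambda>y. sec (\<lambda>s. (if s = m then l j else 0) + - l m * (if s = j then 1 else 0)) i y = 0) gen"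
    proof eventually_elim
      case (elim y)
      have "l j * b m (i, y) - l m * b j (i, y) = 0" using elim m(1) by (metis mult_zero_right)
      then show ?case unfolding sec_linear sec_unit[OF m(1)] sec_unit[OF j(1)] by simp
    qed
    from sections_independent[OF i this m(1)] show False using m(2) lj by simp
  qed
  have "eventually (\<lambda>y. y \<in> C \<and> h k \<in> lr y \<and> h m \<in> lr y \<and> h m y \<noteq> 0) gen"
    using nbD(2)[OF lr_near[OF x hl[OF k(1)]]] nbD(2)[OF lr_near[OF x hl[OF m(1)]]] hm by eventually_elim blast
  then obtain z where z: "z \<in> C" "h k \<in> lr z" "h m \<in> lr z" "h m z \<noteq> 0" using gen_witness by blast
  \<comment> \<open>Its derivative is the Wronskian over the square of \<open>h m\<close>. A
    constant quotient is a linear relation between three distinct basis sections.\<close>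
  let ?q = "\<lambda>y. h k y * inverse (h m y)"
  have q: "?q \<in> lr z" by (intro lr_mult lr_inverse z)
  have "eventually (\<lambda>y. dv y ?q = 0) gen"
    using w hm nbD(2)[OF near] nbD(2)[OF lr_near[OF z(1,2)]] nbD(2)[OF lr_near[OF z(1,3)]]
      nbD(2)[OF lr_near[OF x f[OF k(1)]]] nbD(2)[OF lr_near[OF x f[OF m(1)]]] nbD(2)[OF lr_near[OF x f[OF j(1)]]]
  proof eventually_elim
    case (elim y)
    have y: "y \<in> C" and hy: "h k \<in> lr y" "h m \<in> lr y" using elim by auto
    have dh: "dv y (h s) = (l j * g s y - l s * g j y) * dv y u" if "s \<in> {k, m}" for s
    proof -
      have "?f s \<in> lr y" "?f j \<in> lr y" "s \<le> N" using that elim(6,7,8) k(1) m(1) by auto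
      then have "dv y (h s) = l j * dv y (?f s) - l s * dv y (?f j)"
        using y by (simp add: h_def dv_diff dv_cmult lr_cmult)
      then show ?thesis using elim(3) \<open>s \<le> N\<close> j(1) by (simp add: algebra_simps)
    qed
    have dk: "dv y (h k) = (l j * g k y - l k * g j y) * dv y u" by (rule dh) simp
    have dm: "dv y (h m) = (l j * g m y - l m * g j y) * dv y u" by (rule dh) simp
    have "dv y ?q = h k y * (- dv y (h m) / h m y ^ 2) + inverse (h m y) * dv y (h k)"
      using dv_mult[OF y hy(1) lr_inverse[OF y hy(2) elim(2)]] dv_inverse[OF y hy(2) elim(2)] by simp
    also have "\<dots> = (h m y * dv y (h k) - h k y * dv y (h m)) / h m y ^ 2"
      using elim(2) by (simp add: field_simps power2_eq_square)
    also have "h m y * dv y (h k) - h k y * dv y (h m) =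
      (h m y * (l j * g k y - l k * g j y) - h k y * (l j * g m y - l m * g j y)) * dv y u"
      unfolding dk dm by (simp add: algebra_simps)
    finally show ?case using elim(1) by simp
  qed
  from derivative_zero_const[OF z(1) q this] have c: "eventually (\<lambda>y. ?q y = ?q z) (nb z)" .
  define a where "a = (\<lambda>s. ((if s = k then l j else 0) + - l k * (if s = j then 1 else 0)) +
    - ?q z * ((if s = m then l j else 0) + - l m * (if s = j then 1 else (0::complex))))"
  have "eventually (\<lambda>y. sec a i y = 0) gen"
    using nbD(2)[OF c] hm hsec
  proof eventually_elim
    case (elim y)
    have "h k y = ?q z * h m y" using elim(1,2) by (simp add: field_simps)
    then have "b j' (i, y) * h k y - ?q z * (b j' (i, y) * h m y) = 0" by simp
    then have "(l j * b k (i, y) - l k * b j (i, y)) - ?q z * (l j * b m (i, y) - l m * b j (i, y)) = 0"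
      using elim(3) k(1) m(1) by auto
    then show ?case unfolding a_def sec_linear sec_unit[OF k(1)] sec_unit[OF m(1)] sec_unit[OF j(1)] by simp
  qed
  from sections_independent[OF i this k(1)] show False using k(2) km lj by (simp add: a_def)
qed

text \<open>Only two basis sections are left by \<open>strange_curve\<close>. Their quotient is a
  map to the projective line that is ramified at most over the image of \<open>x0\<close>, which
  contradicts \<open>unramified_at_infinity\<close>.\<close>

lemma unramified_if_irreducible:
  assumes N: "N \<ge> 1" and irr: "irreducible_in (zariski N) (discriminant n C L b N)" and x0: "x0 \<in> C"
  shows "\<not> ram x0"
proof
  assume r: "ram x0"
  obtain i0 where i0: "i0 \<in> idx L" "x0 \<in> chart L i0" using chart_exists[OF x0] by blast
  have hyp: "sec a i0 x0 = 0" if "x \<in> C" "\<forall>k>N. a k = 0" "Sing a x" for x a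
    by (rule discriminant_in_hyperplane[OF N irr i0 r that])
  define l where "l k = b k (i0, x0)" for k
  obtain j where j: "j \<le> N" "l j \<noteq> 0" using base_point_free[OF i0] unfolding l_def by blast
  define k where "k = (if j = 0 then 1 else 0 :: nat)"
  have k: "k \<le> N" "k \<noteq> j" using N by (auto simp: k_def)
  have km: "k = m" if m: "m \<le> N" "m \<noteq> j" for m
    by (rule strange_curve[OF i0 _ j(1) j(2)[unfolded l_def] k m]) (rule hyp)
  have only: "m = j \<or> m = k" if "m \<le> N" for m using km[OF that] by blast
  define c0 where "c0 = (\<lambda>m. if m = j then 1 else (0::complex))"
  \<comment> \<open>This section vanishes at x0, which puts the image of x0 at infinity for the
    coordinate t = c0/c1.\<close>
  define c1 where "c1 = (\<lambda>m. (if m = k then l j else 0) + - l k * (if m = j then 1 else 0))"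
  have s0: "sec c0 i y = b j (i, y)" for i y unfolding c0_def sec_unit[OF j(1)] by simp
  have s1: "sec c1 i y = l j * b k (i, y) - l k * b j (i, y)" for i y
    unfolding c1_def sec_linear sec_unit[OF k(1)] sec_unit[OF j(1)] by simp
  have cs: "c0 m = 0" "c1 m = 0" if "m > N" for m using that j(1) k(1) by (auto simp: c0_def c1_def)
  have nz: "sec c0 i y \<noteq> 0" if "i \<in> idx L" "y \<in> chart L i" "sec c1 i y = 0" for i y
  proof
    assume 0: "sec c0 i y = 0"
    have "b k (i, y) = 0" "b j (i, y) = 0" using 0 that(3) j(2) unfolding s0 s1 by auto
    then show False using base_point_free[OF that(1,2)] only by metis
  qed
  have g0: "eventually (\<lambda>y. sec c i y \<noteq> 0) gen" if "i \<in> idx L" "x \<in> chart L i" "m \<le> N" "c m \<noteq> 0" for c i x m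
  proof (rule ccontr)
    assume "\<not> ?thesis"
    then have "eventually (\<lambda>y. sec c i y = 0) (nb x)"
      using lr_dichotomy[OF chart_C[OF that(1,2)] sec_lr[OF that(1,2)]] by blast
    from sections_independent[OF that(1,2) nbD(2)[OF this] that(3)] show False using that(4) by simp
  qed
  \<comment> \<open>A chart for every point, so that quotients of sections become functions on C.
    The transition factors cancel, and \<open>tc\<close> computes them in any chart.\<close>
  define ch where "ch y = (SOME i. i \<in> idx L \<and> y \<in> chart L i)" for y
  have ch: "ch y \<in> idx L" "y \<in> chart L (ch y)" if y: "y \<in> C" for y
  proof -
    obtain i where "i \<in> idx L \<and> y \<in> chart L i" using chart_exists[OF y] by blast
    then have "ch y \<in> idx L \<and> y \<in> chart L (ch y)" unfolding ch_def by (rule someI)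
    then show "ch y \<in> idx L" "y \<in> chart L (ch y)" by auto
  qed
  define t where "t y = sec c0 (ch y) y / sec c1 (ch y) y" for y
  define w where "w y = sec c1 (ch y) y / sec c0 (ch y) y" for y
  define A where "A = {y \<in> C. sec c1 (ch y) y \<noteq> 0}"
  have tr: "sec c (ch y) y = trans_fun L (ch y) i y * sec c i y" "trans_fun L (ch y) i y \<noteq> 0"
    if "i \<in> idx L" "y \<in> chart L i" for i y c
    using sec_trans[OF ch(1)[OF chart_C[OF that]] that(1) ch(2)[OF chart_C[OF that]] that(2)]
      trans_nonzero[OF ch(1)[OF chart_C[OF that]] that(1) ch(2)[OF chart_C[OF that]] that(2)] by auto
  have tc: "t y = sec c0 i y / sec c1 i y" "w y = sec c1 i y / sec c0 i y" "y \<in> A \<longleftrightarrow> sec c1 i y \<noteq> 0"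
    if "i \<in> idx L" "y \<in> chart L i" for i y
    using tr(2)[OF that] chart_C[OF that] by (simp_all add: t_def w_def A_def tr(1)[OF that])
  have l1: "sec c1 i0 x0 = 0" unfolding s1 by (simp add: l_def)
  have "dv x0 w \<noteq> 0"
  proof (rule unramified_at_infinity[where A = A and t = t])
    show "A \<subseteq> C" by (auto simp: A_def)
    show "x0 \<in> C - A" using tc(3)[OF i0] l1 x0 by blast
    have "eventually (\<lambda>y. sec c0 i0 y \<noteq> 0) gen" by (rule g0[OF i0 j(1)]) (simp add: c0_def)
    moreover have "eventually (\<lambda>y. sec c1 i0 y \<noteq> 0) gen" by (rule g0[OF i0 k(1)]) (use k(2) j(2) in \<open>simp add: c1_def\<close>)
    ultimately show "eventually (\<lambda>y. t y * w y = 1) gen"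
      using nbD(2)[OF chart_nb[OF i0]] by eventually_elim (simp add: tc[OF i0(1)])
  next
    fix x assume "x \<in> A"
    then have xC: "x \<in> C" by (simp add: A_def)
    obtain i where i: "i \<in> idx L" "x \<in> chart L i" using chart_exists[OF xC] by blast
    have x1: "sec c1 i x \<noteq> 0" using \<open>x \<in> A\<close> tc(3)[OF i] by blast
    have "(\<lambda>y. sec c0 i y / sec c1 i y) \<in> lr x" by (intro lr_divide xC sec_lr i x1)
    moreover have "eventually (\<lambda>y. sec c0 i y / sec c1 i y = t y) (nb x)"
      using chart_nb[OF i] by eventually_elim (simp add: tc[OF i(1)])
    ultimately show tl: "t \<in> lr x" by (rule lr_cong[OF xC])
    show "dv x t \<noteq> 0"
    proof
      assume d0: "dv x t = 0"
      \<comment> \<open>This section vanishes at x, and is singular there if dt = 0. Then it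
        vanishes at x0; so would c0, although c0 and c1 have no common zero.\<close>
      define a where "a = (\<lambda>m. c0 m + - t x * c1 m)"
      have "eventually (\<lambda>y. sec a i y = sec c1 i y * (t y - t x)) (nb x)"
        using chart_nb[OF i] lr_nonzero[OF xC sec_lr[OF i] x1]
        unfolding a_def sec_linear by eventually_elim (simp add: tc[OF i(1)] field_simps)
      note e = this
      have "dv x (sec a i) = dv x (\<lambda>y. sec c1 i y * (t y - t x))" by (rule dv_germ[OF xC sec_lr[OF i] e])
      also have "\<dots> = 0"
        using dv_mult[OF xC sec_lr[OF i] lr_diff[OF xC tl lr_const[OF xC]], of c1 "t x"]
          dv_diff[OF xC tl lr_const[OF xC], of "t x"] dv_const[OF xC] d0 by simp
      finally have "Sing a x" unfolding Sing_chart[OF i] using nbD(1)[OF e] by simp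
      moreover have "\<forall>m>N. a m = 0" using cs by (simp add: a_def)
      ultimately have "sec a i0 x0 = 0" using hyp[OF xC] by blast
      then have "sec c0 i0 x0 = 0" unfolding a_def sec_linear l1 by simp
      then show False using nz[OF i0 l1] by simp
    qed
  next
    fix x assume x: "x \<in> C - A"
    then have xC: "x \<in> C" by blast
    obtain i where i: "i \<in> idx L" "x \<in> chart L i" using chart_exists[OF xC] by blast
    have x1: "sec c1 i x = 0" using x tc(3)[OF i] by blast
    have "(\<lambda>y. sec c1 i y / sec c0 i y) \<in> lr x" by (intro lr_divide xC sec_lr i nz x1)
    moreover have "eventually (\<lambda>y. sec c1 i y / sec c0 i y = w y) (nb x)"
      using chart_nb[OF i] by eventually_elim (simp add: tc[OF i(1)])
    ultimately show "w \<in> lr x" by (rule lr_cong[OF xC])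
    show "w x = 0" using tc(2)[OF i] x1 by simp
  qed
  \<comment> \<open>As c1 vanishes at the ramified point x0, it is singular there, and w inherits
    the zero derivative.\<close>
  moreover have "dv x0 w = 0"
  proof -
    have "Sing c1 x0" using r i0 l1 unfolding ram_def by blast
    then have d1: "dv x0 (sec c1 i0) = 0" unfolding Sing_chart[OF i0] by blast
    note c = nz[OF i0 l1]
    have "eventually (\<lambda>y. sec c1 i0 y * inverse (sec c0 i0 y) = w y) (nb x0)"
      using chart_nb[OF i0] by eventually_elim (simp add: tc[OF i0(1)] divide_inverse)
    then have "dv x0 (\<lambda>y. sec c1 i0 y * inverse (sec c0 i0 y)) = dv x0 w"
      by (rule dv_germ[OF x0 lr_mult[OF x0 sec_lr[OF i0] lr_inverse[OF x0 sec_lr[OF i0] c]]])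
    then show ?thesis
      using dv_mult[OF x0 sec_lr[OF i0] lr_inverse[OF x0 sec_lr[OF i0] c], of c1] d1 l1 by simp
  qed
  ultimately show False by simp
qed

text \<open>For N = 0 the single section \<open>b 0\<close> has no zeros and trivializes L with all
  its powers. Sections of a power are then constant multiples of a power of \<open>b 0\<close>, so
  every map they define is constant and cannot embed C.\<close>

lemma ample_dim_pos:
  assumes ample: "ample n C L" shows "N \<ge> 1"
proof (rule ccontr)
  assume "\<not> N \<ge> 1"
  then have N: "N = 0" by simp
  obtain m where "m > 0" "very_ample n C (tensor_power L m)" using ample unfolding ample_def by blast
  then obtain M s where s: "s ` {..M} \<subseteq> H0 n C (tensor_power L m)" and
    emb: "closed_embedding n C M (proj_map (tensor_power L m) s M)" unfolding very_ample_def by blast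
  have inj: "inj_on (proj_map (tensor_power L m) s M) C" using emb by (simp add: closed_embedding_def)
  have tp: "idx (tensor_power L m) = idx L" "chart (tensor_power L m) = chart L"
    "trans_fun (tensor_power L m) = (\<lambda>i j x. trans_fun L i j x ^ m)" by (simp_all add: tensor_power_def)
  have b0: "b 0 (i, y) \<noteq> 0" if "i \<in> idx L" "y \<in> chart L i" for i y
    using base_point_free[OF that] N by auto
  define ch where "ch y = (SOME i. i \<in> idx L \<and> y \<in> chart L i)" for y
  have ch: "ch y \<in> idx L" "y \<in> chart L (ch y)" if y: "y \<in> C" for y
  proof -
    obtain i where "i \<in> idx L \<and> y \<in> chart L i" using chart_exists[OF y] by blast
    then have "ch y \<in> idx L \<and> y \<in> chart L (ch y)" unfolding ch_def by (rule someI)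
    then show "ch y \<in> idx L" "y \<in> chart L (ch y)" by auto
  qed
  \<comment> \<open>Independent of the chart, hence regular on the whole curve and constant.\<close>
  define q where "q k y = s k (ch y, y) / b 0 (ch y, y) ^ m" for k y
  have "\<exists>c. \<forall>y\<in>C. q k y = c" if k: "k \<le> M" for k
  proof -
    have sk: "s k \<in> H0 n C (tensor_power L m)" using s k by blast
    then have tk: "\<forall>i\<in>idx L. \<forall>j\<in>idx L. \<forall>x\<in>chart L i \<inter> chart L j. s k (i, x) = trans_fun L i j x ^ m * s k (j, x)"
      unfolding H0_def mem_Collect_eq tp by (elim conjE)
    have "q k \<in> lr x" if x: "x \<in> C" for x
    proof -
      obtain i where i: "i \<in> idx L" "x \<in> chart L i" using chart_exists[OF x] by blast
      have "(\<lambda>y. s k (i, y)) \<in> lr x" using sk i unfolding H0_def local_ring_def mem_Collect_eq tp by blast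
      then have "(\<lambda>y. s k (i, y) / b 0 (i, y) ^ m) \<in> lr x"
        using b0[OF i] by (intro lr_divide lr_power x b_lr i) auto
      moreover have "eventually (\<lambda>y. s k (i, y) / b 0 (i, y) ^ m = q k y) (nb x)"
        using chart_nb[OF i] nb_C[OF x]
      proof eventually_elim
        case (elim y)
        have "s k (ch y, y) = trans_fun L (ch y) i y ^ m * s k (i, y)"
          using tk ch[OF elim(2)] i(1) elim(1) by blast
        moreover have "b 0 (ch y, y) = trans_fun L (ch y) i y * b 0 (i, y)"
          using b_trans[OF _ ch(1)[OF elim(2)] i(1) ch(2)[OF elim(2)] elim(1), of 0] by simp
        moreover have "trans_fun L (ch y) i y \<noteq> 0"
          by (rule trans_nonzero[OF ch(1)[OF elim(2)] i(1) ch(2)[OF elim(2)] elim(1)])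
        ultimately show ?case by (simp add: q_def power_mult_distrib)
      qed
      ultimately show ?thesis by (rule lr_cong[OF x])
    qed
    then show ?thesis using global_regular_const[of "q k"] by metis
  qed
  then have "\<forall>k\<in>{..M}. \<exists>c. \<forall>y\<in>C. q k y = c" by blast
  from bchoice[OF this] obtain c where c: "\<forall>k\<in>{..M}. \<forall>y\<in>C. q k y = c k" ..
  have "proj_map (tensor_power L m) s M y = hpoint (\<lambda>k. if k \<le> M then c k else 0)" if y: "y \<in> C" for y
  proof -
    have "(\<lambda>k. if k \<le> M then s k (ch y, y) else 0) = cscale (b 0 (ch y, y) ^ m) (\<lambda>k. if k \<le> M then c k else 0)"
    proof
      fix k
      show "(if k \<le> M then s k (ch y, y) else 0) = cscale (b 0 (ch y, y) ^ m) (\<lambda>k. if k \<le> M then c k else 0) k"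
      proof (cases "k \<le> M")
        case True
        then have "q k y = c k" using c y by blast
        then show ?thesis using b0[OF ch[OF y]] True by (simp add: q_def cscale_def field_simps)
      qed (simp add: cscale_def)
    qed
    moreover have "hpoint (cscale (b 0 (ch y, y) ^ m) (\<lambda>k. if k \<le> M then c k else 0)) = hpoint (\<lambda>k. if k \<le> M then c k else 0)"
      by (rule hpoint_cscale) (use b0[OF ch[OF y]] in simp)
    moreover have "proj_map (tensor_power L m) s M y = hpoint (\<lambda>k. if k \<le> M then s k (ch y, y) else 0)"
      unfolding proj_map_def Let_def tp ch_def ..
    ultimately show ?thesis by argo
  qed
  then have eq: "x = y" if "x \<in> C" "y \<in> C" for x y using that inj_onD[OF inj, of x y] by simp
  obtain x where "x \<in> C" using infiniteC by fastforce
  then have "C \<subseteq> {x}" using eq by blast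
  then show False using infiniteC finite_subset by blast
qed

end

theorem mainTheorem3:
  fixes n N :: nat and C :: "pt set" and L :: "'i line_bundle"
    and V :: "'i sec set" and b :: "nat \<Rightarrow> 'i sec"
  assumes "smooth_projective_curve n C"
    and "line_bundle_on n C L"
    and "ample n C L"
    and "cfun.subspace V" and "V \<subseteq> H0 n C L"
    and "generates C L V"
    and "basis_of b N V"
  shows "irreducible_in (zariski N) (discriminant n C L b N) \<longleftrightarrow>
         immersion n C N (PS N) (proj_map L b N)"
proof -
  interpret linear_system n C L V b N
    using assms by unfold_locales
  have "N \<ge> 1" by (rule ample_dim_pos[OF assms(3)])
  then show ?thesis
    unfolding immersion_iff using irreducible_if_unramified unramified_if_irreducible by blast
qed

end
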